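(* Let $e\in\mathbb N\cup\{0\}$, let $\xi:\Omega\to\mathbb R^d$ and $\zeta_i:\Omega\to\mathbb R^d$, $i=1,\dots,e$, be Borel measurable with $\zeta_i\not\equiv0$, and let $c_i\ge0$. Assume $\mathrm{NA}_2(\mathcal P)$ holds. Assume either $e=0$, or $e\ge1$ and for all $\ell\in\mathbb R^e$ and $\eta\in\mathcal A$, $$\sum_{i=1}^e\big(\ell_i\zeta_i-|\ell_i|c_i\mathbf 1_d\big)+\sum_{t=0}^T\eta_t\in K_T\ \ \mathcal P\text{-q.s.}\ \Longrightarrow\ \ell=0.$$ Then $\mathcal S_e$ is nonempty and $$\pi_e(\xi)=\sup_{(\mathbb Q,Z)\in\mathcal S_e}\mathbb E^{\mathbb Q}[\langle\xi,Z_T\rangle].$$ Moreover, there exists $(\hat\eta,\hat\ell)\in\mathcal A\times\mathbb R^e$ such that $$\pi_e(\xi)\mathbf 1_d+\sum_{i=1}^e\big(\hat\ell_i\zeta_i-|\hat\ell_i|c_i\mathbf 1_d\big)+\sum_{t=0}^T\hat\eta_t-\xi\in K_T\quad\mathcal P\text{-q.s.}$$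
   Context: Setting: Fix integers $T\ge1$, $d\ge2$. $\Omega_0=\{\omega_0\}$, $\Omega_1$ is a Polish space, $\Omega_t:=\Omega_0\times\Omega_1^t$, $\Omega:=\Omega_T$. $\mathcal F^0_t:=\mathcal B(\Omega_t)$, $\mathcal F_t$ its universal completion, $\mathbb F^0=(\mathcal F^0_t)$, $\mathbb F=(\mathcal F_t)$, $\mathcal F:=\mathcal F_T$. $\mathfrak B(E)$: probability measures on $E$. For $t\le T-1$, $\omega\in\Omega_t$, $\mathcal P_t(\omega)\subseteq\mathfrak B(\Omega_1)$ is nonempty convex with analytic graph; $\mathcal P:=\{\mathbb P_0\otimes\cdots\otimes\mathbb P_{T-1}\}$ over universally measurable kernels with $\mathbb P_t(\omega)\in\mathcal P_t(\omega)$. Polar sets / q.s. w.r.t. $\mathcal P$ as usual (outside a universally measurable set null for all $\mathbb P\in\mathcal P$). $\mathbb Q\lll\mathcal P$ means $\mathbb Q\ll\mathbb P'$ for some $\mathbb P'\in\mathcal P$. Expectations: $\mathbb E[f]:=\mathbb E[f^+]-\mathbb E[f^-]$ with $\infty-\infty:=-\infty$. For each $t$, $K_t$ is an $\mathcal F^0_t$-measurable random closed convex cone containing $\mathbb R^d_+$; $K^*_t:=\{y:\langle x,y\rangle\ge0\ \forall x\in K_t\}$, $K^{*,0}_t:=\{y\in K^*_t:y^d=1\}$; $K^*_t\cap\partial\mathbb R^d_+=\{0\}$, $\mathrm{int}K^*_t\ne\emptyset$ everywhere; there is an $\mathbb F^0$-adapted $S$ with $S_t\in K^{*,0}_t\cap\mathrm{int}K^*_t$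 everywhere and a constant $c>1$ with $c^{-1}S^i_t\le y^i\le cS^i_t$ for $i\le d-1$, $y\in K^{*,0}_t$. $\mathcal A$: $\mathbb F$-adapted processes $\eta$ with $\eta_t\in-K_t$ $\mathcal P$-q.s. for all $t\le T$. $\mathrm{NA}_2(\mathcal P)$: for all $t\le T-1$ and $\mathcal F_t$-measurable $\zeta$, $\zeta\in K_{t+1}$ $\mathcal P$-q.s. implies $\zeta\in K_t$ $\mathcal P$-q.s. $\mathbf 1_d\in\mathbb R^d$ is the vector with all components $0$ except the last, equal to $1$. Super-hedging price: $\pi_e(\xi):=\inf\{y+\sum_{i=1}^ec_i|\ell_i|:\ y\mathbf 1_d+\sum_{i=1}^e\ell_i\zeta_i+\sum_{t=0}^T\eta_t-\xi\in K_T\ \mathcal P\text{-q.s.},\ (\eta,\ell)\in\mathcal A\times\mathbb R^e\}$ (empty sums are $0$). A strictly consistent price system (SCPS) is a pair $(\mathbb Q,Z)$ with $\mathbb Q\in\mathfrak B(\Omega)$, $\mathbb Q\lll\mathcal P$, and $Z=(Z_s)_{s=0,\dots,T}$ an $\mathbb F^0$-adapted $\mathbb R^d$-valued process with $Z_s\in\mathrm{int}K^*_s$ $\mathbb Q$-a.s. for all $s$ and $Z$ a $(\mathbb Q,\mathbb F)$-martingale. $\mathcal S_0$: SCPS with $Z^d\equiv1$; $\mathcal S_e:=\{(\mathbb Q,Z)\in\mathcal S_0:\mathbb E^{\mathbb Q}[\langle\zeta_i,Z_T\rangle]\in[-c_i,c_i],\ i=1,\dots,e\}$.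
   Formalization: The final claim (existence of an optimal strategy attaining the super-hedging price) is stated only when π_e(ξ) is finite, since π_e(ξ) can equal +∞ for unbounded ξ and then π_e(ξ)1_d is undefined. *)

theory Defs
  imports "HOL-Probability.Probability"
begin

text \<open>A path omega in Omega_t is represented as an extensional function on the
  index set {..<t} (component k = the (k+1)-st coordinate in Omega_1); the trivial
  factor Omega_0 = {omega_0} is suppressed. B(Omega_t) is the product Borel sigma-algebra,
  which coincides with the Borel sigma-algebra of the product topology since Omega_1 is Polish.\<close>

definition Om_t :: "nat \<Rightarrow> (nat \<Rightarrow> 'w::topological_space) measure" where
  "Om_t t = PiM {..<t} (\<lambda>_. borel)"

definition Om_top :: "nat \<Rightarrow> (nat \<Rightarrow> 'w::topological_space) topology" where
  "Om_top t = product_topology (\<lambda>_. euclidean) {..<t}"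

definition probs :: "'a measure \<Rightarrow> 'a measure set" where
  "probs M = {P. sets P = sets M \<and> prob_space P}"

definition univ_sets :: "'a measure \<Rightarrow> 'a set set" where
  "univ_sets M = {A. A \<subseteq> space M \<and> (\<forall>P\<in>probs M. A \<in> sets (completion P))}"

definition univ_completion :: "'a measure \<Rightarrow> 'a measure" where
  "univ_completion M = sigma (space M) (univ_sets M)"

definition F0 :: "nat \<Rightarrow> nat \<Rightarrow> (nat \<Rightarrow> 'w::topological_space) measure" where
  "F0 T t = vimage_algebra (space (Om_t T)) (\<lambda>\<omega>. restrict \<omega> {..<t}) (Om_t t)"

definition Ffilt :: "nat \<Rightarrow> nat \<Rightarrow> (nat \<Rightarrow> 'w::topological_space) measure" where
  "Ffilt T t = vimage_algebra (space (Om_t T)) (\<lambda>\<omega>. restrict \<omega> {..<t}) (univ_completion (Om_t t))"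

definition weak_top :: "'w::topological_space measure topology" where
  "weak_top = topology_generated_by
     {{P \<in> probs (borel :: 'w measure). (\<integral>x. f x \<partial>P) \<in> U} | f U.
        continuous_on UNIV (f :: 'w \<Rightarrow> real) \<and> bounded (range f) \<and> open (U :: real set)}"

definition analytic_in :: "'a topology \<Rightarrow> 'a set \<Rightarrow> bool" where
  "analytic_in X A \<longleftrightarrow> A \<subseteq> topspace X \<and>
     (A = {} \<or> (\<exists>f :: (nat \<Rightarrow> nat) \<Rightarrow> 'a. continuous_map euclidean X f \<and> range f = A))"

definition convex_meas :: "'a measure set \<Rightarrow> bool" where
  "convex_meas S \<longleftrightarrow> (\<forall>P\<in>S. \<forall>Q\<in>S. \<forall>a::real. 0 \<le> a \<and> a \<le> 1 \<longrightarrow>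
      (\<exists>R\<in>S. \<forall>A\<in>sets P. measure R A = a * measure P A + (1 - a) * measure Q A))"

definition univ_kernel :: "nat \<Rightarrow> ((nat \<Rightarrow> 'w::topological_space) \<Rightarrow> 'w measure) \<Rightarrow> bool" where
  "univ_kernel t k \<longleftrightarrow> (\<forall>A\<in>sets (borel :: 'w measure).
      (\<lambda>\<omega>. emeasure (k \<omega>) A) \<in> borel_measurable (univ_completion (Om_t t)))"

fun kprod :: "(nat \<Rightarrow> (nat \<Rightarrow> 'w) \<Rightarrow> 'w measure) \<Rightarrow> nat \<Rightarrow> (nat \<Rightarrow> 'w::topological_space) measure" where
  "kprod k 0 = return (Om_t 0) (\<lambda>_. undefined)"
| "kprod k (Suc t) = measure_of (space (Om_t (Suc t))) (sets (Om_t (Suc t)))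
     (\<lambda>A. \<integral>\<^sup>+\<omega>. emeasure (k t \<omega>) {x. fun_upd \<omega> t x \<in> A} \<partial>(completion (kprod k t)))"

definition Pcal :: "nat \<Rightarrow> (nat \<Rightarrow> (nat \<Rightarrow> 'w) \<Rightarrow> 'w measure set) \<Rightarrow> (nat \<Rightarrow> 'w::topological_space) measure set" where
  "Pcal T Pt = {kprod k T | k. \<forall>t<T. univ_kernel t (k t) \<and> (\<forall>\<omega>\<in>space (Om_t t). k t \<omega> \<in> Pt t \<omega>)}"

definition qs :: "nat \<Rightarrow> (nat \<Rightarrow> 'w::topological_space) measure set \<Rightarrow> ((nat \<Rightarrow> 'w) \<Rightarrow> bool) \<Rightarrow> bool" where
  "qs T PP \<phi> \<longleftrightarrow> (\<exists>N\<in>sets (univ_completion (Om_t T)).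
      {\<omega> \<in> space (Om_t T). \<not> \<phi> \<omega>} \<subseteq> N \<and> (\<forall>P\<in>PP. emeasure (completion P) N = 0))"

definition dlast :: "'d::{finite,linorder}" where
  "dlast = Max UNIV"

definition one_d :: "(real, 'd::{finite,linorder}) vec" where
  "one_d = axis dlast 1"

definition Kstar :: "((real, 'd::finite) vec) set \<Rightarrow> ((real, 'd) vec) set" where
  "Kstar K = {y. \<forall>x\<in>K. 0 \<le> inner x y}"

definition Kstar0 :: "((real, 'd::{finite,linorder}) vec) set \<Rightarrow> ((real, 'd) vec) set" where
  "Kstar0 K = {y \<in> Kstar K. y $ dlast = 1}"

definition orthant :: "((real, 'd::finite) vec) set" where
  "orthant = {x. \<forall>i. 0 \<le> x $ i}"

definition adm :: "nat \<Rightarrow> (nat \<Rightarrow> 'w::topological_space) measure set \<Rightarrow>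
    (nat \<Rightarrow> (nat \<Rightarrow> 'w) \<Rightarrow> ((real, 'd::finite) vec) set) \<Rightarrow> (nat \<Rightarrow> (nat \<Rightarrow> 'w) \<Rightarrow> (real, 'd) vec) set" where
  "adm T PP K = {\<eta>. (\<forall>t\<le>T. \<eta> t \<in> borel_measurable (Ffilt T t)) \<and>
                    (\<forall>t\<le>T. qs T PP (\<lambda>\<omega>. - \<eta> t \<omega> \<in> K t \<omega>))}"

definition NA2 :: "nat \<Rightarrow> (nat \<Rightarrow> 'w::topological_space) measure set \<Rightarrow>
    (nat \<Rightarrow> (nat \<Rightarrow> 'w) \<Rightarrow> ((real, 'd::finite) vec) set) \<Rightarrow> bool" where
  "NA2 T PP K \<longleftrightarrow> (\<forall>t<T. \<forall>\<zeta> \<in> borel_measurable (Ffilt T t).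
      qs T PP (\<lambda>\<omega>. \<zeta> \<omega> \<in> K (Suc t) \<omega>) \<longrightarrow> qs T PP (\<lambda>\<omega>. \<zeta> \<omega> \<in> K t \<omega>))"

text \<open>Super-hedging price pi_e(xi) (infimum of the empty set is +infinity).\<close>
definition spr :: "nat \<Rightarrow> (nat \<Rightarrow> 'w::topological_space) measure set \<Rightarrow>
    (nat \<Rightarrow> (nat \<Rightarrow> 'w) \<Rightarrow> ((real, 'd::{finite,linorder}) vec) set) \<Rightarrow> nat \<Rightarrow> (nat \<Rightarrow> real) \<Rightarrow>
    (nat \<Rightarrow> (nat \<Rightarrow> 'w) \<Rightarrow> (real, 'd) vec) \<Rightarrow> ((nat \<Rightarrow> 'w) \<Rightarrow> (real, 'd) vec) \<Rightarrow> ereal" where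
  "spr T PP K e c \<zeta> \<xi> = Inf {ereal (y + (\<Sum>i\<in>{1..e}. c i * \<bar>l i\<bar>)) | y l \<eta>.
      \<eta> \<in> adm T PP K \<and>
      qs T PP (\<lambda>\<omega>. y *\<^sub>R one_d + (\<Sum>i\<in>{1..e}. l i *\<^sub>R \<zeta> i \<omega>) + (\<Sum>t\<in>{0..T}. \<eta> t \<omega>) - \<xi> \<omega> \<in> K T \<omega>)}"

text \<open>Generalised expectation E[f] = E[f^+] - E[f^-] with the convention inf - inf = -inf.\<close>
definition gexp :: "'a measure \<Rightarrow> ('a \<Rightarrow> real) \<Rightarrow> ereal" where
  "gexp M f = (if (\<integral>\<^sup>+x. ennreal (- f x) \<partial>M) = \<infinity> then -\<infinity>
     else enn2ereal (\<integral>\<^sup>+x. ennreal (f x) \<partial>M) - enn2ereal (\<integral>\<^sup>+x. ennreal (- f x) \<partial>M))"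

text \<open>(Q,F)-martingale, written via the defining property of conditional expectation
  (integrals over F_s-measurable sets, taken w.r.t. the completion of Q).\<close>
definition martingale_F :: "nat \<Rightarrow> (nat \<Rightarrow> 'w::topological_space) measure \<Rightarrow>
    (nat \<Rightarrow> (nat \<Rightarrow> 'w) \<Rightarrow> (real, 'd::finite) vec) \<Rightarrow> bool" where
  "martingale_F T Q Z \<longleftrightarrow> (\<forall>s\<le>T. Z s \<in> borel_measurable (Ffilt T s) \<and> integrable Q (Z s)) \<and>
     (\<forall>s<T. \<forall>A\<in>sets (Ffilt T s).
        (\<integral>\<omega>. indicator A \<omega> *\<^sub>R Z (Suc s) \<omega> \<partial>completion Q) = (\<integral>\<omega>. indicator A \<omega> *\<^sub>R Z s \<omega> \<partial>completion Q))"

definition S0 :: "nat \<Rightarrow> (nat \<Rightarrow> 'w::topological_space) measure set \<Rightarrow>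
    (nat \<Rightarrow> (nat \<Rightarrow> 'w) \<Rightarrow> ((real, 'd::{finite,linorder}) vec) set) \<Rightarrow>
    ((nat \<Rightarrow> 'w) measure \<times> (nat \<Rightarrow> (nat \<Rightarrow> 'w) \<Rightarrow> (real, 'd) vec)) set" where
  "S0 T PP K = {(Q, Z). Q \<in> probs (Om_t T) \<and> (\<exists>P\<in>PP. absolutely_continuous P Q) \<and>
      (\<forall>s\<le>T. Z s \<in> borel_measurable (F0 T s)) \<and>
      (\<forall>s\<le>T. AE \<omega> in Q. Z s \<omega> \<in> interior (Kstar (K s \<omega>))) \<and>
      martingale_F T Q Z \<and>
      (\<forall>s\<le>T. \<forall>\<omega>\<in>space (Om_t T). Z s \<omega> $ dlast = 1)}"

definition Se :: "nat \<Rightarrow> (nat \<Rightarrow> 'w::topological_space) measure set \<Rightarrow>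
    (nat \<Rightarrow> (nat \<Rightarrow> 'w) \<Rightarrow> ((real, 'd::{finite,linorder}) vec) set) \<Rightarrow> nat \<Rightarrow> (nat \<Rightarrow> real) \<Rightarrow>
    (nat \<Rightarrow> (nat \<Rightarrow> 'w) \<Rightarrow> (real, 'd) vec) \<Rightarrow>
    ((nat \<Rightarrow> 'w) measure \<times> (nat \<Rightarrow> (nat \<Rightarrow> 'w) \<Rightarrow> (real, 'd) vec)) set" where
  "Se T PP K e c \<zeta> = {(Q, Z) \<in> S0 T PP K. \<forall>i\<in>{1..e}.
      gexp Q (\<lambda>\<omega>. inner (\<zeta> i \<omega>) (Z T \<omega>)) \<in> {- ereal (c i) .. ereal (c i)}}"

end

theory Submission
  imports Defs
begin

text \<open>
  For a path \<open>w\<close> of length \<open>t\<close> let \<open>G t w\<close> be the open convex cone of triples \<open>(z, v, r)\<close> such that the price vector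
  \<open>z\<close> extends to a strictly consistent price process under which the claim is worth more than \<open>v\<close> and a fixed
  majorant of it less than \<open>r\<close>. Backwards in time, \<open>G t w\<close> consists of the triples with \<open>z\<close> in the interior of the
  dual cone that are convex combinations of triples lying in \<open>G (t + 1)\<close> with positive probability under some
  one-step prior. These sets are Suslin in \<open>w\<close>, hence universally measurable, and the no-arbitrage condition says that
  their price components fill the interior of the dual cone outside a polar set.

  The portfolios dominating \<open>v\<close> on \<open>G t w\<close> are the initial positions of a hedge: by separation each of them can be
  rebalanced into one that dominates \<open>G (t + 1)\<close>, and a closed-set selection makes the strategy measurable.
  Conversely, Caratheodory's theorem and measurable selection turn a point of \<open>G 0\<close> into a measure \<open>Q\<close> and a
  martingale \<open>Z\<close> realising its value. This is the duality without options, with attainment.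

  The values of the claim and the options over price systems form a convex set, since two price systems can be mixed
  under a common dominating prior. A one-dimensional Lagrange multiplier argument, applied to one option at a time,
  then reduces the theorem to the case without options.
\<close>

section \<open>Suslin sets and universal measurability\<close>

text \<open>No reference measure is assumed to dominate the priors, so attainment is not drawn from
  closedness in a space of random variables but from choosing a hedge path by path. Every choice
  must then be measurable for all priors at once. The sets met on the way are projections, and the
  decisive question, whether some prior charges a given projection, is turned by the capacity
  argument into Borel inequalities indexed by one more point of Baire space, so that the answer is
  Suslin again. The cones are open: testing states of a countable dense set suffices, which keeps
  exceptional sets polar. The third coordinate is there because a bare value might be an infinite
  expectation: it controls the majorant, and \<open>r\<close> and \<open>v + r\<close> become
  positive, so both are integrated as nonnegative functions and \<open>v\<close> is recovered as
  their difference. Weak duality meets the opposite obstacle, unbounded strategies; integrability is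
  pushed backwards and then forwards in time.\<close>

abbreviation bai :: "(nat \<Rightarrow> nat) measure" where
  "bai \<equiv> PiM UNIV (\<lambda>_. count_space UNIV)"

lemma space_bai [simp]: "space bai = UNIV"
  by (simp add: space_PiM PiE_UNIV_domain)

lemma measurable_baiI:
  assumes "\<And>i. (\<lambda>x. f x i) \<in> measurable M (count_space UNIV)"
  shows "f \<in> measurable M bai"
  by (rule measurable_PiM_single'[where f="\<lambda>i x. f x i", simplified]) (use assms in auto)

lemma measurable_bai_coord [measurable]: "(\<lambda>x. x i) \<in> measurable bai (count_space UNIV)"
  by (rule measurable_component_singleton) simp

text \<open>The analytic sets relative to \<open>M\<close>. As projections they are easily seen to
  be closed under countable unions and intersections; \<open>suslin_scheme\<close> rewrites them
  through the Souslin operation, the form that gives measurability.\<close>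

definition suslin :: "'a measure \<Rightarrow> 'a set set" where
  "suslin M = {fst ` C | C. C \<in> sets (M \<Otimes>\<^sub>M bai)}"

lemma suslinI: "C \<in> sets (M \<Otimes>\<^sub>M bai) \<Longrightarrow> fst ` C \<in> suslin M"
  by (auto simp: suslin_def)

lemma suslin_sets: "A \<in> sets M \<Longrightarrow> A \<in> suslin M"
proof -
  assume "A \<in> sets M"
  then have "A \<times> UNIV \<in> sets (M \<Otimes>\<^sub>M bai)"
    by (metis pair_measureI sets.top space_bai)
  from suslinI[OF this] show ?thesis by simp
qed

lemma suslin_UN:
  assumes "countable I" "\<And>i. i \<in> I \<Longrightarrow> A i \<in> suslin M"
  shows "(\<Union>i\<in>I. A i) \<in> suslin M"
proof -
  obtain C where C: "\<And>i. i \<in> I \<Longrightarrow> C i \<in> sets (M \<Otimes>\<^sub>M bai) \<and> A i = fst ` C i"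
    using assms(2) unfolding suslin_def by simp metis
  have "(\<Union>i\<in>I. C i) \<in> sets (M \<Otimes>\<^sub>M bai)"
    using assms(1) C by (intro sets.countable_UN') auto
  from suslinI[OF this] show ?thesis using C by (simp add: image_UN)
qed

text \<open>Countably many witnesses fit into one point of Baire space: the \<open>n\<close>-th is
  read at the positions \<open>prod_encode (n, k)\<close>. The intersection is therefore a single
  projection.\<close>

lemma suslin_INT_nat:
  assumes "\<And>i::nat. A i \<in> suslin M"
  shows "(\<Inter>i. A i) \<in> suslin M"
proof -
  obtain C where C: "\<And>i. C i \<in> sets (M \<Otimes>\<^sub>M bai)" "\<And>i. A i = fst ` C i"
    using assms unfolding suslin_def by simp metis
  define D where "D = {p \<in> space (M \<Otimes>\<^sub>M bai). \<forall>n. (fst p, \<lambda>k. snd p (prod_encode (n, k))) \<in> C n}"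
  have m: "(\<lambda>p. (fst p, \<lambda>k. snd p (prod_encode (n, k)))) \<in> measurable (M \<Otimes>\<^sub>M bai) (M \<Otimes>\<^sub>M bai)" for n
    by (intro measurable_Pair measurable_baiI measurable_fst measurable_compose[OF measurable_snd measurable_bai_coord])
  have "D \<in> sets (M \<Otimes>\<^sub>M bai)"
    unfolding D_def
    by (intro sets.sets_Collect_countable_All) (use measurable_sets[OF m C(1)] in \<open>simp add: vimage_def Int_def conj_commute\<close>)
  moreover have "fst ` D = (\<Inter>i. A i)"
  proof (intro equalityI subsetI)
    fix w assume "w \<in> fst ` D" then show "w \<in> (\<Inter>i. A i)" unfolding D_def C(2) by force
  next
    fix w assume "w \<in> (\<Inter>i. A i)"
    then have "\<forall>i. \<exists>x. (w, x) \<in> C i" unfolding C(2) by force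
    then obtain x where x: "\<And>i. (w, x i) \<in> C i" by metis
    define y where "y m = (case prod_decode m of (n, k) \<Rightarrow> x n k)" for m
    have "(\<lambda>k. y (prod_encode (n, k))) = x n" for n by (simp add: y_def)
    moreover have "w \<in> space M" using x[of 0] sets.sets_into_space[OF C(1)] by (force simp: space_pair_measure)
    ultimately have "(w, y) \<in> D" unfolding D_def using x by (simp add: space_pair_measure)
    then show "w \<in> fst ` D" by force
  qed
  ultimately show ?thesis using suslinI by metis
qed

lemma suslin_INT:
  assumes "countable I" "I \<noteq> {}" "\<And>i. i \<in> I \<Longrightarrow> A i \<in> suslin M"
  shows "(\<Inter>i\<in>I. A i) \<in> suslin M"
proof -
  have "(\<Inter>i\<in>I. A i) = (\<Inter>n. A (from_nat_into I n))"
    by (subst range_from_nat_into[OF assms(2,1), symmetric]) (simp add: image_image)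
  also have "\<dots> \<in> suslin M"
    by (rule suslin_INT_nat) (use assms from_nat_into[OF assms(2)] in auto)
  finally show ?thesis .
qed

lemma suslin_Int: "A \<in> suslin M \<Longrightarrow> B \<in> suslin M \<Longrightarrow> A \<inter> B \<in> suslin M"
  using suslin_INT[of "UNIV :: bool set" "\<lambda>b. if b then A else B" M] by (auto simp: UNIV_bool Int_commute)

section \<open>Souslin schemes of measurable sets\<close>

definition prefix_dep :: "(nat \<Rightarrow> (nat \<Rightarrow> nat) \<Rightarrow> 'b) \<Rightarrow> bool" where
  "prefix_dep H \<longleftrightarrow> (\<forall>k y y'. (\<forall>i<k. y i = y' i) \<longrightarrow> H k y = H k y')"

lemma prefix_depD: "prefix_dep H \<Longrightarrow> (\<And>i. i < k \<Longrightarrow> y i = y' i) \<Longrightarrow> H k y = H k y'"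
  by (auto simp: prefix_dep_def)

text \<open>The point \<open>x\<close> of Baire space is a parameter and \<open>z\<close> is the
  branch of the Souslin operation. Keeping them apart makes the representable sets stable under
  countable unions and intersections, which the induction in \<open>scheme_rep_sets\<close>
  needs.\<close>

definition scheme_of ::
  "'a measure \<Rightarrow> ('a \<times> (nat \<Rightarrow> nat)) set \<Rightarrow> (nat \<Rightarrow> (nat \<Rightarrow> nat) \<Rightarrow> (nat \<Rightarrow> nat) \<Rightarrow> 'a set) \<Rightarrow> bool"
where
  "scheme_of M C E \<longleftrightarrow> (\<forall>k x z. E k x z \<in> sets M) \<and>
     (\<forall>k x x' z z'. (\<forall>i<k. x i = x' i \<and> z i = z' i) \<longrightarrow> E k x z = E k x' z') \<and>
     C = {(w, x). w \<in> space M \<and> (\<exists>z. \<forall>k. w \<in> E k x z)}"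

definition scheme_rep :: "'a measure \<Rightarrow> ('a \<times> (nat \<Rightarrow> nat)) set \<Rightarrow> bool" where
  "scheme_rep M C \<longleftrightarrow> (\<exists>E. scheme_of M C E)"

lemma scheme_rep_UN:
  fixes C :: "nat \<Rightarrow> ('a \<times> (nat \<Rightarrow> nat)) set"
  assumes "\<And>n. scheme_rep M (C n)"
  shows "scheme_rep M (\<Union>n. C n)"
proof -
  from assms have "\<forall>n. \<exists>E. scheme_of M (C n) E" by (simp add: scheme_rep_def)
  then obtain E where "\<forall>n. scheme_of M (C n) (E n)" by (rule choice[THEN exE])
  then have E: "\<And>n k x z. E n k x z \<in> sets M"
    and dep: "\<And>n k x x' z z'. (\<forall>i<k. x i = x' i \<and> z i = z' i) \<Longrightarrow> E n k x z = E n k x' z'"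
    and C: "\<And>n. C n = {(w, x). w \<in> space M \<and> (\<exists>z. \<forall>k. w \<in> E n k x z)}"
    unfolding scheme_of_def by blast+
  \<comment> \<open>The first entry of the branch names the member of the union. Level 0 imposes
    nothing, because that entry is not yet visible there.\<close>
  define F where "F k x z = (case k of 0 \<Rightarrow> space M | Suc k \<Rightarrow> E (z 0) k x (\<lambda>j. z (Suc j)))"
    for k x and z :: "nat \<Rightarrow> nat"
  have "(\<Union>n. C n) = {(w, x). w \<in> space M \<and> (\<exists>z. \<forall>k. w \<in> F k x z)}"
  proof (intro equalityI subsetI)
    fix p assume "p \<in> (\<Union>n. C n)"
    then obtain n w x z where p: "p = (w, x)" "w \<in> space M" "\<forall>k. w \<in> E n k x z" unfolding C by auto
    then have "\<forall>k. w \<in> F k x (case_nat n z)" unfolding F_def by (auto split: nat.split)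
    with p show "p \<in> {(w, x). w \<in> space M \<and> (\<exists>z. \<forall>k. w \<in> F k x z)}" by auto
  next
    fix p assume "p \<in> {(w, x). w \<in> space M \<and> (\<exists>z. \<forall>k. w \<in> F k x z)}"
    then obtain w x z where p: "p = (w, x)" "w \<in> space M" "\<forall>k. w \<in> F k x z" by auto
    have "w \<in> E (z 0) k x (\<lambda>j. z (Suc j))" for k using p(3)[rule_format, of "Suc k"] by (simp add: F_def)
    with p show "p \<in> (\<Union>n. C n)" unfolding C by auto
  qed
  moreover have "F k x z \<in> sets M" for k x z unfolding F_def using E by (auto split: nat.split)
  moreover have "F k x z = F k x' z'" if "\<forall>i<k. x i = x' i \<and> z i = z' i" for k x x' z z'
  proof (cases k)
    case (Suc m)
    then have "z 0 = z' 0" "\<forall>i<m. x i = x' i \<and> z (Suc i) = z' (Suc i)" using that by auto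
    with dep[of m x x' "\<lambda>j. z (Suc j)" "\<lambda>j. z' (Suc j)"] show ?thesis by (simp add: F_def Suc)
  qed (simp add: F_def)
  ultimately show ?thesis unfolding scheme_rep_def scheme_of_def by (intro exI[of _ F]) simp
qed

lemma prod_encode_mono2: "j < k \<Longrightarrow> prod_encode (n, j) < prod_encode (n, k)"
proof (induction k)
  case (Suc k)
  have "prod_encode (n, k) < prod_encode (n, Suc k)" by (simp add: prod_encode_def)
  with Suc show ?case by (metis less_antisym less_trans)
qed simp

lemma scheme_rep_INT:
  fixes C :: "nat \<Rightarrow> ('a \<times> (nat \<Rightarrow> nat)) set"
  assumes "\<And>n. scheme_rep M (C n)"
  shows "scheme_rep M (\<Inter>n. C n)"
proof -
  from assms have "\<forall>n. \<exists>E. scheme_of M (C n) E" by (simp add: scheme_rep_def)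
  then obtain E where "\<forall>n. scheme_of M (C n) (E n)" by (rule choice[THEN exE])
  then have E: "\<And>n k x z. E n k x z \<in> sets M"
    and dep: "\<And>n k x x' z z'. (\<forall>i<k. x i = x' i \<and> z i = z' i) \<Longrightarrow> E n k x z = E n k x' z'"
    and C: "\<And>n. C n = {(w, x). w \<in> space M \<and> (\<exists>z. \<forall>k. w \<in> E n k x z)}"
    unfolding scheme_of_def by blast+
  \<comment> \<open>Level \<open>prod_encode (n, k)\<close> tests level \<open>k\<close> of the
    \<open>n\<close>-th scheme. The prefix rule survives because the branch entries read lie at
    \<open>prod_encode (n, j)\<close> with \<open>j < k\<close>, all below this level.\<close>
  define F where "F m x z = (case prod_decode m of (n, k) \<Rightarrow> E n k x (\<lambda>j. z (prod_encode (n, j))))"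
    for m x and z :: "nat \<Rightarrow> nat"
  have Fe: "F (prod_encode (n, k)) x z = E n k x (\<lambda>j. z (prod_encode (n, j)))" for n k x z
    by (simp add: F_def)
  have "(\<Inter>n. C n) = {(w, x). w \<in> space M \<and> (\<exists>z. \<forall>k. w \<in> F k x z)}"
  proof (intro equalityI subsetI)
    fix p assume p: "p \<in> (\<Inter>n. C n)"
    obtain w x where wx: "p = (w, x)" by (cases p)
    from p have "\<forall>n. \<exists>z. \<forall>k. w \<in> E n k x z" and w: "w \<in> space M" unfolding C wx by auto
    then obtain z where z: "\<And>n k. w \<in> E n k x (z n)" by metis
    define y where "y m = (case prod_decode m of (n, k) \<Rightarrow> z n k)" for m
    have "(\<lambda>j. y (prod_encode (n, j))) = z n" for n by (simp add: y_def)
    then have "w \<in> F m x y" for m unfolding F_def using z by (auto split: prod.split)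
    with wx w show "p \<in> {(w, x). w \<in> space M \<and> (\<exists>z. \<forall>k. w \<in> F k x z)}" by auto
  next
    fix p assume "p \<in> {(w, x). w \<in> space M \<and> (\<exists>z. \<forall>k. w \<in> F k x z)}"
    then obtain w x z where p: "p = (w, x)" "w \<in> space M" "\<forall>k. w \<in> F k x z" by auto
    have "w \<in> E n k x (\<lambda>j. z (prod_encode (n, j)))" for n k
      using p(3)[rule_format, of "prod_encode (n, k)"] by (simp add: Fe)
    with p show "p \<in> (\<Inter>n. C n)" unfolding C by blast
  qed
  moreover have "F k x z \<in> sets M" for k x z unfolding F_def using E by (auto split: prod.split)
  moreover have "F m x z = F m x' z'" if h: "\<forall>i<m. x i = x' i \<and> z i = z' i" for m x x' z z'
  proof -
    obtain n k where m: "m = prod_encode (n, k)" by (metis surj_pair prod_decode_inverse)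
    have "k \<le> m" unfolding m by (rule le_prod_encode_2)
    have "\<forall>i<k. x i = x' i \<and> z (prod_encode (n, i)) = z' (prod_encode (n, i))"
      using h prod_encode_mono2[of _ k n] \<open>k \<le> m\<close> unfolding m by auto
    from dep[OF this] show ?thesis unfolding m Fe .
  qed
  ultimately show ?thesis unfolding scheme_rep_def scheme_of_def by (intro exI[of _ F]) simp
qed

lemma scheme_rep_sets:
  assumes "C \<in> sets (M \<Otimes>\<^sub>M bai)"
  shows "scheme_rep M C"
proof -
  define Om where "Om = space M \<times> (UNIV :: (nat \<Rightarrow> nat) set)"
  define G where "G = {A \<times> (UNIV :: (nat \<Rightarrow> nat) set) | A. A \<in> sets M} \<union> {space M \<times> {x. x i = n} | i n. True}"
  have GP: "G \<subseteq> Pow Om" unfolding G_def Om_def using sets.sets_into_space by auto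
  define N where "N = sigma Om G"
  have sN: "space N = Om" and setsN: "sets N = sigma_sets Om G"
    unfolding N_def using GP by (auto simp: space_measure_of_conv sets_measure_of)
  have "(\<lambda>p. p) \<in> measurable N (M \<Otimes>\<^sub>M bai)"
  proof (rule measurable_pair)
    show "fst \<circ> (\<lambda>p. p) \<in> measurable N M"
    proof (rule measurableI)
      fix A assume A: "A \<in> sets M"
      have "(fst \<circ> (\<lambda>p. p)) -` A \<inter> space N = A \<times> UNIV"
        using sets.sets_into_space[OF A] by (auto simp: sN Om_def)
      moreover have "A \<times> UNIV \<in> sets N" unfolding setsN G_def using A by (intro sigma_sets.Basic) auto
      ultimately show "(fst \<circ> (\<lambda>p. p)) -` A \<inter> space N \<in> sets N" by simp
    qed (auto simp: sN Om_def)
    show "snd \<circ> (\<lambda>p. p) \<in> measurable N bai"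
    proof (rule measurable_baiI)
      fix i
      show "(\<lambda>x. (snd \<circ> (\<lambda>p. p)) x i) \<in> measurable N (count_space UNIV)"
      proof (rule measurable_count_space_eq2_countable[THEN iffD2], safe)
        fix n :: nat
        have "(\<lambda>x. (snd \<circ> (\<lambda>p. p)) x i) -` {n} \<inter> space N = space M \<times> {x. x i = n}"
          by (auto simp: sN Om_def)
        moreover have "space M \<times> {x. x i = n} \<in> sets N" unfolding setsN G_def by (intro sigma_sets.Basic) auto
        ultimately show "(\<lambda>x. (snd \<circ> (\<lambda>p. p)) x i) -` {n} \<inter> space N \<in> sets N" by simp
      qed auto
    qed
  qed
  from measurable_sets[OF this assms] sets.sets_into_space[OF assms]
  have "C \<in> sigma_sets Om G"
    by (simp add: setsN[symmetric] sN) (metis Om_def Int_absorb2 space_bai space_pair_measure)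
  then have "scheme_rep M C \<and> scheme_rep M (Om - C)"
  proof induction
    case (Basic a)
    then consider A where "A \<in> sets M" "a = A \<times> UNIV" | i n where "a = space M \<times> {x. x i = n}"
      unfolding G_def by blast
    then show ?case
    proof cases
      case 1
      have "scheme_rep M (B \<times> UNIV)" if "B \<in> sets M" for B
        unfolding scheme_rep_def scheme_of_def using that sets.sets_into_space[OF that]
        by (intro exI[of _ "\<lambda>_ _ _. B"]) auto
      from this[of A] this[of "space M - A"] 1 show ?thesis
        by (simp add: Om_def Times_Diff_distrib1)
    next
      case 2
      have P: "scheme_rep M (space M \<times> {x. P (x i)})" for P
        unfolding scheme_rep_def scheme_of_def
      \<comment> \<open>The condition on entry \<open>i\<close> is imposed only at levels above
        \<open>i\<close>, where the prefix rule allows it.\<close>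
      proof (intro exI[of _ "\<lambda>k x z. if i < k \<and> \<not> P (x i) then {} else space M"] conjI)
        show "space M \<times> {x. P (x i)} = {(w, x). w \<in> space M \<and>
            (\<exists>z::nat \<Rightarrow> nat. \<forall>k. w \<in> (if i < k \<and> \<not> P (x i) then {} else space M))}"
          by (auto split: if_splits)
      qed auto
      have "Om - a = space M \<times> {x. x i \<noteq> n}" unfolding 2 Om_def by auto
      with P[of "\<lambda>v. v = n"] P[of "\<lambda>v. v \<noteq> n"] 2 show ?thesis by simp
    qed
  next
    case Empty
    have "scheme_rep M {}" unfolding scheme_rep_def scheme_of_def by (intro exI[of _ "\<lambda>_ _ _. {}"]) auto
    moreover have "scheme_rep M Om" unfolding scheme_rep_def scheme_of_def Om_def by (intro exI[of _ "\<lambda>_ _ _. space M"]) auto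
    ultimately show ?case by simp
  next
    case (Compl a)
    moreover from Compl have "Om - (Om - a) = a" using sigma_sets_into_sp[OF GP] by blast
    ultimately show ?case by simp
  next
    case (Union a)
    have "Om - (\<Union>i. a i) = (\<Inter>i. Om - a i)" by auto
    moreover have "scheme_rep M (\<Inter>i. Om - a i)" by (rule scheme_rep_INT) (use Union in blast)
    moreover have "scheme_rep M (\<Union>i. a i)" by (rule scheme_rep_UN) (use Union in blast)
    ultimately show ?case by simp
  qed
  then show ?thesis by simp
qed

text \<open>The auxiliary witness \<open>z\<close> of a scheme is interleaved with \<open>x\<close> into a single branch \<open>y\<close>.\<close>
lemma suslin_scheme_pair:
  assumes "C \<in> sets (M \<Otimes>\<^sub>M bai)"
  shows "\<exists>H. (\<forall>k y. H k y \<in> sets M) \<and> prefix_dep H \<and>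
    C = {(w, x). w \<in> space M \<and> (\<exists>y. x = (\<lambda>i. y (2 * i)) \<and> (\<forall>k. w \<in> H k y))}"
proof -
  obtain E where "scheme_of M C E" using scheme_rep_sets[OF assms] unfolding scheme_rep_def by (rule exE)
  then have E: "\<And>k x z. E k x z \<in> sets M"
    and dep: "\<And>k x x' z z'. (\<forall>i<k. x i = x' i \<and> z i = z' i) \<Longrightarrow> E k x z = E k x' z'"
    and C: "C = {(w, x). w \<in> space M \<and> (\<exists>z. \<forall>k. w \<in> E k x z)}"
    unfolding scheme_of_def by blast+
  define H where "H m y = E (m div 2) (\<lambda>i. y (2 * i)) (\<lambda>i. y (2 * i + 1))" for m y
  show ?thesis
  proof (intro exI[of _ H] conjI allI)
    show "H k y \<in> sets M" for k y using E by (simp add: H_def)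
    show "prefix_dep H" unfolding prefix_dep_def H_def by (intro allI impI dep) auto
    show "C = {(w, x). w \<in> space M \<and> (\<exists>y. x = (\<lambda>i. y (2 * i)) \<and> (\<forall>k. w \<in> H k y))}"
    proof (intro equalityI subsetI; clarify)
      fix w x assume "(w, x) \<in> C"
      then obtain z where z: "w \<in> space M" "\<forall>k. w \<in> E k x z" unfolding C by auto
      define y where "y i = (if even i then x (i div 2) else z (i div 2))" for i
      have "x = (\<lambda>i. y (2 * i))" "z = (\<lambda>i. y (2 * i + 1))" by (auto simp: y_def)
      with z show "w \<in> space M \<and> (\<exists>y. x = (\<lambda>i. y (2 * i)) \<and> (\<forall>k. w \<in> H k y))"
        by (metis H_def)
    next
      fix w and y :: "nat \<Rightarrow> nat" assume w: "w \<in> space M" "\<forall>k. w \<in> H k y"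
      have "w \<in> E k (\<lambda>i. y (2 * i)) (\<lambda>i. y (2 * i + 1))" for k
        using w(2)[rule_format, of "2 * k"] by (simp add: H_def)
      with w show "(w, \<lambda>i. y (2 * i)) \<in> C" unfolding C by auto
    qed
  qed
qed

text \<open>The form used from here on. By \<open>prefix_dep\<close>, \<open>H k\<close> is in
  effect indexed by the sequences of length \<open>k\<close>: a Souslin scheme with finite sequences
  replaced by infinite branches.\<close>

lemma suslin_scheme:
  assumes "A \<in> suslin M"
  shows "\<exists>H. (\<forall>k y. H k y \<in> sets M) \<and> prefix_dep H \<and> A = {w \<in> space M. \<exists>y. \<forall>k. w \<in> H k y}"
proof -
  obtain C where C: "C \<in> sets (M \<Otimes>\<^sub>M bai)" "A = fst ` C" using assms by (auto simp: suslin_def)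
  obtain H where H: "\<forall>k y. H k y \<in> sets M" "prefix_dep H"
      "C = {(w, x). w \<in> space M \<and> (\<exists>y. x = (\<lambda>i. y (2 * i)) \<and> (\<forall>k. w \<in> H k y))}"
    using suslin_scheme_pair[OF C(1)] by auto
  show ?thesis by (intro exI[of _ H] conjI H) (force simp: C(2) H(3))
qed

section \<open>Capacitability of Suslin sets\<close>

definition zpad :: "nat list \<Rightarrow> nat \<Rightarrow> nat" where
  "zpad l i = (if i < length l then l ! i else 0)"

lemma zpad_map [simp]: "i < k \<Longrightarrow> zpad (map y [0..<k]) i = y i"
  by (simp add: zpad_def)

text \<open>Measurable outer approximations of that part of the Suslin set whose branches lie in the
  compact box below \<open>n\<close>: the points surviving to level \<open>k\<close> along a branch
  in the box.\<close>

definition bnd :: "'a set \<Rightarrow> (nat \<Rightarrow> (nat \<Rightarrow> nat) \<Rightarrow> 'a set) \<Rightarrow> nat \<Rightarrow> (nat \<Rightarrow> nat) \<Rightarrow> 'a set" where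
  "bnd Om H k n = {w \<in> Om. \<exists>y. (\<forall>i<k. y i \<le> n i) \<and> (\<forall>j\<le>k. w \<in> H j y)}"

text \<open>Only the first \<open>k\<close> entries of a branch matter, so branches are replaced by
  the countably many zero-padded lists.\<close>

lemma bnd_sets:
  assumes "\<And>k y. H k y \<in> sets M" "prefix_dep H"
  shows "bnd (space M) H k n \<in> sets M"
proof -
  have "bnd (space M) H k n = (\<Union>l\<in>{l. \<forall>i<k. zpad l i \<le> n i}. \<Inter>j\<le>k. H j (zpad l))"
  proof (intro equalityI subsetI)
    fix w assume "w \<in> bnd (space M) H k n"
    then obtain y where y: "\<forall>i<k. y i \<le> n i" "\<forall>j\<le>k. w \<in> H j y" by (auto simp: bnd_def)
    have "H j y = H j (zpad (map y [0..<k]))" if "j \<le> k" for j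
      by (rule prefix_depD[OF assms(2)]) (use that in auto)
    with y show "w \<in> (\<Union>l\<in>{l. \<forall>i<k. zpad l i \<le> n i}. \<Inter>j\<le>k. H j (zpad l))"
      by (intro UN_I[of "map y [0..<k]"]) auto
  next
    fix w assume "w \<in> (\<Union>l\<in>{l. \<forall>i<k. zpad l i \<le> n i}. \<Inter>j\<le>k. H j (zpad l))"
    then obtain l where l: "\<forall>i<k. zpad l i \<le> n i" "\<forall>j\<le>k. w \<in> H j (zpad l)" by auto
    moreover have "w \<in> space M" using l(2) sets.sets_into_space[OF assms(1)[of 0 "zpad l"]] by auto
    ultimately show "w \<in> bnd (space M) H k n" unfolding bnd_def by auto
  qed
  moreover have "(\<Inter>j\<le>k. H j (zpad l)) \<in> sets M" for l
    by (intro sets.finite_INT assms) auto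
  ultimately show ?thesis by (auto intro!: sets.countable_UN')
qed

lemma bnd_prefix: "bnd Om H k n = bnd Om H k (zpad (map n [0..<k]))"
  unfolding bnd_def by (simp cong: conj_cong)

lemma bnd_antimono: "k \<le> k' \<Longrightarrow> bnd Om H k' n \<subseteq> bnd Om H k n"
proof
  fix w assume k: "k \<le> k'" and "w \<in> bnd Om H k' n"
  then obtain y where y: "w \<in> Om" "\<forall>i<k'. y i \<le> n i" "\<forall>j\<le>k'. w \<in> H j y"
    unfolding bnd_def by blast
  have "\<forall>i<k. y i \<le> n i" "\<forall>j\<le>k. w \<in> H j y" using y k by simp_all
  with y(1) show "w \<in> bnd Om H k n" unfolding bnd_def by blast
qed

text \<open>Koenig's lemma: the tree of branches bounded by \<open>n\<close> is finitely branching.\<close>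
lemma bnd_Inter:
  assumes dep: "prefix_dep H" and w: "\<And>k. w \<in> bnd Om H k n"
  shows "\<exists>y. \<forall>k. w \<in> H k y"
proof -
  define Q where "Q l \<longleftrightarrow> (\<forall>m. \<exists>y. (\<forall>i<length l. y i = l ! i) \<and> (\<forall>i<m. y i \<le> n i) \<and> (\<forall>j\<le>m. w \<in> H j y))" for l
  have step: "\<exists>v. Q (l @ [v])" if Q: "Q l" for l
  proof (rule ccontr)
    let ?k = "length l"
    assume "\<nexists>v. Q (l @ [v])"
    then have "\<forall>v. \<exists>m. \<not> (\<exists>y. (\<forall>i<length (l @ [v]). y i = (l @ [v]) ! i) \<and> (\<forall>i<m. y i \<le> n i) \<and> (\<forall>j\<le>m. w \<in> H j y))"
      unfolding Q_def by blast
    then obtain m where m: "\<And>v. \<not> (\<exists>y. (\<forall>i<length (l @ [v]). y i = (l @ [v]) ! i) \<and> (\<forall>i<m v. y i \<le> n i) \<and> (\<forall>j\<le>m v. w \<in> H j y))"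
      by metis
    \<comment> \<open>\<open>L\<close> is at least the failing depth of each of the finitely many
      entries allowed next, so a bounded branch surviving to \<open>L\<close> contradicts one of
      them.\<close>
    define L where "L = max (Suc ?k) (Max (m ` {..n ?k}))"
    obtain y where y: "\<forall>i<?k. y i = l ! i" "\<forall>i<L. y i \<le> n i" "\<forall>j\<le>L. w \<in> H j y"
      using Q unfolding Q_def by blast
    have "y ?k \<le> n ?k" using y(2) by (simp add: L_def)
    then have "m (y ?k) \<le> L" unfolding L_def by (simp add: le_max_iff_disj)
    then show False using m[of "y ?k"] y by (auto simp: nth_append less_Suc_eq)
  qed
  have "Q []" unfolding Q_def using w by (auto simp: bnd_def)
  have "\<exists>f. \<forall>k. (Q (f k) \<and> length (f k) = k) \<and> (\<exists>v. f (Suc k) = f k @ [v])"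
    by (rule dependent_nat_choice) (use \<open>Q []\<close> step in fastforce)+
  then obtain f where f: "\<And>k. Q (f k)" "\<And>k. length (f k) = k" "\<And>k. \<exists>v. f (Suc k) = f k @ [v]" by blast
  define y where "y i = f (Suc i) ! i" for i
  have fy: "f k ! i = y i" if "i < k" for i k
    using that
  proof (induction k)
    case (Suc k)
    obtain v where v: "f (Suc k) = f k @ [v]" using f(3) by blast
    show ?case
    proof (cases "i = k")
      case False
      then show ?thesis using Suc v f(2) by (simp add: nth_append)
    qed (simp add: y_def)
  qed simp
  have "w \<in> H k y" for k
  proof -
    obtain z where z: "\<forall>i<k. z i = f k ! i" "\<forall>j\<le>k. w \<in> H j z" using f(1)[of k, unfolded Q_def, rule_format, of k] by (auto simp: f(2))
    have "H k z = H k y" by (rule prefix_depD[OF dep]) (use z fy in auto)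
    with z show ?thesis by auto
  qed
  then show ?thesis by blast
qed

text \<open>Choquet's argument: relaxing the bound on one entry exhausts the set increasingly, and
  outer measure is continuous along increasing sequences of arbitrary sets. So the bounds can be
  fixed one entry at a time without dropping to \<open>r\<close>.\<close>

lemma scheme_capacity:
  assumes A: "A = {w \<in> space M. \<exists>y. \<forall>k. w \<in> H k y}" and r: "r < outer_measure_of M A"
    and H: "\<And>k y. H k y \<in> sets M" "prefix_dep H"
  shows "\<exists>n. \<forall>k. r < emeasure M (bnd (space M) H k n)"
proof -
  define B where "B l = {w \<in> space M. \<exists>y. (\<forall>i<length l. y i \<le> l ! i) \<and> (\<forall>j. w \<in> H j y)}" for l
  have step: "\<exists>v. r < outer_measure_of M (B (l @ [v]))" if "r < outer_measure_of M (B l)" for l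
  proof -
    have "B l = (\<Union>v. B (l @ [v]))"
    proof (intro equalityI subsetI)
      fix w assume "w \<in> B l"
      then obtain y where y: "w \<in> space M" "\<forall>i<length l. y i \<le> l ! i" "\<forall>j. w \<in> H j y" by (auto simp: B_def)
      then have "w \<in> B (l @ [y (length l)])" unfolding B_def
        by (auto intro!: exI[of _ y] simp: nth_append less_Suc_eq)
      then show "w \<in> (\<Union>v. B (l @ [v]))" by blast
    next
      fix w assume "w \<in> (\<Union>v. B (l @ [v]))"
      then obtain v y where y: "w \<in> space M" "\<forall>i<length (l @ [v]). y i \<le> (l @ [v]) ! i" "\<forall>j. w \<in> H j y"
        by (auto simp: B_def)
      have "\<forall>i<length l. y i \<le> l ! i" using y(2) by (metis nth_append length_append_singleton less_SucI)
      with y show "w \<in> B l" unfolding B_def by blast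
    qed
    moreover have "incseq (\<lambda>v. B (l @ [v]))"
    proof (rule incseq_SucI, rule subsetI)
      fix v w assume "w \<in> B (l @ [v])"
      then obtain y where y: "w \<in> space M" "\<forall>i<length (l @ [v]). y i \<le> (l @ [v]) ! i" "\<forall>j. w \<in> H j y"
        by (auto simp: B_def)
      have "\<forall>i<length (l @ [Suc v]). y i \<le> (l @ [Suc v]) ! i"
        using y(2) by (auto simp: nth_append less_Suc_eq le_SucI) 
      with y show "w \<in> B (l @ [Suc v])" unfolding B_def by blast
    qed
    ultimately have "(SUP v. outer_measure_of M (B (l @ [v]))) = outer_measure_of M (B l)"
      using SUP_outer_measure_of_incseq[of "\<lambda>v. B (l @ [v])" M] by (auto simp: B_def)
    with that have "r < (SUP v. outer_measure_of M (B (l @ [v])))" by simp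
    then show ?thesis by (auto simp: less_SUP_iff)
  qed
  have "B [] = A" by (simp add: B_def A)
  have "\<exists>f. \<forall>k. (r < outer_measure_of M (B (f k)) \<and> length (f k) = k) \<and> (\<exists>v. f (Suc k) = f k @ [v])"
    by (rule dependent_nat_choice) (use \<open>B [] = A\<close> r step in fastforce)+
  then obtain f where f: "\<And>k. r < outer_measure_of M (B (f k))" "\<And>k. length (f k) = k"
    "\<And>k. \<exists>v. f (Suc k) = f k @ [v]" by blast
  define n where "n i = f (Suc i) ! i" for i
  have fn: "f k ! i = n i" if "i < k" for i k
    using that
  proof (induction k)
    case (Suc k)
    obtain v where v: "f (Suc k) = f k @ [v]" using f(3) by blast
    show ?case
    proof (cases "i = k")
      case False
      then show ?thesis using Suc v f(2) by (simp add: nth_append)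
    qed (simp add: n_def)
  qed simp
  have "r < emeasure M (bnd (space M) H k n)" for k
  proof -
    have "B (f k) \<subseteq> bnd (space M) H k n" unfolding B_def bnd_def using fn f(2) by auto
    from outer_measure_of_mono[OF this, of M] f(1)[of k] bnd_sets[of H M k n] H
    show ?thesis by (simp add: less_le_trans)
  qed
  then show ?thesis by blast
qed

text \<open>The approximations decrease to a measurable set that lies in \<open>A\<close> by
  \<open>bnd_Inter\<close>; finiteness of the measure carries the lower bound to the limit.\<close>

lemma scheme_inner:
  assumes A: "A = {w \<in> space M. \<exists>y. \<forall>k. w \<in> H k y}" and "finite_measure M"
    and H: "\<And>k y. H k y \<in> sets M" "prefix_dep H" and r: "\<And>k. r \<le> emeasure M (bnd (space M) H k n)"
  shows "\<exists>B\<in>sets M. B \<subseteq> A \<and> r \<le> emeasure M B"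
proof (intro bexI conjI)
  interpret finite_measure M by fact
  let ?B = "\<Inter>k. bnd (space M) H k n"
  show S: "?B \<in> sets M" by (intro sets.countable_INT) (use bnd_sets[of H M] H in auto)
  show "?B \<subseteq> A"
  proof
    fix w assume "w \<in> ?B"
    with bnd_Inter[OF H(2), of w "space M" n] show "w \<in> A" unfolding A by (auto simp: bnd_def)
  qed
  have "emeasure M ?B = (INF k. emeasure M (bnd (space M) H k n))"
    by (rule INF_emeasure_decseq[symmetric])
      (use bnd_sets[of H M] H in \<open>auto simp: decseq_def bnd_antimono\<close>)
  then show "r \<le> emeasure M ?B" using r by (simp add: le_INF_iff)
qed

lemma AE_iff_outer_measure_0:
  assumes "A \<subseteq> space M"
  shows "(AE w in M. w \<notin> A) \<longleftrightarrow> outer_measure_of M A = 0"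
proof
  assume "AE w in M. w \<notin> A"
  then obtain N where N: "N \<in> null_sets M" "{w \<in> space M. \<not> w \<notin> A} \<subseteq> N" by (auto simp: eventually_ae_filter)
  then have "A \<subseteq> N" using assms by auto
  then have "outer_measure_of M A \<le> emeasure M N" using N by (metis null_setsD2 outer_measure_of_eq outer_measure_of_mono)
  then show "outer_measure_of M A = 0" using N by auto
next
  assume 0: "outer_measure_of M A = 0"
  obtain E where "E \<in> sets M" "A \<subseteq> E" "outer_measure_of M A = emeasure M E"
    using outer_measure_of_attain[OF assms] by metis
  with 0 show "AE w in M. w \<notin> A" by (intro AE_I[of _ _ E]) auto
qed

text \<open>The set is squeezed between a measurable hull of the same outer measure and a union of
  inner approximations whose measures come arbitrarily close to it.\<close>

lemma suslin_in_completion: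
  assumes "A \<in> suslin M" "P \<in> probs M"
  shows "A \<in> sets (completion P)"
proof -
  have sP: "sets P = sets M" "space P = space M" and "prob_space P"
    using assms(2) by (auto simp: probs_def dest: sets_eq_imp_space_eq)
  interpret P: prob_space P by fact
  obtain H where "\<forall>k y. H k y \<in> sets M" "prefix_dep H" "A = {w \<in> space M. \<exists>y. \<forall>k. w \<in> H k y}"
    using suslin_scheme[OF assms(1)] by auto
  then have H: "\<And>k y. H k y \<in> sets P" "prefix_dep H" "A = {w \<in> space P. \<exists>y. \<forall>k. w \<in> H k y}"
    by (simp_all add: sP)
  have AP: "A \<subseteq> space P" using H by auto
  obtain E where E: "E \<in> sets P" "A \<subseteq> E" "outer_measure_of P A = emeasure P E"
    using outer_measure_of_attain[OF AP] by metis
  have "\<exists>B\<in>sets P. B \<subseteq> A \<and> emeasure P E \<le> emeasure P B + ennreal (1 / Suc n)" for n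
  proof (cases "emeasure P E = 0")
    case False
    let ?r = "emeasure P E - ennreal (1 / Suc n)"
    have "?r < outer_measure_of P A"
      unfolding E(3) by (rule ennreal_between)
        (use False P.emeasure_finite[of E] in \<open>auto simp: zero_less_iff_neq_zero top.not_eq_extremum[symmetric]\<close>)
    from scheme_capacity[OF H(3) this H(1,2)] obtain m where
      "\<forall>k. ?r < emeasure P (bnd (space P) H k m)" by (rule exE)
    then have "?r \<le> emeasure P (bnd (space P) H k m)" for k by (simp add: less_imp_le)
    from scheme_inner[OF H(3) P.finite_measure_axioms H(1,2) this]
    obtain B where "B \<in> sets P" "B \<subseteq> A" "?r \<le> emeasure P B" by (rule bexE) simp
    then show ?thesis by (intro bexI[of _ B]) (auto simp: ennreal_minus_le_iff add.commute)
  qed (auto intro!: bexI[of _ "{}"])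
  then have "\<forall>n. \<exists>B. B \<in> sets P \<and> B \<subseteq> A \<and> emeasure P E \<le> emeasure P B + ennreal (1 / Suc n)" by blast
  then obtain B where "\<forall>n. B n \<in> sets P \<and> B n \<subseteq> A \<and> emeasure P E \<le> emeasure P (B n) + ennreal (1 / Suc n)"
    by (rule choice[THEN exE])
  then have B: "\<And>n. B n \<in> sets P" "\<And>n. B n \<subseteq> A" "\<And>n. emeasure P E \<le> emeasure P (B n) + ennreal (1 / Suc n)"
    by auto
  let ?B = "\<Union>n. B n"
  have BS: "?B \<in> sets P" "?B \<subseteq> A" using B by auto
  have "emeasure P E \<le> emeasure P ?B"
  proof (rule ennreal_le_epsilon)
    fix e :: real assume "0 < e"
    then obtain n where n: "1 / real (Suc n) < e" using nat_approx_posE by blast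
    have "emeasure P (B n) + ennreal (1 / Suc n) \<le> emeasure P ?B + ennreal e"
      using n BS(1) by (intro add_mono emeasure_mono ennreal_leI) auto
    with B(3)[of n] show "emeasure P E \<le> emeasure P ?B + ennreal e" by (rule order_trans)
  qed
  then have "emeasure P (E - ?B) = 0"
    using emeasure_Diff[of P ?B E] BS E P.emeasure_finite[of E]
    by (auto simp: diff_eq_0_iff_ennreal top.not_eq_extremum[symmetric])
  then have "E - ?B \<in> null_sets P" using E BS by auto
  then show ?thesis
    by (intro sets_completionI[of A ?B "A - ?B" "E - ?B"]) (use BS E in auto)
qed

section \<open>The universal completion\<close>

lemma sigma_algebra_univ_sets: "sigma_algebra (space M) (univ_sets M)"
  unfolding sigma_algebra_iff2
proof (intro conjI ballI allI impI)
  show "univ_sets M \<subseteq> Pow (space M)" by (auto simp: univ_sets_def)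
  show "{} \<in> univ_sets M" by (auto simp: univ_sets_def)
next
  fix A assume A: "A \<in> univ_sets M"
  have "space M - A \<in> sets (completion P)" if P: "P \<in> probs M" for P
  proof -
    have "space (completion P) - A \<in> sets (completion P)"
      using A P by (intro sets.compl_sets) (auto simp: univ_sets_def)
    moreover have "space P = space M" using P by (auto simp: probs_def dest: sets_eq_imp_space_eq)
    ultimately show ?thesis by simp
  qed
  then show "space M - A \<in> univ_sets M" by (auto simp: univ_sets_def)
next
  fix A :: "nat \<Rightarrow> 'a set" assume A: "range A \<subseteq> univ_sets M"
  have "(\<Union>i. A i) \<in> sets (completion P)" if P: "P \<in> probs M" for P
    using A P by (intro sets.countable_UN) (auto simp: univ_sets_def)
  then show "\<Union> (A ` UNIV) \<in> univ_sets M" using A by (auto simp: univ_sets_def)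
qed

lemma space_univ_completion [simp]: "space (univ_completion M) = space M"
  unfolding univ_completion_def by (rule space_measure_of) (auto simp: univ_sets_def)

lemma sets_univ_completion: "sets (univ_completion M) = univ_sets M"
  unfolding univ_completion_def by (rule sigma_algebra.sets_measure_of_eq[OF sigma_algebra_univ_sets])

lemma probs_space: "P \<in> probs M \<Longrightarrow> space P = space M"
  and probs_sets: "P \<in> probs M \<Longrightarrow> sets P = sets M"
  and probs_prob: "P \<in> probs M \<Longrightarrow> prob_space P"
  by (auto simp: probs_def dest: sets_eq_imp_space_eq)

lemma univ_completion_sets_completion:
  "A \<in> sets (univ_completion M) \<Longrightarrow> P \<in> probs M \<Longrightarrow> A \<in> sets (completion P)"
  by (simp add: sets_univ_completion univ_sets_def)

lemma measurable_univ_completionI: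
  assumes "\<And>P. P \<in> probs M \<Longrightarrow> f \<in> measurable (completion P) N" "\<And>x. x \<in> space M \<Longrightarrow> f x \<in> space N"
  shows "f \<in> measurable (univ_completion M) N"
proof (rule measurableI)
  fix A assume A: "A \<in> sets N"
  have "f -` A \<inter> space M \<in> sets (completion P)" if P: "P \<in> probs M" for P
    using measurable_sets[OF assms(1)[OF P] A] by (simp add: probs_space[OF P])
  then show "f -` A \<inter> space (univ_completion M) \<in> sets (univ_completion M)"
    by (simp add: sets_univ_completion univ_sets_def)
qed (use assms(2) in simp)

lemma measurable_univ_completionD:
  assumes "f \<in> measurable (univ_completion M) N" "P \<in> probs M"
  shows "f \<in> measurable (completion P) N"
proof (rule measurableI)
  fix A assume A: "A \<in> sets N"
  show "f -` A \<inter> space (completion P) \<in> sets (completion P)"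
    using univ_completion_sets_completion[OF measurable_sets[OF assms(1) A] assms(2)] probs_space[OF assms(2)] by simp
qed (use assms measurable_space[OF assms(1)] probs_space[OF assms(2)] in simp)

lemma sets_univ_completionI: "A \<in> sets M \<Longrightarrow> A \<in> sets (univ_completion M)"
  using sets.sets_into_space by (auto simp: sets_univ_completion univ_sets_def probs_sets)

lemma measurable_univ_completion: "f \<in> measurable M N \<Longrightarrow> f \<in> measurable (univ_completion M) N"
  by (rule measurableI) (auto dest: measurable_sets measurable_space intro: sets_univ_completionI)

lemma suslin_univ_completion:
  assumes "A \<in> suslin M" shows "A \<in> sets (univ_completion M)"
proof -
  have "A \<subseteq> space M" using assms sets.sets_into_space unfolding suslin_def by (force simp: space_pair_measure)
  then show ?thesis using suslin_in_completion[OF assms] by (auto simp: sets_univ_completion univ_sets_def)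
qed

text \<open>Every probability on the source pushes forward to one on the target, and the measurable
  sandwich for the image law pulls back. In particular restricting or extending paths preserves
  universal measurability.\<close>

lemma measurable_univ_completion_lift:
  assumes g: "g \<in> measurable M N"
  shows "g \<in> measurable (univ_completion M) (univ_completion N)"
proof (rule measurableI)
  fix A assume A: "A \<in> sets (univ_completion N)"
  have "g -` A \<inter> space M \<in> sets (completion P)" if P: "P \<in> probs M" for P
  proof -
    interpret P: prob_space P by (rule probs_prob[OF P])
    have gP: "g \<in> measurable P N" using g probs_sets[OF P] by (simp cong: measurable_cong_sets)
    have "distr P N g \<in> probs N" unfolding probs_def using P.prob_space_distr[OF gP] by simp
    from univ_completion_sets_completion[OF A this]
    obtain S U U' where S: "A = S \<union> U" "U \<subseteq> U'" "U' \<in> null_sets (distr P N g)" "S \<in> sets (distr P N g)"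
      by (rule sets_completionE)
    show ?thesis
    proof (rule sets_completionI)
      show "g -` A \<inter> space M = (g -` S \<inter> space M) \<union> (g -` U \<inter> space M)" using S by auto
      show "g -` U \<inter> space M \<subseteq> g -` U' \<inter> space P" using S probs_space[OF P] by auto
      show "g -` U' \<inter> space P \<in> null_sets P" using S(3) gP
        by (auto simp: null_sets_def emeasure_distr measurable_sets)
      show "g -` S \<inter> space M \<in> sets P" using measurable_sets[OF gP, of S] S(4) probs_space[OF P] by simp
    qed
  qed
  then show "g -` A \<inter> space (univ_completion M) \<in> sets (univ_completion M)"
    by (simp add: sets_univ_completion univ_sets_def)
qed (use measurable_space[OF g] in simp)

lemma measurable_prefix: "(\<lambda>x. map x [0..<k]) \<in> measurable bai (count_space UNIV)"
proof (induction k)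
  case (Suc k)
  have "(\<lambda>x. l @ [x k]) \<in> measurable bai (count_space UNIV)" for l
    by (rule measurable_compose[OF measurable_bai_coord]) simp
  from measurable_compose_countable[OF this Suc] show ?case by simp
qed simp

lemma scheme_pair_sets:
  assumes H: "\<And>k y. H k y \<in> sets M" "prefix_dep H"
  shows "{p \<in> space (M \<Otimes>\<^sub>M bai). (\<forall>i<length l. snd p i = l ! i) \<and> (\<forall>k. fst p \<in> H k (snd p))} \<in> sets (M \<Otimes>\<^sub>M bai)"
proof -
  have 1: "{p \<in> space (M \<Otimes>\<^sub>M bai). fst p \<in> H k (snd p)} \<in> sets (M \<Otimes>\<^sub>M bai)" for k
  proof -
    have "(\<lambda>p. fst p \<in> H k (zpad l)) \<in> measurable (M \<Otimes>\<^sub>M bai) (count_space UNIV)" for l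
      using measurable_sets[OF measurable_fst H(1)[of k "zpad l"], of bai]
      by (simp add: pred_def vimage_def Int_def conj_commute)
    from measurable_compose_countable[OF this measurable_compose[OF measurable_snd measurable_prefix]]
    have "(\<lambda>p. fst p \<in> H k (zpad (map (snd p) [0..<k]))) \<in> measurable (M \<Otimes>\<^sub>M bai) (count_space UNIV)" .
    moreover have "H k (zpad (map y [0..<k])) = H k y" for y
      by (rule prefix_depD[OF H(2)]) simp
    ultimately show ?thesis by (simp add: pred_def)
  qed
  have 2: "{p \<in> space (M \<Otimes>\<^sub>M bai). snd p i = v} \<in> sets (M \<Otimes>\<^sub>M bai)" for i v
  proof -
    have "(\<lambda>p. snd p i) -` {v} \<inter> space (M \<Otimes>\<^sub>M bai) \<in> sets (M \<Otimes>\<^sub>M bai)"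
      by (rule measurable_sets[OF measurable_compose[OF measurable_snd measurable_bai_coord]]) simp
    then show ?thesis by (simp add: vimage_def Int_def conj_commute)
  qed
  show ?thesis
    by (intro sets.sets_Collect_conj sets.sets_Collect_countable_All 1)
      (use 2 in \<open>intro sets.sets_Collect_countable_All sets.sets_Collect_imp sets.sets_Collect_const\<close>)
qed

text \<open>Jankov--von Neumann selection by the leftmost branch.\<close>
lemma suslin_selection:
  assumes C: "C \<in> sets (M \<Otimes>\<^sub>M bai)"
  shows "\<exists>s\<in>measurable (univ_completion M) bai. \<forall>w\<in>fst ` C. (w, s w) \<in> C"
proof -
  obtain H where H: "\<And>k y. H k y \<in> sets M" "prefix_dep H"
    and CH: "C = {(w, x). w \<in> space M \<and> (\<exists>y. x = (\<lambda>i. y (2 * i)) \<and> (\<forall>k. w \<in> H k y))}"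
    using suslin_scheme_pair[OF C] by auto
  \<comment> \<open>\<open>R l\<close> consists of the points with a branch through
    \<open>l\<close>. It is a projection, hence universally measurable, and so is the greedy choice
    of the next entry that keeps the point in some \<open>R\<close>.\<close>
  define R where "R l = {w \<in> space M. \<exists>y. (\<forall>i<length l. y i = l ! i) \<and> (\<forall>k. w \<in> H k y)}" for l
  have R: "R l \<in> sets (univ_completion M)" for l
  proof -
    have "R l = fst ` {p \<in> space (M \<Otimes>\<^sub>M bai). (\<forall>i<length l. snd p i = l ! i) \<and> (\<forall>k. fst p \<in> H k (snd p))}"
    proof (intro equalityI subsetI)
      fix w assume "w \<in> R l"
      then obtain y where "w \<in> space M" "\<forall>i<length l. y i = l ! i" "\<forall>k. w \<in> H k y" by (auto simp: R_def)
      then show "w \<in> fst ` {p \<in> space (M \<Otimes>\<^sub>M bai). (\<forall>i<length l. snd p i = l ! i) \<and> (\<forall>k. fst p \<in> H k (snd p))}"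
        by (intro image_eqI[of _ _ "(w, y)"]) (auto simp: space_pair_measure)
    next
      fix w assume "w \<in> fst ` {p \<in> space (M \<Otimes>\<^sub>M bai). (\<forall>i<length l. snd p i = l ! i) \<and> (\<forall>k. fst p \<in> H k (snd p))}"
      then show "w \<in> R l" unfolding R_def by (auto simp: space_pair_measure)
    qed
    then show ?thesis using suslin_univ_completion[OF suslinI[OF scheme_pair_sets[OF H]]] by simp
  qed
  define pre where "pre k w = rec_nat [] (\<lambda>_ l. l @ [LEAST v. w \<in> R (l @ [v])]) k" for k w
  have pre0: "pre 0 w = []" and preS: "pre (Suc k) w = pre k w @ [LEAST v. w \<in> R (pre k w @ [v])]" for k w
    by (auto simp: pre_def)
  have len: "length (pre k w) = k" for k w by (induction k) (auto simp: pre0 preS)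
  have mpre: "pre k \<in> measurable (univ_completion M) (count_space UNIV)" for k
  proof (induction k)
    case (Suc k)
    have p: "(\<lambda>w. w \<in> R l) \<in> measurable (univ_completion M) (count_space UNIV)" for l
    proof -
      have "{w \<in> space M. w \<in> R l} = R l" by (auto simp: R_def)
      then show ?thesis using R[of l] by (simp add: pred_def)
    qed
    have "(\<lambda>w. l @ [LEAST v. w \<in> R (l @ [v])]) \<in> measurable (univ_completion M) (count_space UNIV)" for l
      by (rule measurable_compose[OF measurable_Least[OF p]]) simp
    from measurable_compose_countable[OF this Suc] show ?case by (simp add: preS)
  qed (simp add: pre0)
  define y where "y w i = pre (Suc i) w ! i" for w i
  have prey: "pre k w ! i = y w i" if "i < k" for i k w
    using that
  proof (induction k)
    case (Suc k)
    then show ?case by (cases "i = k") (simp_all add: y_def preS nth_append len)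
  qed simp
  have my: "(\<lambda>w. y w i) \<in> measurable (univ_completion M) (count_space UNIV)" for i
    unfolding y_def by (rule measurable_compose[OF mpre]) simp
  show ?thesis
  proof (intro bexI ballI)
    show "(\<lambda>w i. y w (2 * i)) \<in> measurable (univ_completion M) bai"
      by (intro measurable_baiI my)
  next
    fix w assume "w \<in> fst ` C"
    then obtain y0 where w: "w \<in> space M" and "\<forall>k. w \<in> H k y0" unfolding CH by auto
    then have w0: "w \<in> R []" unfolding R_def by (simp, intro exI[of _ y0])
    have Rp: "w \<in> R (pre k w)" for k
    proof (induction k)
      case (Suc k)
      then obtain z where z: "\<forall>i<k. z i = pre k w ! i" "\<forall>k. w \<in> H k z" by (auto simp: R_def len)
      have "w \<in> R (pre k w @ [z k])" unfolding R_def using z w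
        by (auto simp: len nth_append less_Suc_eq intro!: exI[of _ z])
      then show ?case unfolding preS by (rule LeastI)
    qed (use w0 pre0 in simp)
    have "w \<in> H k (y w)" for k
    proof -
      obtain z where z: "\<forall>i<k. z i = pre k w ! i" "\<forall>k. w \<in> H k z" using Rp[of k] by (auto simp: R_def len)
      have "H k z = H k (y w)" by (rule prefix_depD[OF H(2)]) (use z prey in auto)
      with z(2) show ?thesis by auto
    qed
    then show "(w, \<lambda>i. y w (2 * i)) \<in> C" using w unfolding CH by auto
  qed
qed

section \<open>Path spaces and kernels\<close>

abbreviation res :: "nat \<Rightarrow> (nat \<Rightarrow> 'w) \<Rightarrow> nat \<Rightarrow> 'w" where
  "res t w \<equiv> restrict w {..<t}"

lemma space_Om: "space (Om_t t) = extensional {..<t}"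
  by (simp add: Om_t_def space_PiM PiE_def)

text \<open>An extensional function on a short index set is also one on a longer set, its further
  entries being \<open>undefined\<close>. So a path of length \<open>t\<close> doubles as one of
  length \<open>T\<close>, and \<open>K t\<close> can be evaluated on it directly.\<close>

lemma Om_mono: "t \<le> t' \<Longrightarrow> w \<in> space (Om_t t) \<Longrightarrow> w \<in> space (Om_t t')"
  by (auto simp: space_Om extensional_def)

lemma res_Om [simp]: "res t w \<in> space (Om_t t)"
  by (simp add: space_Om)

lemma res_id: "w \<in> space (Om_t t) \<Longrightarrow> res t w = w"
  by (auto simp: space_Om extensional_restrict)

lemma res_res: "t \<le> t' \<Longrightarrow> res t (res t' w) = res t w"
  by (auto simp: restrict_def fun_eq_iff)

lemma upd_Om: "w \<in> space (Om_t t) \<Longrightarrow> w(t := x) \<in> space (Om_t (Suc t))"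
  by (auto simp: space_Om extensional_def)

lemma res_upd: "w \<in> space (Om_t t) \<Longrightarrow> s \<le> t \<Longrightarrow> res s (w(t := x)) = res s w"
  by (auto simp: restrict_def fun_eq_iff)

lemma space_Om_nonempty: "space (Om_t t) \<noteq> {}"
  using res_Om by blast

lemma measurable_res: "t \<le> t' \<Longrightarrow> (\<lambda>w. res t w) \<in> measurable (Om_t t') (Om_t t)"
  unfolding Om_t_def by (rule measurable_restrict_subset) auto

lemma measurable_upd: "(\<lambda>(w, x). w(t := x)) \<in> measurable (Om_t t \<Otimes>\<^sub>M borel) (Om_t (Suc t))"
proof -
  have "(\<lambda>p. (fst p)(t := snd p)) \<in> measurable (Om_t t \<Otimes>\<^sub>M borel) (Om_t (Suc t))"
    unfolding Om_t_def
    by (rule measurable_fun_upd[where J="{..<t}"]) (auto simp: lessThan_Suc intro: measurable_fst measurable_snd)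
  then show ?thesis by (simp add: case_prod_beta')
qed

lemma measurable_upd1: "w \<in> space (Om_t t) \<Longrightarrow> (\<lambda>x. w(t := x)) \<in> measurable borel (Om_t (Suc t))"
  using measurable_compose[OF measurable_Pair1' measurable_upd, of w t] by simp

section \<open>Priors with analytic graph\<close>

lemma sets_bai_borel: "sets bai = sets (borel :: (nat \<Rightarrow> nat) measure)"
proof -
  have "sets bai = sets (PiM UNIV (\<lambda>_::nat. borel :: nat measure))"
    by (rule sets_PiM_cong) (auto simp: sets_borel_eq_count_space)
  then show ?thesis by (simp add: sets_PiM_equal_borel)
qed

lemma measurable_bai_continuous: "continuous_on UNIV f \<Longrightarrow> f \<in> borel_measurable bai"
  using borel_measurable_continuous_onI[of f] by (simp cong: measurable_cong_sets add: sets_bai_borel)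

text \<open>For open sets, approximate the indicator by functions of the distance to the complement.\<close>
lemma measurable_kernel_of_weak_continuous:
  fixes f :: "(nat \<Rightarrow> nat) \<Rightarrow> 'w::polish_space measure"
  assumes f: "continuous_map euclidean weak_top f" and fp: "\<And>x. f x \<in> probs borel"
  shows "f \<in> measurable bai (subprob_algebra borel)"
proof (rule measurable_subprob_algebra_generated[where \<Omega>=UNIV and G="{S. open S}"])
  show "sets borel = sigma_sets UNIV {S::'w set. open S}" by (rule sets_borel)
  show "Int_stable {S::'w set. open S}" by (auto simp: Int_stable_def)
  show "subprob_space (f a)" for a using fp[of a] by (auto simp: probs_def intro: prob_space_imp_subprob_space)
  show "sets (f a) = sets borel" for a using fp[of a] by (auto simp: probs_def)
  have ci: "continuous_on UNIV (\<lambda>x. \<integral>a. g a \<partial>f x)"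
    if g: "continuous_on UNIV g" "bounded (range g)" for g :: "'w \<Rightarrow> real"
    unfolding continuous_on_open_vimage[OF open_UNIV]
  proof (intro allI impI)
    fix U :: "real set" assume U: "open U"
    have "openin weak_top {P \<in> probs borel. (\<integral>a. g a \<partial>P) \<in> U}"
      unfolding weak_top_def by (rule topology_generated_by_Basis) (use g U in blast)
    from openin_continuous_map_preimage[OF f this]
    have "open {x. f x \<in> probs borel \<and> (\<integral>a. g a \<partial>f x) \<in> U}" by simp
    then show "open ((\<lambda>x. \<integral>a. g a \<partial>f x) -` U \<inter> UNIV)" using fp by (simp add: vimage_def)
  qed
  have op: "(\<lambda>x. emeasure (f x) A) \<in> borel_measurable bai" if A: "open A" for A
  \<comment> \<open>The whole space is separate: \<open>infdist\<close> to the empty complement is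
    0, so the ramp functions below would vanish identically.\<close>
  proof (cases "A = UNIV")
    case True
    have "emeasure (f x) UNIV = 1" for x
      using prob_space.emeasure_space_1[OF probs_prob[OF fp[of x]]] probs_space[OF fp[of x]] by simp
    then show ?thesis using True by simp
  next
    case False
    define g where "g n a = min 1 (real n * infdist a (- A))" for n a
    have g01: "0 \<le> g n a" "g n a \<le> 1" for n a by (auto simp: g_def infdist_nonneg)
    have gc: "continuous_on UNIV (g n)" for n
      unfolding g_def by (intro continuous_intros)
    have gb: "bounded (range (g n))" for n
      using g01 by (intro boundedI[of _ 1]) auto
    have "(\<lambda>n. \<integral>a. g n a \<partial>f x) \<longlonglongrightarrow> measure (f x) A" for x
    proof -
      interpret prob_space "f x" by (rule probs_prob[OF fp])
      have "(\<lambda>n. \<integral>a. g n a \<partial>f x) \<longlonglongrightarrow> (\<integral>a. indicator A a \<partial>f x)"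
      proof (rule integral_dominated_convergence[where w="\<lambda>_. 1"])
        show "(\<lambda>a. indicator A a :: real) \<in> borel_measurable (f x)"
          using A probs_sets[OF fp[of x]] by (auto intro: borel_measurable_indicator)
        show "g n \<in> borel_measurable (f x)" for n
          using borel_measurable_continuous_onI[OF gc] probs_sets[OF fp[of x]] by (simp cong: measurable_cong_sets)
        show "AE a in f x. (\<lambda>n. g n a) \<longlonglongrightarrow> indicator A a"
        proof (rule AE_I2)
          fix a
          show "(\<lambda>n. g n a) \<longlonglongrightarrow> indicator A a"
          proof (cases "a \<in> A")
            case True
            have "infdist a (- A) > 0"
              using A True False in_closed_iff_infdist_zero[of "- A" a] infdist_nonneg[of a "- A"] by (auto simp: less_le)
            then obtain N :: nat where N: "1 < real N * infdist a (- A)" using reals_Archimedean3 by blast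
            have "g n a = 1" if "N \<le> n" for n
            proof -
              have "real N * infdist a (- A) \<le> real n * infdist a (- A)"
                using that \<open>infdist a (- A) > 0\<close> by (intro mult_right_mono) auto
              with N show ?thesis by (simp add: g_def)
            qed
            then have "eventually (\<lambda>n. g n a = 1) sequentially" by (auto simp: eventually_sequentially)
            then show ?thesis using True by (simp add: tendsto_eventually)
          qed (simp add: g_def)
        qed
        show "AE a in f x. norm (g n a) \<le> 1" for n using g01 by simp
      qed simp
      then show ?thesis using A probs_sets[OF fp[of x]] by simp
    qed
    then have "(\<lambda>x. measure (f x) A) \<in> borel_measurable bai"
      by (rule borel_measurable_LIMSEQ_metric[OF measurable_bai_continuous[OF ci[OF gc gb]]])
    moreover have "emeasure (f x) A = ennreal (measure (f x) A)" for x
      using finite_measure.emeasure_eq_measure[OF prob_space.finite_measure[OF probs_prob[OF fp[of x]]]] by simp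
    ultimately show ?thesis by simp
  qed
  show "(\<lambda>x. emeasure (f x) A) \<in> borel_measurable bai" if "A \<in> {S. open S}" for A using op that by simp
  show "(\<lambda>x. emeasure (f x) UNIV) \<in> borel_measurable bai" by (rule op) simp
qed simp

text \<open>Baire space parametrizes the graph, and weak continuity makes the second coordinate a
  measurable kernel. Quantifying over the priors at \<open>w\<close> becomes quantifying over the
  points \<open>x\<close> with \<open>f1 x = w\<close>.\<close>

lemma analytic_graph_param:
  fixes R :: "(nat \<Rightarrow> 'w::polish_space) \<Rightarrow> 'w measure set"
  assumes an: "analytic_in (prod_topology (Om_top t) weak_top) {(w, P). w \<in> space (Om_t t) \<and> P \<in> R w}"
    and ne: "\<And>w. w \<in> space (Om_t t) \<Longrightarrow> R w \<noteq> {}" and pr: "\<And>w. w \<in> space (Om_t t) \<Longrightarrow> R w \<subseteq> probs borel"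
  shows "\<exists>f1 f2. f1 \<in> measurable bai (Om_t t) \<and> f2 \<in> measurable bai (subprob_algebra borel) \<and>
    (\<forall>x. f2 x \<in> R (f1 x)) \<and> (\<forall>w\<in>space (Om_t t). \<forall>P\<in>R w. \<exists>x. f1 x = w \<and> f2 x = P)"
proof -
  let ?G = "{(w, P). w \<in> space (Om_t t) \<and> P \<in> R w}"
  have "?G \<noteq> {}" using ne space_Om_nonempty[of t] by auto
  then obtain f :: "(nat \<Rightarrow> nat) \<Rightarrow> (nat \<Rightarrow> 'w) \<times> 'w measure"
    where f: "continuous_map euclidean (prod_topology (Om_top t) weak_top) f" "range f = ?G"
    using an unfolding analytic_in_def by blast
  have fG: "fst (f x) \<in> space (Om_t t) \<and> snd (f x) \<in> R (fst (f x))" for x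
  proof -
    have "f x \<in> ?G" by (simp only: f(2)[symmetric] rangeI)
    then show ?thesis by (auto simp: case_prod_beta)
  qed
  have c1: "continuous_map euclidean (Om_top t) (\<lambda>x. fst (f x))"
    and c2: "continuous_map euclidean weak_top (\<lambda>x. snd (f x))"
    using f(1) by (auto simp: continuous_map_pairwise o_def)
  have m1: "(\<lambda>x. fst (f x)) \<in> measurable bai (Om_t t)"
  proof -
    have "(\<lambda>x i. fst (f x) i) \<in> measurable bai (PiM {..<t} (\<lambda>_. borel))"
    proof (rule measurable_PiM_single')
      fix i assume "i \<in> {..<t}"
      then have "continuous_map euclidean euclidean (\<lambda>x. fst (f x) i)"
        using c1 unfolding Om_top_def continuous_map_componentwise by blast
      then show "(\<lambda>x. fst (f x) i) \<in> borel_measurable bai"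
        by (intro measurable_bai_continuous) simp
    next
      show "(\<lambda>x i. fst (f x) i) \<in> space bai \<rightarrow> {..<t} \<rightarrow>\<^sub>E space borel"
        using fG by (auto simp: space_Om PiE_def)
    qed
    then show ?thesis by (simp add: Om_t_def)
  qed
  have m2: "(\<lambda>x. snd (f x)) \<in> measurable bai (subprob_algebra borel)"
    by (rule measurable_kernel_of_weak_continuous[OF c2]) (use fG pr in blast)
  have "\<exists>x. fst (f x) = w \<and> snd (f x) = P" if "w \<in> space (Om_t t)" "P \<in> R w" for w P
  proof -
    have "(w, P) \<in> range f" using f(2) that by auto
    then obtain x where "f x = (w, P)" by (metis imageE)
    then show ?thesis by (intro exI[of _ x]) simp
  qed
  then show ?thesis using m1 m2 fG by (intro exI[of _ "\<lambda>x. fst (f x)"] exI[of _ "\<lambda>x. snd (f x)"]) auto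
qed

text \<open>The capacity argument applied to one section: charged sections are recognised by a bound
  \<open>n\<close> along which all Borel approximations keep a fixed amount of mass. Not being null
  thus becomes an existential statement over Baire space about measurable quantities.\<close>

lemma not_AE_section_iff:
  assumes H: "\<And>k y. H k y \<in> sets (Om_t (Suc t))" "prefix_dep H"
    and A: "A = {w \<in> space (Om_t (Suc t)). \<exists>y. \<forall>k. w \<in> H k y}"
    and w: "w \<in> space (Om_t t)" and P: "P \<in> probs (borel :: 'w::polish_space measure)"
  shows "(\<not> (AE x in P. w(t := x) \<notin> A)) \<longleftrightarrow>
    (\<exists>n m. \<forall>k. ennreal (1 / Suc m) \<le> emeasure P {x. w(t := x) \<in> bnd (space (Om_t (Suc t))) H k n})"
proof -
  interpret P: prob_space P by (rule probs_prob[OF P])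
  have sp: "space P = UNIV" using probs_space[OF P] by simp
  define H' where "H' k y = {x. w(t := x) \<in> H k y}" for k y
  have H': "H' k y \<in> sets P" for k y
    using measurable_sets[OF measurable_upd1[OF w] H(1)[of k y]] probs_sets[OF P] by (simp add: H'_def vimage_def)
  have d': "prefix_dep H'" using H(2) unfolding prefix_dep_def H'_def by metis
  define A' where "A' = {x. w(t := x) \<in> A}"
  have A': "A' = {x \<in> space P. \<exists>y. \<forall>k. x \<in> H' k y}"
    unfolding A'_def A H'_def sp using upd_Om[OF w] by auto
  have b: "bnd (space P) H' k n = {x. w(t := x) \<in> bnd (space (Om_t (Suc t))) H k n}" for k n
    unfolding bnd_def H'_def sp using upd_Om[OF w] by auto
  have "(AE x in P. w(t := x) \<notin> A) \<longleftrightarrow> outer_measure_of P A' = 0"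
    using AE_iff_outer_measure_0[of A' P] sp by (simp add: A'_def)
  moreover have "outer_measure_of P A' \<noteq> 0 \<longleftrightarrow> (\<exists>n m. \<forall>k. ennreal (1 / Suc m) \<le> emeasure P (bnd (space P) H' k n))"
  proof
    assume ne: "outer_measure_of P A' \<noteq> 0"
    have "\<exists>m. ennreal (1 / Suc m) < outer_measure_of P A'"
    proof (cases "outer_measure_of P A'")
      case (real r)
      with ne have "0 < r" by (cases "r = 0") auto
      then obtain m where "1 / real (Suc m) < r" using nat_approx_posE by blast
      with real show ?thesis by (intro exI[of _ m]) (simp add: ennreal_less_iff)
    qed (auto simp: top.not_eq_extremum[symmetric])
    then obtain m where "ennreal (1 / Suc m) < outer_measure_of P A'" by blast
    from scheme_capacity[OF A' this H' d'] show "\<exists>n m. \<forall>k. ennreal (1 / Suc m) \<le> emeasure P (bnd (space P) H' k n)"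
      by (meson less_imp_le)
  next
    assume "\<exists>n m. \<forall>k. ennreal (1 / Suc m) \<le> emeasure P (bnd (space P) H' k n)"
    then obtain n m where nm: "\<And>k. ennreal (1 / Suc m) \<le> emeasure P (bnd (space P) H' k n)" by auto
    from scheme_inner[OF A' P.finite_measure_axioms H' d' nm]
    obtain B where B: "B \<in> sets P" "B \<subseteq> A'" "ennreal (1 / Suc m) \<le> emeasure P B" by auto
    have "emeasure P B \<le> outer_measure_of P A'" using outer_measure_of_mono[OF B(2), of P] B(1) by simp
    moreover have "0 < ennreal (1 / Suc m)" by simp
    ultimately show "outer_measure_of P A' \<noteq> 0" using B(3) by (metis less_le_trans not_less_zero order_less_le_trans)
  qed
  ultimately show ?thesis by (simp add: b)
qed

text \<open>One point of Baire space codes a prior in its even entries and, in its odd entries, the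
  bound that certifies positive mass. The active paths are the projection of the measurable set
  \<open>C\<close> of certified pairs, and a selection from \<open>C\<close> yields the
  kernel.\<close>

lemma active_suslin_kernel:
  fixes R :: "(nat \<Rightarrow> 'w::polish_space) \<Rightarrow> 'w measure set"
  assumes an: "analytic_in (prod_topology (Om_top t) weak_top) {(w, P). w \<in> space (Om_t t) \<and> P \<in> R w}"
    and ne: "\<And>w. w \<in> space (Om_t t) \<Longrightarrow> R w \<noteq> {}" and pr: "\<And>w. w \<in> space (Om_t t) \<Longrightarrow> R w \<subseteq> probs borel"
    and A: "A \<in> suslin (Om_t (Suc t))"
  shows "{w \<in> space (Om_t t). \<exists>P\<in>R w. \<not> (AE x in P. w(t := x) \<notin> A)} \<in> suslin (Om_t t) \<and>
    (\<exists>\<kappa>. univ_kernel t \<kappa> \<and> (\<forall>w\<in>space (Om_t t). \<kappa> w \<in> R w) \<and>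
      (\<forall>w\<in>space (Om_t t). (\<exists>P\<in>R w. \<not> (AE x in P. w(t := x) \<notin> A)) \<longrightarrow> \<not> (AE x in \<kappa> w. w(t := x) \<notin> A)))"
proof -
  obtain f1 f2 where f1: "f1 \<in> measurable bai (Om_t t)" and f2: "f2 \<in> measurable bai (subprob_algebra borel)"
    and fR: "\<And>x. f2 x \<in> R (f1 x)" and fs: "\<And>w P. w \<in> space (Om_t t) \<Longrightarrow> P \<in> R w \<Longrightarrow> \<exists>x. f1 x = w \<and> f2 x = P"
    using analytic_graph_param[OF an ne pr] by blast
  obtain H where H: "\<And>k y. H k y \<in> sets (Om_t (Suc t))" "prefix_dep H"
    and AH: "A = {w \<in> space (Om_t (Suc t)). \<exists>y. \<forall>k. w \<in> H k y}"
    using suslin_scheme[OF A] by auto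
  define Act where "Act = {w \<in> space (Om_t t). \<exists>P\<in>R w. \<not> (AE x in P. w(t := x) \<notin> A)}"
  let ?M = "Om_t t \<Otimes>\<^sub>M bai"
  define ev od :: "(nat \<Rightarrow> nat) \<Rightarrow> nat \<Rightarrow> nat" where "ev y = (\<lambda>i. y (2 * i))" and "od y = (\<lambda>i. y (2 * i + 1))" for y
  have mev: "ev \<in> measurable bai bai" and mod: "od \<in> measurable bai bai"
    unfolding ev_def od_def by (intro measurable_baiI measurable_bai_coord)+
  \<comment> \<open>Equality of paths is a measurable condition because it concerns finitely many
    coordinates.\<close>
  have diag: "{p \<in> space ?M. f1 (g (snd p)) = fst p} \<in> sets ?M" if g: "g \<in> measurable bai bai" for g
  proof -
    have f1g: "(\<lambda>p. f1 (g (snd p))) \<in> measurable ?M (Om_t t)"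
      by (intro measurable_compose[OF measurable_snd] measurable_compose[OF g] f1)
    have e: "{p \<in> space ?M. f1 (g (snd p)) = fst p} = {p \<in> space ?M. \<forall>i\<in>{..<t}. f1 (g (snd p)) i = fst p i}"
    proof (intro Collect_cong conj_cong refl iffI)
      fix p :: "(nat \<Rightarrow> 'w) \<times> (nat \<Rightarrow> nat)" assume p: "p \<in> space ?M" and h: "\<forall>i\<in>{..<t}. f1 (g (snd p)) i = fst p i"
      have "f1 (g (snd p)) \<in> extensional {..<t}" "fst p \<in> extensional {..<t}"
        using measurable_space[OF f1g p] p by (auto simp: space_Om space_pair_measure)
      with h show "f1 (g (snd p)) = fst p" by (intro extensionalityI) auto
    qed simp
    show ?thesis unfolding e
    proof (intro sets.sets_Collect_finite_All)
      fix i assume i: "i \<in> {..<t}"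
      have c: "(\<lambda>w. w i) \<in> borel_measurable (Om_t t)"
        unfolding Om_t_def by (rule measurable_component_singleton) (use i in simp)
      show "{p \<in> space ?M. f1 (g (snd p)) i = fst p i} \<in> sets ?M"
        by (intro measurable_equality_set measurable_compose[OF f1g c] measurable_compose[OF measurable_fst c])
    qed simp
  qed
  have me: "(\<lambda>p. emeasure (f2 (ev (snd p))) {x. (fst p)(t := x) \<in> bnd (space (Om_t (Suc t))) H k (od (snd p))})
      \<in> borel_measurable ?M" for k
  proof -
    have fixed: "(\<lambda>p. emeasure (f2 (ev (snd p))) {x. (fst p)(t := x) \<in> B}) \<in> borel_measurable ?M"
      if B: "B \<in> sets (Om_t (Suc t))" for B
    proof (rule emeasure_measurable_subprob_algebra2[where N=borel])
      have "(\<lambda>q. (fst (fst q))(t := snd q)) \<in> measurable (?M \<Otimes>\<^sub>M borel) (Om_t (Suc t))"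
        using measurable_compose[OF measurable_Pair[OF measurable_compose[OF measurable_fst measurable_fst] measurable_snd] measurable_upd]
        by (simp add: case_prod_beta')
      from measurable_sets[OF this B]
      show "(SIGMA p:space ?M. {x. (fst p)(t := x) \<in> B}) \<in> sets (?M \<Otimes>\<^sub>M borel)"
        by (rule back_subst[of "\<lambda>S. S \<in> sets (?M \<Otimes>\<^sub>M borel)"]) (auto simp: space_pair_measure)
      show "(\<lambda>p. f2 (ev (snd p))) \<in> measurable ?M (subprob_algebra borel)"
        by (intro measurable_compose[OF measurable_snd] measurable_compose[OF mev] f2)
    qed
    have "(\<lambda>p. emeasure (f2 (ev (snd p))) {x. (fst p)(t := x) \<in> bnd (space (Om_t (Suc t))) H k (zpad (map (od (snd p)) [0..<k]))})
      \<in> borel_measurable ?M"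
      by (rule measurable_compose_countable[where g="\<lambda>p. map (od (snd p)) [0..<k]"
            and f="\<lambda>l p. emeasure (f2 (ev (snd p))) {x. (fst p)(t := x) \<in> bnd (space (Om_t (Suc t))) H k (zpad l)}"])
        (intro fixed bnd_sets[OF H], intro measurable_compose[OF measurable_snd] measurable_compose[OF mod] measurable_prefix)
    then show ?thesis unfolding bnd_prefix[symmetric] .
  qed
  define C where "C = {p \<in> space ?M. f1 (ev (snd p)) = fst p \<and>
     (\<exists>m. \<forall>k. ennreal (1 / Suc m) \<le> emeasure (f2 (ev (snd p))) {x. (fst p)(t := x) \<in> bnd (space (Om_t (Suc t))) H k (od (snd p))})}"
  have CS: "C \<in> sets ?M"
    unfolding C_def
    by (intro sets.sets_Collect_conj diag mev sets.sets_Collect_countable_Ex sets.sets_Collect_countable_All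
        borel_measurable_le borel_measurable_const me)
  have R1: "f1 x \<in> space (Om_t t)" for x using measurable_space[OF f1] by simp
  have fp: "f2 x \<in> probs borel" for x using fR pr[OF R1] by blast
  have C1: "fst p \<in> Act \<and> \<not> (AE x in f2 (ev (snd p)). (fst p)(t := x) \<notin> A) \<and> f2 (ev (snd p)) \<in> R (fst p)" if p: "p \<in> C" for p
  proof -
    have w: "fst p \<in> space (Om_t t)" and fx: "f1 (ev (snd p)) = fst p"
      and pos: "\<exists>n m. \<forall>k. ennreal (1 / Suc m) \<le> emeasure (f2 (ev (snd p))) {x. (fst p)(t := x) \<in> bnd (space (Om_t (Suc t))) H k n}"
      using p unfolding C_def by (auto simp: space_pair_measure)
    have "f2 (ev (snd p)) \<in> R (fst p)" using fR[of "ev (snd p)"] fx by simp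
    moreover have "\<not> (AE x in f2 (ev (snd p)). (fst p)(t := x) \<notin> A)"
      using not_AE_section_iff[OF H AH w fp] pos by blast
    ultimately show ?thesis using w unfolding Act_def by blast
  qed
  have C2: "w \<in> fst ` C" if "w \<in> Act" for w
  proof -
    from that obtain P where w: "w \<in> space (Om_t t)" and P: "P \<in> R w" "\<not> (AE x in P. w(t := x) \<notin> A)"
      unfolding Act_def by blast
    obtain x where x: "f1 x = w" "f2 x = P" using fs[OF w P(1)] by blast
    obtain n m where nm: "\<forall>k. ennreal (1 / Suc m) \<le> emeasure P {x. w(t := x) \<in> bnd (space (Om_t (Suc t))) H k n}"
      using not_AE_section_iff[OF H AH w] P pr[OF w] by blast
    define y where "y i = (if even i then x (i div 2) else n (i div 2))" for i
    have "ev y = x" "od y = n" by (auto simp: ev_def od_def y_def)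
    then have "(w, y) \<in> C" unfolding C_def using w x nm by (auto simp: space_pair_measure)
    then show ?thesis by force
  qed
  have ActC: "Act = fst ` C" using C1 C2 by blast
  then have S: "Act \<in> suslin (Om_t t)" using suslinI[OF CS] by simp
  obtain s where s: "s \<in> measurable (univ_completion (Om_t t)) bai" "\<And>w. w \<in> fst ` C \<Longrightarrow> (w, s w) \<in> C"
    using suslin_selection[OF CS] by blast
  \<comment> \<open>Where no prior charges \<open>A\<close>, any prior will do; it is selected from
    the bare parametrization of the graph.\<close>
  define C0 where "C0 = {p \<in> space ?M. f1 (snd p) = fst p}"
  have C0S: "C0 \<in> sets ?M" using diag[of "\<lambda>x. x"] by (simp add: C0_def)
  have C0w: "w \<in> fst ` C0" if w: "w \<in> space (Om_t t)" for w
  proof -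
    obtain P where "P \<in> R w" using ne[OF w] by blast
    then obtain x where "f1 x = w" using fs[OF w] by blast
    then have "(w, x) \<in> C0" using w by (simp add: C0_def space_pair_measure)
    then show ?thesis by force
  qed
  obtain s0 where s0: "s0 \<in> measurable (univ_completion (Om_t t)) bai" "\<And>w. w \<in> fst ` C0 \<Longrightarrow> (w, s0 w) \<in> C0"
    using suslin_selection[OF C0S] by blast
  define \<kappa> where "\<kappa> w = f2 (if w \<in> Act then ev (s w) else s0 w)" for w
  have "(\<lambda>w. if w \<in> Act then ev (s w) else s0 w) \<in> measurable (univ_completion (Om_t t)) bai"
  proof (rule measurable_If)
    show "(\<lambda>w. ev (s w)) \<in> measurable (univ_completion (Om_t t)) bai" by (rule measurable_compose[OF s(1) mev])
    have "{w \<in> space (Om_t t). w \<in> Act} = Act" by (auto simp: Act_def)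
    then show "{w \<in> space (univ_completion (Om_t t)). w \<in> Act} \<in> sets (univ_completion (Om_t t))"
      using suslin_univ_completion[OF S] by simp
  qed (rule s0(1))
  then have "\<kappa> \<in> measurable (univ_completion (Om_t t)) (subprob_algebra borel)"
    unfolding \<kappa>_def by (rule measurable_compose[OF _ f2])
  then have "univ_kernel t \<kappa>" unfolding univ_kernel_def
    by (intro ballI measurable_compose[OF _ measurable_emeasure_subprob_algebra])
  moreover have "\<kappa> w \<in> R w" if w: "w \<in> space (Om_t t)" for w
  proof (cases "w \<in> Act")
    case True
    from C1[OF s(2)] True ActC show ?thesis by (simp add: \<kappa>_def)
  next
    case False
    from s0(2)[OF C0w[OF w]] have "f1 (s0 w) = w" by (simp add: C0_def)
    with fR[of "s0 w"] False show ?thesis by (simp add: \<kappa>_def)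
  qed
  moreover have "\<not> (AE x in \<kappa> w. w(t := x) \<notin> A)" if "w \<in> Act" for w
  proof -
    have "(w, s w) \<in> C" using s(2) that ActC by simp
    from C1[OF this] have "\<not> (AE x in f2 (ev (s w)). w(t := x) \<notin> A)" unfolding fst_conv snd_conv by blast
    moreover have "\<kappa> w = f2 (ev (s w))" using that by (simp add: \<kappa>_def)
    ultimately show ?thesis by metis
  qed
  ultimately show ?thesis using S unfolding Act_def by (intro conjI exI[of _ \<kappa>]) auto
qed

section \<open>Extension of measures by universally measurable kernels\<close>

lemma AE_mono_space: "AE x in M. P x \<Longrightarrow> (\<And>x. x \<in> space M \<Longrightarrow> P x \<Longrightarrow> Q x) \<Longrightarrow> AE x in M. Q x"
  by (erule AE_mp) (auto intro: AE_I2)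

definition kern :: "nat \<Rightarrow> ((nat \<Rightarrow> 'w::polish_space) \<Rightarrow> 'w measure) \<Rightarrow> bool" where
  "kern t \<kappa> \<longleftrightarrow> univ_kernel t \<kappa> \<and> (\<forall>w\<in>space (Om_t t). \<kappa> w \<in> probs borel)"

lemma kern_probs: "kern t \<kappa> \<Longrightarrow> w \<in> space (Om_t t) \<Longrightarrow> \<kappa> w \<in> probs borel"
  by (simp add: kern_def)

lemma kern_subprob: "kern t \<kappa> \<Longrightarrow> \<kappa> \<in> measurable (univ_completion (Om_t t)) (subprob_algebra borel)"
  by (rule measurable_subprob_algebra)
    (auto simp: kern_def univ_kernel_def probs_def intro: prob_space_imp_subprob_space)

text \<open>One step of the product measure. Integration runs over the completion because the kernel
  is only universally measurable.\<close>

definition kext :: "nat \<Rightarrow> (nat \<Rightarrow> 'w::polish_space) measure \<Rightarrow> ((nat \<Rightarrow> 'w) \<Rightarrow> 'w measure) \<Rightarrow> (nat \<Rightarrow> 'w) measure" where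
  "kext t \<mu> \<kappa> = completion \<mu> \<bind> (\<lambda>w. distr (\<kappa> w) (Om_t (Suc t)) (\<lambda>x. w(t := x)))"

lemma measurable_completion_AE:
  assumes g: "g \<in> measurable (completion M) N" and ae: "AE x in M. f x = g x"
    and sp: "\<And>x. x \<in> space M \<Longrightarrow> f x \<in> space N"
  shows "f \<in> measurable (completion M) N"
proof (rule measurableI)
  fix A assume A: "A \<in> sets N"
  obtain U where U: "U \<in> null_sets M" "{x \<in> space M. f x \<noteq> g x} \<subseteq> U"
    using ae by (auto simp: eventually_ae_filter)
  have "f -` A \<inter> space M = (g -` A \<inter> space (completion M) - U) \<union> (f -` A \<inter> space M \<inter> U)"
    using U(2) by auto
  moreover have "g -` A \<inter> space (completion M) - U \<in> sets (completion M)"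
    using measurable_sets[OF g A] U(1) by auto
  moreover have "f -` A \<inter> space M \<inter> U \<in> sets (completion M)"
    by (rule null_sets_completion[OF U(1)]) auto
  ultimately have "f -` A \<inter> space M \<in> sets (completion M)" by (metis sets.Un)
  then show "f -` A \<inter> space (completion M) \<in> sets (completion M)" by simp
qed (use sp in simp)

lemma borel_kint_measurable:
  fixes f :: "_ \<Rightarrow> ennreal"
  assumes \<kappa>: "kern t \<kappa>" and f: "f \<in> borel_measurable (Om_t (Suc t))"
  shows "(\<lambda>w. \<integral>\<^sup>+x. f (w(t := x)) \<partial>\<kappa> w) \<in> borel_measurable (univ_completion (Om_t t))"
proof (rule nn_integral_measurable_subprob_algebra2[OF _ kern_subprob[OF \<kappa>]])
  have i: "(\<lambda>w. w) \<in> measurable (univ_completion (Om_t t)) (Om_t t)"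
    by (rule measurable_univ_completion) simp
  have "(\<lambda>p. (fst p)(t := snd p)) \<in> measurable (univ_completion (Om_t t) \<Otimes>\<^sub>M borel) (Om_t (Suc t))"
    using measurable_compose[OF measurable_Pair[OF measurable_compose[OF measurable_fst i] measurable_snd] measurable_upd]
    by (simp add: case_prod_beta')
  from measurable_compose[OF this f]
  show "(\<lambda>(w, x). f (w(t := x))) \<in> borel_measurable (univ_completion (Om_t t) \<Otimes>\<^sub>M borel)"
    by (simp add: case_prod_beta')
qed

lemma
  assumes \<mu>: "\<mu> \<in> probs (Om_t t)" and \<kappa>: "kern t \<kappa>"
  shows kext_kernel: "(\<lambda>w. distr (\<kappa> w) (Om_t (Suc t)) (\<lambda>x. w(t := x))) \<in> measurable (completion \<mu>) (subprob_algebra (Om_t (Suc t)))"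
    and kext_probs: "kext t \<mu> \<kappa> \<in> probs (Om_t (Suc t))"
    and nn_integral_kext_borel: "f \<in> borel_measurable (Om_t (Suc t)) \<Longrightarrow>
      (\<integral>\<^sup>+w. f w \<partial>kext t \<mu> \<kappa>) = (\<integral>\<^sup>+w. \<integral>\<^sup>+x. f (w(t := x)) \<partial>\<kappa> w \<partial>\<mu>)"
proof -
  interpret \<mu>: prob_space \<mu> by (rule probs_prob[OF \<mu>])
  interpret c: prob_space "completion \<mu>" by (rule \<mu>.prob_space_completion)
  have sp: "space \<mu> = space (Om_t t)" by (rule probs_space[OF \<mu>])
  have ne: "space (completion \<mu>) \<noteq> {}" using space_Om_nonempty[of t] sp by simp
  have i: "(\<lambda>w. w) \<in> measurable (completion \<mu>) (Om_t t)"
    by (rule measurable_completion) (use probs_sets[OF \<mu>] in \<open>simp cong: measurable_cong_sets\<close>)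
  have "(\<lambda>p. (fst p)(t := snd p)) \<in> measurable (completion \<mu> \<Otimes>\<^sub>M borel) (Om_t (Suc t))"
    using measurable_compose[OF measurable_Pair[OF measurable_compose[OF measurable_fst i] measurable_snd] measurable_upd]
    by (simp add: case_prod_beta')
  then have u: "(\<lambda>(w, x). w(t := x)) \<in> measurable (completion \<mu> \<Otimes>\<^sub>M borel) (Om_t (Suc t))"
    by (simp add: case_prod_beta')
  show k: "(\<lambda>w. distr (\<kappa> w) (Om_t (Suc t)) (\<lambda>x. w(t := x))) \<in> measurable (completion \<mu>) (subprob_algebra (Om_t (Suc t)))"
    by (rule measurable_distr2[OF u measurable_univ_completionD[OF kern_subprob[OF \<kappa>] \<mu>]])
  have m1: "(\<lambda>x. w(t := x)) \<in> measurable (\<kappa> w) (Om_t (Suc t))" if "w \<in> space (Om_t t)" for w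
    using measurable_upd1[OF that] probs_sets[OF kern_probs[OF \<kappa> that]] by (simp cong: measurable_cong_sets)
  have "prob_space (kext t \<mu> \<kappa>)" unfolding kext_def
  proof (rule c.prob_space_bind[OF _ k], rule AE_I2)
    fix w assume "w \<in> space (completion \<mu>)"
    then have w: "w \<in> space (Om_t t)" using sp by simp
    show "prob_space (distr (\<kappa> w) (Om_t (Suc t)) (\<lambda>x. w(t := x)))"
      by (rule prob_space.prob_space_distr[OF probs_prob[OF kern_probs[OF \<kappa> w]] m1[OF w]])
  qed
  moreover have "sets (kext t \<mu> \<kappa>) = sets (Om_t (Suc t))"
    unfolding kext_def by (rule sets_bind[OF _ ne]) simp
  ultimately show "kext t \<mu> \<kappa> \<in> probs (Om_t (Suc t))" by (simp add: probs_def)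
  assume f: "f \<in> borel_measurable (Om_t (Suc t))"
  have "(\<integral>\<^sup>+w. f w \<partial>kext t \<mu> \<kappa>) = (\<integral>\<^sup>+w. (\<integral>\<^sup>+v. f v \<partial>distr (\<kappa> w) (Om_t (Suc t)) (\<lambda>x. w(t := x))) \<partial>completion \<mu>)"
    unfolding kext_def by (rule nn_integral_bind[OF f k])
  also have "\<dots> = (\<integral>\<^sup>+w. \<integral>\<^sup>+x. f (w(t := x)) \<partial>\<kappa> w \<partial>completion \<mu>)"
  proof (rule nn_integral_cong)
    fix w assume "w \<in> space (completion \<mu>)"
    then have w: "w \<in> space (Om_t t)" using sp by simp
    show "(\<integral>\<^sup>+v. f v \<partial>distr (\<kappa> w) (Om_t (Suc t)) (\<lambda>x. w(t := x))) = (\<integral>\<^sup>+x. f (w(t := x)) \<partial>\<kappa> w)"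
      by (rule nn_integral_distr[OF m1[OF w]]) (use f in simp)
  qed
  finally show "(\<integral>\<^sup>+w. f w \<partial>kext t \<mu> \<kappa>) = (\<integral>\<^sup>+w. \<integral>\<^sup>+x. f (w(t := x)) \<partial>\<kappa> w \<partial>\<mu>)"
    by (simp add: nn_integral_completion)
qed

text \<open>Fubini for null sets. It is the bridge to universally measurable integrands, which agree
  with a Borel function up to a null set of the extended law.\<close>

lemma kext_AE_section:
  assumes \<mu>: "\<mu> \<in> probs (Om_t t)" and \<kappa>: "kern t \<kappa>" and ae: "AE w in kext t \<mu> \<kappa>. P w"
  shows "AE w in \<mu>. AE x in \<kappa> w. P (w(t := x))"
proof -
  have sp: "space (kext t \<mu> \<kappa>) = space (Om_t (Suc t))" by (rule probs_space[OF kext_probs[OF \<mu> \<kappa>]])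
  obtain N where N: "N \<in> null_sets (kext t \<mu> \<kappa>)" "{w \<in> space (Om_t (Suc t)). \<not> P w} \<subseteq> N"
    using ae unfolding eventually_ae_filter sp by auto
  have NS: "N \<in> sets (Om_t (Suc t))" using N(1) probs_sets[OF kext_probs[OF \<mu> \<kappa>]] by auto
  have "0 = (\<integral>\<^sup>+w. indicator N w \<partial>kext t \<mu> \<kappa>)" using N(1) by (subst nn_integral_indicator) auto
  also have "\<dots> = (\<integral>\<^sup>+w. \<integral>\<^sup>+x. indicator N (w(t := x)) \<partial>\<kappa> w \<partial>\<mu>)"
    by (rule nn_integral_kext_borel[OF \<mu> \<kappa>]) (use NS in simp)
  finally have "(\<integral>\<^sup>+w. \<integral>\<^sup>+x. indicator N (w(t := x)) \<partial>\<kappa> w \<partial>completion \<mu>) = 0" by (simp add: nn_integral_completion)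
  then have "AE w in completion \<mu>. (\<integral>\<^sup>+x. indicator N (w(t := x)) \<partial>\<kappa> w) = 0"
    by (subst (asm) nn_integral_0_iff_AE)
      (rule measurable_univ_completionD[OF borel_kint_measurable[OF \<kappa>] \<mu>], use NS in simp)
  then have "AE w in \<mu>. (\<integral>\<^sup>+x. indicator N (w(t := x)) \<partial>\<kappa> w) = 0" by (simp add: AE_completion_iff)
  then show ?thesis
  proof (rule AE_mono_space)
    fix w assume "w \<in> space \<mu>" and 0: "(\<integral>\<^sup>+x. indicator N (w(t := x)) \<partial>\<kappa> w) = (0::ennreal)"
    then have w: "w \<in> space (Om_t t)" using probs_space[OF \<mu>] by simp
    have "(\<lambda>x. indicator N (w(t := x)) :: ennreal) \<in> borel_measurable (\<kappa> w)"
      using measurable_compose[OF measurable_upd1[OF w] borel_measurable_indicator[OF NS]] probs_sets[OF kern_probs[OF \<kappa> w]]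
      by (simp cong: measurable_cong_sets)
    with 0 have "AE x in \<kappa> w. indicator N (w(t := x)) = (0::ennreal)" by (simp add: nn_integral_0_iff_AE)
    then show "AE x in \<kappa> w. P (w(t := x))"
    proof (rule AE_mono_space)
      fix x assume "indicator N (w(t := x)) = (0::ennreal)"
      then show "P (w(t := x))" using N(2) upd_Om[OF w, of x] by (auto split: split_indicator_asm)
    qed
  qed
qed

text \<open>For each initial law separately, the integrand is replaced by a Borel version under the
  extended law. The version varies with the law, but measurability for every completion is exactly
  universal measurability.\<close>

lemma
  fixes f :: "(nat \<Rightarrow> 'w::polish_space) \<Rightarrow> ennreal"
  assumes \<kappa>: "kern t \<kappa>" and f: "f \<in> borel_measurable (univ_completion (Om_t (Suc t)))"
  shows kint_measurable: "(\<lambda>w. \<integral>\<^sup>+x. f (w(t := x)) \<partial>\<kappa> w) \<in> borel_measurable (univ_completion (Om_t t))"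
    and nn_integral_kext: "\<mu> \<in> probs (Om_t t) \<Longrightarrow>
      (\<integral>\<^sup>+w. f w \<partial>kext t \<mu> \<kappa>) = (\<integral>\<^sup>+w. \<integral>\<^sup>+x. f (w(t := x)) \<partial>\<kappa> w \<partial>\<mu>)"
proof -
  have main: "(\<lambda>w. \<integral>\<^sup>+x. f (w(t := x)) \<partial>\<kappa> w) \<in> borel_measurable (completion \<mu>) \<and>
      (\<integral>\<^sup>+w. f w \<partial>kext t \<mu> \<kappa>) = (\<integral>\<^sup>+w. \<integral>\<^sup>+x. f (w(t := x)) \<partial>\<kappa> w \<partial>\<mu>)" if \<mu>: "\<mu> \<in> probs (Om_t t)" for \<mu>
  proof -
    obtain g where g: "g \<in> borel_measurable (kext t \<mu> \<kappa>)" and fg: "AE w in kext t \<mu> \<kappa>. f w = g w"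
      using completion_ex_borel_measurable[OF measurable_univ_completionD[OF f kext_probs[OF \<mu> \<kappa>]]] by blast
    have g': "g \<in> borel_measurable (Om_t (Suc t))"
      using g probs_sets[OF kext_probs[OF \<mu> \<kappa>]] by (simp cong: measurable_cong_sets)
    have ae: "AE w in \<mu>. (\<integral>\<^sup>+x. f (w(t := x)) \<partial>\<kappa> w) = (\<integral>\<^sup>+x. g (w(t := x)) \<partial>\<kappa> w)"
      using kext_AE_section[OF \<mu> \<kappa> fg] by (rule AE_mp) (auto intro!: AE_I2 nn_integral_cong_AE)
    have "(\<integral>\<^sup>+w. f w \<partial>kext t \<mu> \<kappa>) = (\<integral>\<^sup>+w. g w \<partial>kext t \<mu> \<kappa>)" by (rule nn_integral_cong_AE[OF fg])
    also have "\<dots> = (\<integral>\<^sup>+w. \<integral>\<^sup>+x. g (w(t := x)) \<partial>\<kappa> w \<partial>\<mu>)" by (rule nn_integral_kext_borel[OF \<mu> \<kappa> g'])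
    also have "\<dots> = (\<integral>\<^sup>+w. \<integral>\<^sup>+x. f (w(t := x)) \<partial>\<kappa> w \<partial>\<mu>)"
      using ae by (intro nn_integral_cong_AE) (auto simp: eq_commute)
    finally show ?thesis
      using measurable_completion_AE[OF measurable_univ_completionD[OF borel_kint_measurable[OF \<kappa> g'] \<mu>] ae] by simp
  qed
  show "(\<lambda>w. \<integral>\<^sup>+x. f (w(t := x)) \<partial>\<kappa> w) \<in> borel_measurable (univ_completion (Om_t t))"
    by (rule measurable_univ_completionI) (use main in auto)
  show "\<mu> \<in> probs (Om_t t) \<Longrightarrow> (\<integral>\<^sup>+w. f w \<partial>kext t \<mu> \<kappa>) = (\<integral>\<^sup>+w. \<integral>\<^sup>+x. f (w(t := x)) \<partial>\<kappa> w \<partial>\<mu>)"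
    using main by blast
qed

text \<open>\<open>kprod\<close> is defined through \<open>measure_of\<close> from a bare set
  function. Its agreement with a \<open>bind\<close> shows that this function is a measure and makes
  the integration rules available.\<close>

lemma kprod_Suc_kext:
  fixes k :: "nat \<Rightarrow> (nat \<Rightarrow> 'w::polish_space) \<Rightarrow> 'w measure"
  assumes \<mu>: "kprod k t \<in> probs (Om_t t)" and \<kappa>: "kern t (k t)"
  shows "kprod k (Suc t) = kext t (kprod k t) (k t)"
proof -
  have p: "kext t (kprod k t) (k t) \<in> probs (Om_t (Suc t))" by (rule kext_probs[OF assms])
  have "kprod k (Suc t) = measure_of (space (Om_t (Suc t))) (sets (Om_t (Suc t))) (emeasure (kext t (kprod k t) (k t)))"
    unfolding kprod.simps
  proof (rule measure_of_eq[OF sets.space_closed])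
    fix A :: "(nat \<Rightarrow> 'w) set" assume "A \<in> sigma_sets (space (Om_t (Suc t))) (sets (Om_t (Suc t)))"
    then have A: "A \<in> sets (Om_t (Suc t))" by (simp add: sets.sigma_sets_eq)
    have "emeasure (kext t (kprod k t) (k t)) A = (\<integral>\<^sup>+w. indicator A w \<partial>kext t (kprod k t) (k t))"
      using A probs_sets[OF p] by simp
    also have "\<dots> = (\<integral>\<^sup>+w. \<integral>\<^sup>+x. indicator A (w(t := x)) \<partial>k t w \<partial>completion (kprod k t))"
      by (subst nn_integral_kext_borel[OF assms]) (use A in \<open>auto simp: nn_integral_completion\<close>)
    also have "\<dots> = (\<integral>\<^sup>+w. emeasure (k t w) {x. w(t := x) \<in> A} \<partial>completion (kprod k t))"
    proof (rule nn_integral_cong)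
      fix w assume "w \<in> space (completion (kprod k t))"
      then have w: "w \<in> space (Om_t t)" using probs_space[OF \<mu>] by simp
      have "{x. w(t := x) \<in> A} \<in> sets (k t w)"
        using measurable_sets[OF measurable_upd1[OF w] A] probs_sets[OF kern_probs[OF \<kappa> w]] by (simp add: vimage_def)
      moreover have "(\<lambda>x. indicator A (w(t := x)) :: ennreal) = indicator {x. w(t := x) \<in> A}" by (auto simp: indicator_def)
      ultimately show "(\<integral>\<^sup>+x. indicator A (w(t := x)) \<partial>k t w) = emeasure (k t w) {x. w(t := x) \<in> A}" by simp
    qed
    finally show "(\<integral>\<^sup>+w. emeasure (k t w) {x. w(t := x) \<in> A} \<partial>completion (kprod k t)) = emeasure (kext t (kprod k t) (k t)) A" by simp
  qed
  also have "\<dots> = kext t (kprod k t) (k t)"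
    using measure_of_of_measure[of "kext t (kprod k t) (k t)"] probs_sets[OF p] probs_space[OF p] by simp
  finally show ?thesis .
qed

lemma kprod_probs: "(\<And>s. s < t \<Longrightarrow> kern s (k s)) \<Longrightarrow> kprod k t \<in> probs (Om_t t)"
proof (induction t)
  case 0
  have "(\<lambda>_. undefined) \<in> space (Om_t 0)" by (simp add: space_Om)
  from prob_space_return[OF this] show ?case by (simp add: probs_def)
next
  case (Suc t)
  then have p: "kprod k t \<in> probs (Om_t t)" by simp
  show ?case unfolding kprod_Suc_kext[OF p Suc.prems[of t, simplified]]
    by (rule kext_probs[OF p Suc.prems]) simp
qed

lemma nn_integral_kprod_Suc:
  fixes f :: "(nat \<Rightarrow> 'w::polish_space) \<Rightarrow> ennreal"
  assumes "\<And>s. s \<le> t \<Longrightarrow> kern s (k s)" and f: "f \<in> borel_measurable (univ_completion (Om_t (Suc t)))"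
  shows "(\<integral>\<^sup>+w. f w \<partial>kprod k (Suc t)) = (\<integral>\<^sup>+w. \<integral>\<^sup>+x. f (w(t := x)) \<partial>k t w \<partial>kprod k t)"
proof -
  have p: "kprod k t \<in> probs (Om_t t)" using assms(1) by (intro kprod_probs) simp
  show ?thesis unfolding kprod_Suc_kext[OF p assms(1)[OF order_refl]]
    by (rule nn_integral_kext[OF assms(1)[OF order_refl] f p])
qed

lemma measurable_univ_res: "t \<le> n \<Longrightarrow> f \<in> measurable (univ_completion (Om_t t)) N \<Longrightarrow>
    (\<lambda>w. f (res t w)) \<in> measurable (univ_completion (Om_t n)) N"
  by (rule measurable_compose[OF measurable_univ_completion_lift[OF measurable_res]])

text \<open>The kernels after time \<open>t\<close> have mass 1 and integrate out, so the law of the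
  first \<open>t\<close> coordinates is \<open>kprod k t\<close>.\<close>

lemma nn_integral_kprod_res:
  fixes f :: "(nat \<Rightarrow> 'w::polish_space) \<Rightarrow> ennreal"
  assumes "\<And>s. s < n \<Longrightarrow> kern s (k s)" "t \<le> n" and f: "f \<in> borel_measurable (univ_completion (Om_t t))"
  shows "(\<integral>\<^sup>+w. f (res t w) \<partial>kprod k n) = (\<integral>\<^sup>+w. f w \<partial>kprod k t)"
  using assms(2,1)
proof (induction n rule: dec_induct)
  case base
  then show ?case
    by (intro nn_integral_cong) (use probs_space[OF kprod_probs[of t k]] in \<open>simp add: res_id\<close>)
next
  case (step n)
  have "(\<integral>\<^sup>+w. f (res t w) \<partial>kprod k (Suc n)) = (\<integral>\<^sup>+w. \<integral>\<^sup>+x. f (res t (w(n := x))) \<partial>k n w \<partial>kprod k n)"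
    by (rule nn_integral_kprod_Suc) (use step f in \<open>auto intro!: measurable_univ_res\<close>)
  also have "\<dots> = (\<integral>\<^sup>+w. f (res t w) \<partial>kprod k n)"
  proof (rule nn_integral_cong)
    fix w assume "w \<in> space (kprod k n)"
    then have w: "w \<in> space (Om_t n)" using probs_space[OF kprod_probs[of n k]] step by simp
    interpret prob_space "k n w" by (rule probs_prob[OF kern_probs[OF _ w]]) (use step in simp)
    show "(\<integral>\<^sup>+x. f (res t (w(n := x))) \<partial>k n w) = f (res t w)"
      using step(1) by (simp add: res_upd[OF w] emeasure_space_1)
  qed
  also have "\<dots> = (\<integral>\<^sup>+w. f w \<partial>kprod k t)" by (rule step.IH) (use step.prems in simp)
  finally show ?case .
qed

text \<open>A null set of the dominating product has null sections along almost every path; these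
  sections stay null under the dominated kernel, and the exceptional paths stay null by
  induction.\<close>

lemma kprod_absolutely_continuous:
  assumes "\<And>s. s < t \<Longrightarrow> kern s (k s) \<and> kern s (k' s)"
    and "\<And>s w A. s < t \<Longrightarrow> w \<in> space (Om_t s) \<Longrightarrow> A \<in> null_sets (k s w) \<Longrightarrow> A \<in> null_sets (k' s w)"
  shows "absolutely_continuous (kprod k t) (kprod k' t)"
  using assms
proof (induction t)
  case 0
  then show ?case by (simp add: absolutely_continuous_def)
next
  case (Suc t)
  have p: "kprod k t \<in> probs (Om_t t)" "kprod k' t \<in> probs (Om_t t)" using Suc.prems by (auto intro!: kprod_probs)
  have \<kappa>: "kern t (k t)" "kern t (k' t)" using Suc.prems by auto
  have ac: "absolutely_continuous (kprod k t) (kprod k' t)" using Suc by simp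
  have eq: "kprod k (Suc t) = kext t (kprod k t) (k t)" "kprod k' (Suc t) = kext t (kprod k' t) (k' t)"
    using kprod_Suc_kext p \<kappa> by auto
  have P: "kext t (kprod k t) (k t) \<in> probs (Om_t (Suc t))" "kext t (kprod k' t) (k' t) \<in> probs (Om_t (Suc t))"
    using kext_probs p \<kappa> by auto
  show ?case unfolding absolutely_continuous_def eq
  proof
    fix N assume N: "N \<in> null_sets (kext t (kprod k t) (k t))"
    then have NS: "N \<in> sets (Om_t (Suc t))" using probs_sets[OF P(1)] by auto
    have "AE w in kext t (kprod k t) (k t). w \<notin> N" using N by (rule AE_not_in)
    from kext_AE_section[OF p(1) \<kappa>(1) this]
    have "AE w in kprod k' t. AE x in k t w. w(t := x) \<notin> N"
      by (rule absolutely_continuous_AE[OF _ ac, rotated]) (use p in \<open>simp add: probs_sets\<close>)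
    then have "AE w in kprod k' t. AE x in k' t w. w(t := x) \<notin> N"
    proof (rule AE_mono_space)
      fix w assume "w \<in> space (kprod k' t)" and ae: "AE x in k t w. w(t := x) \<notin> N"
      then have w: "w \<in> space (Om_t t)" using probs_space[OF p(2)] by simp
      show "AE x in k' t w. w(t := x) \<notin> N"
      proof (rule absolutely_continuous_AE[OF _ _ ae])
        show "sets (k' t w) = sets (k t w)" using probs_sets[OF kern_probs[OF _ w]] \<kappa> by metis
        show "absolutely_continuous (k t w) (k' t w)"
          unfolding absolutely_continuous_def using Suc.prems(2)[of t w] w by auto
      qed
    qed
    then have "AE w in kprod k' t. (\<integral>\<^sup>+x. indicator N (w(t := x)) \<partial>k' t w) = (0::ennreal)"
    proof (rule AE_mono_space)
      fix w assume "AE x in k' t w. w(t := x) \<notin> N"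
      then have "(\<integral>\<^sup>+x. indicator N (w(t := x)) \<partial>k' t w) = (\<integral>\<^sup>+x. 0 \<partial>k' t w)"
        by (intro nn_integral_cong_AE) (auto elim!: eventually_mono)
      then show "(\<integral>\<^sup>+x. indicator N (w(t := x)) \<partial>k' t w) = (0::ennreal)" by simp
    qed
    then have "(\<integral>\<^sup>+w. \<integral>\<^sup>+x. indicator N (w(t := x)) \<partial>k' t w \<partial>kprod k' t) = (\<integral>\<^sup>+w. 0 \<partial>kprod k' t)"
      by (rule nn_integral_cong_AE)
    then have "(\<integral>\<^sup>+w. indicator N w \<partial>kext t (kprod k' t) (k' t)) = 0"
      by (subst nn_integral_kext_borel[OF p(2) \<kappa>(2)]) (use NS in auto)
    then show "N \<in> null_sets (kext t (kprod k' t) (k' t))" using NS probs_sets[OF P(2)] by (auto simp: null_sets_def)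
  qed
qed

section \<open>Dual cones and closed-set selection\<close>

text \<open>A fixed countable dense set. The cones of states are open, so testing members of
  \<open>dset\<close> suffices, and almost sure statements about all states cost only countably many
  exceptional sets.\<close>

definition dset :: "'a::second_countable_topology set" where
  "dset = (SOME D. countable D \<and> (\<forall>X. open X \<longrightarrow> X \<noteq> {} \<longrightarrow> (\<exists>d\<in>D. d \<in> X)))"

lemma dset: "countable (dset :: 'a::second_countable_topology set)"
  "open X \<Longrightarrow> X \<noteq> {} \<Longrightarrow> \<exists>d\<in>dset. d \<in> (X :: 'a set)"
proof -
  have "\<exists>D::'a set. countable D \<and> (\<forall>X. open X \<longrightarrow> X \<noteq> {} \<longrightarrow> (\<exists>d\<in>D. d \<in> X))"
    using countable_dense_exists by blast
  from someI_ex[OF this] show "countable (dset :: 'a set)" "open X \<Longrightarrow> X \<noteq> {} \<Longrightarrow> \<exists>d\<in>dset. d \<in> (X :: 'a set)"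
    unfolding dset_def by blast+
qed

lemma dset_nonempty: "(dset :: 'a::second_countable_topology set) \<noteq> {}"
  using dset(2)[of UNIV] by auto

text \<open>The hull of \<open>U\<close> is open and lies in the closure of the hull of the dense
  points; a convex set has the same interior as its closure.\<close>

lemma convex_hull_dset:
  fixes U :: "'a::euclidean_space set"
  assumes U: "open U"
  shows "convex hull (dset \<inter> U) = convex hull U"
proof
  show "convex hull (dset \<inter> U) \<subseteq> convex hull U" by (rule hull_mono) auto
  let ?S = "convex hull (dset \<inter> U)"
  have "U \<subseteq> closure (dset \<inter> U)"
  proof
    fix x assume x: "x \<in> U"
    show "x \<in> closure (dset \<inter> U)"
      unfolding closure_iff_nhds_not_empty
    proof (intro allI impI)
      fix A V assume "V \<subseteq> A" "open V" "x \<in> V"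
      then show "dset \<inter> U \<inter> A \<noteq> {}" using dset(2)[of "U \<inter> V"] U x by auto
    qed
  qed
  also have "\<dots> \<subseteq> closure ?S" by (rule closure_mono[OF hull_subset])
  finally have "convex hull U \<subseteq> closure ?S" by (intro hull_minimal convex_closure convex_convex_hull)
  then have "convex hull U \<subseteq> interior (closure ?S)" by (intro interior_maximal open_convex_hull U)
  also have "\<dots> = interior ?S" by (rule convex_interior_closure[OF convex_convex_hull])
  finally show "convex hull U \<subseteq> ?S" using interior_subset by blast
qed

lemma convex_hull_basis_index:
  fixes p :: "'b::euclidean_space"
  assumes "p \<in> convex hull S"
  shows "\<exists>(f :: 'b \<times> real \<Rightarrow> 'b) (l :: 'b \<times> real). (\<forall>i\<in>Basis. f i \<in> S) \<and> (\<forall>i\<in>Basis. 0 \<le> l \<bullet> i) \<and>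
    (\<Sum>i\<in>Basis. l \<bullet> i) = 1 \<and> (\<Sum>i\<in>Basis. (l \<bullet> i) *\<^sub>R f i) = p"
proof -
  obtain F where F: "finite F" "F \<subseteq> S" "card F \<le> DIM('b) + 1" "p \<in> convex hull F"
    using assms caratheodory[of S] by auto
  obtain u where u: "\<And>x. x \<in> F \<Longrightarrow> 0 \<le> u x" "sum u F = 1" "(\<Sum>x\<in>F. u x *\<^sub>R x) = p"
    using F(4) unfolding convex_hull_finite[OF F(1)] by auto
  then have "F \<noteq> {}" by auto
  then obtain s0 where s0: "s0 \<in> F" by blast
  let ?B = "Basis :: ('b \<times> real) set"
  have "card F \<le> card ?B" using F(3) by simp
  then obtain g where g: "g ` F \<subseteq> ?B" "inj_on g F" using card_le_inj[OF F(1) finite_Basis] by blast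
  define f where "f i = (if i \<in> g ` F then inv_into F g i else s0)" for i
  define l where "l = (\<Sum>i\<in>?B. (if i \<in> g ` F then u (inv_into F g i) else 0) *\<^sub>R i)"
  have li: "l \<bullet> i = (if i \<in> g ` F then u (inv_into F g i) else 0)" if "i \<in> ?B" for i
    unfolding l_def using that by (subst inner_sum_left_Basis) auto
  have inv: "inv_into F g (g x) = x" if "x \<in> F" for x using g(2) that by simp
  have fF: "f i \<in> F" for i unfolding f_def using s0 inv by auto
  have "(\<Sum>i\<in>?B. l \<bullet> i) = (\<Sum>i\<in>g ` F. u (inv_into F g i))"
    using g(1) by (intro sum.mono_neutral_cong_right ballI) (simp_all add: li subsetD[OF g(1)])
  also have "\<dots> = 1" by (subst sum.reindex[OF g(2)]) (use u inv in simp)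
  finally have s1: "(\<Sum>i\<in>?B. l \<bullet> i) = 1" .
  have "(\<Sum>i\<in>?B. (l \<bullet> i) *\<^sub>R f i) = (\<Sum>i\<in>g ` F. u (inv_into F g i) *\<^sub>R inv_into F g i)"
    using g(1) by (intro sum.mono_neutral_cong_right ballI) (simp_all add: li f_def subsetD[OF g(1)])
  also have "\<dots> = p" by (subst sum.reindex[OF g(2)]) (use u inv in simp)
  finally have s2: "(\<Sum>i\<in>?B. (l \<bullet> i) *\<^sub>R f i) = p" .
  have "0 \<le> l \<bullet> i" if "i \<in> ?B" for i using li[OF that] u(1) inv by auto
  then show ?thesis using s1 s2 fF F(2) by (intro exI[of _ f] exI[of _ l]) auto
qed

text \<open>The Kuratowski--Ryll-Nardzewski construction: at each stage the first dense centre is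
  taken whose ball of radius \<open>(1/2) ^ n\<close> meets the set. Closed balls are compact here,
  so hitting events of compact sets suffice.\<close>

lemma closed_set_selection:
  fixes \<Gamma> :: "'a \<Rightarrow> 'b::euclidean_space set"
  assumes hit: "\<And>C. compact C \<Longrightarrow> {w \<in> space M. \<Gamma> w \<inter> C \<noteq> {}} \<in> sets M"
    and cl: "\<And>w. w \<in> space M \<Longrightarrow> closed (\<Gamma> w)"
  shows "\<exists>Y\<in>borel_measurable M. \<forall>w\<in>space M. \<Gamma> w \<noteq> {} \<longrightarrow> Y w \<in> \<Gamma> w"
proof -
  define e where "e = from_nat_into (dset :: 'b set)"
  have e: "\<exists>i. dist (e i) y < r" if "0 < r" for y r
  proof -
    have "ball y r \<noteq> {}" using that by simp
    from dset(2)[OF open_ball this] obtain d where "d \<in> dset" "d \<in> ball y r" by blast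
    moreover have "range e = dset" unfolding e_def by (rule range_from_nat_into[OF dset_nonempty dset(1)])
    ultimately show ?thesis by (metis dist_commute mem_ball rangeE)
  qed
  \<comment> \<open>The next ball must meet the set inside the previous ball. Consecutive centres
    then differ by at most \<open>(1/2) ^ n + (1/2) ^ Suc n\<close> and form a Cauchy
    sequence.\<close>
  define ix where "ix w n = rec_nat (LEAST i. \<Gamma> w \<inter> cball (e i) 1 \<noteq> {})
    (\<lambda>n j. LEAST i. \<Gamma> w \<inter> (cball (e i) ((1/2) ^ Suc n) \<inter> cball (e j) ((1/2) ^ n)) \<noteq> {}) n" for w n
  have ix0: "ix w 0 = (LEAST i. \<Gamma> w \<inter> cball (e i) 1 \<noteq> {})" for w by (simp add: ix_def)
  have ixS: "ix w (Suc n) = (LEAST i. \<Gamma> w \<inter> (cball (e i) ((1/2) ^ Suc n) \<inter> cball (e (ix w n)) ((1/2) ^ n)) \<noteq> {})" for w n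
    by (simp add: ix_def)
  have hp: "(\<lambda>w. \<Gamma> w \<inter> C \<noteq> {}) \<in> measurable M (count_space UNIV)" if "compact C" for C
    using hit[OF that] by (simp add: pred_def)
  have mix: "(\<lambda>w. ix w n) \<in> measurable M (count_space UNIV)" for n
  proof (induction n)
    case 0 show ?case unfolding ix0 by (intro measurable_Least hp compact_cball)
  next
    case (Suc n)
    show ?case unfolding ixS
      by (rule measurable_compose_countable[OF _ Suc, where
            f="\<lambda>j w. LEAST i. \<Gamma> w \<inter> (cball (e i) ((1/2) ^ Suc n) \<inter> cball (e j) ((1/2) ^ n)) \<noteq> {}"])
        (intro measurable_Least hp compact_Int compact_cball)
  qed
  have my: "(\<lambda>w. e (ix w n)) \<in> borel_measurable M" for n
    by (rule measurable_compose[OF mix]) simp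
  define Y where "Y w = lim (\<lambda>n. e (ix w n))" for w
  have "Y \<in> borel_measurable M" unfolding Y_def by (rule borel_measurable_lim_metric[OF my])
  moreover have "Y w \<in> \<Gamma> w" if w: "w \<in> space M" and ne: "\<Gamma> w \<noteq> {}" for w
  proof -
    let ?y = "\<lambda>n. e (ix w n)"
    have inv: "\<Gamma> w \<inter> cball (?y n) ((1/2) ^ n) \<noteq> {}"
      and st: "\<Gamma> w \<inter> cball (?y n) ((1/2) ^ n) \<noteq> {} \<Longrightarrow>
        \<Gamma> w \<inter> (cball (?y (Suc n)) ((1/2) ^ Suc n) \<inter> cball (?y n) ((1/2) ^ n)) \<noteq> {}" for n
    proof -
      show st: "\<Gamma> w \<inter> (cball (?y (Suc n)) ((1/2) ^ Suc n) \<inter> cball (?y n) ((1/2) ^ n)) \<noteq> {}"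
        if h: "\<Gamma> w \<inter> cball (?y n) ((1/2) ^ n) \<noteq> {}" for n
      proof -
        obtain g where g: "g \<in> \<Gamma> w" "g \<in> cball (?y n) ((1/2) ^ n)" using h by blast
        obtain i where "dist (e i) g < (1/2) ^ Suc n" using e[of "(1/2) ^ Suc n" g] by auto
        then have "\<Gamma> w \<inter> (cball (e i) ((1/2) ^ Suc n) \<inter> cball (?y n) ((1/2) ^ n)) \<noteq> {}"
          using g by (auto intro!: exI[of _ g] simp: less_imp_le)
        then show ?thesis unfolding ixS by (rule LeastI)
      qed
      show "\<Gamma> w \<inter> cball (?y n) ((1/2) ^ n) \<noteq> {}"
      proof (induction n)
        case 0
        obtain g where g: "g \<in> \<Gamma> w" using ne by blast
        obtain i where "dist (e i) g < 1" using e[of 1 g] by auto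
        then have "\<Gamma> w \<inter> cball (e i) 1 \<noteq> {}" using g by (auto intro!: exI[of _ g] simp: less_imp_le)
        then show ?case unfolding ix0 power_0 by (rule LeastI)
      next
        case (Suc n)
        from st[OF Suc] show ?case by blast
      qed
    qed
    have d: "dist (?y n) (?y (Suc n)) \<le> 2 * (1/2) ^ n" for n
    proof -
      obtain g where "g \<in> cball (?y (Suc n)) ((1/2) ^ Suc n)" "g \<in> cball (?y n) ((1/2) ^ n)" using st[OF inv] by blast
      then have "dist (?y n) (?y (Suc n)) \<le> (1/2) ^ n + (1/2) ^ Suc n"
        by (metis add_mono dist_triangle_le mem_cball dist_commute)
      moreover have "(1/2::real) ^ Suc n \<le> (1/2) ^ n" by simp
      ultimately show ?thesis by linarith
    qed
    have "Cauchy ?y"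
    proof -
      have "summable (\<lambda>n. norm (?y (Suc n) - ?y n))"
      proof (rule summable_comparison_test)
        show "summable (\<lambda>n. 2 * (1/2::real) ^ n)" by (intro summable_mult summable_geometric) simp
        show "\<exists>N. \<forall>n\<ge>N. norm (norm (?y (Suc n) - ?y n)) \<le> 2 * (1/2) ^ n"
          using d by (auto simp: dist_norm norm_minus_commute)
      qed
      then have "summable (\<lambda>n. ?y (Suc n) - ?y n)" by (rule summable_norm_cancel)
      then have "convergent (\<lambda>n. \<Sum>i<n. ?y (Suc i) - ?y i)" by (simp add: summable_iff_convergent)
      then have "convergent (\<lambda>n. ?y n - ?y 0)" using sum_lessThan_telescope[of ?y] by simp
      then have "convergent ?y" by (simp add: convergent_diff_const_right_iff)
      then show ?thesis by (rule convergent_Cauchy)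
    qed
    then have L: "?y \<longlonglongrightarrow> Y w" unfolding Y_def using convergent_LIMSEQ_iff Cauchy_convergent by blast
    have "\<forall>n. \<exists>g. g \<in> \<Gamma> w \<and> dist (?y n) g \<le> (1/2) ^ n" 
      using inv by (metis Int_iff all_not_in_conv mem_cball)
    then obtain g where g: "\<And>n. g n \<in> \<Gamma> w" "\<And>n. dist (?y n) (g n) \<le> (1/2) ^ n" by metis
    have "(\<lambda>n. ?y n - g n) \<longlonglongrightarrow> 0"
      by (rule Lim_null_comparison[where g="\<lambda>n. (1/2) ^ n"])
        (use g(2) in \<open>auto simp: dist_norm intro!: LIMSEQ_realpow_zero always_eventually\<close>)
    from tendsto_diff[OF L this] have "g \<longlonglongrightarrow> Y w" by simp
    then show ?thesis using closed_sequentially[OF cl[OF w]] g(1) by blast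
  qed
  ultimately show ?thesis by (intro bexI[of _ Y]) auto
qed

section \<open>The interior of the dual cone, and separation\<close>

definition icone :: "(real ^ 'd::finite) set \<Rightarrow> (real ^ 'd) set" where
  "icone K = interior (Kstar K)"

lemma convex_Kstar: "convex (Kstar K)"
  unfolding Kstar_def convex_def by (auto simp: inner_add_right)

lemma icone_open: "open (icone K)" by (simp add: icone_def)

lemma icone_convex: "convex (icone K)" unfolding icone_def by (rule convex_interior[OF convex_Kstar])

text \<open>Moving \<open>z\<close> a fixed distance against the direction of \<open>x\<close> must
  keep the pairing nonnegative, which amounts to a margin proportional to \<open>norm x\<close>. In
  this form measurability in a random cone becomes accessible.\<close>

lemma icone_iff: "z \<in> icone K \<longleftrightarrow> (\<exists>e>0. \<forall>x\<in>K. e * norm x \<le> x \<bullet> z)"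
proof
  assume "z \<in> icone K"
  then obtain e where e: "0 < e" "cball z e \<subseteq> Kstar K" unfolding icone_def mem_interior_cball by blast
  have "e * norm x \<le> x \<bullet> z" if x: "x \<in> K" for x
  proof (cases "x = 0")
    case False
    have "z - (e / norm x) *\<^sub>R x \<in> cball z e" using e False by (simp add: dist_norm)
    then have "0 \<le> x \<bullet> (z - (e / norm x) *\<^sub>R x)" using e x unfolding Kstar_def by blast
    also have "\<dots> = x \<bullet> z - e * norm x"
      using False by (simp add: inner_diff_right dot_square_norm power2_eq_square)
    finally show ?thesis by simp
  qed simp
  then show "\<exists>e>0. \<forall>x\<in>K. e * norm x \<le> x \<bullet> z" using e(1) by blast
next
  assume "\<exists>e>0. \<forall>x\<in>K. e * norm x \<le> x \<bullet> z"
  then obtain e where e: "0 < e" "\<And>x. x \<in> K \<Longrightarrow> e * norm x \<le> x \<bullet> z" by blast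
  have "cball z e \<subseteq> Kstar K"
  proof
    fix y assume "y \<in> cball z e"
    then have y: "norm (y - z) \<le> e" by (simp add: dist_norm norm_minus_commute)
    show "y \<in> Kstar K" unfolding Kstar_def
    proof (safe)
      fix x assume x: "x \<in> K"
      have "\<bar>x \<bullet> (y - z)\<bar> \<le> norm x * norm (y - z)" by (rule Cauchy_Schwarz_ineq2)
      also have "\<dots> \<le> norm x * e" using y by (simp add: mult_left_mono)
      finally show "0 \<le> x \<bullet> y" using e(2)[OF x] by (simp add: inner_diff_right mult.commute)
    qed
  qed
  then show "z \<in> icone K" unfolding icone_def mem_interior_cball using e(1) by blast
qed

lemma icone_pos: "z \<in> icone K \<Longrightarrow> x \<in> K \<Longrightarrow> x \<noteq> 0 \<Longrightarrow> 0 < x \<bullet> z"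
  unfolding icone_iff by (metis zero_less_mult_iff zero_less_norm_iff less_le_trans)

lemma icone_scale: "z \<in> icone K \<Longrightarrow> 0 < c \<Longrightarrow> c *\<^sub>R z \<in> icone K"
proof -
  assume "z \<in> icone K" and c: "0 < c"
  then obtain e where e: "0 < e" "\<And>x. x \<in> K \<Longrightarrow> e * norm x \<le> x \<bullet> z" unfolding icone_iff by blast
  have "(c * e) * norm x \<le> x \<bullet> (c *\<^sub>R z)" if "x \<in> K" for x
    using e(2)[OF that] c by (simp add: mult.assoc)
  then show ?thesis unfolding icone_iff using e(1) c by (intro exI[of _ "c * e"]) simp
qed

lemma icone_add: "z \<in> icone K \<Longrightarrow> a \<in> Kstar K \<Longrightarrow> a + z \<in> icone K"
  unfolding icone_iff Kstar_def
  by (smt (verit, ccfv_threshold) inner_add_right mem_Collect_eq)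

lemma icone_component_pos: "z \<in> icone K \<Longrightarrow> orthant \<subseteq> K \<Longrightarrow> 0 < z $ i"
proof -
  assume z: "z \<in> icone K" and o: "orthant \<subseteq> K"
  have "axis i 1 \<in> orthant" by (auto simp: orthant_def axis_def)
  then have "0 < axis i 1 \<bullet> z" using icone_pos[OF z, of "axis i 1"] o by (auto simp: axis_eq_0_iff)
  then show ?thesis by (simp add: inner_axis')
qed

lemma icone_0: "orthant \<subseteq> K \<Longrightarrow> 0 \<notin> icone K"
  using icone_component_pos[of 0 K] by auto

text \<open>The bipolar theorem with only interior dual vectors as tests: an arbitrary dual vector
  \<open>a\<close> is the limit of the interior points \<open>a + c *\<^sub>R z\<close> as
  \<open>c\<close> tends to 0.\<close>

lemma icone_separates:
  fixes K :: "(real ^ 'd::finite) set"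
  assumes K: "closed K" "convex_cone K" and ne: "icone K \<noteq> {}" and x: "\<And>z. z \<in> icone K \<Longrightarrow> 0 \<le> x \<bullet> z"
  shows "x \<in> K"
proof (rule ccontr)
  assume xK: "x \<notin> K"
  have cv: "convex K" and 0: "0 \<in> K" and sc: "\<And>k c. k \<in> K \<Longrightarrow> 0 \<le> c \<Longrightarrow> c *\<^sub>R k \<in> K"
    using K(2) by (auto simp: convex_cone_def cone_0 conic_def) (metis all_not_in_conv conicD order_refl scale_zero_left conic_def)+
  obtain a b where ab: "a \<bullet> x < b" "\<And>k. k \<in> K \<Longrightarrow> b < a \<bullet> k"
    using separating_hyperplane_closed_point[OF cv K(1) xK] by blast
  have b: "b < 0" using ab(2)[OF 0] by simp
  have "a \<in> Kstar K" unfolding Kstar_def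
  proof safe
    fix k assume k: "k \<in> K"
    show "0 \<le> k \<bullet> a"
    proof (rule ccontr)
      assume "\<not> 0 \<le> k \<bullet> a"
      then have n: "k \<bullet> a < 0" by simp
      have "b < a \<bullet> ((b / (k \<bullet> a)) *\<^sub>R k)" using ab(2)[OF sc[OF k, of "b / (k \<bullet> a)"]] b n by (simp add: divide_nonpos_neg)
      then show False using n by (simp add: inner_commute)
    qed
  qed
  obtain z where z: "z \<in> icone K" using ne by blast
  have "0 \<le> x \<bullet> (a + c *\<^sub>R z)" if "0 < c" for c
    by (rule x[OF icone_add[OF icone_scale[OF z that] \<open>a \<in> Kstar K\<close>]])
  then have "0 \<le> x \<bullet> a + c * (x \<bullet> z)" if "0 < c" for c using that by (simp add: inner_add_right)
  moreover have "((\<lambda>c. x \<bullet> a + c * (x \<bullet> z)) \<longlongrightarrow> x \<bullet> a + 0 * (x \<bullet> z)) (at_right 0)"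
    by (intro tendsto_intros)
  ultimately have "0 \<le> x \<bullet> a + 0 * (x \<bullet> z)"
    by (intro tendsto_lowerbound[where F="at_right 0"]) (auto simp: eventually_at_filter)
  then show False using ab(1) b by (simp add: inner_commute)
qed

text \<open>Closure under positive scaling forces a separating functional to be nonnegative on
  \<open>U\<close>, and forces the separating level to be at most 0.\<close>

lemma cone_separating_direction:
  fixes U :: "'a::euclidean_space set"
  assumes U: "convex U" "\<And>u c. u \<in> U \<Longrightarrow> 0 < c \<Longrightarrow> c *\<^sub>R u \<in> U" and z: "z \<notin> U" "z \<noteq> 0"
  shows "\<exists>x. x \<noteq> 0 \<and> (\<forall>u\<in>U. 0 \<le> x \<bullet> u) \<and> x \<bullet> z \<le> 0"
proof (cases "U = {}")
  case True
  then show ?thesis using z by (intro exI[of _ "- z"]) auto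
next
  case False
  obtain a b where ab: "a \<noteq> 0" "a \<bullet> z \<le> b" "\<And>u. u \<in> U \<Longrightarrow> b \<le> a \<bullet> u"
    using separating_hyperplane_sets[of "{z}" U] U(1) False z by auto
  have pos: "0 \<le> a \<bullet> u" if u: "u \<in> U" for u
  proof (rule ccontr)
    assume "\<not> 0 \<le> a \<bullet> u"
    then have n: "a \<bullet> u < 0" by simp
    \<comment> \<open>Scaled by this factor, \<open>u\<close> would have the value
      \<open>- (\<bar>b\<bar> + 1)\<close>, which is below the level \<open>b\<close>.\<close>
    define c where "c = (\<bar>b\<bar> + 1) / - (a \<bullet> u)"
    have "0 < c" using n by (simp add: c_def divide_pos_neg)
    from ab(3)[OF U(2)[OF u this]] have "b \<le> c * (a \<bullet> u)" by simp
    also have "\<dots> = - (\<bar>b\<bar> + 1)" using n by (simp add: c_def)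
    finally show False by linarith
  qed
  obtain u where u: "u \<in> U" using False by blast
  have "b \<le> 0"
  proof (rule field_le_epsilon)
    fix e :: real assume e: "0 < e"
    define c where "c = e / (a \<bullet> u + 1)"
    have "0 < c" using e pos[OF u] by (simp add: c_def)
    from ab(3)[OF U(2)[OF u this]] have "b \<le> c * (a \<bullet> u)" by simp
    also have "\<dots> \<le> e" using e pos[OF u] by (simp add: c_def field_simps)
    finally show "b \<le> 0 + e" by simp
  qed
  then show ?thesis using ab pos by (intro exI[of _ a]) auto
qed

text \<open>Domination by \<open>X\<close> at the prices in \<open>icone K\<close> says that the
  image of \<open>C\<close> under \<open>L\<close> misses \<open>icone K\<close> times the positive
  half line. A separating normal \<open>(k, \<beta>)\<close> supplies the trade \<open>k\<close>
  divided by \<open>\<beta>\<close>, solvent by \<open>icone_separates\<close>. Were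
  \<open>\<beta>\<close> zero, \<open>k\<close> would be a nonzero element of \<open>K\<close> with
  nonpositive value at the interior price \<open>z0\<close> reached by \<open>C\<close>, against
  \<open>icone_pos\<close>.\<close>

lemma hedge_step_exists:
  fixes K :: "(real ^ 'd::finite) set" and C :: "((real ^ 'd) \<times> real \<times> real) set"
  assumes K: "closed K" "convex_cone K" and ne: "icone K \<noteq> {}"
    and C: "convex C" "\<And>p c. p \<in> C \<Longrightarrow> 0 < c \<Longrightarrow> c *\<^sub>R p \<in> C"
    and full: "\<And>z. z \<in> icone K \<Longrightarrow> \<exists>v w. (z, v, w) \<in> C"
    and X: "\<And>z v w. (z, v, w) \<in> C \<Longrightarrow> z \<in> icone K \<Longrightarrow> v \<le> X \<bullet> z"
  shows "\<exists>Y. X - Y \<in> K \<and> (\<forall>(z, v, w)\<in>C. v \<le> Y \<bullet> z)"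
proof -
  define L where "L p = (fst p, fst (snd p) - X \<bullet> fst p)" for p :: "(real ^ 'd) \<times> real \<times> real"
  have lL: "linear L" unfolding L_def
    by (intro linearI) (auto simp: inner_add_right algebra_simps)
  define A where "A = L ` C"
  define B where "B = icone K \<times> {0::real<..}"
  have cA: "convex A" unfolding A_def by (rule convex_linear_image[OF lL C(1)])
  have cB: "convex B" unfolding B_def by (intro convex_Times icone_convex) simp
  obtain z0 where z0: "z0 \<in> icone K" using ne by blast
  obtain v0 w0 where p0: "(z0, v0, w0) \<in> C" using full[OF z0] by blast
  have "A \<inter> B = {}" using X by (force simp: A_def B_def L_def)
  moreover have "A \<noteq> {}" "B \<noteq> {}" using p0 z0 by (auto simp: A_def B_def intro!: exI[of _ 1])
  ultimately obtain a b where ab: "a \<noteq> 0" "\<And>p. p \<in> A \<Longrightarrow> a \<bullet> p \<le> b" "\<And>p. p \<in> B \<Longrightarrow> b \<le> a \<bullet> p"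
    using separating_hyperplane_sets[OF cA cB] by blast
  have scA: "c *\<^sub>R p \<in> A" if "p \<in> A" "0 < c" for p c
    using that C(2) linear_scale[OF lL] unfolding A_def by (metis (no_types, lifting) image_iff)
  have scB: "c *\<^sub>R p \<in> B" if "p \<in> B" "0 < c" for p c
    using that icone_scale by (auto simp: B_def)
  have posB: "0 \<le> a \<bullet> p" if p: "p \<in> B" for p
  proof (rule ccontr)
    assume "\<not> 0 \<le> a \<bullet> p"
    then have n: "a \<bullet> p < 0" by simp
    define c where "c = (\<bar>b\<bar> + 1) / - (a \<bullet> p)"
    have "0 < c" using n by (simp add: c_def divide_pos_neg)
    from ab(3)[OF scB[OF p this]] have "b \<le> c * (a \<bullet> p)" by simp
    also have "\<dots> = - (\<bar>b\<bar> + 1)" using n by (simp add: c_def)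
    finally show False by linarith
  qed
  have negA: "a \<bullet> p \<le> 0" if p: "p \<in> A" for p
  proof (rule ccontr)
    assume "\<not> a \<bullet> p \<le> 0"
    then have n: "0 < a \<bullet> p" by simp
    define c where "c = (\<bar>b\<bar> + 1) / (a \<bullet> p)"
    have "0 < c" using n by (simp add: c_def)
    from ab(2)[OF scA[OF p this]] have "c * (a \<bullet> p) \<le> b" by simp
    moreover have "c * (a \<bullet> p) = \<bar>b\<bar> + 1" using n by (simp add: c_def)
    ultimately show False by linarith
  qed
  obtain k \<beta> where a: "a = (k, \<beta>)" by (cases a)
  have kB: "0 \<le> k \<bullet> z + \<beta> * r" if "z \<in> icone K" "0 < r" for z r
    using posB[of "(z, r)"] that by (simp add: a B_def)
  have b0: "0 \<le> \<beta>"
  proof (rule ccontr)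
    assume "\<not> 0 \<le> \<beta>"
    then have "\<beta> < 0" by simp
    define r where "r = (\<bar>k \<bullet> z0\<bar> + 1) / - \<beta>"
    have "0 < r" using \<open>\<beta> < 0\<close> by (simp add: r_def divide_pos_neg)
    from kB[OF z0 this] have "0 \<le> k \<bullet> z0 - (\<bar>k \<bullet> z0\<bar> + 1)" using \<open>\<beta> < 0\<close> by (simp add: r_def)
    then show False by linarith
  qed
  have kK: "k \<in> K"
  proof (rule icone_separates[OF K ne])
    fix z assume z: "z \<in> icone K"
    show "0 \<le> k \<bullet> z"
    proof (rule field_le_epsilon)
      fix e :: real assume e: "0 < e"
      have "0 \<le> k \<bullet> z + \<beta> * (e / (\<beta> + 1))" using kB[OF z, of "e / (\<beta> + 1)"] e b0 by simp
      also have "\<beta> * (e / (\<beta> + 1)) \<le> e" using e b0 by (simp add: field_simps)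
      finally show "0 \<le> k \<bullet> z + e" by simp
    qed
  qed
  have kA: "k \<bullet> z + \<beta> * (v - X \<bullet> z) \<le> 0" if "(z, v, w) \<in> C" for z v w
  proof -
    have "L (z, v, w) \<in> A" unfolding A_def using that by blast
    from negA[OF this] show ?thesis by (simp add: a L_def)
  qed
  have bp: "0 < \<beta>"
  proof (rule ccontr)
    assume "\<not> 0 < \<beta>"
    then have "\<beta> = 0" using b0 by simp
    then have "k \<noteq> 0" using ab(1) by (simp add: a zero_prod_def)
    from icone_pos[OF z0 kK this] kA[OF p0] show False by (simp add: \<open>\<beta> = 0\<close>)
  qed
  have "(1 / \<beta>) *\<^sub>R k \<in> K" using K(2) kK bp by (auto simp: convex_cone_def conic_def)
  moreover have "v \<le> (X - (1 / \<beta>) *\<^sub>R k) \<bullet> z" if "(z, v, w) \<in> C" for z v w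
    using kA[OF that] bp by (simp add: inner_diff_left field_simps)
  ultimately show ?thesis by (intro exI[of _ "X - (1 / \<beta>) *\<^sub>R k"]) auto
qed

text \<open>By \<open>icone_iff\<close> with the margins \<open>1 / Suc n\<close>, membership says
  that \<open>K w\<close> misses one of countably many open sets.\<close>

lemma icone_measurable:
  fixes K :: "'a \<Rightarrow> (real ^ 'd::finite) set"
  assumes "\<And>U. open U \<Longrightarrow> {w \<in> space M. K w \<inter> U \<noteq> {}} \<in> sets M"
  shows "{w \<in> space M. z \<in> icone (K w)} \<in> sets M"
proof -
  let ?U = "\<lambda>n. {x. x \<bullet> z < norm x / real (Suc n)}"
  have o: "open (?U n)" for n by (intro open_Collect_less continuous_intros) auto
  have "z \<in> icone (K w) \<longleftrightarrow> (\<exists>n. \<not> (K w \<inter> ?U n \<noteq> {}))" for w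
  proof -
    have "z \<in> icone (K w) \<longleftrightarrow> (\<exists>n. \<forall>x\<in>K w. norm x / real (Suc n) \<le> x \<bullet> z)"
      unfolding icone_iff
    proof
      assume "\<exists>e>0. \<forall>x\<in>K w. e * norm x \<le> x \<bullet> z"
      then obtain e where e: "0 < e" "\<And>x. x \<in> K w \<Longrightarrow> e * norm x \<le> x \<bullet> z" by blast
      obtain n where n: "1 / real (Suc n) < e" using e(1) nat_approx_posE by blast
      have "norm x / real (Suc n) \<le> x \<bullet> z" if "x \<in> K w" for x
      proof -
        have "norm x / real (Suc n) = 1 / real (Suc n) * norm x" by simp
        also have "\<dots> \<le> e * norm x" using n by (intro mult_right_mono) auto
        finally show ?thesis using e(2)[OF that] by simp
      qed
      then show "\<exists>n. \<forall>x\<in>K w. norm x / real (Suc n) \<le> x \<bullet> z" by blast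
    next
      assume "\<exists>n. \<forall>x\<in>K w. norm x / real (Suc n) \<le> x \<bullet> z"
      then obtain n where "\<forall>x\<in>K w. norm x / real (Suc n) \<le> x \<bullet> z" by blast
      then show "\<exists>e>0. \<forall>x\<in>K w. e * norm x \<le> x \<bullet> z" by (intro exI[of _ "1 / real (Suc n)"]) simp
    qed
    also have "\<dots> \<longleftrightarrow> (\<exists>n. \<not> (K w \<inter> ?U n \<noteq> {}))" by (auto simp: not_less Int_def)
    finally show ?thesis .
  qed
  moreover have "{w \<in> space M. \<exists>n. \<not> (K w \<inter> ?U n \<noteq> {})} \<in> sets M"
    by (intro sets.sets_Collect_countable_Ex sets.sets_Collect_neg assms o)
  ultimately show ?thesis by simp
qed

text \<open>The moving point is compared with fixed balls around dense points, for which the hitting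
  events are measurable.\<close>

lemma closed_mem_measurable:
  fixes K :: "'a \<Rightarrow> 'b::euclidean_space set"
  assumes K: "\<And>U. open U \<Longrightarrow> {w \<in> space M. K w \<inter> U \<noteq> {}} \<in> sets M"
    and cl: "\<And>w. w \<in> space M \<Longrightarrow> closed (K w)" and X: "X \<in> borel_measurable M"
  shows "{w \<in> space M. X w \<in> K w} \<in> sets M"
proof -
  have "X w \<in> K w \<longleftrightarrow> (\<forall>n. \<exists>d\<in>dset. d \<in> ball (X w) (1 / real (Suc n)) \<and> K w \<inter> ball d (1 / real (Suc n)) \<noteq> {})"
    if w: "w \<in> space M" for w
  proof
    assume x: "X w \<in> K w"
    show "\<forall>n. \<exists>d\<in>dset. d \<in> ball (X w) (1 / real (Suc n)) \<and> K w \<inter> ball d (1 / real (Suc n)) \<noteq> {}"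
    proof
      fix n
      obtain d where "d \<in> dset" "d \<in> ball (X w) (1 / real (Suc n))"
        using dset(2)[of "ball (X w) (1 / real (Suc n))"] by auto
      then show "\<exists>d\<in>dset. d \<in> ball (X w) (1 / real (Suc n)) \<and> K w \<inter> ball d (1 / real (Suc n)) \<noteq> {}"
        using x by (intro bexI[of _ d]) (auto simp: dist_commute)
    qed
  next
    assume h: "\<forall>n. \<exists>d\<in>dset. d \<in> ball (X w) (1 / real (Suc n)) \<and> K w \<inter> ball d (1 / real (Suc n)) \<noteq> {}"
    have "X w \<in> closure (K w)"
      unfolding closure_approachable
    proof (intro allI impI)
      fix e :: real assume "0 < e"
      then obtain n where n: "1 / real (Suc n) < e / 2" using nat_approx_posE[of "e / 2"] by auto
      from h[rule_format, of n] obtain d where d: "d \<in> ball (X w) (1 / real (Suc n))"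
        "K w \<inter> ball d (1 / real (Suc n)) \<noteq> {}" by blast
      from d(2) obtain y where "y \<in> K w" "y \<in> ball d (1 / real (Suc n))" by blast
      with d(1) have "dist (X w) d < 1 / real (Suc n)" "y \<in> K w" "dist d y < 1 / real (Suc n)" by simp_all
      then have "dist y (X w) < e" using n dist_triangle[of y "X w" d] by (simp add: dist_commute)
      then show "\<exists>y\<in>K w. dist y (X w) < e" using \<open>y \<in> K w\<close> by blast
    qed
    then show "X w \<in> K w" using cl[OF w] by simp
  qed
  then have "{w \<in> space M. X w \<in> K w} =
    {w \<in> space M. \<forall>n. \<exists>d\<in>dset. d \<in> ball (X w) (1 / real (Suc n)) \<and> K w \<inter> ball d (1 / real (Suc n)) \<noteq> {}}" by auto
  also have "\<dots> \<in> sets M"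
  proof (intro sets.sets_Collect_countable_All sets.sets_Collect_countable_Ex' sets.sets_Collect_conj K open_ball dset(1))
    fix n and d :: 'b
    have "{w \<in> space M. d \<in> ball (X w) (1 / real (Suc n))} = X -` ball d (1 / real (Suc n)) \<inter> space M"
      by (auto simp: dist_commute)
    then show "{w \<in> space M. d \<in> ball (X w) (1 / real (Suc n))} \<in> sets M"
      using measurable_sets[OF X, of "ball d (1 / real (Suc n))"] by simp
  qed
  finally show ?thesis .
qed

section \<open>The market and its polar sets\<close>

lemma kprod_AE_SucI:
  assumes k: "\<And>s. s \<le> t \<Longrightarrow> kern s (k s)" and N: "N \<in> sets (univ_completion (Om_t (Suc t)))"
    and ae: "\<And>w. w \<in> space (Om_t t) \<Longrightarrow> AE x in k t w. w(t := x) \<notin> N"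
  shows "AE w in kprod k (Suc t). w \<notin> N"
proof -
  have pr: "kprod k (Suc t) \<in> probs (Om_t (Suc t))" "kprod k t \<in> probs (Om_t t)"
    using k by (auto intro!: kprod_probs simp del: kprod.simps)
  have "(\<integral>\<^sup>+w. indicator N w \<partial>kprod k (Suc t)) = (\<integral>\<^sup>+w. \<integral>\<^sup>+x. indicator N (w(t := x)) \<partial>k t w \<partial>kprod k t)"
    by (rule nn_integral_kprod_Suc[OF k]) (use N in auto)
  also have "\<dots> = (\<integral>\<^sup>+w. 0 \<partial>kprod k t)"
  proof (rule nn_integral_cong)
    fix w assume "w \<in> space (kprod k t)"
    then have w: "w \<in> space (Om_t t)" using probs_space[OF pr(2)] by simp
    have "(\<integral>\<^sup>+x. indicator N (w(t := x)) \<partial>k t w) = (\<integral>\<^sup>+x. 0 \<partial>k t w)"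
      using ae[OF w] by (intro nn_integral_cong_AE) (auto elim!: eventually_mono)
    then show "(\<integral>\<^sup>+x. indicator N (w(t := x)) \<partial>k t w) = (0::ennreal)" by simp
  qed
  finally have "(\<integral>\<^sup>+w. indicator N w \<partial>completion (kprod k (Suc t))) = 0" by (simp add: nn_integral_completion del: kprod.simps)
  moreover have NC: "N \<in> sets (completion (kprod k (Suc t)))" by (rule univ_completion_sets_completion[OF N pr(1)])
  ultimately have "N \<in> null_sets (completion (kprod k (Suc t)))"
    by (simp add: null_sets_def nn_integral_indicator del: kprod.simps emeasure_completion)
  then have "AE w in completion (kprod k (Suc t)). w \<notin> N" by (rule AE_not_in)
  then show ?thesis by (simp add: AE_completion_iff del: kprod.simps)
qed

locale market =
  fixes T :: nat
    and Pt :: "nat \<Rightarrow> (nat \<Rightarrow> 'w::polish_space) \<Rightarrow> 'w measure set"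
    and K :: "nat \<Rightarrow> (nat \<Rightarrow> 'w) \<Rightarrow> ((real, 'd::{finite,linorder}) vec) set"
    and S :: "nat \<Rightarrow> (nat \<Rightarrow> 'w) \<Rightarrow> (real, 'd) vec"
  assumes Pt_nonempty: "\<forall>t<T. \<forall>\<omega>\<in>space (Om_t t). Pt t \<omega> \<noteq> {}"
    and Pt_probs: "\<forall>t<T. \<forall>\<omega>\<in>space (Om_t t). Pt t \<omega> \<subseteq> probs (borel :: 'w measure)"
    and Pt_convex: "\<forall>t<T. \<forall>\<omega>\<in>space (Om_t t). convex_meas (Pt t \<omega>)"
    and Pt_analytic: "\<forall>t<T. analytic_in (prod_topology (Om_top t) weak_top)
                         {(\<omega>, P). \<omega> \<in> space (Om_t t) \<and> P \<in> Pt t \<omega>}"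
    and K_meas: "\<forall>t\<le>T. \<forall>U. open U \<longrightarrow>
                   {\<omega> \<in> space (Om_t T). K t \<omega> \<inter> U \<noteq> {}} \<in> sets (F0 T t)"
    and K_closed: "\<forall>t\<le>T. \<forall>\<omega>\<in>space (Om_t T). closed (K t \<omega>)"
    and K_cone: "\<forall>t\<le>T. \<forall>\<omega>\<in>space (Om_t T). convex_cone (K t \<omega>)"
    and K_orthant: "\<forall>t\<le>T. \<forall>\<omega>\<in>space (Om_t T). orthant \<subseteq> K t \<omega>"
    and S_adapted: "\<forall>t\<le>T. S t \<in> borel_measurable (F0 T t)"
    and S_in: "\<forall>t\<le>T. \<forall>\<omega>\<in>space (Om_t T).
                 S t \<omega> \<in> Kstar0 (K t \<omega>) \<inter> interior (Kstar (K t \<omega>))"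
    and NA: "NA2 T (Pcal T Pt) K"
begin

abbreviation PP :: "(nat \<Rightarrow> 'w) measure set" where "PP \<equiv> Pcal T Pt"

definition valid :: "(nat \<Rightarrow> (nat \<Rightarrow> 'w) \<Rightarrow> 'w measure) \<Rightarrow> bool" where
  "valid k \<longleftrightarrow> (\<forall>t<T. univ_kernel t (k t) \<and> (\<forall>w\<in>space (Om_t t). k t w \<in> Pt t w))"

lemma PP_eq: "PP = {kprod k T | k. valid k}"
  by (simp add: Pcal_def valid_def)

lemma valid_kern: "valid k \<Longrightarrow> t < T \<Longrightarrow> kern t (k t)"
  using Pt_probs unfolding valid_def kern_def by blast

lemma valid_probs: "valid k \<Longrightarrow> t \<le> T \<Longrightarrow> kprod k t \<in> probs (Om_t t)"
  by (intro kprod_probs valid_kern) auto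

lemma sets_F0: "sets (F0 T t) = {(\<lambda>w. res t w) -` A \<inter> space (Om_t T) | A. A \<in> sets (Om_t t)}"
  unfolding F0_def by (rule sets_vimage_algebra2) (auto simp: space_Om)

lemma K_hit_res:
  assumes "t \<le> T" "open U" "w \<in> space (Om_t T)"
  shows "K t w \<inter> U \<noteq> {} \<longleftrightarrow> K t (res t w) \<inter> U \<noteq> {}"
proof -
  have "{\<omega> \<in> space (Om_t T). K t \<omega> \<inter> U \<noteq> {}} \<in> sets (F0 T t)" using K_meas assms by simp
  then obtain A where A: "{\<omega> \<in> space (Om_t T). K t \<omega> \<inter> U \<noteq> {}} = (\<lambda>w. res t w) -` A \<inter> space (Om_t T)"
    unfolding sets_F0 by blast
  have r: "res t w \<in> space (Om_t T)" by (rule Om_mono[OF assms(1) res_Om])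
  have "K t v \<inter> U \<noteq> {} \<longleftrightarrow> res t v \<in> A" if "v \<in> space (Om_t T)" for v
  proof -
    have "v \<in> {\<omega> \<in> space (Om_t T). K t \<omega> \<inter> U \<noteq> {}} \<longleftrightarrow> res t v \<in> A" unfolding A using that by simp
    then show ?thesis using that by simp
  qed
  from this[OF assms(3)] this[OF r] show ?thesis by (simp add: res_res)
qed

text \<open>Adaptedness in pointwise form: whether the cone hits a given open set depends only on
  the first \<open>t\<close> coordinates, and a closed set is determined by the balls it
  hits.\<close>

lemma K_res: assumes "t \<le> T" "w \<in> space (Om_t T)" shows "K t (res t w) = K t w"
proof -
  have r: "res t w \<in> space (Om_t T)" by (rule Om_mono[OF assms(1) res_Om])
  have cl: "x \<in> A \<longleftrightarrow> (\<forall>e>0. A \<inter> ball x e \<noteq> {})" if "closed A" for A :: "((real, 'd) vec) set" and x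
  proof -
    have "x \<in> A \<longleftrightarrow> (\<forall>e>0. \<exists>y\<in>A. dist y x < e)" using closure_approachable[of x A] that by simp
    also have "\<dots> \<longleftrightarrow> (\<forall>e>0. A \<inter> ball x e \<noteq> {})" by (simp add: dist_commute Int_def ball_def) blast
    finally show ?thesis .
  qed
  have "x \<in> K t (res t w) \<longleftrightarrow> x \<in> K t w" for x
  proof -
    have "closed (K t w)" "closed (K t (res t w))" using K_closed assms r by simp_all
    then show ?thesis using K_hit_res[OF assms(1) open_ball assms(2)] by (simp add: cl)
  qed
  then show ?thesis by blast
qed

lemma K_hit:
  assumes "t \<le> T" "open U"
  shows "{w \<in> space (Om_t t). K t w \<inter> U \<noteq> {}} \<in> sets (Om_t t)"
proof -
  have "{\<omega> \<in> space (Om_t T). K t \<omega> \<inter> U \<noteq> {}} \<in> sets (F0 T t)" using K_meas assms by simp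
  then obtain A where AS: "A \<in> sets (Om_t t)"
    and A: "{\<omega> \<in> space (Om_t T). K t \<omega> \<inter> U \<noteq> {}} = (\<lambda>w. res t w) -` A \<inter> space (Om_t T)"
    unfolding sets_F0 by blast
  have "w \<in> A \<longleftrightarrow> K t w \<inter> U \<noteq> {}" if w: "w \<in> space (Om_t t)" for w
  proof -
    have wT: "w \<in> space (Om_t T)" by (rule Om_mono[OF assms(1) w])
    have "w \<in> {\<omega> \<in> space (Om_t T). K t \<omega> \<inter> U \<noteq> {}} \<longleftrightarrow> res t w \<in> A" unfolding A using wT by simp
    then show ?thesis using wT by (simp add: res_id[OF w])
  qed
  then have "{w \<in> space (Om_t t). K t w \<inter> U \<noteq> {}} = A" 
    using sets.sets_into_space[OF AS] by auto
  then show ?thesis using AS by simp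
qed

lemma K_facts:
  assumes "t \<le> T" "w \<in> space (Om_t t)"
  shows "closed (K t w)" "convex_cone (K t w)" "orthant \<subseteq> K t w" "icone (K t w) \<noteq> {}"
proof -
  have w: "w \<in> space (Om_t T)" by (rule Om_mono[OF assms])
  show "closed (K t w)" "convex_cone (K t w)" "orthant \<subseteq> K t w"
    using K_closed K_cone K_orthant assms(1) w by simp_all
  have "S t w \<in> Kstar0 (K t w) \<inter> interior (Kstar (K t w))" using S_in assms(1) w by blast
  then show "icone (K t w) \<noteq> {}" unfolding icone_def by auto
qed

lemma K_add: "t \<le> T \<Longrightarrow> w \<in> space (Om_t t) \<Longrightarrow> x \<in> K t w \<Longrightarrow> y \<in> K t w \<Longrightarrow> x + y \<in> K t w"
  using K_facts(2)[of t w] by (simp add: convex_cone_add)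

lemma K_0: "t \<le> T \<Longrightarrow> w \<in> space (Om_t t) \<Longrightarrow> 0 \<in> K t w"
  using K_facts(3)[of t w] by (auto simp: orthant_def)

lemma icone_sets: "t \<le> T \<Longrightarrow> {w \<in> space (Om_t t). z \<in> icone (K t w)} \<in> sets (Om_t t)"
  by (rule icone_measurable[OF K_hit])

text \<open>Stated for paths of length \<open>t\<close>, so that an exceptional set can be kept at
  the time where it arises. \<open>qs_polarI\<close> and \<open>qs_polarD\<close> translate to and
  from \<open>qs\<close>, which lives at the horizon.\<close>

definition polar :: "nat \<Rightarrow> (nat \<Rightarrow> 'w) set \<Rightarrow> bool" where
  "polar t N \<longleftrightarrow> N \<in> sets (univ_completion (Om_t t)) \<and> (\<forall>k. valid k \<longrightarrow> (AE w in kprod k t. w \<notin> N))"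

lemma polar_UN: "countable I \<Longrightarrow> (\<And>i. i \<in> I \<Longrightarrow> polar t (N i)) \<Longrightarrow> polar t (\<Union>i\<in>I. N i)"
  unfolding polar_def by (auto intro!: sets.countable_UN' simp: AE_ball_countable)

lemma polar_Un: "polar t N \<Longrightarrow> polar t N' \<Longrightarrow> polar t (N \<union> N')"
  unfolding polar_def by auto

lemma polar_empty: "polar t {}" unfolding polar_def by simp

lemma polar_lift: assumes "t \<le> n" "n \<le> T" "polar t N" shows "polar n {w \<in> space (Om_t n). res t w \<in> N}"
  unfolding polar_def
proof (intro conjI allI impI)
  have N: "N \<in> sets (univ_completion (Om_t t))" using assms(3) by (simp add: polar_def)
  show S: "{w \<in> space (Om_t n). res t w \<in> N} \<in> sets (univ_completion (Om_t n))"
    using measurable_sets[OF measurable_univ_completion_lift[OF measurable_res[OF assms(1)]] N]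
    by (simp add: vimage_def Int_def conj_commute)
  fix k assume k: "valid k"
  have pr: "kprod k n \<in> probs (Om_t n)" "kprod k t \<in> probs (Om_t t)" using valid_probs[OF k] assms by auto
  have "(\<integral>\<^sup>+w. indicator N (res t w) \<partial>kprod k n) = (\<integral>\<^sup>+w. indicator N w \<partial>kprod k t)"
    by (rule nn_integral_kprod_res) (use valid_kern[OF k] assms N in auto)
  also have "\<dots> = (\<integral>\<^sup>+w. 0 \<partial>kprod k t)"
    using assms(3) k unfolding polar_def by (intro nn_integral_cong_AE) (auto elim!: eventually_mono)
  finally have 0: "(\<integral>\<^sup>+w. indicator N (res t w) \<partial>completion (kprod k n)) = 0" by (simp add: nn_integral_completion)
  have "(\<lambda>w. indicator N (res t w) :: ennreal) \<in> borel_measurable (completion (kprod k n))"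
    by (rule measurable_univ_completionD[OF measurable_univ_res[OF assms(1)] pr(1)]) (use N in simp)
  with 0 have "AE w in completion (kprod k n). indicator N (res t w) = (0::ennreal)" by (simp add: nn_integral_0_iff_AE)
  then have "AE w in kprod k n. indicator N (res t w) = (0::ennreal)" by (simp add: AE_completion_iff)
  then show "AE w in kprod k n. w \<notin> {w \<in> space (Om_t n). res t w \<in> N}"
    by (rule eventually_mono) (auto split: split_indicator_asm)
qed

lemma qs_polarI:
  assumes "t \<le> T" "polar t N" "\<And>w. w \<in> space (Om_t T) \<Longrightarrow> res t w \<notin> N \<Longrightarrow> \<phi> w"
  shows "qs T PP \<phi>"
proof -
  let ?N = "{w \<in> space (Om_t T). res t w \<in> N}"
  have p: "polar T ?N" by (rule polar_lift[OF assms(1) order_refl assms(2)])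
  have S: "?N \<in> sets (univ_completion (Om_t T))" using p by (simp add: polar_def)
  have "emeasure (completion P) ?N = 0" if "P \<in> PP" for P
  proof -
    obtain k where k: "valid k" "P = kprod k T" using \<open>P \<in> PP\<close> unfolding PP_eq by blast
    have "AE w in completion P. w \<notin> ?N" using p k unfolding polar_def AE_completion_iff by blast
    moreover have "?N \<in> sets (completion P)" using univ_completion_sets_completion[OF S valid_probs[OF k(1)]] k(2) by simp
    ultimately show ?thesis using AE_iff_null_sets by blast
  qed
  then show ?thesis unfolding qs_def using S assms(3) by (intro bexI[of _ ?N]) auto
qed

lemma qs_polarD:
  assumes q: "qs T PP \<phi>"
  obtains N where "polar T N" "\<And>w. w \<in> space (Om_t T) \<Longrightarrow> w \<notin> N \<Longrightarrow> \<phi> w"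
proof -
  obtain N where N: "N \<in> sets (univ_completion (Om_t T))" "{\<omega> \<in> space (Om_t T). \<not> \<phi> \<omega>} \<subseteq> N"
    "\<forall>P\<in>PP. emeasure (completion P) N = 0" using q unfolding qs_def by blast
  have "AE w in kprod k T. w \<notin> N" if k: "valid k" for k
  proof -
    have "kprod k T \<in> PP" using k PP_eq by blast
    then have "N \<in> null_sets (completion (kprod k T))"
      using N univ_completion_sets_completion[OF N(1) valid_probs[OF k order_refl]] by blast
    from AE_not_in[OF this] show ?thesis by (simp add: AE_completion_iff)
  qed
  then have "polar T N" unfolding polar_def using N(1) by blast
  then show ?thesis by (rule that) (use N(2) in blast)
qed

text \<open>The no-arbitrage condition yields exceptional sets of full paths. Since
  \<open>kprod k t\<close> is a marginal of \<open>kprod k T\<close>, a set of short paths is polar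
  once its cylinder lies in a polar set.\<close>

lemma polar_project:
  assumes t: "t \<le> T" and p: "polar T N" and B: "B \<in> sets (univ_completion (Om_t t))"
    and sub: "\<And>w. w \<in> space (Om_t T) \<Longrightarrow> res t w \<in> B \<Longrightarrow> w \<in> N"
  shows "polar t B"
  unfolding polar_def
proof (intro conjI allI impI B)
  fix k assume k: "valid k"
  have pr: "kprod k t \<in> probs (Om_t t)" "kprod k T \<in> probs (Om_t T)" using valid_probs[OF k] t by auto
  have "(\<integral>\<^sup>+w. indicator B w \<partial>kprod k t) = (\<integral>\<^sup>+w. indicator B (res t w) \<partial>kprod k T)"
    by (rule nn_integral_kprod_res[symmetric]) (use valid_kern[OF k] t B in auto)
  also have "\<dots> = (\<integral>\<^sup>+w. 0 \<partial>kprod k T)"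
  proof (rule nn_integral_cong_AE, rule AE_mono_space)
    show "AE w in kprod k T. w \<notin> N" using p k by (simp add: polar_def)
  qed (use sub probs_space[OF pr(2)] in \<open>auto split: split_indicator\<close>)
  finally have "(\<integral>\<^sup>+w. indicator B w \<partial>completion (kprod k t)) = 0" by (simp add: nn_integral_completion)
  moreover have NC: "B \<in> sets (completion (kprod k t))" by (rule univ_completion_sets_completion[OF B pr(1)])
  ultimately have "B \<in> null_sets (completion (kprod k t))"
    by (simp add: null_sets_def nn_integral_indicator del: emeasure_completion)
  from AE_not_in[OF this] show "AE w in kprod k t. w \<notin> B" by (simp add: AE_completion_iff)
qed

lemma selector_exists:
  assumes t: "t < T" and A: "A \<in> suslin (Om_t (Suc t))"
  shows "\<exists>\<kappa>. univ_kernel t \<kappa> \<and> (\<forall>w\<in>space (Om_t t). \<kappa> w \<in> Pt t w) \<and>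
      (\<forall>w\<in>space (Om_t t). (\<exists>P\<in>Pt t w. \<not> (AE x in P. w(t := x) \<notin> A)) \<longrightarrow> \<not> (AE x in \<kappa> w. w(t := x) \<notin> A))"
    and "{w \<in> space (Om_t t). \<exists>P\<in>Pt t w. \<not> (AE x in P. w(t := x) \<notin> A)} \<in> suslin (Om_t t)"
proof -
  have "analytic_in (prod_topology (Om_top t) weak_top) {(\<omega>, P). \<omega> \<in> space (Om_t t) \<and> P \<in> Pt t \<omega>}"
    using Pt_analytic t by simp
  moreover have "Pt t w \<noteq> {}" "Pt t w \<subseteq> probs borel" if "w \<in> space (Om_t t)" for w
    using Pt_nonempty Pt_probs t that by simp_all
  ultimately have *: "{w \<in> space (Om_t t). \<exists>P\<in>Pt t w. \<not> (AE x in P. w(t := x) \<notin> A)} \<in> suslin (Om_t t) \<and>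
    (\<exists>\<kappa>. univ_kernel t \<kappa> \<and> (\<forall>w\<in>space (Om_t t). \<kappa> w \<in> Pt t w) \<and>
      (\<forall>w\<in>space (Om_t t). (\<exists>P\<in>Pt t w. \<not> (AE x in P. w(t := x) \<notin> A)) \<longrightarrow> \<not> (AE x in \<kappa> w. w(t := x) \<notin> A)))"
    by (rule active_suslin_kernel[OF _ _ _ A])
  from conjunct2[OF *] conjunct1[OF *] show
    "\<exists>\<kappa>. univ_kernel t \<kappa> \<and> (\<forall>w\<in>space (Om_t t). \<kappa> w \<in> Pt t w) \<and>
      (\<forall>w\<in>space (Om_t t). (\<exists>P\<in>Pt t w. \<not> (AE x in P. w(t := x) \<notin> A)) \<longrightarrow> \<not> (AE x in \<kappa> w. w(t := x) \<notin> A))"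
    "{w \<in> space (Om_t t). \<exists>P\<in>Pt t w. \<not> (AE x in P. w(t := x) \<notin> A)} \<in> suslin (Om_t t)" .
qed

lemma valid_exists: "\<exists>k. valid k"
proof -
  have "\<forall>t. \<exists>\<kappa>. t < T \<longrightarrow> univ_kernel t \<kappa> \<and> (\<forall>w\<in>space (Om_t t). \<kappa> w \<in> Pt t w)"
    using selector_exists(1)[OF _ suslin_sets[OF sets.empty_sets]] by metis
  then have "\<exists>k. \<forall>t. t < T \<longrightarrow> univ_kernel t (k t) \<and> (\<forall>w\<in>space (Om_t t). k t w \<in> Pt t w)" by (rule choice)
  then show ?thesis unfolding valid_def .
qed

end

section \<open>Cones of achievable prices\<close>

locale claim = market T Pt K S
  for T :: nat
    and Pt :: "nat \<Rightarrow> (nat \<Rightarrow> 'w::polish_space) \<Rightarrow> 'w measure set"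
    and K :: "nat \<Rightarrow> (nat \<Rightarrow> 'w) \<Rightarrow> ((real, 'd::{finite,linorder}) vec) set"
    and S :: "nat \<Rightarrow> (nat \<Rightarrow> 'w) \<Rightarrow> (real, 'd) vec" +
  fixes \<xi> :: "(nat \<Rightarrow> 'w) \<Rightarrow> (real, 'd) vec" and \<phi> :: "(nat \<Rightarrow> 'w) \<Rightarrow> real"
  assumes xi_meas: "\<xi> \<in> borel_measurable (Om_t T)"
    and phi_meas: "\<phi> \<in> borel_measurable (Om_t T)"
    and xi_le_phi: "\<And>w. norm (\<xi> w) \<le> \<phi> w"
begin

text \<open>A state \<open>(z, v, r)\<close> collects a price vector \<open>z\<close>, a lower bound \<open>v\<close> for the value of the claim at that
  price, and an upper bound \<open>r\<close> for the expectation of \<open>\<phi> |Z\<^sub>T|\<close> along a continuation.\<close>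
primrec Gs :: "nat \<Rightarrow> (nat \<Rightarrow> 'w) \<Rightarrow> ((real, 'd) vec \<times> real \<times> real) set" where
  "Gs 0 w = {(z, v, r). z \<in> icone (K T w) \<and> v < \<xi> w \<bullet> z \<and> \<phi> w * norm z < r \<and> - r < v}"
| "Gs (Suc n) w = {p \<in> convex hull {p. \<exists>P\<in>Pt (T - Suc n) w. \<not> (AE x in P. p \<notin> Gs n (w(T - Suc n := x)))}.
     fst p \<in> icone (K (T - Suc n) w)}"

definition G :: "nat \<Rightarrow> (nat \<Rightarrow> 'w) \<Rightarrow> ((real, 'd) vec \<times> real \<times> real) set" where
  "G t = Gs (T - t)"

text \<open>Positive probability is expressed as failure of almost sure exclusion: the section of
  \<open>G\<close> is only known to be Suslin, and \<open>emeasure\<close> would be 0 on a set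
  outside the sigma-algebra.\<close>

definition Act :: "nat \<Rightarrow> (nat \<Rightarrow> 'w) \<Rightarrow> ((real, 'd) vec \<times> real \<times> real) set" where
  "Act t w = {p. \<exists>P\<in>Pt t w. \<not> (AE x in P. p \<notin> G (Suc t) (w(t := x)))}"

lemma G_T: "(z, v, r) \<in> G T w \<longleftrightarrow> z \<in> icone (K T w) \<and> v < \<xi> w \<bullet> z \<and> \<phi> w * norm z < r \<and> - r < v"
  by (simp add: G_def)

lemma G_step:
  assumes "t < T"
  shows "G t w = {p \<in> convex hull Act t w. fst p \<in> icone (K t w)}"
proof -
  have e: "T - t = Suc (T - Suc t)" "T - Suc (T - Suc t) = t" using assms by auto
  have "G t w = Gs (Suc (T - Suc t)) w" unfolding G_def e(1) by (rule refl)
  then show ?thesis unfolding Gs.simps Act_def e(2) G_def[of "Suc t", symmetric] .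
qed

lemma ActI: "P \<in> Pt t w \<Longrightarrow> \<not> (AE x in P. p \<notin> G (Suc t) (w(t := x))) \<Longrightarrow> p \<in> Act t w"
  unfolding Act_def by (rule CollectI) (rule bexI)

lemma ActE: assumes "p \<in> Act t w" obtains P where "P \<in> Pt t w" "\<not> (AE x in P. p \<notin> G (Suc t) (w(t := x)))"
proof -
  from assms have "\<exists>P\<in>Pt t w. \<not> (AE x in P. p \<notin> G (Suc t) (w(t := x)))" unfolding Act_def by (rule CollectD)
  then show ?thesis by (rule bexE) (rule that)
qed

lemma Act_realized: assumes "p \<in> Act t w" shows "\<exists>x. p \<in> G (Suc t) (w(t := x))"
proof (rule ccontr)
  assume "\<nexists>x. p \<in> G (Suc t) (w(t := x))"
  then have n: "p \<notin> G (Suc t) (w(t := x))" for x by blast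
  from assms obtain P where P: "P \<in> Pt t w" "\<not> (AE x in P. p \<notin> G (Suc t) (w(t := x)))" by (rule ActE)
  have "AE x in P. p \<notin> G (Suc t) (w(t := x))" by (rule AE_I2) (rule n)
  with P(2) show False by contradiction
qed

lemma phi_nonneg: "0 \<le> \<phi> w" using xi_le_phi[of w] norm_ge_zero order_trans by blast

text \<open>The invariants of the backward recursion. Openness allows dense tests; the bound on the
  second coordinate makes \<open>r\<close> and \<open>v + r\<close> positive; positive prices let
  positions be increased without losing domination.\<close>

definition nice :: "((real, 'd) vec \<times> real \<times> real) set \<Rightarrow> bool" where
  "nice A \<longleftrightarrow> open A \<and> convex A \<and> (\<forall>p\<in>A. \<forall>c>0. c *\<^sub>R p \<in> A) \<and> (\<forall>p\<in>A. \<bar>fst (snd p)\<bar> < snd (snd p)) \<and> (\<forall>p\<in>A. \<forall>i. 0 < fst p $ i)"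

text \<open>The bound comes from Cauchy-Schwarz: \<open>v\<close> is below \<xi> \<bullet> z, which
  is at most \<phi> times the norm of \<open>z\<close> and hence below \<open>r\<close>; the other
  half is the condition \<open>- r < v\<close> built into the terminal cone.\<close>

lemma nice_GT: assumes w: "w \<in> space (Om_t T)" shows "nice (G T w)"
proof -
  have eq: "G T w = {p. fst p \<in> icone (K T w) \<and> fst (snd p) < \<xi> w \<bullet> fst p \<and> \<phi> w * norm (fst p) < snd (snd p) \<and> - snd (snd p) < fst (snd p)}"
    using G_T by auto
  have o: "open (G T w)" unfolding eq
  proof (intro open_Collect_conj open_Collect_less continuous_intros)
    have "{p :: (real, 'd) vec \<times> real \<times> real. fst p \<in> icone (K T w)} = icone (K T w) \<times> UNIV" by auto
    then show "open {p :: (real, 'd) vec \<times> real \<times> real. fst p \<in> icone (K T w)}" by (simp add: open_Times icone_open)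
  qed
  have c: "convex (G T w)"
  proof (rule convexI)
    fix p q u s assume p: "p \<in> G T w" and q: "q \<in> G T w" and us: "0 \<le> (u::real)" "0 \<le> (s::real)" "u + s = 1"
    have us': "u > 0 \<or> s > 0" using us by linarith
    have strict: "u * a + s * b < u * a' + s * b'" if "a < a'" "b < b'" for a b a' b' :: real
      using us us' that
      by (cases "u = 0") (auto intro!: add_less_le_mono mult_left_mono mult_strict_left_mono simp: less_imp_le)
    have z: "u *\<^sub>R fst p + s *\<^sub>R fst q \<in> icone (K T w)"
      using p q us by (intro convexD[OF icone_convex]) (auto simp: eq)
    have v: "u * fst (snd p) + s * fst (snd q) < u * (\<xi> w \<bullet> fst p) + s * (\<xi> w \<bullet> fst q)"
      using p q by (intro strict) (auto simp: eq)
    have "\<phi> w * norm (u *\<^sub>R fst p + s *\<^sub>R fst q) \<le> \<phi> w * (u * norm (fst p) + s * norm (fst q))"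
      using us phi_nonneg by (intro mult_left_mono norm_triangle_le) auto
    also have "\<dots> = u * (\<phi> w * norm (fst p)) + s * (\<phi> w * norm (fst q))" by (simp add: algebra_simps)
    also have "\<dots> < u * snd (snd p) + s * snd (snd q)" using p q by (intro strict) (auto simp: eq)
    finally have r: "\<phi> w * norm (u *\<^sub>R fst p + s *\<^sub>R fst q) < u * snd (snd p) + s * snd (snd q)" .
    have "u * (- snd (snd p)) + s * (- snd (snd q)) < u * fst (snd p) + s * fst (snd q)"
      using p q by (intro strict) (auto simp: eq)
    with z v r show "u *\<^sub>R p + s *\<^sub>R q \<in> G T w" unfolding eq by (simp add: inner_add_right)
  qed
  have sc: "c *\<^sub>R p \<in> G T w" if p: "p \<in> G T w" and c: "0 < c" for p c
  proof -
    obtain z v r where pz: "p = (z, v, r)" by (cases p)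
    have h: "z \<in> icone (K T w)" "v < \<xi> w \<bullet> z" "\<phi> w * norm z < r" "- r < v" using p unfolding pz G_T by auto
    have "c * v < c * (\<xi> w \<bullet> z)" "c * (\<phi> w * norm z) < c * r" "c * - r < c * v"
      using h c by (intro mult_strict_left_mono; simp)+
    then show ?thesis unfolding pz using icone_scale[OF h(1) c] c by (simp add: G_T algebra_simps)
  qed
  have b: "\<bar>fst (snd p)\<bar> < snd (snd p)" if p: "p \<in> G T w" for p
  proof -
    have "fst (snd p) < \<xi> w \<bullet> fst p" using p by (simp add: eq)
    also have "\<dots> \<le> norm (\<xi> w) * norm (fst p)" by (rule norm_cauchy_schwarz)
    also have "\<dots> \<le> \<phi> w * norm (fst p)" using xi_le_phi by (intro mult_right_mono) auto
    also have "\<dots> < snd (snd p)" using p by (simp add: eq)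
    finally show ?thesis using p by (simp add: eq abs_less_iff)
  qed
  have "0 < fst p $ i" if p: "p \<in> G T w" for p i
    using icone_component_pos[of "fst p" "K T w"] K_facts(3)[OF order_refl w] p by (simp add: eq)
  with o c sc b show ?thesis unfolding nice_def by blast
qed

text \<open>If each ball of radius \<open>1 / Suc n\<close> around \<open>p\<close> were almost
  surely not contained in the cone, countable additivity and openness would exclude \<open>p\<close>
  itself. So one radius works with positive probability.\<close>

lemma open_Act:
  assumes o: "\<And>x. open (G (Suc t) (w(t := x)))"
  shows "open (Act t w)"
proof (rule openI)
  fix p assume "p \<in> Act t w"
  then obtain P where P: "P \<in> Pt t w" "\<not> (AE x in P. p \<notin> G (Suc t) (w(t := x)))" by (rule ActE)
  have "\<exists>n. \<not> (AE x in P. \<not> ball p (1 / real (Suc n)) \<subseteq> G (Suc t) (w(t := x)))"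
  proof (rule ccontr)
    assume "\<nexists>n. \<not> (AE x in P. \<not> ball p (1 / real (Suc n)) \<subseteq> G (Suc t) (w(t := x)))"
    then have "AE x in P. \<forall>n. \<not> ball p (1 / real (Suc n)) \<subseteq> G (Suc t) (w(t := x))"
      by (simp only: AE_all_countable) blast
    then have "AE x in P. p \<notin> G (Suc t) (w(t := x))"
    proof (rule eventually_mono)
      fix x assume h: "\<forall>n. \<not> ball p (1 / real (Suc n)) \<subseteq> G (Suc t) (w(t := x))"
      show "p \<notin> G (Suc t) (w(t := x))"
      proof
        assume "p \<in> G (Suc t) (w(t := x))"
        then obtain e where e: "0 < e" "ball p e \<subseteq> G (Suc t) (w(t := x))" using o open_contains_ball by blast
        obtain n where "1 / real (Suc n) < e" using e(1) nat_approx_posE by blast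
        then have "ball p (1 / real (Suc n)) \<subseteq> ball p e" by (intro subset_ball) simp
        with e(2) h show False by blast
      qed
    qed
    with P(2) show False by contradiction
  qed
  then obtain n where n: "\<not> (AE x in P. \<not> ball p (1 / real (Suc n)) \<subseteq> G (Suc t) (w(t := x)))" by blast
  have "ball p (1 / real (Suc n)) \<subseteq> Act t w"
  proof
    fix q assume q: "q \<in> ball p (1 / real (Suc n))"
    show "q \<in> Act t w"
    proof (rule ActI[OF P(1)])
      show "\<not> (AE x in P. q \<notin> G (Suc t) (w(t := x)))"
      proof
        assume "AE x in P. q \<notin> G (Suc t) (w(t := x))"
        then have "AE x in P. \<not> ball p (1 / real (Suc n)) \<subseteq> G (Suc t) (w(t := x))"
          by (rule eventually_mono) (use q in blast)
        with n show False by contradiction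
      qed
    qed
  qed
  then show "\<exists>e>0. ball p e \<subseteq> Act t w" by (intro exI[of _ "1 / real (Suc n)"]) simp
qed

lemma convex_hull_scale:
  fixes A :: "'v::real_vector set"
  assumes "\<And>p c. p \<in> A \<Longrightarrow> 0 < c \<Longrightarrow> c *\<^sub>R p \<in> A" "p \<in> convex hull A" "0 < c"
  shows "c *\<^sub>R p \<in> convex hull A"
proof -
  have "c *\<^sub>R p \<in> (\<lambda>x. c *\<^sub>R x) ` (convex hull A)" using assms(2) by blast
  also have "\<dots> = convex hull ((\<lambda>x. c *\<^sub>R x) ` A)" by (rule convex_hull_scaling[symmetric])
  also have "\<dots> \<subseteq> convex hull A" by (rule hull_mono) (use assms in blast)
  finally show ?thesis .
qed

lemma Act_facts:
  assumes w: "w \<in> space (Om_t t)" and n: "\<And>v. v \<in> space (Om_t (Suc t)) \<Longrightarrow> nice (G (Suc t) v)"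
  shows "open (Act t w)" "\<And>p c. p \<in> Act t w \<Longrightarrow> 0 < c \<Longrightarrow> c *\<^sub>R p \<in> Act t w"
    "convex hull Act t w \<subseteq> {p. \<bar>fst (snd p)\<bar> < snd (snd p) \<and> (\<forall>i. 0 < fst p $ i)}"
proof -
  have n': "nice (G (Suc t) (w(t := x)))" for x by (rule n[OF upd_Om[OF w]])
  show "open (Act t w)" by (rule open_Act) (use n' in \<open>simp add: nice_def\<close>)
  show "c *\<^sub>R p \<in> Act t w" if p: "p \<in> Act t w" and c: "0 < c" for p c
  proof -
    obtain P where P: "P \<in> Pt t w" "\<not> (AE x in P. p \<notin> G (Suc t) (w(t := x)))" using p by (rule ActE)
    show ?thesis
    proof (rule ActI[OF P(1)], rule notI)
      assume "AE x in P. c *\<^sub>R p \<notin> G (Suc t) (w(t := x))"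
      then have "AE x in P. p \<notin> G (Suc t) (w(t := x))"
        by (rule eventually_mono) (use n' c in \<open>auto simp: nice_def\<close>)
      with P(2) show False by contradiction
    qed
  qed
  show "convex hull Act t w \<subseteq> {p. \<bar>fst (snd p)\<bar> < snd (snd p) \<and> (\<forall>i. 0 < fst p $ i)}"
  proof (rule hull_minimal)
    show "Act t w \<subseteq> {p. \<bar>fst (snd p)\<bar> < snd (snd p) \<and> (\<forall>i. 0 < fst p $ i)}"
    proof
      fix p assume "p \<in> Act t w"
      then obtain x where "p \<in> G (Suc t) (w(t := x))" using Act_realized by blast
      with n'[of x] show "p \<in> {p. \<bar>fst (snd p)\<bar> < snd (snd p) \<and> (\<forall>i. 0 < fst p $ i)}" unfolding nice_def by blast
    qed
    show "convex {p :: (real, 'd) vec \<times> real \<times> real. \<bar>fst (snd p)\<bar> < snd (snd p) \<and> (\<forall>i. 0 < fst p $ i)}"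
    proof (rule convexI)
      fix p q :: "(real, 'd) vec \<times> real \<times> real" and u s :: real
      assume p: "p \<in> {p. \<bar>fst (snd p)\<bar> < snd (snd p) \<and> (\<forall>i. 0 < fst p $ i)}"
        and q: "q \<in> {p. \<bar>fst (snd p)\<bar> < snd (snd p) \<and> (\<forall>i. 0 < fst p $ i)}" and us: "0 \<le> u" "0 \<le> s" "u + s = 1"
      have us': "u > 0 \<or> s > 0" using us by linarith
      have strict: "u * a + s * b < u * a' + s * b'" if "a < a'" "b < b'" for a b a' b' :: real
        using us us' that
        by (cases "u = 0") (auto intro!: add_less_le_mono mult_left_mono mult_strict_left_mono simp: less_imp_le)
      have "\<bar>u * fst (snd p) + s * fst (snd q)\<bar> \<le> \<bar>u * fst (snd p)\<bar> + \<bar>s * fst (snd q)\<bar>" by (rule abs_triangle_ineq)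
      also have "\<dots> = u * \<bar>fst (snd p)\<bar> + s * \<bar>fst (snd q)\<bar>" using us by (simp add: abs_mult)
      also have "\<dots> < u * snd (snd p) + s * snd (snd q)" using p q by (intro strict) auto
      finally have "\<bar>u * fst (snd p) + s * fst (snd q)\<bar> < u * snd (snd p) + s * snd (snd q)" .
      moreover have "0 < u * fst p $ i + s * fst q $ i" for i
        using strict[of 0 "fst p $ i" 0 "fst q $ i"] p q by simp
      ultimately show "u *\<^sub>R p + s *\<^sub>R q \<in> {p. \<bar>fst (snd p)\<bar> < snd (snd p) \<and> (\<forall>i. 0 < fst p $ i)}" by simp
    qed
  qed
qed

lemma nice_G: "t \<le> T \<Longrightarrow> w \<in> space (Om_t t) \<Longrightarrow> nice (G t w)"
proof (induction t arbitrary: w rule: inc_induct)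
  case base
  then show ?case by (rule nice_GT)
next
  case (step t)
  note A = Act_facts[OF step.prems step.IH]
  have eq: "G t w = convex hull Act t w \<inter> (icone (K t w) \<times> UNIV)"
    unfolding G_step[OF step.hyps(2)] by auto
  have "open (G t w)" unfolding eq by (intro open_Int open_convex_hull A(1) open_Times icone_open open_UNIV)
  moreover have "convex (G t w)" unfolding eq by (intro convex_Int convex_convex_hull convex_Times icone_convex convex_UNIV)
  moreover have "c *\<^sub>R p \<in> G t w" if "p \<in> G t w" "0 < c" for p c
    using that convex_hull_scale[OF A(2)] icone_scale unfolding eq by (cases p) auto
  ultimately show ?case unfolding nice_def using A(3) eq by blast
qed

lemma Act_props:
  assumes t: "t < T" and w: "w \<in> space (Om_t t)"
  shows "open (Act t w)" "\<And>p c. p \<in> Act t w \<Longrightarrow> 0 < c \<Longrightarrow> c *\<^sub>R p \<in> Act t w"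
    "p \<in> Act t w \<Longrightarrow> 0 < fst p $ i"
proof -
  note A = Act_facts[OF w nice_G[OF Suc_leI[OF t]]]
  show "open (Act t w)" by (rule A(1))
  show "\<And>p c. p \<in> Act t w \<Longrightarrow> 0 < c \<Longrightarrow> c *\<^sub>R p \<in> Act t w" by (rule A(2))
  show "p \<in> Act t w \<Longrightarrow> 0 < fst p $ i" using A(3) hull_inc[of p "Act t w" convex] by blast
qed

lemma Act_section: "w \<in> space (Om_t t) \<Longrightarrow>
    (AE x in P. w(t := x) \<notin> {v \<in> space (Om_t (Suc t)). p \<in> G (Suc t) v}) \<longleftrightarrow> (AE x in P. p \<notin> G (Suc t) (w(t := x)))"
  using upd_Om[of w t] by simp

lemma Act_suslin:
  assumes t: "t < T" and A: "{v \<in> space (Om_t (Suc t)). p \<in> G (Suc t) v} \<in> suslin (Om_t (Suc t))"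
  shows "{w \<in> space (Om_t t). p \<in> Act t w} \<in> suslin (Om_t t)"
proof -
  have "{w \<in> space (Om_t t). p \<in> Act t w} =
    {w \<in> space (Om_t t). \<exists>P\<in>Pt t w. \<not> (AE x in P. w(t := x) \<notin> {v \<in> space (Om_t (Suc t)). p \<in> G (Suc t) v})}"
    unfolding Act_def mem_Collect_eq by (intro Collect_cong conj_cong bex_cong refl) (simp add: upd_Om)
  then show ?thesis using selector_exists(2)[OF t A] by simp
qed

text \<open>By \<open>convex_hull_dset\<close>, membership in the hull is witnessed by a finite set
  of dense active states. The event is a countable union of finite intersections of Suslin
  sets.\<close>

lemma G_suslin: "t \<le> T \<Longrightarrow> {w \<in> space (Om_t t). p \<in> G t w} \<in> suslin (Om_t t)"
proof (induction t arbitrary: p rule: inc_induct)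
  case base
  obtain z v r where p: "p = (z, v, r)" by (cases p)
  have "{w \<in> space (Om_t T). z \<in> icone (K T w) \<and> v < \<xi> w \<bullet> z \<and> \<phi> w * norm z < r \<and> - r < v} \<in> sets (Om_t T)"
    by (intro sets.sets_Collect_conj icone_sets order_refl borel_measurable_less borel_measurable_const
        borel_measurable_inner borel_measurable_times xi_meas phi_meas)
  then show ?case unfolding p G_T by (rule suslin_sets)
next
  case (step t)
  have A: "{w \<in> space (Om_t t). q \<in> Act t w} \<in> suslin (Om_t t)" for q
    by (rule Act_suslin[OF step.hyps(2) step.IH])
  let ?D = "dset :: ((real, 'd) vec \<times> real \<times> real) set"
  let ?F = "{F. finite F \<and> F \<subseteq> ?D \<and> p \<in> convex hull F}"
  have ne: "F \<noteq> {}" if "F \<in> ?F" for F using that by auto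
  have cF: "countable ?F"
    by (rule countable_subset[OF _ countable_Collect_finite_subset[OF dset(1)]]) auto
  have h: "p \<in> convex hull Act t w \<longleftrightarrow> (\<exists>F\<in>?F. \<forall>q\<in>F. q \<in> Act t w)" if w: "w \<in> space (Om_t t)" for w
  proof -
    have "p \<in> convex hull Act t w \<longleftrightarrow> p \<in> convex hull (?D \<inter> Act t w)"
      using convex_hull_dset[OF Act_props(1)[OF step.hyps(2) w]] by simp
    also have "\<dots> \<longleftrightarrow> (\<exists>F. finite F \<and> F \<subseteq> ?D \<inter> Act t w \<and> p \<in> convex hull F)"
    proof
      assume "p \<in> convex hull (?D \<inter> Act t w)"
      then have "\<exists>F. finite F \<and> F \<subseteq> ?D \<inter> Act t w \<and> card F \<le> DIM((real, 'd) vec \<times> real \<times> real) + 1 \<and> p \<in> convex hull F"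
        unfolding caratheodory[of "?D \<inter> Act t w"] by (rule CollectD)
      then show "\<exists>F. finite F \<and> F \<subseteq> ?D \<inter> Act t w \<and> p \<in> convex hull F" by (elim ex_forward conj_forward) simp_all
    next
      assume "\<exists>F. finite F \<and> F \<subseteq> ?D \<inter> Act t w \<and> p \<in> convex hull F"
      then obtain F where "finite F" "F \<subseteq> ?D \<inter> Act t w" "p \<in> convex hull F" by (elim exE conjE)
      then show "p \<in> convex hull (?D \<inter> Act t w)" using hull_mono[of F "?D \<inter> Act t w" convex] by blast
    qed
    also have "\<dots> \<longleftrightarrow> (\<exists>F\<in>?F. \<forall>q\<in>F. q \<in> Act t w)" by blast
    finally show ?thesis .
  qed
  have "{w \<in> space (Om_t t). p \<in> G t w} =
     (\<Union>F\<in>?F. \<Inter>q\<in>F. {w \<in> space (Om_t t). q \<in> Act t w}) \<inter> {w \<in> space (Om_t t). fst p \<in> icone (K t w)}"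
    unfolding G_step[OF step.hyps(2)] using h ne by auto
  also have "\<dots> \<in> suslin (Om_t t)"
  proof (rule suslin_Int)
    show "(\<Union>F\<in>?F. \<Inter>q\<in>F. {w \<in> space (Om_t t). q \<in> Act t w}) \<in> suslin (Om_t t)"
    proof (rule suslin_UN[OF cF])
      fix F assume F: "F \<in> ?F"
      show "(\<Inter>q\<in>F. {w \<in> space (Om_t t). q \<in> Act t w}) \<in> suslin (Om_t t)"
        by (rule suslin_INT) (use F ne A in \<open>auto intro: countable_finite\<close>)
    qed
    show "{w \<in> space (Om_t t). fst p \<in> icone (K t w)} \<in> suslin (Om_t t)"
      by (rule suslin_sets[OF icone_sets]) (use step.hyps in simp)
  qed
  finally show ?case .
qed

lemma G_univ: "t \<le> T \<Longrightarrow> {w \<in> space (Om_t t). p \<in> G t w} \<in> sets (univ_completion (Om_t t))"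
  by (rule suslin_univ_completion[OF G_suslin])

lemma Act_univ: "t < T \<Longrightarrow> {w \<in> space (Om_t t). p \<in> Act t w} \<in> sets (univ_completion (Om_t t))"
  by (rule suslin_univ_completion[OF Act_suslin[OF _ G_suslin]]) auto

text \<open>For a fixed state, one measurable kernel charges it along every path where some prior
  does.\<close>

lemma Act_kernel:
  assumes t: "t < T"
  shows "\<exists>\<kappa>. univ_kernel t \<kappa> \<and> (\<forall>w\<in>space (Om_t t). \<kappa> w \<in> Pt t w) \<and>
      (\<forall>w\<in>space (Om_t t). p \<in> Act t w \<longrightarrow> \<not> (AE x in \<kappa> w. p \<notin> G (Suc t) (w(t := x))))"
proof -
  let ?A = "{v \<in> space (Om_t (Suc t)). p \<in> G (Suc t) v}"
  obtain \<kappa> where \<kappa>: "univ_kernel t \<kappa>" "\<forall>w\<in>space (Om_t t). \<kappa> w \<in> Pt t w"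
    "\<forall>w\<in>space (Om_t t). (\<exists>P\<in>Pt t w. \<not> (AE x in P. w(t := x) \<notin> ?A)) \<longrightarrow> \<not> (AE x in \<kappa> w. w(t := x) \<notin> ?A)"
    using selector_exists(1)[OF t G_suslin[OF Suc_leI[OF t], of p]] by (elim exE conjE)
  have "\<not> (AE x in \<kappa> w. p \<notin> G (Suc t) (w(t := x)))" if w: "w \<in> space (Om_t t)" and p: "p \<in> Act t w" for w
  proof -
    obtain P where P: "P \<in> Pt t w" "\<not> (AE x in P. p \<notin> G (Suc t) (w(t := x)))" using p by (rule ActE)
    then have "\<exists>P\<in>Pt t w. \<not> (AE x in P. w(t := x) \<notin> ?A)" unfolding Act_section[OF w] by (intro bexI[of _ P])
    with \<kappa>(3) w have "\<not> (AE x in \<kappa> w. w(t := x) \<notin> ?A)" by blast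
    then show ?thesis unfolding Act_section[OF w] .
  qed
  with \<kappa>(1,2) show ?thesis by (intro exI[of _ \<kappa>]) blast
qed

end

section \<open>Superhedging strategies\<close>

text \<open>Rounding upwards in every coordinate: because prices are positive, the dense position
  \<open>q\<close> is worth at least as much as \<open>y\<close> at every achievable price.\<close>

lemma above_dset:
  fixes y :: "(real, 'd::finite) vec"
  assumes "0 < e"
  shows "\<exists>q\<in>dset. (\<forall>i. y $ i < q $ i) \<and> dist q y < e"
proof -
  let ?O = "(\<Inter>i. {q. y $ i < q $ i}) \<inter> ball y e"
  have "open {q :: (real, 'd) vec. y $ i < q $ i}" for i
    by (rule open_Collect_less) (intro continuous_intros)+
  then have "open ?O" by (intro open_Int open_INT open_ball) auto
  moreover have "?O \<noteq> {}"
  proof -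
    define u :: "(real, 'd) vec" where "u = (\<chi> i. 1)"
    define c where "c = e / (norm u + 1)"
    have c: "0 < c" using assms by (simp add: c_def add_nonneg_pos)
    have "norm (c *\<^sub>R u) = e * (norm u / (norm u + 1))" using c assms by (simp add: c_def)
    also have "\<dots> < e * 1" using assms by (intro mult_strict_left_mono) (auto simp: add_nonneg_pos)
    finally have "y + c *\<^sub>R u \<in> ball y e" by (simp add: dist_norm)
    moreover have "y $ i < (y + c *\<^sub>R u) $ i" for i using c by (simp add: u_def)
    ultimately show ?thesis by blast
  qed
  ultimately obtain q where "q \<in> dset" "q \<in> ?O" using dset(2)[of ?O] by blast
  then show ?thesis by (intro bexI[of _ q]) (auto simp: dist_commute)
qed

lemma sets_Collect_ball_countable:
  assumes "countable I" "\<And>i. i \<in> I \<Longrightarrow> {w \<in> space M. P i w} \<in> sets M"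
  shows "{w \<in> space M. \<forall>i\<in>I. P i w} \<in> sets M"
proof -
  have "{w \<in> space M. \<forall>i\<in>I. P i w} = space M - (\<Union>i\<in>I. space M - {w \<in> space M. P i w})" by auto
  also have "\<dots> \<in> sets M" using assms by (intro sets.Diff sets.countable_UN' sets.top) auto
  finally show ?thesis .
qed

text \<open>A violation at one point of the open set would persist on a neighbourhood and so at a
  dense point. The factor \<open>a\<close> is 0 for solvency and 1 for domination of the
  claim.\<close>

lemma dense_le:
  fixes G :: "((real, 'd::finite) vec \<times> real \<times> real) set"
  assumes "open G" and le: "\<And>p. p \<in> dset \<Longrightarrow> p \<in> G \<Longrightarrow> a * fst (snd p) \<le> y \<bullet> fst p" and p: "p \<in> G"
  shows "a * fst (snd p) \<le> y \<bullet> fst p"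
proof (rule ccontr)
  assume n: "\<not> a * fst (snd p) \<le> y \<bullet> fst p"
  let ?O = "G \<inter> {p. y \<bullet> fst p < a * fst (snd p)}"
  have "open ?O" by (intro open_Int assms(1) open_Collect_less continuous_intros)
  moreover have "?O \<noteq> {}" using p n by auto
  ultimately obtain q where "q \<in> dset" "q \<in> ?O" using dset(2)[of ?O] by blast
  then show False using le[of q] by auto
qed

context market
begin

lemma measurable_Ffilt_res:
  assumes "f \<in> measurable (univ_completion (Om_t t)) N"
  shows "(\<lambda>w. f (res t w)) \<in> measurable (Ffilt T t) N"
  unfolding Ffilt_def
  by (rule measurable_compose[OF measurable_vimage_algebra1 assms]) simp

end

context claim
begin

section \<open>No-arbitrage and the achievable prices\<close>

definition Inact :: "nat \<Rightarrow> (nat \<Rightarrow> 'w) set" where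
  "Inact t = {w \<in> space (Om_t (Suc t)). \<exists>p\<in>dset. p \<in> G (Suc t) w \<and> p \<notin> Act t (res t w)}"

text \<open>A dense state that is not active is excluded almost surely by every one-step prior, and
  there are only countably many dense states.\<close>

lemma Inact_polar: assumes t: "t < T" shows "polar (Suc t) (Inact t)"
  unfolding polar_def
proof (intro conjI allI impI)
  have "{w \<in> space (Om_t (Suc t)). p \<in> G (Suc t) w} - {w \<in> space (Om_t (Suc t)). p \<in> Act t (res t w)}
      \<in> sets (univ_completion (Om_t (Suc t)))" for p
  proof (rule sets.Diff[OF G_univ])
    have "(\<lambda>w. res t w) \<in> measurable (univ_completion (Om_t (Suc t))) (univ_completion (Om_t t))"
      by (rule measurable_univ_completion_lift[OF measurable_res]) simp
    from measurable_sets[OF this Act_univ[OF t, of p]]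
    show "{w \<in> space (Om_t (Suc t)). p \<in> Act t (res t w)} \<in> sets (univ_completion (Om_t (Suc t)))"
      by (simp add: vimage_def Int_def conj_commute)
  qed (use t in simp)
  then have "(\<Union>p\<in>dset. {w \<in> space (Om_t (Suc t)). p \<in> G (Suc t) w} - {w \<in> space (Om_t (Suc t)). p \<in> Act t (res t w)})
      \<in> sets (univ_completion (Om_t (Suc t)))" by (intro sets.countable_UN' dset(1)) auto
  moreover have "Inact t = (\<Union>p\<in>dset. {w \<in> space (Om_t (Suc t)). p \<in> G (Suc t) w} - {w \<in> space (Om_t (Suc t)). p \<in> Act t (res t w)})"
    unfolding Inact_def by auto
  ultimately show I: "Inact t \<in> sets (univ_completion (Om_t (Suc t)))" by simp
  fix k assume k: "valid k"
  show "AE w in kprod k (Suc t). w \<notin> Inact t"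
  proof (rule kprod_AE_SucI[OF _ I])
    show "kern s (k s)" if "s \<le> t" for s using valid_kern[OF k] t that by simp
    fix w :: "nat \<Rightarrow> 'w" assume w: "w \<in> space (Om_t t)"
    have kw: "k t w \<in> Pt t w" using k t w by (simp add: valid_def)
    have "AE x in k t w. p \<notin> Act t w \<longrightarrow> p \<notin> G (Suc t) (w(t := x))" for p
    proof (cases "p \<in> Act t w")
      case False
      then have "AE x in k t w. p \<notin> G (Suc t) (w(t := x))" using ActI[OF kw] by blast
      then show ?thesis by (rule eventually_mono) simp
    qed simp
    then have "AE x in k t w. \<forall>p\<in>dset. p \<notin> Act t w \<longrightarrow> p \<notin> G (Suc t) (w(t := x))"
      by (simp add: AE_ball_countable[OF dset(1)])
    then show "AE x in k t w. w(t := x) \<notin> Inact t"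
    proof (rule eventually_mono)
      fix x assume "\<forall>p\<in>dset. p \<notin> Act t w \<longrightarrow> p \<notin> G (Suc t) (w(t := x))"
      then show "w(t := x) \<notin> Inact t" unfolding Inact_def by (auto simp: res_upd[OF w] res_id[OF w])
    qed
  qed
qed

definition full :: "nat \<Rightarrow> (nat \<Rightarrow> 'w) \<Rightarrow> bool" where
  "full t w \<longleftrightarrow> (\<forall>z\<in>icone (K t w). \<exists>v r. (z, v, r) \<in> G t w)"

lemma full_T: "full T w"
  unfolding full_def
proof
  fix z assume z: "z \<in> icone (K T w)"
  have "(z, \<xi> w \<bullet> z - 1, max (\<phi> w * norm z) (1 - \<xi> w \<bullet> z) + 1) \<in> G T w" unfolding G_T using z by auto
  then show "\<exists>v r. (z, v, r) \<in> G T w" by blast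
qed

text \<open>Paths on which \<open>q\<close> would be an arbitrage of the second kind: insolvent now,
  yet worth a nonnegative amount at every active price of the next date.\<close>

definition Bad :: "nat \<Rightarrow> (real, 'd) vec \<Rightarrow> (nat \<Rightarrow> 'w) set" where
  "Bad t q = {w \<in> space (Om_t t). q \<notin> K t w \<and> (\<forall>p\<in>dset. p \<in> Act t w \<longrightarrow> 0 \<le> q \<bullet> fst p)}"

text \<open>A missing price \<open>z\<close> is separated from the cone of achievable prices by some
  \<open>x\<close>, and nonpositive value at the interior price \<open>z\<close> puts
  \<open>x\<close> outside \<open>K t w\<close>. The complement of the cone is open, so
  \<open>x\<close> can be rounded up to a dense \<open>q\<close>, which keeps nonnegative value
  because active prices are positive.\<close>

lemma full_or_Bad:
  assumes t: "t < T" and w: "w \<in> space (Om_t t)" and n: "\<not> full t w"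
  shows "\<exists>q\<in>dset. w \<in> Bad t q"
proof -
  note A = Act_props[OF t w]
  note Kf = K_facts[OF less_imp_le[OF t] w]
  let ?U = "fst ` (convex hull Act t w)"
  obtain z where z: "z \<in> icone (K t w)" "\<And>v r. (z, v, r) \<notin> G t w" using n unfolding full_def by blast
  have zU: "z \<notin> ?U"
  proof
    assume "z \<in> ?U"
    then obtain p where "p \<in> convex hull Act t w" "fst p = z" by blast
    then have "(z, fst (snd p), snd (snd p)) \<in> G t w" unfolding G_step[OF t] using z(1) by (cases p) auto
    then show False using z(2) by blast
  qed
  have cU: "convex ?U" by (intro convex_linear_image convex_convex_hull) (simp add: linear_fst)
  have sU: "c *\<^sub>R u \<in> ?U" if "u \<in> ?U" "0 < c" for u c
  proof -
    obtain p where p: "p \<in> convex hull Act t w" "u = fst p" using \<open>u \<in> ?U\<close> by blast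
    have "c *\<^sub>R p \<in> convex hull Act t w" by (rule convex_hull_scale[OF A(2) p(1) that(2)])
    then show ?thesis unfolding p(2) by (intro image_eqI[of _ _ "c *\<^sub>R p"]) simp
  qed
  have z0: "z \<noteq> 0" using icone_0[OF Kf(3)] z(1) by blast
  obtain x where x: "x \<noteq> 0" "\<forall>u\<in>?U. 0 \<le> x \<bullet> u" "x \<bullet> z \<le> 0"
    using cone_separating_direction[OF cU sU zU z0] by blast
  have "x \<notin> K t w" using icone_pos[OF z(1) _ x(1)] x(3) by force
  then obtain e where e: "0 < e" "ball x e \<inter> K t w = {}"
    using Kf(1) by (metis ComplI closed_def disjoint_eq_subset_Compl open_contains_ball)
  obtain q where q: "q \<in> dset" "\<And>i. x $ i < q $ i" "dist q x < e" using above_dset[OF e(1)] by blast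
  have "q \<in> ball x e" using q(3) by (simp add: dist_commute)
  then have "q \<notin> K t w" using e(2) by blast
  moreover have "0 \<le> q \<bullet> fst p" if p: "p \<in> Act t w" for p
  proof -
    have "0 \<le> x \<bullet> fst p" using x(2) hull_inc[OF p, of convex] by blast
    also have "\<dots> \<le> q \<bullet> fst p" unfolding inner_vec_def
      using q(2) A(3)[OF p] by (intro sum_mono) (simp add: less_imp_le mult_right_mono)
    finally show ?thesis .
  qed
  ultimately show ?thesis using q(1) w unfolding Bad_def by blast
qed

lemma Bad_univ: assumes t: "t < T" shows "Bad t q \<in> sets (univ_completion (Om_t t))"
proof -
  have "{w \<in> space (Om_t t). q \<in> K t w} \<in> sets (Om_t t)"
    by (rule closed_mem_measurable[OF K_hit]) (use t K_facts in auto)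
  then have 1: "{w \<in> space (univ_completion (Om_t t)). q \<in> K t w} \<in> sets (univ_completion (Om_t t))"
    using sets_univ_completionI by simp
  have 2: "{w \<in> space (univ_completion (Om_t t)). p \<in> Act t w \<longrightarrow> 0 \<le> q \<bullet> fst p} \<in> sets (univ_completion (Om_t t))" for p
    by (intro sets.sets_Collect_imp sets.sets_Collect_const) (use Act_univ[OF t, of p] in simp)
  have "{w \<in> space (univ_completion (Om_t t)). \<not> q \<in> K t w \<and> (\<forall>p\<in>dset. p \<in> Act t w \<longrightarrow> 0 \<le> q \<bullet> fst p)} \<in> sets (univ_completion (Om_t t))"
    by (intro sets.sets_Collect_conj sets.sets_Collect_neg 1 sets_Collect_ball_countable dset(1) 2)
  then show ?thesis by (simp add: Bad_def)
qed

text \<open>Backward induction through the no-arbitrage condition. Outside polar sets every dense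
  state of \<open>G (Suc t)\<close> is active and the prices in \<open>G (Suc t)\<close> fill the
  dual cone, so \<open>icone_separates\<close> makes \<open>q\<close> solvent at
  \<open>Suc t\<close> on \<open>Bad t q\<close>. Solvency already at \<open>t\<close> then
  contradicts the definition of \<open>Bad\<close> outside a polar set.\<close>

lemma full_qs: "t \<le> T \<Longrightarrow> \<exists>N. polar t N \<and> (\<forall>w\<in>space (Om_t t) - N. full t w)"
proof (induction t rule: inc_induct)
  case base
  show ?case using polar_empty full_T by blast
next
  case (step t)
  then have t: "t < T" "t \<le> T" "Suc t \<le> T" by auto
  obtain N where N: "polar (Suc t) N" "\<forall>w\<in>space (Om_t (Suc t)) - N. full (Suc t) w" using step.IH by blast
  have "polar t (Bad t q)" for q
  proof -
    \<comment> \<open>The candidate arbitrage must be defined on all paths; it is 0 off the bad set,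
      where solvency is trivial.\<close>
    define \<zeta> where "\<zeta> w = (if res t w \<in> Bad t q then q else 0)" for w :: "nat \<Rightarrow> 'w"
    have "(\<lambda>w. if w \<in> Bad t q then q else 0) \<in> borel_measurable (univ_completion (Om_t t))"
    proof (rule measurable_If)
      have "{w \<in> space (univ_completion (Om_t t)). w \<in> Bad t q} = Bad t q" by (auto simp: Bad_def)
      then show "{w \<in> space (univ_completion (Om_t t)). w \<in> Bad t q} \<in> sets (univ_completion (Om_t t))" using Bad_univ[OF t(1)] by simp
    qed auto
    then have m: "\<zeta> \<in> borel_measurable (Ffilt T t)" unfolding \<zeta>_def by (rule measurable_Ffilt_res)
    have "qs T PP (\<lambda>w. \<zeta> w \<in> K (Suc t) w)"
    proof (rule qs_polarI[OF t(3) polar_Un[OF N(1) Inact_polar[OF t(1)]]])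
      fix w :: "nat \<Rightarrow> 'w" assume w: "w \<in> space (Om_t T)" and nN: "res (Suc t) w \<notin> N \<union> Inact t"
      let ?v = "res (Suc t) w"
      have v: "?v \<in> space (Om_t (Suc t))" by simp
      have Kv: "K (Suc t) w = K (Suc t) ?v" using K_res[OF t(3) w] by simp
      have rv: "res t ?v = res t w" by (rule res_res) simp
      show "\<zeta> w \<in> K (Suc t) w"
      proof (cases "res t w \<in> Bad t q")
        case False
        then show ?thesis using K_0[OF t(3) v] by (simp add: \<zeta>_def Kv)
      next
        case True
        have "q \<in> K (Suc t) ?v"
        proof (rule icone_separates)
          show "closed (K (Suc t) ?v)" "convex_cone (K (Suc t) ?v)" "icone (K (Suc t) ?v) \<noteq> {}"
            using K_facts[OF t(3) v] by auto
          fix z assume z: "z \<in> icone (K (Suc t) ?v)"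
          have "full (Suc t) ?v" using N(2) v nN by blast
          then obtain c r where p: "(z, c, r) \<in> G (Suc t) ?v" using z unfolding full_def by blast
          have "0 * fst (snd p) \<le> q \<bullet> fst p" if "p \<in> dset" "p \<in> G (Suc t) ?v" for p
          proof -
            have "p \<in> Act t (res t ?v)" using nN that v unfolding Inact_def by blast
            then show ?thesis using True that(1) unfolding Bad_def rv by auto
          qed
          from dense_le[OF _ this p] nice_G[OF t(3) v] show "0 \<le> q \<bullet> z" by (simp add: nice_def)
        qed
        then show ?thesis using True by (simp add: \<zeta>_def Kv)
      qed
    qed
    then have "qs T PP (\<lambda>w. \<zeta> w \<in> K t w)" using NA m t(1) unfolding NA2_def by blast
    then obtain N' where N': "polar T N'" "\<And>w. w \<in> space (Om_t T) \<Longrightarrow> w \<notin> N' \<Longrightarrow> \<zeta> w \<in> K t w"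
      by (rule qs_polarD) blast
    show ?thesis
    proof (rule polar_project[OF t(2) N'(1) Bad_univ[OF t(1)]])
      fix w :: "nat \<Rightarrow> 'w" assume w: "w \<in> space (Om_t T)" and b: "res t w \<in> Bad t q"
      show "w \<in> N'"
      proof (rule ccontr)
        assume "w \<notin> N'"
        from N'(2)[OF w this] b have "q \<in> K t (res t w)" using K_res[OF t(2) w] by (simp add: \<zeta>_def)
        then show False using b by (simp add: Bad_def)
      qed
    qed
  qed
  then have "polar t (\<Union>q\<in>dset. Bad t q)" by (intro polar_UN dset(1))
  then show ?case using full_or_Bad[OF t(1)] by (intro exI[of _ "\<Union>q\<in>dset. Bad t q"]) blast
qed

section \<open>Measurable rebalancing of hedges\<close>

definition Dset :: "nat \<Rightarrow> (nat \<Rightarrow> 'w) \<Rightarrow> ((real, 'd) vec) set" where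
  "Dset t w = {x. \<forall>p\<in>G t w. fst (snd p) \<le> x \<bullet> fst p}"

text \<open>Domination is demanded at dense states only, so that dependence on \<open>w\<close>
  involves countably many conditions; \<open>Dset_Suc\<close> recovers the remaining states by
  openness.\<close>

definition Hedge :: "nat \<Rightarrow> ((nat \<Rightarrow> 'w) \<Rightarrow> (real, 'd) vec) \<Rightarrow> (nat \<Rightarrow> 'w) \<Rightarrow> ((real, 'd) vec) set" where
  "Hedge t X w = {y. X w - y \<in> K t w \<and> (\<forall>p\<in>dset. p \<in> Act t w \<longrightarrow> fst (snd p) \<le> y \<bullet> fst p)}"

text \<open>Hitting \<open>C\<close> is approximated by dense positions near \<open>C\<close> that
  are solvent up to a small payment; compactness supplies a limit in \<open>C\<close>. Domination is
  kept without slack, because the approximating position is chosen above the true one.\<close>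

lemma Hedge_hit:
  assumes t: "t < T" and X: "X \<in> borel_measurable (univ_completion (Om_t t))" and C: "compact C"
  shows "{w \<in> space (univ_completion (Om_t t)). Hedge t X w \<inter> C \<noteq> {}} \<in> sets (univ_completion (Om_t t))"
proof (cases "C = {}")
  case False
  let ?M = "univ_completion (Om_t t)"
  \<comment> \<open>The all-ones vector pays for replacing \<open>y\<close> by the nearby
    \<open>q\<close>: the difference is at most \<open>1 / Suc n\<close> in each coordinate, and
    \<open>K\<close> contains the orthant.\<close>
  define u :: "(real, 'd) vec" where "u = (\<chi> i. 1)"
  have tT: "t \<le> T" using t by simp
  let ?Q = "\<lambda>w n q. infdist q C \<le> 1 / real (Suc n) \<and> (\<forall>p\<in>dset. p \<in> Act t w \<longrightarrow> fst (snd p) \<le> q \<bullet> fst p) \<and>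
      X w - q + (1 / real (Suc n)) *\<^sub>R u \<in> K t w"
  have eq: "Hedge t X w \<inter> C \<noteq> {} \<longleftrightarrow> (\<forall>n. \<exists>q\<in>dset. ?Q w n q)" if w: "w \<in> space (Om_t t)" for w
  proof
    assume "Hedge t X w \<inter> C \<noteq> {}"
    then obtain y where y: "y \<in> C" "X w - y \<in> K t w" "\<And>p. p \<in> dset \<Longrightarrow> p \<in> Act t w \<Longrightarrow> fst (snd p) \<le> y \<bullet> fst p"
      unfolding Hedge_def by blast
    show "\<forall>n. \<exists>q\<in>dset. ?Q w n q"
    proof
      fix n
      obtain q where q: "q \<in> dset" "\<And>i. y $ i < q $ i" "dist q y < 1 / real (Suc n)"
        using above_dset[of "1 / real (Suc n)" y] by auto
      have "infdist q C \<le> 1 / real (Suc n)" using infdist_le[OF y(1), of q] q(3) by simp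
      moreover have "fst (snd p) \<le> q \<bullet> fst p" if p: "p \<in> dset" "p \<in> Act t w" for p
      proof -
        have "y \<bullet> fst p \<le> q \<bullet> fst p" unfolding inner_vec_def
          using q(2) Act_props(3)[OF t w p(2)] by (intro sum_mono) (simp add: less_imp_le mult_right_mono)
        with y(3)[OF p] show ?thesis by simp
      qed
      moreover have "X w - q + (1 / real (Suc n)) *\<^sub>R u \<in> K t w"
      proof -
        have "0 \<le> ((1 / real (Suc n)) *\<^sub>R u - (q - y)) $ i" for i
          using component_le_norm_cart[of "q - y" i] q(3) by (simp add: u_def dist_norm)
        then have "(1 / real (Suc n)) *\<^sub>R u - (q - y) \<in> K t w"
          using K_facts(3)[OF tT w] by (auto simp: orthant_def)
        from K_add[OF tT w y(2) this] show ?thesis by (simp add: algebra_simps)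
      qed
      ultimately show "\<exists>q\<in>dset. ?Q w n q" using q(1) by blast
    qed
  next
    assume "\<forall>n. \<exists>q\<in>dset. ?Q w n q"
    then have "\<forall>n. \<exists>q. ?Q w n q" by blast
    then obtain q where q: "\<And>n. ?Q w n (q n)" by metis
    have "\<exists>c\<in>C. infdist (q n) C = dist (q n) c" for n
      using infdist_attains_inf[OF compact_imp_closed[OF C] False] by metis
    then obtain c where c: "\<And>n. c n \<in> C" "\<And>n. infdist (q n) C = dist (q n) (c n)" by metis
    obtain y r where y: "y \<in> C" "strict_mono r" "(c \<circ> r) \<longlonglongrightarrow> y"
      using C c(1) unfolding compact_def by blast
    have z: "(\<lambda>n. 1 / real (Suc (r n))) \<longlonglongrightarrow> 0"
      using LIMSEQ_subseq_LIMSEQ[OF LIMSEQ_inverse_real_of_nat y(2)] by (simp add: o_def inverse_eq_divide)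
    have "(\<lambda>n. q (r n) - c (r n)) \<longlonglongrightarrow> 0"
    proof (rule Lim_null_comparison[OF _ z])
      show "\<forall>\<^sub>F n in sequentially. norm (q (r n) - c (r n)) \<le> 1 / real (Suc (r n))"
        using q c(2) by (auto simp: dist_norm)
    qed
    from tendsto_add[OF this y(3)] have qy: "(\<lambda>n. q (r n)) \<longlonglongrightarrow> y" by (simp add: o_def)
    have "fst (snd p) \<le> y \<bullet> fst p" if "p \<in> dset" "p \<in> Act t w" for p
      by (rule tendsto_lowerbound[OF tendsto_inner[OF qy tendsto_const]]) (use q that in auto)
    moreover have "X w - y \<in> K t w"
    proof -
      have lim: "(\<lambda>n. X w - q (r n) + (1 / real (Suc (r n))) *\<^sub>R u) \<longlonglongrightarrow> X w - y + 0 *\<^sub>R u"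
        by (intro tendsto_intros qy z)
      have m: "X w - q (r n) + (1 / real (Suc (r n))) *\<^sub>R u \<in> K t w" for n using q by blast
      have "X w - y + 0 *\<^sub>R u \<in> K t w"
        by (rule closed_sequentially[OF K_facts(1)[OF tT w] m lim])
      then show ?thesis by simp
    qed
    ultimately have "y \<in> Hedge t X w" unfolding Hedge_def by blast
    then show "Hedge t X w \<inter> C \<noteq> {}" using y(1) by blast
  qed
  have "{w \<in> space ?M. \<forall>n. \<exists>q\<in>dset. ?Q w n q} \<in> sets ?M"
  proof (intro sets.sets_Collect_countable_All sets.sets_Collect_countable_Ex' dset(1) sets.sets_Collect_conj
      sets.sets_Collect_const sets_Collect_ball_countable sets.sets_Collect_imp)
    show "{w \<in> space ?M. p \<in> Act t w} \<in> sets ?M" for p using Act_univ[OF t] by simp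
    fix n and q :: "(real, 'd) vec"
    show "{w \<in> space ?M. X w - q + (1 / real (Suc n)) *\<^sub>R u \<in> K t w} \<in> sets ?M"
    proof (rule closed_mem_measurable)
      show "{w \<in> space ?M. K t w \<inter> U \<noteq> {}} \<in> sets ?M" if "open U" for U
        using sets_univ_completionI[OF K_hit[OF tT that]] by simp
      show "closed (K t w)" if "w \<in> space ?M" for w using K_facts(1)[OF tT] that by simp
      show "(\<lambda>w. X w - q + (1 / real (Suc n)) *\<^sub>R u) \<in> borel_measurable ?M"
        by (intro borel_measurable_add borel_measurable_diff X borel_measurable_const)
    qed
  qed
  moreover have "{w \<in> space ?M. Hedge t X w \<inter> C \<noteq> {}} = {w \<in> space ?M. \<forall>n. \<exists>q\<in>dset. ?Q w n q}"
    using eq by auto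
  ultimately show ?thesis by simp
qed simp

lemma Hedge_closed:
  assumes t: "t < T" and w: "w \<in> space (Om_t t)"
  shows "closed (Hedge t X w)"
proof -
  have "closed ((\<lambda>y. X w - y) -` K t w)"
    by (rule closed_vimage[OF K_facts(1)[OF less_imp_le[OF t] w]]) (intro continuous_intros)
  moreover have "closed (\<Inter>p\<in>dset \<inter> Act t w. {y. fst (snd p) \<le> y \<bullet> fst p})"
    by (intro closed_INT ballI closed_Collect_le continuous_intros)
  moreover have "Hedge t X w = ((\<lambda>y. X w - y) -` K t w) \<inter> (\<Inter>p\<in>dset \<inter> Act t w. {y. fst (snd p) \<le> y \<bullet> fst p})"
    unfolding Hedge_def by auto
  ultimately show ?thesis by (simp add: closed_Int)
qed

lemma Hedge_nonempty:
  assumes t: "t < T" and w: "w \<in> space (Om_t t)" and f: "full t w" and X: "X w \<in> Dset t w"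
  shows "Hedge t X w \<noteq> {}"
proof -
  note Kf = K_facts[OF less_imp_le[OF t] w]
  note A = Act_props[OF t w]
  obtain Y where Y: "X w - Y \<in> K t w" "\<forall>(z, v, r)\<in>convex hull Act t w. v \<le> Y \<bullet> z"
  proof (rule exE[OF hedge_step_exists[OF Kf(1,2,4) convex_convex_hull convex_hull_scale[OF A(2)]]])
    show "\<exists>v r. (z, v, r) \<in> convex hull Act t w" if "z \<in> icone (K t w)" for z
      using f that unfolding full_def G_step[OF t] by blast
    show "v \<le> X w \<bullet> z" if "(z, v, r) \<in> convex hull Act t w" "z \<in> icone (K t w)" for z v r
    proof -
      have "(z, v, r) \<in> G t w" unfolding G_step[OF t] using that by simp
      then show ?thesis using X unfolding Dset_def by fastforce
    qed
  qed auto
  have "fst (snd p) \<le> Y \<bullet> fst p" if "p \<in> Act t w" for p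
    using Y(2) hull_inc[OF that, of convex] by (cases p) auto
  then have "Y \<in> Hedge t X w" unfolding Hedge_def using Y(1) by blast
  then show ?thesis by blast
qed

lemma Hedge_selection:
  assumes t: "t < T" and X: "X \<in> borel_measurable (univ_completion (Om_t t))"
  shows "\<exists>Y. Y \<in> borel_measurable (univ_completion (Om_t t)) \<and>
    (\<forall>w\<in>space (Om_t t). Hedge t X w \<noteq> {} \<longrightarrow> Y w \<in> Hedge t X w)"
  using closed_set_selection[OF Hedge_hit[OF t X]] Hedge_closed[OF t] by auto

lemma Dset_Suc:
  assumes t: "t < T" and v: "v \<in> space (Om_t (Suc t))" "v \<notin> Inact t" and y: "y \<in> Hedge t X (res t v)"
  shows "y \<in> Dset (Suc t) v"
proof -
  have "1 * fst (snd p) \<le> y \<bullet> fst p" if "p \<in> G (Suc t) v" for p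
  proof (rule dense_le[OF _ _ that])
    show "open (G (Suc t) v)" using nice_G[of "Suc t" v] t v by (simp add: nice_def)
    fix p assume p: "p \<in> dset" "p \<in> G (Suc t) v"
    then have "p \<in> Act t (res t v)" using v unfolding Inact_def by blast
    then show "1 * fst (snd p) \<le> y \<bullet> fst p" using y p(1) unfolding Hedge_def by simp
  qed
  then show ?thesis unfolding Dset_def by simp
qed

text \<open>Selections from \<open>Hedge\<close> are iterated, and off polar sets the current
  position dominates the cone of its date. At the horizon this domination becomes solvency of the
  position minus the claim.\<close>

theorem superhedge_exists:
  assumes x0: "\<And>w. w \<in> space (Om_t 0) \<Longrightarrow> x0 \<in> Dset 0 w"
  shows "\<exists>\<eta>\<in>adm T PP K. qs T PP (\<lambda>w. x0 + (\<Sum>t\<in>{0..T}. \<eta> t w) - \<xi> w \<in> K T w)"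
proof -
  define sel where "sel t X = (SOME Y. Y \<in> borel_measurable (univ_completion (Om_t t)) \<and>
    (\<forall>w\<in>space (Om_t t). Hedge t X w \<noteq> {} \<longrightarrow> Y w \<in> Hedge t X w))" for t X
  have sel: "sel t X \<in> borel_measurable (univ_completion (Om_t t))"
    "\<forall>w\<in>space (Om_t t). Hedge t X w \<noteq> {} \<longrightarrow> sel t X w \<in> Hedge t X w"
    if "t < T" "X \<in> borel_measurable (univ_completion (Om_t t))" for t X
    using someI_ex[OF Hedge_selection[OF that]] unfolding sel_def by blast+
  define X where "X = rec_nat (\<lambda>_. x0) (\<lambda>t X v. sel t X (res t v))"
  have X0: "X 0 = (\<lambda>_. x0)" and XS: "X (Suc t) = (\<lambda>v. sel t (X t) (res t v))" for t by (auto simp: X_def)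
  have Xm: "X t \<in> borel_measurable (univ_completion (Om_t t))" if "t \<le> T" for t
    using that
  proof (induction t)
    case (Suc t)
    then show ?case unfolding XS by (intro measurable_univ_res sel(1)) auto
  qed (simp add: X0)
  obtain FN where FN: "\<And>t. t \<le> T \<Longrightarrow> polar t (FN t)" "\<And>t w. t \<le> T \<Longrightarrow> w \<in> space (Om_t t) \<Longrightarrow> w \<notin> FN t \<Longrightarrow> full t w"
    using full_qs by (metis DiffI)
  have XD: "\<exists>N. polar t N \<and> (\<forall>w\<in>space (Om_t t) - N. X t w \<in> Dset t w)" if "t \<le> T" for t
    using that
  proof (induction t)
    case 0
    then show ?case using x0 polar_empty by (auto simp: X0)
  next
    case (Suc t)
    then obtain N where N: "polar t N" "\<forall>w\<in>space (Om_t t) - N. X t w \<in> Dset t w" by auto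
    have t: "t < T" using Suc.prems by simp
    let ?N = "{w \<in> space (Om_t (Suc t)). res t w \<in> N \<union> FN t} \<union> Inact t"
    have "polar (Suc t) ?N"
      by (intro polar_Un polar_lift Inact_polar t N FN) (use t in auto)
    moreover have "X (Suc t) v \<in> Dset (Suc t) v" if v: "v \<in> space (Om_t (Suc t)) - ?N" for v
    proof -
      have "full t (res t v)" using FN(2)[of t "res t v"] t v by auto
      moreover have "X t (res t v) \<in> Dset t (res t v)" using N(2) v by auto
      ultimately have "Hedge t (X t) (res t v) \<noteq> {}" by (intro Hedge_nonempty[OF t]) auto
      then have "sel t (X t) (res t v) \<in> Hedge t (X t) (res t v)" using sel(2)[OF t Xm] t by auto
      then show ?thesis unfolding XS using Dset_Suc[OF t] v by blast
    qed
    ultimately show ?case by blast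
  qed
  \<comment> \<open>The position carried into \<open>Suc t\<close> is selected from the path up to
    \<open>t\<close>, so the change of position is a trade at time \<open>t\<close>; at
    \<open>T\<close> nothing is left to trade.\<close>
  define \<eta> where "\<eta> t w = (if t < T then sel t (X t) (res t w) - X t (res t w) else 0)" for t and w :: "nat \<Rightarrow> 'w"
  have "\<eta> t \<in> borel_measurable (Ffilt T t)" if "t \<le> T" for t
  proof (cases "t < T")
    case True
    have "(\<lambda>w. sel t (X t) w - X t w) \<in> borel_measurable (univ_completion (Om_t t))"
      by (intro borel_measurable_diff sel Xm True that)
    from measurable_Ffilt_res[OF this] True show ?thesis by (simp add: \<eta>_def[abs_def])
  qed (simp add: \<eta>_def[abs_def])
  moreover have "qs T PP (\<lambda>w. - \<eta> t w \<in> K t w)" if tT: "t \<le> T" for t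
  proof (cases "t < T")
    case True
    obtain N where N: "polar t N" "\<forall>w\<in>space (Om_t t) - N. X t w \<in> Dset t w" using XD[OF tT] by blast
    show ?thesis
    proof (rule qs_polarI[OF tT polar_Un[OF N(1) FN(1)[OF tT]]])
      fix w :: "nat \<Rightarrow> 'w" assume w: "w \<in> space (Om_t T)" and n: "res t w \<notin> N \<union> FN t"
      have "Hedge t (X t) (res t w) \<noteq> {}"
        using n N(2) FN(2)[OF tT, of "res t w"] by (intro Hedge_nonempty[OF True]) auto
      then have "sel t (X t) (res t w) \<in> Hedge t (X t) (res t w)" using sel(2)[OF True Xm[OF tT]] by auto
      then show "- \<eta> t w \<in> K t w" using True K_res[OF tT w] by (simp add: \<eta>_def Hedge_def)
    qed
  next
    case False
    then show ?thesis using K_0[OF tT] K_res[OF tT]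
      by (intro qs_polarI[OF tT polar_empty]) (metis \<eta>_def minus_zero res_Om)
  qed
  ultimately have "\<eta> \<in> adm T PP K" unfolding adm_def by blast
  moreover have "qs T PP (\<lambda>w. x0 + (\<Sum>t\<in>{0..T}. \<eta> t w) - \<xi> w \<in> K T w)"
  proof -
    obtain N where N: "polar T N" "\<forall>w\<in>space (Om_t T) - N. X T w \<in> Dset T w" using XD[OF order_refl] by blast
    show ?thesis
    proof (rule qs_polarI[OF order_refl N(1)])
      fix w :: "nat \<Rightarrow> 'w" assume w: "w \<in> space (Om_t T)" and "res T w \<notin> N"
      then have XT: "X T w \<in> Dset T w" using N(2) by (simp add: res_id)
      have tel: "x0 + (\<Sum>t<n. \<eta> t w) = X n (res n w)" if "n \<le> T" for n
        using that
      proof (induction n)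
        case (Suc n)
        then have "x0 + (\<Sum>t<n. \<eta> t w) = X n (res n w)" by (intro Suc.IH) simp
        then have "x0 + (\<Sum>t<Suc n. \<eta> t w) = X n (res n w) + \<eta> n w"
          unfolding sum.lessThan_Suc add.assoc[symmetric] by (rule arg_cong)
        also have "\<dots> = sel n (X n) (res n w)" using Suc.prems by (simp add: \<eta>_def)
        also have "\<dots> = X (Suc n) (res (Suc n) w)" unfolding XS by (subst res_res) auto
        finally show ?case .
      qed (simp add: X0)
      have "{0..T} = insert T {..<T}" by auto
      then have "x0 + (\<Sum>t\<in>{0..T}. \<eta> t w) = X T w"
        using tel[OF order_refl] w by (simp add: \<eta>_def[of T] res_id)
      moreover have "X T w - \<xi> w \<in> K T w"
      proof (rule icone_separates)
        show "closed (K T w)" "convex_cone (K T w)" "icone (K T w) \<noteq> {}" using K_facts[OF order_refl w] by auto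
        fix z assume z: "z \<in> icone (K T w)"
        show "0 \<le> (X T w - \<xi> w) \<bullet> z"
        proof (rule field_le_epsilon)
          fix e :: real assume e: "0 < e"
          \<comment> \<open>A terminal state whose value falls short of the claim by
            \<open>e\<close>, with the third coordinate large enough for both of its
            constraints.\<close>
          have "(z, \<xi> w \<bullet> z - e, max (\<phi> w * norm z) (e - \<xi> w \<bullet> z) + 1) \<in> G T w" unfolding G_T using z e by auto
          then have "\<xi> w \<bullet> z - e \<le> X T w \<bullet> z" using XT unfolding Dset_def by fastforce
          then show "0 \<le> (X T w - \<xi> w) \<bullet> z + e" by (simp add: inner_diff_left)
        qed
      qed
      ultimately show "x0 + (\<Sum>t\<in>{0..T}. \<eta> t w) - \<xi> w \<in> K T w" by simp
    qed
  qed
  ultimately show ?thesis by blast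
qed

end

section \<open>Construction of price systems\<close>

context market
begin

definition ksel :: "nat \<Rightarrow> ((nat \<Rightarrow> 'w) \<Rightarrow> 'w measure) \<Rightarrow> bool" where
  "ksel t \<kappa> \<longleftrightarrow> univ_kernel t \<kappa> \<and> (\<forall>w\<in>space (Om_t t). \<kappa> w \<in> Pt t w)"

lemma ksel_kern: "ksel t \<kappa> \<Longrightarrow> t < T \<Longrightarrow> kern t \<kappa>"
  using Pt_probs unfolding ksel_def kern_def by blast

text \<open>Equal weights in the convexity of the priors. The mixture is picked path by path without
  a selection theorem, since its mass on each event is an average of measurable functions.\<close>

lemma ksel_mix:
  assumes t: "t < T" and 1: "ksel t \<kappa>1" and 2: "ksel t \<kappa>2"
  shows "\<exists>\<kappa>. ksel t \<kappa> \<and> (\<forall>w\<in>space (Om_t t). null_sets (\<kappa> w) \<subseteq> null_sets (\<kappa>1 w) \<and> null_sets (\<kappa> w) \<subseteq> null_sets (\<kappa>2 w))"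
proof -
  have "\<exists>R. R \<in> Pt t w \<and> (\<forall>A\<in>sets (\<kappa>1 w). measure R A = 1/2 * measure (\<kappa>1 w) A + (1 - 1/2) * measure (\<kappa>2 w) A)"
    if w: "w \<in> space (Om_t t)" for w
  proof -
    have c: "convex_meas (Pt t w)" using Pt_convex t w by blast
    have k: "\<kappa>1 w \<in> Pt t w" "\<kappa>2 w \<in> Pt t w" using 1 2 w by (auto simp: ksel_def)
    show ?thesis
      using c[unfolded convex_meas_def, rule_format, OF k, of "1/2"] by auto
  qed
  then have "\<exists>\<kappa>. \<forall>w\<in>space (Om_t t). \<kappa> w \<in> Pt t w \<and> (\<forall>A\<in>sets (\<kappa>1 w). measure (\<kappa> w) A = 1/2 * measure (\<kappa>1 w) A + (1 - 1/2) * measure (\<kappa>2 w) A)"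
    by (intro bchoice) blast
  then obtain \<kappa> where \<kappa>: "\<And>w. w \<in> space (Om_t t) \<Longrightarrow> \<kappa> w \<in> Pt t w"
    "\<And>w A. w \<in> space (Om_t t) \<Longrightarrow> A \<in> sets (\<kappa>1 w) \<Longrightarrow> measure (\<kappa> w) A = 1/2 * measure (\<kappa>1 w) A + (1 - 1/2) * measure (\<kappa>2 w) A"
    by blast
  have pr: "\<kappa> w \<in> probs borel" "\<kappa>1 w \<in> probs borel" "\<kappa>2 w \<in> probs borel" if "w \<in> space (Om_t t)" for w
    using Pt_probs t that \<kappa>(1)[OF that] 1 2 unfolding ksel_def by blast+
  have em: "emeasure (\<kappa> w) A = ennreal (1/2) * emeasure (\<kappa>1 w) A + ennreal (1/2) * emeasure (\<kappa>2 w) A"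
    if w: "w \<in> space (Om_t t)" and A: "A \<in> sets borel" for w A
  proof -
    interpret a: prob_space "\<kappa> w" by (rule probs_prob[OF pr(1)[OF w]])
    interpret b: prob_space "\<kappa>1 w" by (rule probs_prob[OF pr(2)[OF w]])
    interpret c: prob_space "\<kappa>2 w" by (rule probs_prob[OF pr(3)[OF w]])
    have "A \<in> sets (\<kappa>1 w)" using A probs_sets[OF pr(2)[OF w]] by simp
    from \<kappa>(2)[OF w this] have "measure (\<kappa> w) A = 1/2 * measure (\<kappa>1 w) A + 1/2 * measure (\<kappa>2 w) A" by simp
    moreover have "ennreal (1/2 * measure (\<kappa>1 w) A + 1/2 * measure (\<kappa>2 w) A) =
        ennreal (1/2 * measure (\<kappa>1 w) A) + ennreal (1/2 * measure (\<kappa>2 w) A)" by (rule ennreal_plus) auto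
    moreover have "ennreal (1/2 * measure (\<kappa>1 w) A) = ennreal (1/2) * ennreal (measure (\<kappa>1 w) A)" by (rule ennreal_mult) auto
    moreover have "ennreal (1/2 * measure (\<kappa>2 w) A) = ennreal (1/2) * ennreal (measure (\<kappa>2 w) A)" by (rule ennreal_mult) auto
    ultimately show ?thesis
      by (simp only: a.emeasure_eq_measure b.emeasure_eq_measure c.emeasure_eq_measure)
  qed
  have "univ_kernel t \<kappa>" unfolding univ_kernel_def
  proof
    fix A :: "'w set" assume A: "A \<in> sets borel"
    have "(\<lambda>w. ennreal (1/2) * emeasure (\<kappa>1 w) A + ennreal (1/2) * emeasure (\<kappa>2 w) A) \<in> borel_measurable (univ_completion (Om_t t))"
      using 1 2 A unfolding ksel_def univ_kernel_def
      by (intro borel_measurable_add borel_measurable_times borel_measurable_const) auto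
    then show "(\<lambda>w. emeasure (\<kappa> w) A) \<in> borel_measurable (univ_completion (Om_t t))"
      by (rule measurable_cong[THEN iffD1, rotated]) (use em A in auto)
  qed
  moreover have "null_sets (\<kappa> w) \<subseteq> null_sets (\<kappa>1 w) \<and> null_sets (\<kappa> w) \<subseteq> null_sets (\<kappa>2 w)" if w: "w \<in> space (Om_t t)" for w
    using em[OF w] pr[OF w] by (auto simp: null_sets_def probs_def)
  ultimately show ?thesis using \<kappa>(1) unfolding ksel_def by blast
qed

text \<open>The vertices of one Caratheodory combination come with different kernels; this gives a
  single kernel that charges whatever any of them charges.\<close>

lemma ksel_dominating:
  assumes t: "t < T" and F: "finite F" "F \<noteq> {}" "\<And>i. i \<in> F \<Longrightarrow> ksel t (\<kappa> i)"
  shows "\<exists>\<kappa>'. ksel t \<kappa>' \<and> (\<forall>i\<in>F. \<forall>w\<in>space (Om_t t). null_sets (\<kappa>' w) \<subseteq> null_sets (\<kappa> i w))"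
  using F
proof (induction F rule: finite_ne_induct)
  case (singleton i)
  then show ?case by auto
next
  case (insert i F)
  then have "\<exists>\<kappa>'. ksel t \<kappa>' \<and> (\<forall>j\<in>F. \<forall>w\<in>space (Om_t t). null_sets (\<kappa>' w) \<subseteq> null_sets (\<kappa> j w))" by simp
  then obtain \<kappa>' where \<kappa>': "ksel t \<kappa>'" "\<forall>j\<in>F. \<forall>w\<in>space (Om_t t). null_sets (\<kappa>' w) \<subseteq> null_sets (\<kappa> j w)" by (elim exE conjE)
  obtain \<kappa>'' where \<kappa>'': "ksel t \<kappa>''"
    "\<forall>w\<in>space (Om_t t). null_sets (\<kappa>'' w) \<subseteq> null_sets (\<kappa> i w) \<and> null_sets (\<kappa>'' w) \<subseteq> null_sets (\<kappa>' w)"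
    using ksel_mix[OF t insert.prems(1)[OF insertI1] \<kappa>'(1)] by (elim exE conjE)
  have "null_sets (\<kappa>'' w) \<subseteq> null_sets (\<kappa> j w)" if "j \<in> insert i F" "w \<in> space (Om_t t)" for j w
    using \<kappa>''(2) \<kappa>'(2) that by blast
  then show ?case using \<kappa>''(1) by blast
qed

lemma univ_section_measurable:
  assumes f: "f \<in> measurable (univ_completion (Om_t (Suc t))) N" and w: "w \<in> space (Om_t t)" and P: "P \<in> probs (borel :: 'w measure)"
  shows "(\<lambda>x. f (w(t := x))) \<in> measurable (completion P) N"
  by (rule measurable_univ_completionD[OF measurable_compose[OF measurable_univ_completion_lift[OF measurable_upd1[OF w]] f] P])

end

section \<open>Splitting a state over the next step\<close>

lemma cone_sum:
  fixes G :: "'v::real_vector set"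
  assumes G: "convex G" "\<And>p c. p \<in> G \<Longrightarrow> 0 < c \<Longrightarrow> c *\<^sub>R p \<in> G"
    and F: "finite F" "\<And>i. i \<in> F \<Longrightarrow> 0 \<le> c i" "\<And>i. i \<in> F \<Longrightarrow> 0 < c i \<Longrightarrow> p i \<in> G"
  shows "(\<Sum>i\<in>F. c i *\<^sub>R p i) \<in> G \<union> {0}"
proof -
  have add: "p + q \<in> G" if "p \<in> G" "q \<in> G" for p q
  proof -
    have "(1/2) *\<^sub>R p + (1/2) *\<^sub>R q \<in> G" using G(1) that by (intro convexD) auto
    from G(2)[OF this, of 2] show ?thesis by (simp add: scaleR_add_right)
  qed
  show ?thesis using F
  proof (induction F rule: finite_induct)
    case (insert i F)
    then have IH: "(\<Sum>i\<in>F. c i *\<^sub>R p i) \<in> G \<union> {0}" by simp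
    show ?case
    proof (cases "c i = 0")
      case False
      then have "c i *\<^sub>R p i \<in> G" using insert.prems G(2) by (simp add: less_le)
      then show ?thesis using IH add insert.hyps by auto
    qed (use IH insert.hyps in simp)
  qed simp
qed

context claim
begin

lemma G_icone: "t \<le> T \<Longrightarrow> p \<in> G t w \<Longrightarrow> fst p \<in> icone (K t w)"
proof (cases "t < T")
  case True
  then show "p \<in> G t w \<Longrightarrow> ?thesis" using G_step by simp
next
  case False
  then show "t \<le> T \<Longrightarrow> p \<in> G t w \<Longrightarrow> ?thesis" using G_T by (cases p) simp
qed

text \<open>Weight vectors for Caratheodory combinations of states; the extra factor
  \<open>real\<close> provides one index more than the dimension.\<close>

definition simplex1 :: "((((real, 'd) vec) \<times> real \<times> real) \<times> real) set" where
  "simplex1 = {l. (\<forall>i\<in>Basis. 0 \<le> l \<bullet> i) \<and> (\<Sum>i\<in>Basis. l \<bullet> i) = 1}"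

lemma compact_simplex1: "compact simplex1"
proof -
  have "closed simplex1"
  proof -
    have "simplex1 = (\<Inter>i\<in>Basis. {l. 0 \<le> l \<bullet> i}) \<inter> {l. (\<Sum>i\<in>Basis. l \<bullet> i) = 1}" unfolding simplex1_def by auto
    moreover have "closed ((\<Inter>i\<in>Basis. {l :: (((real, 'd) vec) \<times> real \<times> real) \<times> real. 0 \<le> l \<bullet> i}) \<inter> {l. (\<Sum>i\<in>Basis. l \<bullet> i) = 1})"
      by (intro closed_Int closed_INT ballI closed_Collect_le closed_Collect_eq continuous_intros)
    ultimately show ?thesis by simp
  qed
  moreover have "bounded simplex1"
  proof (rule boundedI)
    fix l assume l: "l \<in> simplex1"
    have "norm l \<le> (\<Sum>i\<in>Basis. \<bar>l \<bullet> i\<bar>)" by (rule norm_le_l1)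
    also have "\<dots> = (\<Sum>i\<in>Basis. l \<bullet> i)" using l by (intro sum.cong) (auto simp: simplex1_def)
    finally show "norm l \<le> 1" using l by (simp add: simplex1_def)
  qed
  ultimately show ?thesis by (simp add: compact_eq_bounded_closed)
qed

definition comb :: "((((real, 'd) vec) \<times> real \<times> real) \<times> real \<Rightarrow> ((real, 'd) vec) \<times> real \<times> real) \<Rightarrow>
    (((real, 'd) vec) \<times> real \<times> real) \<times> real \<Rightarrow> ((real, 'd) vec) \<times> real \<times> real" where
  "comb \<tau> l = (\<Sum>i\<in>Basis. (l \<bullet> i) *\<^sub>R \<tau> i)"

lemma comb_continuous: "continuous_on A (comb \<tau>)"
  unfolding comb_def by (intro continuous_intros)

lemma weight_selection:
  assumes M: "M \<in> borel_measurable N"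
  shows "\<exists>l\<in>borel_measurable N. \<forall>w\<in>space N. M w \<in> comb \<tau> ` simplex1 \<longrightarrow> l w \<in> simplex1 \<and> comb \<tau> (l w) = M w"
proof -
  let ?\<Gamma> = "\<lambda>w. {l \<in> simplex1. comb \<tau> l = M w}"
  have "\<exists>Y\<in>borel_measurable N. \<forall>w\<in>space N. ?\<Gamma> w \<noteq> {} \<longrightarrow> Y w \<in> ?\<Gamma> w"
  proof (rule closed_set_selection)
    fix C :: "((((real, 'd) vec) \<times> real \<times> real) \<times> real) set" assume "compact C"
    then have "compact (comb \<tau> ` (simplex1 \<inter> C))"
      by (intro compact_continuous_image comb_continuous compact_Int compact_simplex1)
    then have "M -` (comb \<tau> ` (simplex1 \<inter> C)) \<inter> space N \<in> sets N"
      by (intro measurable_sets[OF M]) (simp add: borel_compact)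
    moreover have "?\<Gamma> w \<inter> C \<noteq> {} \<longleftrightarrow> M w \<in> comb \<tau> ` (simplex1 \<inter> C)" for w
    proof
      assume "?\<Gamma> w \<inter> C \<noteq> {}"
      then obtain l where "l \<in> simplex1" "comb \<tau> l = M w" "l \<in> C" by blast
      then show "M w \<in> comb \<tau> ` (simplex1 \<inter> C)" by (intro image_eqI[of _ _ l]) auto
    next
      assume "M w \<in> comb \<tau> ` (simplex1 \<inter> C)"
      then obtain l where "M w = comb \<tau> l" "l \<in> simplex1 \<inter> C" by (rule imageE)
      then show "?\<Gamma> w \<inter> C \<noteq> {}" by auto
    qed
    then have "{w \<in> space N. ?\<Gamma> w \<inter> C \<noteq> {}} = M -` (comb \<tau> ` (simplex1 \<inter> C)) \<inter> space N" by auto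
    ultimately show "{w \<in> space N. ?\<Gamma> w \<inter> C \<noteq> {}} \<in> sets N" by simp
  next
    fix w
    have "?\<Gamma> w = simplex1 \<inter> comb \<tau> -` {M w}" by auto
    moreover have "closed (simplex1 \<inter> comb \<tau> -` {M w})"
      by (rule continuous_closed_preimage[OF comb_continuous compact_imp_closed[OF compact_simplex1]]) simp
    ultimately show "closed (?\<Gamma> w)" by simp
  qed
  then obtain Y where Y: "Y \<in> borel_measurable N" "\<forall>w\<in>space N. ?\<Gamma> w \<noteq> {} \<longrightarrow> Y w \<in> ?\<Gamma> w" by blast
  show ?thesis
  proof (intro bexI[OF _ Y(1)] ballI impI)
    fix w assume w: "w \<in> space N" and "M w \<in> comb \<tau> ` simplex1"
    then obtain l where "M w = comb \<tau> l" "l \<in> simplex1" by (elim imageE)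
    then have "l \<in> ?\<Gamma> w" by simp
    then have "?\<Gamma> w \<noteq> {}" by blast
    then show "Y w \<in> simplex1 \<and> comb \<tau> (Y w) = M w" using Y(2) w by blast
  qed
qed

text \<open>With vertices from \<open>dset\<close> there are countably many tuples
  \<open>\<tau>\<close>, so the tuple can be chosen as the first suitable one and only the weights
  need a selection theorem.\<close>

lemma Act_comb:
  assumes t: "t < T" and w: "w \<in> space (Om_t t)" and p: "p \<in> G t w"
  shows "\<exists>\<tau>\<in>PiE Basis (\<lambda>_. dset). (\<forall>i\<in>Basis. \<tau> i \<in> Act t w) \<and> p \<in> comb \<tau> ` simplex1"
proof -
  have "p \<in> convex hull (dset \<inter> Act t w)"
    using p convex_hull_dset[OF Act_props(1)[OF t w]] unfolding G_step[OF t] by blast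
  from convex_hull_basis_index[OF this] obtain f :: "(((real, 'd) vec) \<times> real \<times> real) \<times> real \<Rightarrow> ((real, 'd) vec) \<times> real \<times> real" and l
    where f: "\<forall>i\<in>Basis. f i \<in> dset \<inter> Act t w" "\<forall>i\<in>Basis. 0 \<le> l \<bullet> i" "(\<Sum>i\<in>Basis. l \<bullet> i) = 1" "(\<Sum>i\<in>Basis. (l \<bullet> i) *\<^sub>R f i) = p"
    by auto
  show ?thesis
  proof (intro bexI[of _ "restrict f Basis"] conjI ballI)
    show "p \<in> comb (restrict f Basis) ` simplex1"
      using f by (intro image_eqI[of _ _ l]) (auto simp: comb_def simplex1_def)
  qed (use f in auto)
qed

text \<open>Functionals whose values along a dual process are nonnegative. Means are stated for
  these only, as extended integrals without integrability conditions; the coordinates are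
  combinations of them.\<close>

definition pos_fun :: "((real, 'd) vec) \<times> real \<times> real \<Rightarrow> bool" where
  "pos_fun a \<longleftrightarrow> (\<forall>t\<le>T. \<forall>w\<in>space (Om_t t). \<forall>p\<in>G t w. 0 \<le> a \<bullet> p)"

lemma dual_step:
  assumes t: "t < T" and M: "M \<in> borel_measurable (univ_completion (Om_t t))"
    and MG: "\<And>w. w \<in> space (Om_t t) \<Longrightarrow> M w \<in> G t w \<union> {0}"
  shows "\<exists>\<kappa> M'. ksel t \<kappa> \<and> M' \<in> borel_measurable (univ_completion (Om_t (Suc t))) \<and>
    (\<forall>v\<in>space (Om_t (Suc t)). M' v \<in> G (Suc t) v \<union> {0}) \<and>
    (\<forall>v\<in>space (Om_t (Suc t)). M (res t v) = 0 \<longrightarrow> M' v = 0) \<and>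
    (\<forall>a. pos_fun a \<longrightarrow> (\<forall>w\<in>space (Om_t t). (\<integral>\<^sup>+x. ennreal (a \<bullet> M' (w(t := x))) \<partial>\<kappa> w) = ennreal (a \<bullet> M w)))"
proof -
  let ?B = "Basis :: ((((real, 'd) vec) \<times> real \<times> real) \<times> real) set"
  let ?U = "univ_completion (Om_t t)"
  let ?V = "univ_completion (Om_t (Suc t))"
  have ST: "Suc t \<le> T" using t by simp
  define I where "I = PiE ?B (\<lambda>_. dset :: (((real, 'd) vec) \<times> real \<times> real) set)"
  have cI: "countable I" unfolding I_def by (intro countable_PiE finite_Basis dset(1))
  have neI: "I \<noteq> {}" unfolding I_def using dset_nonempty by (simp only: PiE_eq_empty_iff) blast
  define en where "en = from_nat_into I"
  have enI: "en n \<in> I" for n unfolding en_def by (rule from_nat_into[OF neI])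
  have "\<forall>p. \<exists>\<kappa>. ksel t \<kappa> \<and> (\<forall>w\<in>space (Om_t t). p \<in> Act t w \<longrightarrow> \<not> (AE x in \<kappa> w. p \<notin> G (Suc t) (w(t := x))))"
    using Act_kernel[OF t] unfolding ksel_def by blast
  then obtain kp where "\<forall>p. ksel t (kp p) \<and> (\<forall>w\<in>space (Om_t t). p \<in> Act t w \<longrightarrow> \<not> (AE x in kp p w. p \<notin> G (Suc t) (w(t := x))))"
    by (rule choice[THEN exE])
  then have kp: "\<And>p. ksel t (kp p)" "\<And>p w. w \<in> space (Om_t t) \<Longrightarrow> p \<in> Act t w \<Longrightarrow> \<not> (AE x in kp p w. p \<notin> G (Suc t) (w(t := x)))"
    by blast+
  have "\<forall>n. \<exists>\<kappa>'. ksel t \<kappa>' \<and> (\<forall>i\<in>?B. \<forall>w\<in>space (Om_t t). null_sets (\<kappa>' w) \<subseteq> null_sets (kp (en n i) w))"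
    \<comment> \<open>One kernel serves the whole \<open>n\<close>-th tuple and charges every event
      charged by the kernels of its vertices, so all divisors \<open>m n i\<close> used later are
      positive.\<close>
    by (intro allI ksel_dominating[OF t]) (use kp(1) in auto)
  then obtain kt where "\<forall>n. ksel t (kt n) \<and> (\<forall>i\<in>?B. \<forall>w\<in>space (Om_t t). null_sets (kt n w) \<subseteq> null_sets (kp (en n i) w))"
    by (rule choice[THEN exE])
  then have kt: "\<And>n. ksel t (kt n)" "\<And>n i w. i \<in> ?B \<Longrightarrow> w \<in> space (Om_t t) \<Longrightarrow> null_sets (kt n w) \<subseteq> null_sets (kp (en n i) w)"
    by blast+
  have ktk: "kern t (kt n)" for n by (rule ksel_kern[OF kt(1) t])
  have kpk: "kern t (kp p)" for p by (rule ksel_kern[OF kp(1) t])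
  define E where "E p = {v \<in> space (Om_t (Suc t)). p \<in> G (Suc t) v}" for p
  have ES: "E p \<in> sets ?V" for p unfolding E_def by (rule G_univ[OF ST])
  define m where "m n i w = (\<integral>\<^sup>+x. indicator (E (en n i)) (w(t := x)) \<partial>kt n w)" for n i and w :: "nat \<Rightarrow> 'w"
  have mm: "m n i \<in> borel_measurable ?U" for n i
    unfolding m_def by (rule kint_measurable[OF ktk]) (use ES in simp)
  have m1: "m n i w \<le> 1" if w: "w \<in> space (Om_t t)" for n i w
  proof -
    interpret prob_space "kt n w" by (rule probs_prob[OF kern_probs[OF ktk w]])
    have "m n i w \<le> (\<integral>\<^sup>+x. 1 \<partial>kt n w)" unfolding m_def by (intro nn_integral_mono) (simp add: indicator_def)
    then show ?thesis by (simp add: emeasure_space_1)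
  qed
  have m0: "m n i w \<noteq> 0" if w: "w \<in> space (Om_t t)" and i: "i \<in> ?B" and a: "en n i \<in> Act t w" for n i w
  proof
    assume "m n i w = 0"
    then have "(\<integral>\<^sup>+x. indicator (E (en n i)) (w(t := x)) \<partial>completion (kt n w)) = (0::ennreal)"
      unfolding m_def by (simp add: nn_integral_completion)
    moreover have "(\<lambda>x. indicator (E (en n i)) (w(t := x)) :: ennreal) \<in> borel_measurable (completion (kt n w))"
      by (rule univ_section_measurable[OF _ w kern_probs[OF ktk w]]) (use ES in simp)
    ultimately have "AE x in completion (kt n w). indicator (E (en n i)) (w(t := x)) = (0::ennreal)"
      by (simp add: nn_integral_0_iff_AE)
    then have ae: "AE x in kt n w. indicator (E (en n i)) (w(t := x)) = (0::ennreal)" by (simp add: AE_completion_iff)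
    have "AE x in kt n w. en n i \<notin> G (Suc t) (w(t := x))"
      using ae by (rule eventually_mono) (use upd_Om[OF w] in \<open>auto simp: E_def split: split_indicator_asm\<close>)
    then have "AE x in kp (en n i) w. en n i \<notin> G (Suc t) (w(t := x))"
    proof (rule absolutely_continuous_AE[rotated 2])
      show "sets (kp (en n i) w) = sets (kt n w)"
        using probs_sets[OF kern_probs[OF ktk w]] probs_sets[OF kern_probs[OF kpk w]] by simp
      show "absolutely_continuous (kt n w) (kp (en n i) w)" unfolding absolutely_continuous_def by (rule kt(2)[OF i w])
    qed
    with kp(2)[OF w a] show False by contradiction
  qed
  have "\<forall>n. \<exists>l. l \<in> borel_measurable ?U \<and> (\<forall>w\<in>space ?U. M w \<in> comb (en n) ` simplex1 \<longrightarrow> l w \<in> simplex1 \<and> comb (en n) (l w) = M w)"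
    using weight_selection[OF M] by blast
  then obtain l where "\<forall>n. l n \<in> borel_measurable ?U \<and> (\<forall>w\<in>space ?U. M w \<in> comb (en n) ` simplex1 \<longrightarrow> l n w \<in> simplex1 \<and> comb (en n) (l n w) = M w)"
    by (rule choice[THEN exE])
  then have lm: "\<And>n. l n \<in> borel_measurable ?U"
    and l: "\<And>n w. w \<in> space (Om_t t) \<Longrightarrow> M w \<in> comb (en n) ` simplex1 \<Longrightarrow> l n w \<in> simplex1 \<and> comb (en n) (l n w) = M w" by auto
  define cond where "cond n w \<longleftrightarrow> (\<forall>i\<in>?B. en n i \<in> Act t w) \<and> M w \<in> comb (en n) ` simplex1" for n w
  \<comment> \<open>Taking the first suitable tuple is a measurable choice among countably
    many.\<close>
  define ix where "ix w = (LEAST n. cond n w)" for w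
  have "Measurable.pred ?U (cond n)" for n
  proof -
    have "M -` (comb (en n) ` simplex1) \<inter> space ?U \<in> sets ?U"
      by (intro measurable_sets[OF M] borel_compact compact_continuous_image comb_continuous compact_simplex1)
    then have "{w \<in> space ?U. M w \<in> comb (en n) ` simplex1} \<in> sets ?U" by (simp add: vimage_def Int_def conj_commute)
    then have "{w \<in> space ?U. cond n w} \<in> sets ?U" unfolding cond_def
      by (intro sets.sets_Collect_conj sets_Collect_ball_countable countable_finite finite_Basis) (use Act_univ[OF t] in auto)
    then show ?thesis by (simp add: pred_def)
  qed
  then have ixm: "ix \<in> measurable ?U (count_space UNIV)" unfolding ix_def[abs_def] by (rule measurable_Least)
  have ixc: "cond (ix w) w" if w: "w \<in> space (Om_t t)" and "M w \<noteq> 0" for w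
  proof -
    have "M w \<in> G t w" using MG[OF w] that(2) by blast
    from Act_comb[OF t w this] obtain \<tau> where \<tau>: "\<tau> \<in> I" "\<forall>i\<in>?B. \<tau> i \<in> Act t w" "M w \<in> comb \<tau> ` simplex1" unfolding I_def by blast
    obtain n where "\<tau> = en n" unfolding en_def using \<tau>(1) range_from_nat_into[OF neI cI] by blast
    with \<tau> have "cond n w" by (simp add: cond_def)
    then show ?thesis unfolding ix_def by (rule LeastI)
  qed
  define \<kappa> where "\<kappa> w = kt (ix w) w" for w
  define M'n where "M'n n v = (if M (res t v) = 0 then 0 else
     (\<Sum>i\<in>?B. ((l n (res t v) \<bullet> i) / enn2real (m n i (res t v)) * indicator (E (en n i)) v) *\<^sub>R en n i))" for n and v :: "nat \<Rightarrow> 'w"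
  define M' where "M' v = M'n (ix (res t v)) v" for v
  have "ksel t \<kappa>" unfolding ksel_def
  proof
    show "univ_kernel t \<kappa>" unfolding univ_kernel_def \<kappa>_def
    proof
      fix A :: "'w set" assume A: "A \<in> sets borel"
      show "(\<lambda>w. emeasure (kt (ix w) w) A) \<in> borel_measurable ?U"
        by (rule measurable_compose_countable[OF _ ixm]) (use kt(1) A in \<open>auto simp: ksel_def univ_kernel_def\<close>)
    qed
    show "\<forall>w\<in>space (Om_t t). \<kappa> w \<in> Pt t w" using kt(1) by (auto simp: \<kappa>_def ksel_def)
  qed
  moreover have "M' \<in> borel_measurable ?V"
  proof -
    have r: "f \<in> measurable ?U N \<Longrightarrow> (\<lambda>v. f (res t v)) \<in> measurable ?V N" for f N
      by (rule measurable_univ_res) auto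
    have M'nm: "M'n n \<in> borel_measurable ?V" for n
      unfolding M'n_def
    proof (rule measurable_If)
      show "{v \<in> space ?V. M (res t v) = 0} \<in> sets ?V"
        using measurable_sets[OF r[OF M], of "{0}"] by (simp add: vimage_def Int_def conj_commute)
      show "(\<lambda>v. \<Sum>i\<in>?B. ((l n (res t v) \<bullet> i) / enn2real (m n i (res t v)) * indicator (E (en n i)) v) *\<^sub>R en n i) \<in> borel_measurable ?V"
        using ES
        by (intro borel_measurable_sum borel_measurable_scaleR borel_measurable_times borel_measurable_divide borel_measurable_inner
            borel_measurable_const r[OF lm] borel_measurable_indicator borel_measurable_enn2real r[OF mm])
    qed simp
    show ?thesis unfolding M'_def[abs_def] by (rule measurable_compose_countable[OF M'nm r[OF ixm]])
  qed
  moreover have "M' v \<in> G (Suc t) v \<union> {0}" if v: "v \<in> space (Om_t (Suc t))" for v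
  proof (cases "M (res t v) = 0")
    case False
    let ?w = "res t v" let ?n = "ix (res t v)"
    have n: "nice (G (Suc t) v)" by (rule nice_G[OF ST v])
    have c: "cond ?n ?w" by (rule ixc[OF res_Om False])
    then have ls: "l ?n ?w \<in> simplex1" using l[OF res_Om, of v ?n] unfolding cond_def by blast
    have "(\<Sum>i\<in>?B. ((l ?n ?w \<bullet> i) / enn2real (m ?n i ?w) * indicator (E (en ?n i)) v) *\<^sub>R en ?n i) \<in> G (Suc t) v \<union> {0}"
    proof (rule cone_sum)
      show "convex (G (Suc t) v)" using n by (simp add: nice_def)
      show "c *\<^sub>R p \<in> G (Suc t) v" if "p \<in> G (Suc t) v" "0 < c" for p c using n that by (simp add: nice_def)
      show "0 \<le> (l ?n ?w \<bullet> i) / enn2real (m ?n i ?w) * indicator (E (en ?n i)) v" if "i \<in> ?B" for i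
        using ls that by (simp add: simplex1_def)
      show "en ?n i \<in> G (Suc t) v" if "i \<in> ?B" "0 < (l ?n ?w \<bullet> i) / enn2real (m ?n i ?w) * indicator (E (en ?n i)) v" for i
      proof -
        have "indicator (E (en ?n i)) v \<noteq> (0::real)" using that(2) by (metis mult_zero_right order_less_irrefl)
        then show ?thesis by (simp add: indicator_eq_0_iff E_def)
      qed
    qed simp
    then show ?thesis using False by (simp add: M'_def M'n_def)
  qed (simp add: M'_def M'n_def)
  moreover have "M' v = 0" if "M (res t v) = 0" for v using that by (simp add: M'_def M'n_def)
  moreover have "(\<integral>\<^sup>+x. ennreal (a \<bullet> M' (w(t := x))) \<partial>\<kappa> w) = ennreal (a \<bullet> M w)"
    if a: "pos_fun a" and w: "w \<in> space (Om_t t)" for a w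
  proof -
    have rw: "res t (w(t := x)) = w" for x using res_upd[OF w order_refl] res_id[OF w] by simp
    show ?thesis
    proof (cases "M w = 0")
      case True
      then show ?thesis by (simp add: M'_def M'n_def rw)
    next
      case False
      let ?n = "ix w"
      have c: "cond ?n w" by (rule ixc[OF w False])
      then have ls: "l ?n w \<in> simplex1" "comb (en ?n) (l ?n w) = M w" using l[OF w, of ?n] unfolding cond_def by blast+
      have act: "en ?n i \<in> Act t w" if "i \<in> ?B" for i using c that by (simp add: cond_def)
      have l0: "0 \<le> l ?n w \<bullet> i" if "i \<in> ?B" for i using ls(1) that by (simp add: simplex1_def)
      have ap: "0 \<le> a \<bullet> en ?n i" if i: "i \<in> ?B" for i
      proof -
        obtain x where "en ?n i \<in> G (Suc t) (w(t := x))" using Act_realized[OF act[OF i]] by blast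
        then show ?thesis using a ST upd_Om[OF w] unfolding pos_fun_def by blast
      qed
      have mfin: "m ?n i w = ennreal (enn2real (m ?n i w))" "enn2real (m ?n i w) > 0" if i: "i \<in> ?B" for i
      proof -
        have "m ?n i w < \<top>" using m1[OF w, of ?n i] by (metis ennreal_one_less_top order_le_less_trans)
        then show "m ?n i w = ennreal (enn2real (m ?n i w))" by simp
        show "enn2real (m ?n i w) > 0" using m0[OF w i act[OF i]] \<open>m ?n i w < \<top>\<close>
          by (simp add: enn2real_positive_iff zero_less_iff_neq_zero)
      qed
      let ?c = "\<lambda>i. (l ?n w \<bullet> i) / enn2real (m ?n i w) * (a \<bullet> en ?n i)"
      have c0: "0 \<le> ?c i" if "i \<in> ?B" for i using l0[OF that] ap[OF that] by simp
      have "ennreal (a \<bullet> M' (w(t := x))) = (\<Sum>i\<in>?B. ennreal (?c i) * indicator (E (en ?n i)) (w(t := x)))" for x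
      proof -
        have e1: "a \<bullet> M' (w(t := x)) = (\<Sum>i\<in>?B. ?c i * indicator (E (en ?n i)) (w(t := x)))"
          using False by (simp add: M'_def M'n_def rw inner_sum_right mult.assoc mult.commute mult.left_commute)
        have e2: "ennreal (\<Sum>i\<in>?B. ?c i * indicator (E (en ?n i)) (w(t := x))) = (\<Sum>i\<in>?B. ennreal (?c i * indicator (E (en ?n i)) (w(t := x))))"
          by (rule sum_ennreal[symmetric], rule mult_nonneg_nonneg, rule c0) simp_all
        have "ennreal (c * indicator A y) = ennreal c * indicator A y" for c A and y :: "nat \<Rightarrow> 'w"
          by (cases "y \<in> A") simp_all
        then show ?thesis by (simp only: e1 e2)
      qed
      then have "(\<integral>\<^sup>+x. ennreal (a \<bullet> M' (w(t := x))) \<partial>\<kappa> w) =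
          (\<integral>\<^sup>+x. (\<Sum>i\<in>?B. ennreal (?c i) * indicator (E (en ?n i)) (w(t := x))) \<partial>completion (kt ?n w))"
        by (simp add: \<kappa>_def nn_integral_completion)
      also have "\<dots> = (\<Sum>i\<in>?B. \<integral>\<^sup>+x. ennreal (?c i) * indicator (E (en ?n i)) (w(t := x)) \<partial>completion (kt ?n w))"
      proof (rule nn_integral_sum)
        fix i
        show "(\<lambda>x. ennreal (?c i) * indicator (E (en ?n i)) (w(t := x))) \<in> borel_measurable (completion (kt ?n w))"
          by (rule univ_section_measurable[OF _ w kern_probs[OF ktk w]]) (use ES in simp)
      qed
      also have "\<dots> = (\<Sum>i\<in>?B. ennreal (?c i) * m ?n i w)"
      proof (rule sum.cong[OF refl])
        fix i assume "i \<in> ?B"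
        have "(\<lambda>x. indicator (E (en ?n i)) (w(t := x)) :: ennreal) \<in> borel_measurable (completion (kt ?n w))"
          by (rule univ_section_measurable[OF _ w kern_probs[OF ktk w]]) (use ES in simp)
        then show "(\<integral>\<^sup>+x. ennreal (?c i) * indicator (E (en ?n i)) (w(t := x)) \<partial>completion (kt ?n w)) = ennreal (?c i) * m ?n i w"
          by (subst nn_integral_cmult) (simp_all add: m_def nn_integral_completion)
      qed
      also have "\<dots> = (\<Sum>i\<in>?B. ennreal ((l ?n w \<bullet> i) * (a \<bullet> en ?n i)))"
      proof (rule sum.cong[OF refl])
        fix i assume i: "i \<in> ?B"
        have "ennreal (?c i) * m ?n i w = ennreal (?c i) * ennreal (enn2real (m ?n i w))" 
          by (rule arg_cong[where f="\<lambda>u. ennreal (?c i) * u", OF mfin(1)[OF i]])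
        also have "\<dots> = ennreal (?c i * enn2real (m ?n i w))" by (rule ennreal_mult[symmetric]) (use c0[OF i] in auto)
        finally have e3: "ennreal (?c i) * m ?n i w = ennreal (?c i * enn2real (m ?n i w))" .
        have e4: "?c i * enn2real (m ?n i w) = (l ?n w \<bullet> i) * (a \<bullet> en ?n i)" using mfin(2)[OF i] by (simp add: field_simps)
        show "ennreal (?c i) * m ?n i w = ennreal ((l ?n w \<bullet> i) * (a \<bullet> en ?n i))" unfolding e3 e4 by (rule refl)
      qed
      also have "\<dots> = ennreal (\<Sum>i\<in>?B. (l ?n w \<bullet> i) * (a \<bullet> en ?n i))" by (rule sum_ennreal) (use l0 ap in simp)
      finally have fin: "(\<integral>\<^sup>+x. ennreal (a \<bullet> M' (w(t := x))) \<partial>\<kappa> w) = ennreal (\<Sum>i\<in>?B. (l ?n w \<bullet> i) * (a \<bullet> en ?n i))" .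
      have "(\<Sum>i\<in>?B. (l ?n w \<bullet> i) * (a \<bullet> en ?n i)) = a \<bullet> M w"
        unfolding ls(2)[symmetric] comb_def by (simp add: inner_sum_right)
      with fin show ?thesis by simp
    qed
  qed
  ultimately show ?thesis by (intro exI[of _ \<kappa>] exI[of _ M']) blast
qed

end

lemma completion_ex_borel_measurable_euclidean:
  fixes f :: "'a \<Rightarrow> 'b::euclidean_space"
  assumes f: "f \<in> borel_measurable (completion M)"
  shows "\<exists>g\<in>borel_measurable M. AE x in M. f x = g x"
proof -
  have "\<forall>b. \<exists>g. g \<in> borel_measurable M \<and> (AE x in M. f x \<bullet> b = g x)"
  proof
    fix b
    have "(\<lambda>x. f x \<bullet> b) \<in> borel_measurable (completion M)" by (intro borel_measurable_inner f borel_measurable_const)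
    from completion_ex_borel_measurable_real[OF this] show "\<exists>g. g \<in> borel_measurable M \<and> (AE x in M. f x \<bullet> b = g x)" by blast
  qed
  then obtain g where g: "\<forall>b. g b \<in> borel_measurable M \<and> (AE x in M. f x \<bullet> b = g b x)" by (rule choice[THEN exE])
  have m: "(\<lambda>x. \<Sum>b\<in>Basis. g b x *\<^sub>R b) \<in> borel_measurable M"
    using g by (intro borel_measurable_sum borel_measurable_scaleR) auto
  have "AE x in M. \<forall>b\<in>Basis. f x \<bullet> b = g b x" using g by (simp add: AE_finite_all)
  then have ae: "AE x in M. f x = (\<Sum>b\<in>Basis. g b x *\<^sub>R b)"
  proof (rule eventually_mono)
    fix x assume h: "\<forall>b\<in>Basis. f x \<bullet> b = g b x"
    have "f x = (\<Sum>b\<in>Basis. (f x \<bullet> b) *\<^sub>R b)" by (rule euclidean_representation[symmetric])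
    also have "\<dots> = (\<Sum>b\<in>Basis. g b x *\<^sub>R b)" using h by (intro sum.cong) auto
    finally show "f x = (\<Sum>b\<in>Basis. g b x *\<^sub>R b)" .
  qed
  show ?thesis using m ae by (intro bexI[of _ "\<lambda>x. \<Sum>b\<in>Basis. g b x *\<^sub>R b"])
qed

lemma nn_integral_density_completion:
  assumes f: "f \<in> borel_measurable (completion M)" and g: "g \<in> borel_measurable M"
  shows "(\<integral>\<^sup>+x. f x \<partial>density M g) = (\<integral>\<^sup>+x. g x * f x \<partial>M)"
proof -
  obtain f' where f': "f' \<in> borel_measurable M" "AE x in M. f x = f' x"
    using completion_ex_borel_measurable[OF f] by blast
  have "AE x in density M g. f x = f' x" unfolding AE_density[OF g] using f'(2) by (rule eventually_mono) simp
  then have "(\<integral>\<^sup>+x. f x \<partial>density M g) = (\<integral>\<^sup>+x. f' x \<partial>density M g)" by (rule nn_integral_cong_AE)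
  also have "\<dots> = (\<integral>\<^sup>+x. g x * f' x \<partial>M)" by (rule nn_integral_density[OF g f'(1)])
  also have "\<dots> = (\<integral>\<^sup>+x. g x * f x \<partial>M)" by (rule nn_integral_cong_AE) (use f'(2) in \<open>rule eventually_mono, simp\<close>)
  finally show ?thesis .
qed

lemma integrable_vecI:
  fixes f :: "'a \<Rightarrow> (real, 'd::finite) vec"
  assumes "\<And>i. integrable M (\<lambda>x. f x $ i)"
  shows "integrable M f"
proof -
  have eq: "f = (\<lambda>x. \<Sum>i\<in>UNIV. (f x $ i) *\<^sub>R axis i 1)"
    by (simp add: fun_eq_iff vec_eq_iff axis_def if_distrib sum.If_cases cong: if_cong)
  have int: "integrable M (\<lambda>x. \<Sum>i\<in>UNIV. (f x $ i) *\<^sub>R axis i (1::real))"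
    by (intro Bochner_Integration.integrable_sum integrable_scaleR_left assms)
  show ?thesis by (subst eq) (rule int)
qed

lemma integral_vec_nth:
  fixes f :: "'a \<Rightarrow> (real, 'd::finite) vec"
  assumes "integrable M f"
  shows "(\<integral>x. f x \<partial>M) $ i = (\<integral>x. f x $ i \<partial>M)"
  using integral_bounded_linear[OF bounded_linear_vec_nth[of i] assms] by simp

context market
begin

lemma sets_Ffilt: "sets (Ffilt T t) = {(\<lambda>w. res t w) -` A \<inter> space (Om_t T) | A. A \<in> sets (univ_completion (Om_t t))}"
  unfolding Ffilt_def by (rule sets_vimage_algebra2) (auto simp: space_Om)

lemma space_Ffilt [simp]: "space (Ffilt T t) = space (Om_t T)"
  by (simp add: Ffilt_def)

lemma space_F0 [simp]: "space (F0 T t) = space (Om_t T)"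
  by (simp add: F0_def)

lemma measurable_F0_Ffilt: "f \<in> measurable (F0 T t) N \<Longrightarrow> f \<in> measurable (Ffilt T t) N"
proof (rule measurableI)
  fix A assume f: "f \<in> measurable (F0 T t) N" and A: "A \<in> sets N"
  have "f -` A \<inter> space (Om_t T) \<in> sets (F0 T t)" using measurable_sets[OF f A] by simp
  then show "f -` A \<inter> space (Ffilt T t) \<in> sets (Ffilt T t)"
    unfolding sets_F0 sets_Ffilt by (auto intro: sets_univ_completionI)
qed (auto dest: measurable_space)

lemma measurable_F0_res: "f \<in> measurable (Om_t t) N \<Longrightarrow> (\<lambda>w. f (res t w)) \<in> measurable (F0 T t) N"
  unfolding F0_def by (rule measurable_compose[OF measurable_vimage_algebra1]) (intro Pi_I res_Om)

lemma measurable_F0_Om: assumes "t \<le> T" "f \<in> measurable (F0 T t) N" shows "f \<in> measurable (Om_t T) N"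
proof (rule measurableI)
  fix A assume "A \<in> sets N"
  then have "f -` A \<inter> space (Om_t T) \<in> sets (F0 T t)" using measurable_sets[OF assms(2)] by simp
  then obtain B where "B \<in> sets (Om_t t)" "f -` A \<inter> space (Om_t T) = (\<lambda>w. res t w) -` B \<inter> space (Om_t T)" unfolding sets_F0 by blast
  then show "f -` A \<inter> space (Om_t T) \<in> sets (Om_t T)" using measurable_sets[OF measurable_res[OF assms(1)]] by metis
qed (use measurable_space[OF assms(2)] in simp)

lemma Ffilt_sub_univ: "t \<le> T \<Longrightarrow> A \<in> sets (Ffilt T t) \<Longrightarrow> A \<in> sets (univ_completion (Om_t T))"
proof -
  assume t: "t \<le> T" and "A \<in> sets (Ffilt T t)"
  then obtain B where B: "B \<in> sets (univ_completion (Om_t t))" "A = (\<lambda>w. res t w) -` B \<inter> space (Om_t T)"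
    unfolding sets_Ffilt by blast
  then show ?thesis using measurable_sets[OF measurable_univ_completion_lift[OF measurable_res[OF t]] B(1)] by simp
qed

lemma kprod_AE_res:
  assumes k: "valid k" and t: "t \<le> T" and ae: "AE w in kprod k t. R w"
  shows "AE w in kprod k T. R (res t w)"
proof -
  have pr: "kprod k t \<in> probs (Om_t t)" "kprod k T \<in> probs (Om_t T)" using valid_probs[OF k] t by auto
  obtain N where N: "N \<in> null_sets (kprod k t)" "{w \<in> space (kprod k t). \<not> R w} \<subseteq> N"
    using ae by (auto simp: eventually_ae_filter)
  have NS: "N \<in> sets (Om_t t)" using N(1) probs_sets[OF pr(1)] by auto
  have "(\<integral>\<^sup>+w. indicator N (res t w) \<partial>kprod k T) = (\<integral>\<^sup>+w. indicator N w \<partial>kprod k t)"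
    by (rule nn_integral_kprod_res) (use valid_kern[OF k] t sets_univ_completionI[OF NS] in auto)
  also have "\<dots> = 0" using N(1) by (subst nn_integral_indicator) auto
  finally have 0: "(\<integral>\<^sup>+w. indicator N (res t w) \<partial>kprod k T) = 0" .
  have "(\<lambda>w. indicator N (res t w) :: ennreal) \<in> borel_measurable (kprod k T)"
    using measurable_compose[OF measurable_res[OF t] borel_measurable_indicator[OF NS]] probs_sets[OF pr(2)]
    by (simp cong: measurable_cong_sets)
  with 0 have "AE w in kprod k T. indicator N (res t w) = (0::ennreal)" by (simp add: nn_integral_0_iff_AE)
  then show ?thesis
    by (rule eventually_mono) (use N(2) probs_space[OF pr(1)] in \<open>auto split: split_indicator_asm\<close>)
qed

end

section \<open>The price system carried by a dual process\<close>

locale dual_proc = claim T Pt K S \<xi> \<phi>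
  for T :: nat
    and Pt :: "nat \<Rightarrow> (nat \<Rightarrow> 'w::polish_space) \<Rightarrow> 'w measure set"
    and K :: "nat \<Rightarrow> (nat \<Rightarrow> 'w) \<Rightarrow> ((real, 'd::{finite,linorder}) vec) set"
    and S :: "nat \<Rightarrow> (nat \<Rightarrow> 'w) \<Rightarrow> (real, 'd) vec"
    and \<xi> :: "(nat \<Rightarrow> 'w) \<Rightarrow> (real, 'd) vec" and \<phi> :: "(nat \<Rightarrow> 'w) \<Rightarrow> real" +
  fixes k :: "nat \<Rightarrow> (nat \<Rightarrow> 'w) \<Rightarrow> 'w measure" and M :: "nat \<Rightarrow> (nat \<Rightarrow> 'w) \<Rightarrow> ((real, 'd) vec) \<times> real \<times> real"
    and p0 :: "((real, 'd) vec) \<times> real \<times> real"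
  assumes k: "valid k" and M0: "M 0 = (\<lambda>_. p0)"
    and Mm: "\<And>t. t \<le> T \<Longrightarrow> M t \<in> borel_measurable (univ_completion (Om_t t))"
    and MG: "\<And>t w. t \<le> T \<Longrightarrow> w \<in> space (Om_t t) \<Longrightarrow> M t w \<in> G t w \<union> {0}"
    and Mz: "\<And>t v. t < T \<Longrightarrow> v \<in> space (Om_t (Suc t)) \<Longrightarrow> M t (res t v) = 0 \<Longrightarrow> M (Suc t) v = 0"
    and Mi: "\<And>a t w. pos_fun a \<Longrightarrow> t < T \<Longrightarrow> w \<in> space (Om_t t) \<Longrightarrow>
      (\<integral>\<^sup>+x. ennreal (a \<bullet> M (Suc t) (w(t := x))) \<partial>k t w) = ennreal (a \<bullet> M t w)"
    and p0d: "fst p0 $ dlast = 1"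
begin

text \<open>A weight known at time \<open>s\<close> is constant under all later kernels, so the mean
  identity of one step can be iterated under it.\<close>

lemma mart:
  assumes a: "pos_fun a" and h: "h \<in> borel_measurable (univ_completion (Om_t s))" and sn: "s \<le> n" "n \<le> T"
  shows "(\<integral>\<^sup>+w. h (res s w) * ennreal (a \<bullet> M n w) \<partial>kprod k n) = (\<integral>\<^sup>+w. h w * ennreal (a \<bullet> M s w) \<partial>kprod k s)"
  using sn
proof (induction n rule: dec_induct)
  case base
  then show ?case
    by (intro nn_integral_cong) (use probs_space[OF valid_probs[OF k]] in \<open>simp add: res_id\<close>)
next
  case (step n)
  have n: "n < T" using step.prems by simp
  have nm: "(\<lambda>w. ennreal (a \<bullet> M (Suc n) w)) \<in> borel_measurable (univ_completion (Om_t (Suc n)))"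
    by (intro measurable_compose[OF _ measurable_ennreal] borel_measurable_inner borel_measurable_const Mm step.prems)
  have "(\<integral>\<^sup>+w. h (res s w) * ennreal (a \<bullet> M (Suc n) w) \<partial>kprod k (Suc n)) =
      (\<integral>\<^sup>+w. \<integral>\<^sup>+x. h (res s (w(n := x))) * ennreal (a \<bullet> M (Suc n) (w(n := x))) \<partial>k n w \<partial>kprod k n)"
  proof (rule nn_integral_kprod_Suc)
    show "kern s (k s)" if "s \<le> n" for s using valid_kern[OF k] that n by simp
    show "(\<lambda>w. h (res s w) * ennreal (a \<bullet> M (Suc n) w)) \<in> borel_measurable (univ_completion (Om_t (Suc n)))"
      by (intro borel_measurable_times_ennreal measurable_univ_res h nm) (use step.hyps in simp)
  qed
  also have "\<dots> = (\<integral>\<^sup>+w. h (res s w) * ennreal (a \<bullet> M n w) \<partial>kprod k n)"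
  proof (rule nn_integral_cong)
    fix w assume "w \<in> space (kprod k n)"
    then have w: "w \<in> space (Om_t n)" using probs_space[OF valid_probs[OF k]] n by simp
    have "(\<integral>\<^sup>+x. h (res s (w(n := x))) * ennreal (a \<bullet> M (Suc n) (w(n := x))) \<partial>k n w) =
       (\<integral>\<^sup>+x. h (res s w) * ennreal (a \<bullet> M (Suc n) (w(n := x))) \<partial>completion (k n w))"
      using step.hyps by (simp only: res_upd[OF w] nn_integral_completion)
    also have "\<dots> = h (res s w) * (\<integral>\<^sup>+x. ennreal (a \<bullet> M (Suc n) (w(n := x))) \<partial>completion (k n w))"
      by (rule nn_integral_cmult[OF univ_section_measurable[OF nm w kern_probs[OF valid_kern[OF k n] w]]])
    also have "\<dots> = h (res s w) * ennreal (a \<bullet> M n w)" by (simp only: nn_integral_completion Mi[OF a n w])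
    finally show "(\<integral>\<^sup>+x. h (res s (w(n := x))) * ennreal (a \<bullet> M (Suc n) (w(n := x))) \<partial>k n w) = h (res s w) * ennreal (a \<bullet> M n w)" .
  qed
  also have "\<dots> = (\<integral>\<^sup>+w. h w * ennreal (a \<bullet> M s w) \<partial>kprod k s)" by (rule step.IH) (use n in simp)
  finally show ?case .
qed

lemma mart_total: assumes a: "pos_fun a" and n: "n \<le> T"
  shows "(\<integral>\<^sup>+w. ennreal (a \<bullet> M n w) \<partial>kprod k n) = ennreal (a \<bullet> p0)"
proof -
  interpret prob_space "kprod k 0" by (rule probs_prob[OF valid_probs[OF k]]) simp
  have "(\<integral>\<^sup>+w. ennreal (a \<bullet> M n w) \<partial>kprod k n) = (\<integral>\<^sup>+w. 1 * ennreal (a \<bullet> M n w) \<partial>kprod k n)" by simp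
  also have "\<dots> = (\<integral>\<^sup>+w. 1 * ennreal (a \<bullet> M 0 w) \<partial>kprod k 0)"
    by (rule mart[OF a, of "\<lambda>_. 1"]) (use n in auto)
  also have "\<dots> = ennreal (a \<bullet> p0)" using emeasure_space_1 by (simp add: M0 del: kprod.simps)
  finally show ?thesis .
qed

text \<open>Since 0 is absorbing, a nonzero terminal state certifies that the whole trajectory
  stayed inside the cones.\<close>

lemma M_zero: assumes "n \<le> T" "w \<in> space (Om_t T)" "M n (res n w) = 0" shows "M T w = 0"
proof -
  have "M m (res m w) = 0" if "n \<le> m" "m \<le> T" for m
    using that
  proof (induction m rule: dec_induct)
    case base show ?case by (rule assms(3))
  next
    case (step m)
    have "M m (res m w) = 0" by (rule step.IH) (use step.prems in simp)
    then have "M m (res m (res (Suc m) w)) = 0" by (subst res_res) auto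
    then show ?case by (intro Mz[OF _ res_Om]) (use step.prems in simp_all)
  qed
  from this[OF assms(1) order_refl] show ?thesis by (simp add: res_id[OF assms(2)])
qed

text \<open>Functionals for the price components, for \<open>r\<close> and for \<open>v + r\<close>.
  The value \<open>v\<close> has no sign of its own, so it enters as the difference of the last
  two.\<close>

definition zc :: "'d \<Rightarrow> ((real, 'd) vec) \<times> real \<times> real" where "zc i = (axis i 1, 0, 0)"
definition rc :: "((real, 'd) vec) \<times> real \<times> real" where "rc = (0, 0, 1)"
definition vrc :: "((real, 'd) vec) \<times> real \<times> real" where "vrc = (0, 1, 1)"

lemma coords: "zc i \<bullet> p = fst p $ i" "rc \<bullet> p = snd (snd p)" "vrc \<bullet> p = fst (snd p) + snd (snd p)"
  by (simp_all add: zc_def rc_def vrc_def inner_prod_def inner_axis')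

lemma pos_coords: "pos_fun (zc i)" "pos_fun rc" "pos_fun vrc"
proof -
  have n: "0 < fst p $ i \<and> \<bar>fst (snd p)\<bar> < snd (snd p)" if "t \<le> T" "w \<in> space (Om_t t)" "p \<in> G t w" for t w p
    using nice_G[OF that(1,2)] that(3) unfolding nice_def by blast
  show "pos_fun (zc i)" unfolding pos_fun_def coords using n less_imp_le by blast
  show "pos_fun rc" unfolding pos_fun_def coords
  proof (intro allI impI ballI)
    fix t w p assume "t \<le> T" "w \<in> space (Om_t t)" "p \<in> G t w"
    from n[OF this] show "0 \<le> snd (snd p)" by linarith
  qed
  show "pos_fun vrc" unfolding pos_fun_def coords
  proof (intro allI impI ballI)
    fix t w p assume "t \<le> T" "w \<in> space (Om_t t)" "p \<in> G t w"
    from n[OF this] show "0 \<le> fst (snd p) + snd (snd p)" by linarith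
  qed
qed

lemma kpr: "t \<le> T \<Longrightarrow> kprod k t \<in> probs (Om_t t)" by (rule valid_probs[OF k])

text \<open>The states are only universally measurable, whereas a price system has to be Borel
  adapted; they are replaced by almost sure versions under the constructed prior.\<close>

lemma borel_versions: "\<exists>N. \<forall>t. t \<le> T \<longrightarrow> N t \<in> borel_measurable (Om_t t) \<and> (AE w in kprod k t. M t w = N t w)"
proof (rule choice, rule allI)
  fix t
  show "\<exists>N. t \<le> T \<longrightarrow> N \<in> borel_measurable (Om_t t) \<and> (AE w in kprod k t. M t w = N w)"
  proof (cases "t \<le> T")
    case True
    obtain g where "g \<in> borel_measurable (kprod k t)" "AE w in kprod k t. M t w = g w"
      using completion_ex_borel_measurable_euclidean[OF measurable_univ_completionD[OF Mm[OF True] kpr[OF True]]] by blast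
    then show ?thesis using probs_sets[OF kpr[OF True]] by (intro exI[of _ g]) (simp cong: measurable_cong_sets)
  qed simp
qed

definition N where "N = (SOME N. \<forall>t. t \<le> T \<longrightarrow> N t \<in> borel_measurable (Om_t t) \<and> (AE w in kprod k t. M t w = N t w))"

lemma N: assumes "t \<le> T" shows "N t \<in> borel_measurable (Om_t t)" "AE w in kprod k t. M t w = N t w"
  using someI_ex[OF borel_versions] assms unfolding N_def by blast+

abbreviation "P \<equiv> kprod k T"

lemma setsP: "sets P = sets (Om_t T)" and spaceP: "space P = space (Om_t T)" and probP: "prob_space P"
  using kpr[OF order_refl] by (simp_all add: probs_sets probs_space probs_prob)

lemma NM: "t \<le> T \<Longrightarrow> AE w in P. M t (res t w) = N t (res t w)"
  by (rule kprod_AE_res[OF k _ N(2)])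

text \<open>A change of numeraire: the terminal last price component becomes the density of
  \<open>Q\<close>, and prices are quoted in units of the last asset. Its mean is 1 by the
  normalisation of \<open>p0\<close>.\<close>

definition L where "L w = fst (N T w) $ dlast"

lemma measurable_fst_nth: "f \<in> borel_measurable A \<Longrightarrow> (\<lambda>w. fst (f w :: ((real, 'd) vec) \<times> real \<times> real) $ i) \<in> borel_measurable A"
  unfolding coords(1)[symmetric] by (intro borel_measurable_inner borel_measurable_const)

lemma L_meas: "L \<in> borel_measurable P"
  unfolding L_def[abs_def] using measurable_fst_nth[OF N(1)[OF order_refl]] setsP by (simp cong: measurable_cong_sets)

lemma L_eq: "AE w in P. L w = zc dlast \<bullet> M T w"
  using NM[OF order_refl] by (rule AE_mono_space) (simp add: spaceP res_id L_def coords)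

definition Q where "Q = density P (\<lambda>w. ennreal (L w))"

lemma setsQ: "sets Q = sets (Om_t T)" and spaceQ: "space Q = space (Om_t T)"
  by (simp_all add: Q_def setsP spaceP)

lemma Q_probs: "Q \<in> probs (Om_t T)"
proof -
  have "emeasure Q (space Q) = (\<integral>\<^sup>+w. ennreal (L w) \<partial>P)"
    unfolding Q_def using L_meas by (subst emeasure_density) (auto intro!: nn_integral_cong simp del: kprod.simps)
  also have "\<dots> = (\<integral>\<^sup>+w. ennreal (zc dlast \<bullet> M T w) \<partial>P)"
    by (rule nn_integral_cong_AE) (use L_eq in \<open>rule eventually_mono, simp\<close>)
  also have "\<dots> = 1" using mart_total[OF pos_coords(1) order_refl, of dlast] p0d by (simp add: coords)
  finally show ?thesis unfolding probs_def using setsQ by (auto intro: prob_spaceI)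
qed

lemma Q_AE: "AE w in Q. \<forall>t\<in>{..T}. M t (res t w) = N t (res t w) \<and> M t (res t w) \<in> G t (res t w)"
proof -
  have "AE w in P. (\<forall>t\<in>{..T}. M t (res t w) = N t (res t w)) \<and> L w = zc dlast \<bullet> M T w"
    using NM L_eq by (intro AE_conjI AE_finite_allI) auto
  then have "AE w in P. 0 < ennreal (L w) \<longrightarrow> (\<forall>t\<in>{..T}. M t (res t w) = N t (res t w) \<and> M t (res t w) \<in> G t (res t w))"
  proof (rule AE_mono_space, intro impI ballI conjI)
    fix w t assume w: "w \<in> space P" and h: "(\<forall>t\<in>{..T}. M t (res t w) = N t (res t w)) \<and> L w = zc dlast \<bullet> M T w"
      and l: "0 < ennreal (L w)" and t: "t \<in> {..T}"
    show "M t (res t w) = N t (res t w)" using h t by blast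
    have "M T w \<noteq> 0" using h l by (auto simp: coords)
    then have "M t (res t w) \<noteq> 0" using M_zero[of t w] t w spaceP by auto
    then show "M t (res t w) \<in> G t (res t w)" using MG[of t "res t w"] t by auto
  qed
  then show ?thesis unfolding Q_def by (subst AE_density) (use L_meas in auto)
qed

text \<open>Where the version \<open>N\<close> has no positive last component the reference process
  \<open>S\<close> is inserted, so that the last coordinate is 1 on every path and not just almost
  surely.\<close>

definition Z where "Z t w = (if 0 < fst (N t (res t w)) $ dlast then (1 / fst (N t (res t w)) $ dlast) *\<^sub>R fst (N t (res t w)) else S t w)"

lemma Z_dlast: assumes "t \<le> T" "w \<in> space (Om_t T)" shows "Z t w $ dlast = 1"
proof -
  have "S t w \<in> Kstar0 (K t w)" using S_in assms by blast
  then show ?thesis by (simp add: Z_def Kstar0_def)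
qed

lemma Z_F0: assumes "t \<le> T" shows "Z t \<in> borel_measurable (F0 T t)"
  unfolding Z_def[abs_def]
proof (rule measurable_If)
  have n: "(\<lambda>w. N t (res t w)) \<in> borel_measurable (F0 T t)" by (rule measurable_F0_res[OF N(1)[OF assms]])
  have f: "(\<lambda>w. fst (N t (res t w))) \<in> borel_measurable (F0 T t)"
    by (rule measurable_compose[OF n borel_measurable_continuous_onI[OF continuous_on_fst[OF continuous_on_id]]])
  show "{w \<in> space (F0 T t). 0 < fst (N t (res t w)) $ dlast} \<in> sets (F0 T t)"
    by (intro borel_measurable_less borel_measurable_const measurable_fst_nth n)
  show "(\<lambda>w. (1 / fst (N t (res t w)) $ dlast) *\<^sub>R fst (N t (res t w))) \<in> borel_measurable (F0 T t)"
    by (intro borel_measurable_scaleR borel_measurable_divide borel_measurable_const measurable_fst_nth n f)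
  show "S t \<in> borel_measurable (F0 T t)" using S_adapted assms by blast
qed

lemma G_pos: "t \<le> T \<Longrightarrow> w \<in> space (Om_t t) \<Longrightarrow> p \<in> G t w \<Longrightarrow> 0 < fst p $ i"
  using nice_G unfolding nice_def by blast

lemma Z_M: "AE w in Q. \<forall>t\<in>{..T}. Z t w = (1 / fst (N t (res t w)) $ dlast) *\<^sub>R fst (N t (res t w)) \<and>
    N t (res t w) \<in> G t (res t w)"
  using Q_AE
proof (rule eventually_mono, intro ballI)
  fix w t assume h: "\<forall>t\<in>{..T}. M t (res t w) = N t (res t w) \<and> M t (res t w) \<in> G t (res t w)" and t: "t \<in> {..T}"
  then have g: "N t (res t w) \<in> G t (res t w)" by metis
  from G_pos[OF _ res_Om g, of dlast] t have "0 < fst (N t (res t w)) $ dlast" by simp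
  with g show "Z t w = (1 / fst (N t (res t w)) $ dlast) *\<^sub>R fst (N t (res t w)) \<and> N t (res t w) \<in> G t (res t w)"
    by (simp add: Z_def)
qed

lemma Z_icone: assumes t: "t \<le> T" shows "AE w in Q. Z t w \<in> icone (K t w)"
  using Z_M
proof (rule AE_mono_space)
  fix w assume w: "w \<in> space Q" and h: "\<forall>t\<in>{..T}. Z t w = (1 / fst (N t (res t w)) $ dlast) *\<^sub>R fst (N t (res t w)) \<and> N t (res t w) \<in> G t (res t w)"
  then have g: "N t (res t w) \<in> G t (res t w)" and z: "Z t w = (1 / fst (N t (res t w)) $ dlast) *\<^sub>R fst (N t (res t w))" using t by auto
  have "0 < fst (N t (res t w)) $ dlast" by (rule G_pos[OF t res_Om g])
  then have "Z t w \<in> icone (K t (res t w))" unfolding z by (intro icone_scale G_icone[OF t g]) simp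
  then show "Z t w \<in> icone (K t w)" using K_res[OF t] w spaceQ by simp
qed

lemma Z_nonneg: assumes t: "t \<le> T" shows "AE w in Q. 0 \<le> Z t w $ i"
  using Z_icone[OF t]
proof (rule AE_mono_space)
  fix w assume w: "w \<in> space Q" and z: "Z t w \<in> icone (K t w)"
  have "orthant \<subseteq> K t w" using K_orthant t w spaceQ by blast
  from icone_component_pos[OF z this, of i] show "0 \<le> Z t w $ i" by simp
qed

text \<open>Bayes' rule: given the path up to \<open>t\<close>, the density averages to the last
  component of \<open>M t\<close>, which cancels the denominator of \<open>Z t\<close>. Where
  \<open>M t\<close> is 0 both sides vanish.\<close>

lemma Z_integral:
  assumes st: "s \<le> t" "t \<le> T" and B: "B \<in> sets (univ_completion (Om_t s))"
  shows "(\<integral>\<^sup>+w. indicator B (res s w) * ennreal (Z t w $ i) \<partial>Q) = (\<integral>\<^sup>+w. indicator B w * ennreal (zc i \<bullet> M s w) \<partial>kprod k s)"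
proof -
  define Zn where "Zn w = (1 / fst (N t w) $ dlast) * fst (N t w) $ i" for w
  have Znm: "Zn \<in> borel_measurable (Om_t t)" unfolding Zn_def[abs_def]
    by (intro borel_measurable_times borel_measurable_divide borel_measurable_const measurable_fst_nth N(1) st)
  define h where "h w = indicator B (res s w) * ennreal (Zn w)" for w
  have hm: "h \<in> borel_measurable (univ_completion (Om_t t))" unfolding h_def
    by (intro borel_measurable_times_ennreal measurable_univ_res borel_measurable_indicator B st(1)
        measurable_compose[OF measurable_univ_completion[OF Znm] measurable_ennreal])
  have hT: "(\<lambda>w. h (res t w)) \<in> borel_measurable (completion P)"
    by (rule measurable_univ_completionD[OF measurable_univ_res[OF st(2) hm] kpr[OF order_refl]])
  have rr: "res s (res t w) = res s w" for w :: "nat \<Rightarrow> 'w" by (rule res_res[OF st(1)])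
  have "(\<integral>\<^sup>+w. indicator B (res s w) * ennreal (Z t w $ i) \<partial>Q) = (\<integral>\<^sup>+w. h (res t w) \<partial>Q)"
  proof (rule nn_integral_cong_AE, rule eventually_mono[OF Z_M])
    fix w assume "\<forall>t\<in>{..T}. Z t w = (1 / fst (N t (res t w)) $ dlast) *\<^sub>R fst (N t (res t w)) \<and> N t (res t w) \<in> G t (res t w)"
    then have zt: "Z t w $ i = Zn (res t w)" using st(2) by (simp add: Zn_def)
    show "indicator B (res s w) * ennreal (Z t w $ i) = h (res t w)" unfolding h_def rr zt by (rule refl)
  qed
  also have "\<dots> = (\<integral>\<^sup>+w. ennreal (L w) * h (res t w) \<partial>P)"
    unfolding Q_def by (rule nn_integral_density_completion[OF hT]) (use L_meas in simp)
  also have "\<dots> = (\<integral>\<^sup>+w. h (res t w) * ennreal (zc dlast \<bullet> M T w) \<partial>P)"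
    by (rule nn_integral_cong_AE) (use L_eq in \<open>rule eventually_mono, simp add: mult.commute\<close>)
  also have "\<dots> = (\<integral>\<^sup>+w. h w * ennreal (zc dlast \<bullet> M t w) \<partial>kprod k t)"
    by (rule mart[OF pos_coords(1) hm st(2) order_refl])
  also have "\<dots> = (\<integral>\<^sup>+w. indicator B (res s w) * ennreal (zc i \<bullet> M t w) \<partial>kprod k t)"
  proof (rule nn_integral_cong_AE, rule AE_mono_space[OF N(2)[OF st(2)]])
    fix w assume "w \<in> space (kprod k t)" and e: "M t w = N t w"
    then have w: "w \<in> space (Om_t t)" using probs_space[OF kpr[OF st(2)]] by simp
    have "ennreal (Zn w) * ennreal (zc dlast \<bullet> M t w) = ennreal (zc i \<bullet> M t w)"
    proof (cases "M t w = 0")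
      case True
      then show ?thesis by (simp add: coords)
    next
      case False
      then have g: "M t w \<in> G t w" using MG[OF st(2) w] by blast
      have d: "0 < fst (M t w) $ dlast" "0 < fst (M t w) $ i" by (rule G_pos[OF st(2) w g])+
      then show ?thesis by (simp add: coords Zn_def e[symmetric] ennreal_mult[symmetric])
    qed
    then show "h w * ennreal (zc dlast \<bullet> M t w) = indicator B (res s w) * ennreal (zc i \<bullet> M t w)"
      by (simp add: h_def mult.assoc)
  qed
  also have "\<dots> = (\<integral>\<^sup>+w. indicator B w * ennreal (zc i \<bullet> M s w) \<partial>kprod k s)"
    by (rule mart[OF pos_coords(1) _ st]) (use B in simp)
  finally show ?thesis .
qed

lemma Z_meas: "t \<le> T \<Longrightarrow> Z t \<in> borel_measurable Q"
  using measurable_F0_Om[OF _ Z_F0] setsQ by (simp cong: measurable_cong_sets)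

lemma nth_meas: "f \<in> borel_measurable A \<Longrightarrow> (\<lambda>w. (f w :: (real, 'd) vec) $ i) \<in> borel_measurable A"
proof -
  assume f: "f \<in> borel_measurable A"
  have "(\<lambda>w. f w \<bullet> axis i 1) \<in> borel_measurable A" by (intro borel_measurable_inner f borel_measurable_const)
  then show ?thesis by (simp add: inner_axis)
qed

lemma Z_integrable: assumes t: "t \<le> T" shows "integrable Q (Z t)"
proof (rule integrable_vecI)
  fix i
  have "(\<integral>\<^sup>+w. ennreal (Z t w $ i) \<partial>Q) = (\<integral>\<^sup>+w. indicator (space (Om_t t)) (res t w) * ennreal (Z t w $ i) \<partial>Q)"
    by (intro nn_integral_cong) simp
  also have "\<dots> = (\<integral>\<^sup>+w. indicator (space (Om_t t)) w * ennreal (zc i \<bullet> M t w) \<partial>kprod k t)"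
    by (rule Z_integral[OF order_refl t]) (metis sets.top space_univ_completion)
  also have "\<dots> \<le> (\<integral>\<^sup>+w. ennreal (zc i \<bullet> M t w) \<partial>kprod k t)"
    by (intro nn_integral_mono) (simp split: split_indicator)
  also have "\<dots> = ennreal (zc i \<bullet> p0)" by (rule mart_total[OF pos_coords(1) t])
  also have "\<dots> < \<infinity>" by simp
  finally have "(\<integral>\<^sup>+w. ennreal (Z t w $ i) \<partial>Q) < \<infinity>" .
  then show "integrable Q (\<lambda>w. Z t w $ i)"
    using Z_nonneg[OF t] nth_meas[OF Z_meas[OF t]] by (intro integrableI_nonneg)
qed

text \<open>Over an event known at \<open>s\<close>, the integrals of \<open>Z s\<close> and of
  \<open>Z (Suc s)\<close> reduce by \<open>Z_integral\<close> to the same integral of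
  \<open>M s\<close>.\<close>

lemma Z_martingale: "martingale_F T Q Z"
  unfolding martingale_F_def
proof (intro conjI allI impI ballI)
  show "Z s \<in> borel_measurable (Ffilt T s)" if "s \<le> T" for s by (rule measurable_F0_Ffilt[OF Z_F0[OF that]])
  show "integrable Q (Z s)" if "s \<le> T" for s by (rule Z_integrable[OF that])
  fix s and A :: "(nat \<Rightarrow> 'w) set" assume s: "s < T" and A: "A \<in> sets (Ffilt T s)"
  obtain B where B: "B \<in> sets (univ_completion (Om_t s))" "A = (\<lambda>w. res s w) -` B \<inter> space (Om_t T)" using A unfolding sets_Ffilt by blast
  have AQ: "A \<in> sets (completion Q)"
    by (rule univ_completion_sets_completion[OF Ffilt_sub_univ[OF less_imp_le[OF s] A] Q_probs])
  have int: "integrable (completion Q) (\<lambda>w. indicator A w *\<^sub>R Z t w)" if t: "t \<le> T" for t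
    by (rule integrable_mult_indicator[OF AQ]) (use Z_integrable[OF t] integrable_completion[OF Z_meas[OF t]] in simp)
  have v: "(\<integral>w. indicator A w *\<^sub>R Z t w \<partial>completion Q) $ i = enn2real (\<integral>\<^sup>+w. indicator B w * ennreal (zc i \<bullet> M s w) \<partial>kprod k s)"
    if t: "s \<le> t" "t \<le> T" for t i
  proof -
    have "(\<integral>w. indicator A w *\<^sub>R Z t w \<partial>completion Q) $ i = (\<integral>w. indicator A w * Z t w $ i \<partial>completion Q)"
      using integral_vec_nth[OF int[OF t(2)]] by simp
    also have "\<dots> = enn2real (\<integral>\<^sup>+w. ennreal (indicator A w * Z t w $ i) \<partial>completion Q)"
    proof (rule integral_eq_nn_integral)
      have "(\<lambda>w. (indicator A w *\<^sub>R Z t w) $ i) \<in> borel_measurable (completion Q)"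
        by (rule nth_meas[OF borel_measurable_integrable[OF int[OF t(2)]]])
      then show "(\<lambda>w. indicator A w * Z t w $ i) \<in> borel_measurable (completion Q)" by simp
      show "AE w in completion Q. 0 \<le> indicator A w * Z t w $ i"
        unfolding AE_completion_iff using Z_nonneg[OF t(2), of i] by (rule eventually_mono) simp
    qed
    also have "(\<integral>\<^sup>+w. ennreal (indicator A w * Z t w $ i) \<partial>completion Q) = (\<integral>\<^sup>+w. indicator B (res s w) * ennreal (Z t w $ i) \<partial>Q)"
      unfolding nn_integral_completion
      by (intro nn_integral_cong) (auto simp: B(2) spaceQ split: split_indicator)
    also have "\<dots> = (\<integral>\<^sup>+w. indicator B w * ennreal (zc i \<bullet> M s w) \<partial>kprod k s)" by (rule Z_integral[OF t B(1)])
    finally show ?thesis .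
  qed
  show "(\<integral>w. indicator A w *\<^sub>R Z (Suc s) w \<partial>completion Q) = (\<integral>w. indicator A w *\<^sub>R Z s w \<partial>completion Q)"
    unfolding vec_eq_iff using v[of "Suc s"] v[of s] s by simp
qed

lemma QZ_S0: "(Q, Z) \<in> S0 T PP K"
proof -
  have "P \<in> PP" unfolding PP_eq using k by blast
  moreover have "absolutely_continuous P Q" unfolding Q_def
    by (rule absolutely_continuousI_density) (use L_meas in simp)
  ultimately show ?thesis unfolding S0_def
    using Q_probs Z_F0 Z_icone Z_martingale Z_dlast unfolding icone_def by blast
qed

lemma L_phi_Z: "AE w in P. L w = fst (M T w) $ dlast \<and> 0 \<le> L w \<and> L w *\<^sub>R Z T w = fst (M T w) \<and> \<phi> w * norm (fst (M T w)) \<le> rc \<bullet> M T w \<and>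
    fst (snd (M T w)) \<le> \<xi> w \<bullet> fst (M T w)"
  using NM[OF order_refl]
proof (rule AE_mono_space)
  fix w assume "w \<in> space P" and e: "M T (res T w) = N T (res T w)"
  then have w: "w \<in> space (Om_t T)" using spaceP by simp
  have e': "N T w = M T w" using e res_id[OF w] by simp
  show "L w = fst (M T w) $ dlast \<and> 0 \<le> L w \<and> L w *\<^sub>R Z T w = fst (M T w) \<and> \<phi> w * norm (fst (M T w)) \<le> rc \<bullet> M T w \<and>
    fst (snd (M T w)) \<le> \<xi> w \<bullet> fst (M T w)"
  proof (cases "M T w = 0")
    case True
    then show ?thesis by (simp add: L_def e' coords)
  next
    case False
    then have g: "M T w \<in> G T w" using MG[OF order_refl w] by blast
    have d: "0 < fst (M T w) $ dlast" by (rule G_pos[OF order_refl w g])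
    obtain z v r where zvr: "M T w = (z, v, r)" by (cases "M T w")
    show ?thesis using g d unfolding zvr G_T
      by (simp add: L_def e' zvr coords Z_def res_id[OF w])
  qed
qed

text \<open>This is the purpose of the third coordinate: at the horizon it dominates the density
  times \<open>\<phi> w * norm (Z T w)\<close>, and its mean is the finite number found in
  \<open>p0\<close>.\<close>

lemma phi_Z_integrable: "integrable Q (\<lambda>w. \<phi> w * norm (Z T w))"
proof -
  have fm: "(\<lambda>w. \<phi> w * norm (Z T w)) \<in> borel_measurable Q"
    by (intro borel_measurable_times measurable_compose[OF Z_meas[OF order_refl] borel_measurable_norm])
      (use phi_meas setsQ in \<open>simp_all cong: measurable_cong_sets\<close>)
  have fmP: "(\<lambda>w. ennreal (\<phi> w * norm (Z T w))) \<in> borel_measurable P"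
    using fm setsQ setsP by (simp cong: measurable_cong_sets)
  have "(\<integral>\<^sup>+w. ennreal (\<phi> w * norm (Z T w)) \<partial>Q) = (\<integral>\<^sup>+w. ennreal (L w) * ennreal (\<phi> w * norm (Z T w)) \<partial>P)"
    unfolding Q_def by (rule nn_integral_density) (use L_meas fmP in auto)
  also have "\<dots> \<le> (\<integral>\<^sup>+w. ennreal (rc \<bullet> M T w) \<partial>P)"
  proof (rule nn_integral_mono_AE, rule AE_mono_space[OF L_phi_Z])
    fix w assume h: "L w = fst (M T w) $ dlast \<and> 0 \<le> L w \<and> L w *\<^sub>R Z T w = fst (M T w) \<and> \<phi> w * norm (fst (M T w)) \<le> rc \<bullet> M T w \<and>
      fst (snd (M T w)) \<le> \<xi> w \<bullet> fst (M T w)"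
    have "norm (fst (M T w)) = L w * norm (Z T w)" using h by (metis abs_of_nonneg norm_scaleR)
    then have "L w * (\<phi> w * norm (Z T w)) \<le> rc \<bullet> M T w" using h by (simp add: mult.left_commute)
    then show "ennreal (L w) * ennreal (\<phi> w * norm (Z T w)) \<le> ennreal (rc \<bullet> M T w)"
      using h phi_nonneg[of w] by (simp add: ennreal_mult[symmetric] ennreal_leI)
  qed
  also have "\<dots> = ennreal (rc \<bullet> p0)" by (rule mart_total[OF pos_coords(2) order_refl])
  also have "\<dots> < \<infinity>" by simp
  finally show ?thesis using fm phi_nonneg by (intro integrableI_nonneg) auto
qed

lemma M_integral: assumes a: "pos_fun a" and a0: "0 \<le> a \<bullet> p0"
  shows "integrable (completion P) (\<lambda>w. a \<bullet> M T w)" "(\<integral>w. a \<bullet> M T w \<partial>completion P) = a \<bullet> p0"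
proof -
  have m: "(\<lambda>w. a \<bullet> M T w) \<in> borel_measurable (completion P)"
    by (rule measurable_univ_completionD[OF _ kpr[OF order_refl]]) (intro borel_measurable_inner borel_measurable_const Mm order_refl)
  have nn: "AE w in completion P. 0 \<le> a \<bullet> M T w"
  proof (rule AE_I2)
    fix w assume "w \<in> space (completion P)"
    then have w: "w \<in> space (Om_t T)" using spaceP by simp
    show "0 \<le> a \<bullet> M T w" using MG[OF order_refl w] a w unfolding pos_fun_def by (auto simp del: split_paired_All)
  qed
  have i: "(\<integral>\<^sup>+w. ennreal (a \<bullet> M T w) \<partial>completion P) = ennreal (a \<bullet> p0)"
    unfolding nn_integral_completion by (rule mart_total[OF a order_refl])
  show "integrable (completion P) (\<lambda>w. a \<bullet> M T w)" by (rule integrableI_nonneg[OF m nn]) (simp add: i)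
  show "(\<integral>w. a \<bullet> M T w \<partial>completion P) = a \<bullet> p0" by (subst integral_eq_nn_integral[OF m nn]) (simp add: i a0)
qed

text \<open>Terminal values \<open>v\<close> lie below the claim times the unnormalised price. Their
  mean is that of \<open>p0\<close>, obtained as the difference of the means of \<open>v + r\<close>
  and \<open>r\<close>.\<close>

lemma xi_Z_integral:
  assumes p0G: "\<exists>w\<in>space (Om_t 0). p0 \<in> G 0 w"
  shows "integrable Q (\<lambda>w. \<xi> w \<bullet> Z T w)" "fst (snd p0) \<le> (\<integral>w. \<xi> w \<bullet> Z T w \<partial>Q)"
proof -
  have fm: "(\<lambda>w. \<xi> w \<bullet> Z T w) \<in> borel_measurable Q"
    by (intro borel_measurable_inner Z_meas order_refl) (use xi_meas setsQ in \<open>simp cong: measurable_cong_sets\<close>)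
  show i: "integrable Q (\<lambda>w. \<xi> w \<bullet> Z T w)"
  proof (rule Bochner_Integration.integrable_bound[OF phi_Z_integrable fm], rule AE_I2)
    fix w
    have "\<bar>\<xi> w \<bullet> Z T w\<bar> \<le> norm (\<xi> w) * norm (Z T w)" by (rule Cauchy_Schwarz_ineq2)
    also have "\<dots> \<le> \<phi> w * norm (Z T w)" by (intro mult_right_mono xi_le_phi) simp
    finally show "norm (\<xi> w \<bullet> Z T w) \<le> norm (\<phi> w * norm (Z T w))" by simp
  qed
  have fmP: "(\<lambda>w. \<xi> w \<bullet> Z T w) \<in> borel_measurable P" using fm setsQ setsP by (simp cong: measurable_cong_sets)
  have L0: "AE w in P. 0 \<le> L w" using L_phi_Z by (rule eventually_mono) simp
  have iP: "integrable P (\<lambda>w. L w *\<^sub>R (\<xi> w \<bullet> Z T w))"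
    using i unfolding Q_def by (subst (asm) integrable_density[OF fmP L_meas L0])
  have eq: "(\<integral>w. \<xi> w \<bullet> Z T w \<partial>Q) = (\<integral>w. L w *\<^sub>R (\<xi> w \<bullet> Z T w) \<partial>P)"
    unfolding Q_def by (rule integral_density[OF fmP L_meas L0])
  have p: "0 \<le> rc \<bullet> p0" "0 \<le> vrc \<bullet> p0" using p0G pos_coords unfolding pos_fun_def by blast+
  note R = M_integral[OF pos_coords(2) p(1)] and VR = M_integral[OF pos_coords(3) p(2)]
  have "fst (snd p0) = vrc \<bullet> p0 - rc \<bullet> p0" by (simp add: coords)
  also have "\<dots> = (\<integral>w. vrc \<bullet> M T w - rc \<bullet> M T w \<partial>completion P)" using R VR by simp
  also have "\<dots> \<le> (\<integral>w. L w *\<^sub>R (\<xi> w \<bullet> Z T w) \<partial>completion P)"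
  proof (rule integral_mono_AE)
    show "integrable (completion P) (\<lambda>w. vrc \<bullet> M T w - rc \<bullet> M T w)" using R VR by simp
    show "integrable (completion P) (\<lambda>w. L w *\<^sub>R (\<xi> w \<bullet> Z T w))"
      using iP integrable_completion[OF borel_measurable_integrable[OF iP]] by simp
    show "AE w in completion P. vrc \<bullet> M T w - rc \<bullet> M T w \<le> L w *\<^sub>R (\<xi> w \<bullet> Z T w)"
      unfolding AE_completion_iff using L_phi_Z
    proof (rule eventually_mono)
      fix w assume h: "L w = fst (M T w) $ dlast \<and> 0 \<le> L w \<and> L w *\<^sub>R Z T w = fst (M T w) \<and> \<phi> w * norm (fst (M T w)) \<le> rc \<bullet> M T w \<and>
        fst (snd (M T w)) \<le> \<xi> w \<bullet> fst (M T w)"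
      have "L w *\<^sub>R (\<xi> w \<bullet> Z T w) = \<xi> w \<bullet> (L w *\<^sub>R Z T w)" by simp
      moreover have "L w *\<^sub>R Z T w = fst (M T w)" "fst (snd (M T w)) \<le> \<xi> w \<bullet> fst (M T w)" using h by blast+
      ultimately show "vrc \<bullet> M T w - rc \<bullet> M T w \<le> L w *\<^sub>R (\<xi> w \<bullet> Z T w)" by (simp only: coords)
    qed
  qed
  also have "\<dots> = (\<integral>w. \<xi> w \<bullet> Z T w \<partial>Q)"
    unfolding eq by (rule integral_completion[OF borel_measurable_integrable[OF iP]])
  finally show "fst (snd p0) \<le> (\<integral>w. \<xi> w \<bullet> Z T w \<partial>Q)" .
qed

end

context claim
begin

text \<open>The kernel and the next state function are chosen as one pair at each step, because the
  mean identity ties them together.\<close>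

lemma dual_process_exists:
  assumes p0: "\<And>w. w \<in> space (Om_t 0) \<Longrightarrow> p0 \<in> G 0 w" and d: "fst p0 $ dlast = 1"
  shows "\<exists>k M. dual_proc T Pt K S \<xi> \<phi> k M p0"
proof -
  define good where "good t M r \<longleftrightarrow> ksel t (fst r) \<and> snd r \<in> borel_measurable (univ_completion (Om_t (Suc t))) \<and>
    (\<forall>v\<in>space (Om_t (Suc t)). snd r v \<in> G (Suc t) v \<union> {0}) \<and>
    (\<forall>v\<in>space (Om_t (Suc t)). M (res t v) = 0 \<longrightarrow> snd r v = 0) \<and>
    (\<forall>a. pos_fun a \<longrightarrow> (\<forall>w\<in>space (Om_t t). (\<integral>\<^sup>+x. ennreal (a \<bullet> snd r (w(t := x))) \<partial>fst r w) = ennreal (a \<bullet> M w)))" for t M r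
  define st where "st t M = (SOME r. good t M r)" for t M
  define M where "M = rec_nat (\<lambda>_. p0) (\<lambda>t M. snd (st t M))"
  have M0: "M 0 = (\<lambda>_. p0)" and MS: "M (Suc t) = snd (st t (M t))" for t by (auto simp: M_def)
  define k where "k t = fst (st t (M t))" for t
  have ok: "good t (M t) (st t (M t))" if "t < T" "M t \<in> borel_measurable (univ_completion (Om_t t))"
    "\<forall>w\<in>space (Om_t t). M t w \<in> G t w \<union> {0}" for t
  proof -
    have "\<exists>r. good t (M t) r"
      using dual_step[OF that(1,2)] that(3) unfolding good_def by simp
    then show ?thesis unfolding st_def by (rule someI_ex)
  qed
  have inv: "M t \<in> borel_measurable (univ_completion (Om_t t)) \<and> (\<forall>w\<in>space (Om_t t). M t w \<in> G t w \<union> {0})" if "t \<le> T" for t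
    using that
  proof (induction t)
    case 0 then show ?case using p0 by (simp add: M0)
  next
    case (Suc t)
    then have "good t (M t) (st t (M t))" by (intro ok) auto
    then show ?case unfolding good_def MS by blast
  qed
  have gd: "good t (M t) (k t, M (Suc t))" if "t < T" for t
    using ok[OF that] inv[of t] that unfolding k_def MS by simp
  have "dual_proc T Pt K S \<xi> \<phi> k M p0"
  proof (unfold_locales)
    show "valid k" unfolding valid_def using gd unfolding good_def ksel_def by simp
    show "M 0 = (\<lambda>_. p0)" by (rule M0)
    show "M t \<in> borel_measurable (univ_completion (Om_t t))" if "t \<le> T" for t using inv[OF that] by blast
    show "M t w \<in> G t w \<union> {0}" if "t \<le> T" "w \<in> space (Om_t t)" for t w using inv[OF that(1)] that(2) by blast
    show "M (Suc t) v = 0" if "t < T" "v \<in> space (Om_t (Suc t))" "M t (res t v) = 0" for t v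
      using gd[OF that(1)] that(2,3) unfolding good_def by simp
    show "(\<integral>\<^sup>+x. ennreal (a \<bullet> M (Suc t) (w(t := x))) \<partial>k t w) = ennreal (a \<bullet> M t w)"
      if "pos_fun a" "t < T" "w \<in> space (Om_t t)" for a t w
      using gd[OF that(2)] that(1,3) unfolding good_def by (simp del: split_paired_All)
    show "fst p0 $ dlast = 1" by (rule d)
  qed
  then show ?thesis by blast
qed

theorem SCPS_exists:
  assumes p0: "\<And>w. w \<in> space (Om_t 0) \<Longrightarrow> p0 \<in> G 0 w" and d: "fst p0 $ dlast = 1"
  shows "\<exists>Q Z. (Q, Z) \<in> S0 T PP K \<and> integrable Q (\<lambda>w. \<phi> w * norm (Z T w)) \<and> fst (snd p0) \<le> (\<integral>w. \<xi> w \<bullet> Z T w \<partial>Q)"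
proof -
  obtain k M where "dual_proc T Pt K S \<xi> \<phi> k M p0" using dual_process_exists[OF assms] by blast
  then interpret dual_proc T Pt K S \<xi> \<phi> k M p0 .
  have "\<exists>w\<in>space (Om_t 0). p0 \<in> G 0 w" using p0 space_Om_nonempty[of 0] by blast
  then show ?thesis using QZ_S0 phi_Z_integrable xi_Z_integral(2) by blast
qed

end

section \<open>Weak duality\<close>

lemma measurable_probs: "R \<in> probs M \<Longrightarrow> measurable R N = measurable M N"
  by (rule measurable_cong_sets[OF probs_sets refl])

context market
begin

lemma S0D:
  assumes "(Q, Z) \<in> S0 T PP K"
  shows "Q \<in> probs (Om_t T)" "\<exists>P\<in>PP. absolutely_continuous P Q" "\<And>s. s \<le> T \<Longrightarrow> Z s \<in> borel_measurable (F0 T s)"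
    "\<And>s. s \<le> T \<Longrightarrow> AE w in Q. Z s w \<in> icone (K s w)" "martingale_F T Q Z"
    "\<And>s w. s \<le> T \<Longrightarrow> w \<in> space (Om_t T) \<Longrightarrow> Z s w $ dlast = 1"
proof -
  have *: "Q \<in> probs (Om_t T) \<and> (\<exists>P\<in>PP. absolutely_continuous P Q) \<and>
      (\<forall>s\<le>T. Z s \<in> borel_measurable (F0 T s)) \<and> (\<forall>s\<le>T. AE w in Q. Z s w \<in> icone (K s w)) \<and>
      martingale_F T Q Z \<and> (\<forall>s\<le>T. \<forall>w\<in>space (Om_t T). Z s w $ dlast = 1)"
    using assms unfolding S0_def icone_def mem_Collect_eq prod.case .
  show "Q \<in> probs (Om_t T)" "\<exists>P\<in>PP. absolutely_continuous P Q" "\<And>s. s \<le> T \<Longrightarrow> Z s \<in> borel_measurable (F0 T s)"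
    "\<And>s. s \<le> T \<Longrightarrow> AE w in Q. Z s w \<in> icone (K s w)" "martingale_F T Q Z"
    "\<And>s w. s \<le> T \<Longrightarrow> w \<in> space (Om_t T) \<Longrightarrow> Z s w $ dlast = 1"
    using * by simp_all
qed

lemma qs_AE:
  assumes QZ: "(Q, Z) \<in> S0 T PP K" and q: "qs T PP \<psi>"
  shows "AE w in Q. \<psi> w"
proof -
  obtain P where P: "P \<in> PP" "absolutely_continuous P Q" using S0D(2)[OF QZ] by blast
  obtain k where k: "valid k" "P = kprod k T" using P(1) unfolding PP_eq by blast
  obtain N where N: "polar T N" "\<And>w. w \<in> space (Om_t T) \<Longrightarrow> w \<notin> N \<Longrightarrow> \<psi> w" using q by (rule qs_polarD) blast
  have "AE w in P. w \<notin> N" using N(1) k unfolding polar_def by blast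
  then have "AE w in Q. w \<notin> N"
    by (rule absolutely_continuous_AE[OF _ P(2), rotated])
      (use probs_sets[OF S0D(1)[OF QZ]] probs_sets[OF valid_probs[OF k(1) order_refl]] k(2) in simp)
  then show ?thesis by (rule AE_mono_space) (use N(2) probs_space[OF S0D(1)[OF QZ]] in simp)
qed

lemma Ffilt_mono: assumes "s \<le> t" "t \<le> T" "f \<in> measurable (Ffilt T s) N" shows "f \<in> measurable (Ffilt T t) N"
proof (rule measurableI)
  fix A assume "A \<in> sets N"
  then have "f -` A \<inter> space (Om_t T) \<in> sets (Ffilt T s)" using measurable_sets[OF assms(3)] by simp
  then have "\<exists>B. f -` A \<inter> space (Om_t T) = (\<lambda>w. res s w) -` B \<inter> space (Om_t T) \<and> B \<in> sets (univ_completion (Om_t s))"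
    unfolding sets_Ffilt mem_Collect_eq .
  then obtain B where B: "B \<in> sets (univ_completion (Om_t s))" "f -` A \<inter> space (Om_t T) = (\<lambda>w. res s w) -` B \<inter> space (Om_t T)"
    by (elim exE conjE)
  let ?B = "(\<lambda>w. res s w) -` B \<inter> space (univ_completion (Om_t t))"
  have "?B \<in> sets (univ_completion (Om_t t))"
    by (rule measurable_sets[OF measurable_univ_completion_lift[OF measurable_res[OF assms(1)]] B(1)])
  moreover have "f -` A \<inter> space (Om_t T) = (\<lambda>w. res t w) -` ?B \<inter> space (Om_t T)"
  proof -
    have "(w \<in> space (Om_t T) \<and> res s w \<in> B) \<longleftrightarrow> (w \<in> space (Om_t T) \<and> res t w \<in> space (univ_completion (Om_t t)) \<and> res s (res t w) \<in> B)" for w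
      unfolding res_res[OF assms(1)] space_univ_completion using res_Om by blast
    then show ?thesis unfolding B(2) by blast
  qed
  ultimately have "\<exists>B. f -` A \<inter> space (Om_t T) = (\<lambda>w. res t w) -` B \<inter> space (Om_t T) \<and> B \<in> sets (univ_completion (Om_t t))" by blast
  then show "f -` A \<inter> space (Ffilt T t) \<in> sets (Ffilt T t)" unfolding sets_Ffilt space_Ffilt by (rule CollectI)
qed (use measurable_space[OF assms(3)] in simp)

text \<open>Used to pass from events of the completed filtration to Borel events when testing the
  martingale property of a mixture.\<close>

lemma Ffilt_F0_AE:
  assumes R: "R \<in> probs (Om_t T)" and s: "s \<le> T" and A: "A \<in> sets (Ffilt T s)"
  shows "\<exists>A'\<in>sets (F0 T s). AE w in R. w \<in> A \<longleftrightarrow> w \<in> A'"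
proof -
  interpret prob_space R by (rule probs_prob[OF R])
  obtain B where B: "B \<in> sets (univ_completion (Om_t s))" "A = (\<lambda>w. res s w) -` B \<inter> space (Om_t T)" 
    using A unfolding sets_Ffilt mem_Collect_eq by (elim exE conjE)
  have m: "(\<lambda>w. res s w) \<in> measurable R (Om_t s)" unfolding measurable_probs[OF R] by (rule measurable_res[OF s])
  let ?\<mu> = "distr R (Om_t s) (\<lambda>w. res s w)"
  have "?\<mu> \<in> probs (Om_t s)" unfolding probs_def using prob_space_distr[OF m] by simp
  from univ_completion_sets_completion[OF B(1) this]
  obtain E U U' where E: "B = E \<union> U" "U \<subseteq> U'" "U' \<in> null_sets ?\<mu>" "E \<in> sets ?\<mu>" by (rule sets_completionE)
  have U': "U' \<in> sets (Om_t s)" using null_setsD2[OF E(3)] unfolding sets_distr .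
  have "emeasure R ((\<lambda>w. res s w) -` U' \<inter> space R) = 0" using null_setsD1[OF E(3)] unfolding emeasure_distr[OF m U'] .
  then have "(\<lambda>w. res s w) -` U' \<inter> space R \<in> null_sets R" by (rule null_setsI[OF _ measurable_sets[OF m U']])
  from AE_not_in[OF this] have "AE w in R. w \<in> A \<longleftrightarrow> w \<in> (\<lambda>w. res s w) -` E \<inter> space (Om_t T)"
    by (rule AE_mono_space) (use E(2) in \<open>unfold E(1) B(2) probs_space[OF R], blast\<close>)
  moreover have "(\<lambda>w. res s w) -` E \<inter> space (Om_t T) \<in> sets (F0 T s)"
    unfolding sets_F0 using E(4) unfolding sets_distr by blast
  ultimately show ?thesis by (rule bexI)
qed

lemma S0_Q_meas: "(Q, Z) \<in> S0 T PP K \<Longrightarrow> s \<le> T \<Longrightarrow> Z s \<in> borel_measurable Q"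
  by (subst measurable_probs[OF S0D(1)], assumption) (rule measurable_F0_Om[OF _ S0D(3)])

lemma vec_nth_meas: "f \<in> borel_measurable A \<Longrightarrow> (\<lambda>w. (f w :: (real, 'd) vec) $ i) \<in> borel_measurable A"
proof -
  assume f: "f \<in> borel_measurable A"
  have "(\<lambda>w. f w \<bullet> axis i 1) \<in> borel_measurable A" by (intro borel_measurable_inner f borel_measurable_const)
  then show ?thesis by (simp add: inner_axis)
qed

lemma subalgebra_Ffilt:
  assumes R: "R \<in> probs (Om_t T)" and s: "s \<le> T"
  shows "sigma_finite_subalgebra (completion R) (Ffilt T s)"
proof (rule finite_measure_subalgebra_is_sigma_finite)
  interpret prob_space R by (rule probs_prob[OF R])
  interpret c: prob_space "completion R" by (rule prob_space_completion)
  have "subalgebra (completion R) (Ffilt T s)" unfolding subalgebra_def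
    using probs_space[OF R] univ_completion_sets_completion[OF Ffilt_sub_univ[OF s] R] by auto
  then show "finite_measure_subalgebra (completion R) (Ffilt T s)"
    unfolding finite_measure_subalgebra_def finite_measure_subalgebra_axioms_def using c.finite_measure_axioms by simp
qed

section \<open>One time step against an unbounded position\<close>

context
  fixes Q Z t and X :: "(nat \<Rightarrow> 'w) \<Rightarrow> (real, 'd) vec"
  assumes QZ: "(Q, Z) \<in> S0 T PP K" and t: "t < T" and X: "X \<in> borel_measurable (Ffilt T t)"
begin

interpretation sub: sigma_finite_subalgebra "completion Q" "Ffilt T t"
  by (rule subalgebra_Ffilt[OF S0D(1)[OF QZ]]) (use t in simp)

lemma cQ_meas: "f \<in> borel_measurable (Ffilt T t) \<Longrightarrow> f \<in> borel_measurable (completion Q)"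
  by (rule measurable_from_subalg[OF sub.subalg])

lemma Z_int: assumes s: "s \<le> T" shows "integrable (completion Q) (Z s)"
proof -
  have "integrable Q (Z s)" using S0D(5)[OF QZ] s unfolding martingale_F_def by simp
  then show ?thesis unfolding integrable_completion[OF S0_Q_meas[OF QZ s]] .
qed

lemma Z_intn: "s \<le> T \<Longrightarrow> integrable (completion Q) (\<lambda>w. Z s w $ i)"
  using integrable_bounded_linear[OF bounded_linear_vec_nth[of i] Z_int] by simp

lemma cond_Z: "AE w in completion Q. real_cond_exp (completion Q) (Ffilt T t) (\<lambda>w. Z (Suc t) w $ i) w = Z t w $ i"
proof (rule sub.real_cond_exp_charact)
  fix A :: "(nat \<Rightarrow> 'w) set" assume A: "A \<in> sets (Ffilt T t)"
  then have AQ: "A \<in> sets (completion Q)" using sub.subalg unfolding subalgebra_def by blast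
  have e: "(LINT w|completion Q. indicator A w *\<^sub>R Z (Suc t) w) = (LINT w|completion Q. indicator A w *\<^sub>R Z t w)"
    using S0D(5)[OF QZ] t A unfolding martingale_F_def by blast
  have i: "integrable (completion Q) (\<lambda>w. indicator A w *\<^sub>R Z s w)" if "s \<le> T" for s
    by (rule integrable_mult_indicator[OF AQ Z_int[OF that]])
  have "(LINT w|completion Q. (indicator A w *\<^sub>R Z (Suc t) w) $ i) = (LINT w|completion Q. (indicator A w *\<^sub>R Z t w) $ i)"
    using arg_cong[OF e, of "\<lambda>v. v $ i"] integral_vec_nth[OF i] t by simp
  then show "(LINT w:A|completion Q. Z (Suc t) w $ i) = (LINT w:A|completion Q. Z t w $ i)"
    by (simp add: set_lebesgue_integral_def)
next
  show "(\<lambda>w. Z t w $ i) \<in> borel_measurable (Ffilt T t)"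
    using vec_nth_meas[OF measurable_F0_Ffilt[OF S0D(3)[OF QZ]]] t by simp
qed (use Z_intn t in auto)

lemma bounded_swap:
  assumes h: "h \<in> borel_measurable (Ffilt T t)" and b: "\<And>w. norm (h w) \<le> c"
  shows "(\<integral>w. h w \<bullet> Z (Suc t) w \<partial>completion Q) = (\<integral>w. h w \<bullet> Z t w \<partial>completion Q)"
    "\<And>s. s \<le> T \<Longrightarrow> integrable (completion Q) (\<lambda>w. h w \<bullet> Z s w)"
proof -
  have hi: "(\<lambda>w. h w $ i) \<in> borel_measurable (Ffilt T t)" for i by (rule vec_nth_meas[OF h])
  have int: "integrable (completion Q) (\<lambda>w. h w $ i * Z s w $ i)" if s: "s \<le> T" for s i
  proof (rule Bochner_Integration.integrable_bound)
    show "integrable (completion Q) (\<lambda>w. c * Z s w $ i)" using Z_intn[OF s] by simp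
    show "(\<lambda>w. h w $ i * Z s w $ i) \<in> borel_measurable (completion Q)"
      by (intro borel_measurable_times cQ_meas[OF hi] borel_measurable_integrable[OF Z_intn[OF s]])
    show "AE w in completion Q. norm (h w $ i * Z s w $ i) \<le> norm (c * Z s w $ i)"
    proof (rule AE_I2)
      fix w
      have "\<bar>h w $ i\<bar> \<le> \<bar>c\<bar>" using component_le_norm_cart[of "h w" i] b[of w] by linarith
      then show "norm (h w $ i * Z s w $ i) \<le> norm (c * Z s w $ i)" by (simp add: abs_mult mult_right_mono)
    qed
  qed
  have iv: "h w \<bullet> Z s w = (\<Sum>i\<in>UNIV. h w $ i * Z s w $ i)" for w s by (simp add: inner_vec_def)
  show "integrable (completion Q) (\<lambda>w. h w \<bullet> Z s w)" if "s \<le> T" for s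
    unfolding iv by (intro Bochner_Integration.integrable_sum int[OF that])
  have "(\<integral>w. h w $ i * Z (Suc t) w $ i \<partial>completion Q) = (\<integral>w. h w $ i * Z t w $ i \<partial>completion Q)" for i
  proof -
    have "(\<integral>w. h w $ i * Z (Suc t) w $ i \<partial>completion Q) =
        (\<integral>w. h w $ i * real_cond_exp (completion Q) (Ffilt T t) (\<lambda>w. Z (Suc t) w $ i) w \<partial>completion Q)"
      by (rule sub.real_cond_exp_intg(2)[symmetric])
        (use int[of "Suc t" i] t hi borel_measurable_integrable[OF Z_intn[of "Suc t" i]] in auto)
    also have "\<dots> = (\<integral>w. h w $ i * Z t w $ i \<partial>completion Q)"
    proof (rule integral_cong_AE)
      show "(\<lambda>w. h w $ i * Z t w $ i) \<in> borel_measurable (completion Q)"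
        by (rule borel_measurable_integrable[OF int]) (use t in simp)
      show "AE w in completion Q. h w $ i * real_cond_exp (completion Q) (Ffilt T t) (\<lambda>w. Z (Suc t) w $ i) w = h w $ i * Z t w $ i"
        using cond_Z[of i] by (rule eventually_mono) simp
      show "(\<lambda>w. h w $ i * real_cond_exp (completion Q) (Ffilt T t) (\<lambda>w. Z (Suc t) w $ i) w) \<in> borel_measurable (completion Q)"
        by (intro borel_measurable_times cQ_meas[OF hi] borel_measurable_cond_exp2)
    qed
    finally show ?thesis .
  qed
  then show "(\<integral>w. h w \<bullet> Z (Suc t) w \<partial>completion Q) = (\<integral>w. h w \<bullet> Z t w \<partial>completion Q)"
    unfolding iv using int t by simp
qed

text \<open>The event that \<open>X\<close> has norm at most \<open>n\<close> is known at time
  \<open>t\<close>, so cutting off there leaves a bounded integrand, to which the martingale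
  property applies.\<close>

lemma trunc_swap:
  assumes C: "C \<in> sets (Ffilt T t)"
  shows "(\<integral>w. indicator (C \<inter> {w. norm (X w) \<le> real n}) w * (X w \<bullet> Z (Suc t) w) \<partial>completion Q) =
      (\<integral>w. indicator (C \<inter> {w. norm (X w) \<le> real n}) w * (X w \<bullet> Z t w) \<partial>completion Q)"
    "\<And>s. s \<le> T \<Longrightarrow> integrable (completion Q) (\<lambda>w. indicator (C \<inter> {w. norm (X w) \<le> real n}) w * (X w \<bullet> Z s w))"
proof -
  let ?B = "C \<inter> {w. norm (X w) \<le> real n}"
  let ?h = "\<lambda>w. indicator ?B w *\<^sub>R X w"
  have "C \<inter> {w \<in> space (Ffilt T t). norm (X w) \<le> real n} \<in> sets (Ffilt T t)"
    by (intro sets.Int C borel_measurable_le measurable_compose[OF X borel_measurable_norm] borel_measurable_const)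
  moreover have "C \<inter> {w \<in> space (Ffilt T t). norm (X w) \<le> real n} = ?B" using sets.sets_into_space[OF C] by auto
  ultimately have BS: "?B \<in> sets (Ffilt T t)" by simp
  have hm: "?h \<in> borel_measurable (Ffilt T t)" by (intro borel_measurable_scaleR borel_measurable_indicator BS X)
  have hb: "norm (?h w) \<le> real n" for w by (auto split: split_indicator)
  from bounded_swap[OF hm hb] show "(\<integral>w. indicator ?B w * (X w \<bullet> Z (Suc t) w) \<partial>completion Q) =
      (\<integral>w. indicator ?B w * (X w \<bullet> Z t w) \<partial>completion Q)"
    "\<And>s. s \<le> T \<Longrightarrow> integrable (completion Q) (\<lambda>w. indicator ?B w * (X w \<bullet> Z s w))" by simp_all
qed

lemma XZ_meas: "s \<le> T \<Longrightarrow> (\<lambda>w. X w \<bullet> Z s w) \<in> borel_measurable (completion Q)"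
  by (intro borel_measurable_inner cQ_meas[OF X] borel_measurable_integrable[OF Z_int])

lemma nn_trunc_le:
  assumes f: "f \<in> borel_measurable (completion Q)" and le: "\<And>n. (\<integral>\<^sup>+w. indicator {w. norm (X w) \<le> real n} w * ennreal (f w) \<partial>completion Q) \<le> c"
  shows "(\<integral>\<^sup>+w. ennreal (f w) \<partial>completion Q) \<le> c"
proof -
  let ?g = "\<lambda>n w. indicator {w. norm (X w) \<le> real n} w * ennreal (f w)"
  have s: "(SUP n. ?g n w) = ennreal (f w)" for w
  proof (rule antisym)
    show "(SUP n. ?g n w) \<le> ennreal (f w)" by (intro SUP_least) (auto split: split_indicator)
    obtain n :: nat where "norm (X w) \<le> real n" using real_arch_simple by blast
    then have "ennreal (f w) = ?g n w" by simp
    also have "\<dots> \<le> (SUP n. ?g n w)" by (rule SUP_upper) simp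
    finally show "ennreal (f w) \<le> (SUP n. ?g n w)" .
  qed
  have "(\<integral>\<^sup>+w. ennreal (f w) \<partial>completion Q) = (\<integral>\<^sup>+w. (SUP n. ?g n w) \<partial>completion Q)" by (simp only: s)
  also have "\<dots> = (SUP n. \<integral>\<^sup>+w. ?g n w \<partial>completion Q)"
  proof (rule nn_integral_monotone_convergence_SUP)
    show "incseq ?g" by (intro incseq_SucI le_funI) (auto split: split_indicator)
    fix n
    have "{w \<in> space (completion Q). norm (X w) \<le> real n} \<in> sets (completion Q)"
      by (intro borel_measurable_le measurable_compose[OF cQ_meas[OF X] borel_measurable_norm] borel_measurable_const)
    then have "(\<lambda>w. indicator {w \<in> space (completion Q). norm (X w) \<le> real n} w * ennreal (f w)) \<in> borel_measurable (completion Q)"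
      using f by simp
    then show "?g n \<in> borel_measurable (completion Q)"
      by (rule measurable_cong[THEN iffD1, rotated]) (auto split: split_indicator)
  qed
  also have "\<dots> \<le> c" by (rule SUP_least) (rule le)
  finally show ?thesis .
qed

text \<open>On the event where \<open>X w \<bullet> Z t w\<close> is negative, the truncated
  exchange bounds the mean of the negative part at \<open>t\<close> by that at \<open>Suc t\<close>;
  monotone convergence removes the truncation.\<close>

lemma step_down:
  assumes fin: "(\<integral>\<^sup>+w. ennreal (- (X w \<bullet> Z (Suc t) w)) \<partial>completion Q) < \<infinity>"
  shows "(\<integral>\<^sup>+w. ennreal (- (X w \<bullet> Z t w)) \<partial>completion Q) < \<infinity>"
proof -
  have tT: "t \<le> T" "Suc t \<le> T" using t by auto
  define C where "C = {w \<in> space (Ffilt T t). X w \<bullet> Z t w < 0}"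
  have CS: "C \<in> sets (Ffilt T t)" unfolding C_def
    by (intro borel_measurable_less borel_measurable_inner X measurable_F0_Ffilt[OF S0D(3)[OF QZ tT(1)]] borel_measurable_const)
  have "(\<integral>\<^sup>+w. ennreal (- (X w \<bullet> Z t w)) \<partial>completion Q) \<le> (\<integral>\<^sup>+w. ennreal (- (X w \<bullet> Z (Suc t) w)) \<partial>completion Q)"
  proof (rule nn_trunc_le)
    show "(\<lambda>w. - (X w \<bullet> Z t w)) \<in> borel_measurable (completion Q)" using XZ_meas[OF tT(1)] by simp
    fix n :: nat
    let ?B = "C \<inter> {w. norm (X w) \<le> real n}"
    note sw = trunc_swap(1)[OF CS, where n=n] trunc_swap(2)[OF CS, where n=n]
    have i: "integrable (completion Q) (\<lambda>w. - (indicator ?B w * (X w \<bullet> Z s w)))" if "s \<le> T" for s using sw(2)[OF that] by simp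
    have "(\<integral>\<^sup>+w. indicator {w. norm (X w) \<le> real n} w * ennreal (- (X w \<bullet> Z t w)) \<partial>completion Q) =
        (\<integral>\<^sup>+w. ennreal (- (indicator ?B w * (X w \<bullet> Z t w))) \<partial>completion Q)"
    proof (rule nn_integral_cong)
      fix w assume w: "w \<in> space (completion Q)"
      then have wC: "w \<in> C \<longleftrightarrow> X w \<bullet> Z t w < 0" using probs_space[OF S0D(1)[OF QZ]] by (simp add: C_def)
      show "indicator {w. norm (X w) \<le> real n} w * ennreal (- (X w \<bullet> Z t w)) = ennreal (- (indicator ?B w * (X w \<bullet> Z t w)))"
        using wC by (cases "w \<in> C"; cases "norm (X w) \<le> real n") (simp_all add: ennreal_neg)
    qed
    also have "\<dots> = ennreal (\<integral>w. - (indicator ?B w * (X w \<bullet> Z t w)) \<partial>completion Q)"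
      by (rule nn_integral_eq_integral[OF i[OF tT(1)]]) (auto simp: C_def split: split_indicator intro!: AE_I2)
    also have "(\<integral>w. - (indicator ?B w * (X w \<bullet> Z t w)) \<partial>completion Q) = (\<integral>w. - (indicator ?B w * (X w \<bullet> Z (Suc t) w)) \<partial>completion Q)"
      using sw(1) by simp
    also have "ennreal \<dots> \<le> (\<integral>\<^sup>+w. ennreal (- (indicator ?B w * (X w \<bullet> Z (Suc t) w))) \<partial>completion Q)"
    proof -
      let ?f = "\<lambda>w. - (indicator ?B w * (X w \<bullet> Z (Suc t) w))"
      have "(\<integral>w. ?f w \<partial>completion Q) \<le> (\<integral>w. max 0 (?f w) \<partial>completion Q)"
        by (rule integral_mono[OF i[OF tT(2)]]) (use i[OF tT(2)] in auto)
      then have "ennreal (\<integral>w. ?f w \<partial>completion Q) \<le> ennreal (\<integral>w. max 0 (?f w) \<partial>completion Q)" by (rule ennreal_leI)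
      also have "\<dots> = (\<integral>\<^sup>+w. ennreal (max 0 (?f w)) \<partial>completion Q)"
        by (rule nn_integral_eq_integral[symmetric]) (use i[OF tT(2)] in auto)
      also have "\<dots> = (\<integral>\<^sup>+w. ennreal (?f w) \<partial>completion Q)" by (simp add: max_def ennreal_neg cong: if_cong)
          (intro nn_integral_cong, simp add: ennreal_neg)
      finally show ?thesis .
    qed
    also have "\<dots> \<le> (\<integral>\<^sup>+w. ennreal (- (X w \<bullet> Z (Suc t) w)) \<partial>completion Q)"
      by (intro nn_integral_mono) (auto split: split_indicator)
    finally show "(\<integral>\<^sup>+w. indicator {w. norm (X w) \<le> real n} w * ennreal (- (X w \<bullet> Z t w)) \<partial>completion Q)
        \<le> (\<integral>\<^sup>+w. ennreal (- (X w \<bullet> Z (Suc t) w)) \<partial>completion Q)" .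
  qed
  then show ?thesis using fin by (rule order_le_less_trans)
qed

text \<open>The truncated means agree with those of the integrable
  \<open>X w \<bullet> Z t w\<close>, and the negative part is controlled, so the positive part has
  a uniform bound. Once integrability is known, dominated convergence gives the equality.\<close>

lemma step_up:
  assumes fin: "(\<integral>\<^sup>+w. ennreal (- (X w \<bullet> Z (Suc t) w)) \<partial>completion Q) < \<infinity>"
    and int: "integrable (completion Q) (\<lambda>w. X w \<bullet> Z t w)"
  shows "integrable (completion Q) (\<lambda>w. X w \<bullet> Z (Suc t) w)"
    "(\<integral>w. X w \<bullet> Z (Suc t) w \<partial>completion Q) = (\<integral>w. X w \<bullet> Z t w \<partial>completion Q)"
proof -
  have tT: "t \<le> T" "Suc t \<le> T" using t by auto
  let ?g = "\<lambda>w. X w \<bullet> Z (Suc t) w" and ?f = "\<lambda>w. X w \<bullet> Z t w"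
  have gm: "?g \<in> borel_measurable (completion Q)" by (rule XZ_meas[OF tT(2)])
  have neg: "integrable (completion Q) (\<lambda>w. max 0 (- ?g w))"
  proof (rule integrableI_nonneg)
    have "(\<integral>\<^sup>+w. ennreal (max 0 (- ?g w)) \<partial>completion Q) = (\<integral>\<^sup>+w. ennreal (- ?g w) \<partial>completion Q)"
      by (intro nn_integral_cong) (simp add: max_def ennreal_neg)
    then show "(\<integral>\<^sup>+w. ennreal (max 0 (- ?g w)) \<partial>completion Q) < \<infinity>" using fin by simp
  qed (use gm in auto)
  have FS: "space (Ffilt T t) \<in> sets (Ffilt T t)" by (rule sets.top)
  let ?B = "\<lambda>n. space (Ffilt T t) \<inter> {w. norm (X w) \<le> real n}"
  note sw = trunc_swap[OF FS]
  let ?c = "(\<integral>w. \<bar>?f w\<bar> \<partial>completion Q) + (\<integral>w. max 0 (- ?g w) \<partial>completion Q)"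
  have "(\<integral>\<^sup>+w. ennreal (?g w) \<partial>completion Q) \<le> ennreal ?c"
  proof (rule nn_trunc_le[OF gm])
    fix n
    have ip: "integrable (completion Q) (\<lambda>w. max 0 (indicator (?B n) w * ?g w))" using sw(2)[OF tT(2), of n] by simp
    have "(\<integral>\<^sup>+w. indicator {w. norm (X w) \<le> real n} w * ennreal (?g w) \<partial>completion Q) =
        (\<integral>\<^sup>+w. ennreal (max 0 (indicator (?B n) w * ?g w)) \<partial>completion Q)"
    proof (rule nn_integral_cong)
      fix w assume "w \<in> space (completion Q)"
      then have "w \<in> space (Ffilt T t)" using probs_space[OF S0D(1)[OF QZ]] by simp
      then show "indicator {w. norm (X w) \<le> real n} w * ennreal (?g w) = ennreal (max 0 (indicator (?B n) w * ?g w))"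
        by (cases "norm (X w) \<le> real n") (simp_all add: max_def ennreal_neg)
    qed
    also have "\<dots> = ennreal (\<integral>w. max 0 (indicator (?B n) w * ?g w) \<partial>completion Q)"
      by (rule nn_integral_eq_integral[OF ip]) simp
    also have "\<dots> \<le> ennreal ?c"
    proof (rule ennreal_leI)
      have "(\<integral>w. max 0 (indicator (?B n) w * ?g w) \<partial>completion Q) \<le> (\<integral>w. indicator (?B n) w * ?g w + max 0 (- ?g w) \<partial>completion Q)"
        by (rule integral_mono[OF ip]) (use sw(2)[OF tT(2), of n] neg in \<open>auto split: split_indicator\<close>)
      also have "\<dots> = (\<integral>w. indicator (?B n) w * ?g w \<partial>completion Q) + (\<integral>w. max 0 (- ?g w) \<partial>completion Q)"
        using sw(2)[OF tT(2), of n] neg by simp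
      also have "(\<integral>w. indicator (?B n) w * ?g w \<partial>completion Q) = (\<integral>w. indicator (?B n) w * ?f w \<partial>completion Q)" by (rule sw(1))
      also have "\<dots> \<le> (\<integral>w. \<bar>?f w\<bar> \<partial>completion Q)"
        by (rule integral_mono[OF sw(2)[OF tT(1)]]) (use int in \<open>auto split: split_indicator\<close>)
      finally show "(\<integral>w. max 0 (indicator (?B n) w * ?g w) \<partial>completion Q) \<le> ?c" by simp
    qed
    finally show "(\<integral>\<^sup>+w. indicator {w. norm (X w) \<le> real n} w * ennreal (?g w) \<partial>completion Q) \<le> ennreal ?c" .
  qed
  then have "(\<integral>\<^sup>+w. ennreal (?g w) \<partial>completion Q) < \<infinity>" by (simp add: order_le_less_trans)
  then show gi: "integrable (completion Q) ?g" using fin gm unfolding real_integrable_def by auto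
  have lim: "(\<lambda>n. \<integral>w. indicator (?B n) w * h w \<partial>completion Q) \<longlonglongrightarrow> (\<integral>w. h w \<partial>completion Q)"
    if h: "integrable (completion Q) h" and bm: "\<And>n. (\<lambda>w. indicator (?B n) w * h w) \<in> borel_measurable (completion Q)" for h :: "_ \<Rightarrow> real"
  proof (rule integral_dominated_convergence[where w="\<lambda>w. \<bar>h w\<bar>"])
    show "AE w in completion Q. (\<lambda>n. indicator (?B n) w * h w) \<longlonglongrightarrow> h w"
    proof (rule AE_I2)
      fix w assume "w \<in> space (completion Q)"
      then have w: "w \<in> space (Ffilt T t)" using probs_space[OF S0D(1)[OF QZ]] by simp
      obtain m :: nat where m: "norm (X w) \<le> real m" using real_arch_simple by blast
      have "indicator (?B n) w * h w = h w" if "m \<le> n" for n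
        using w m that by (simp add: order_trans[OF m])
      then show "(\<lambda>n. indicator (?B n) w * h w) \<longlonglongrightarrow> h w"
        by (intro tendsto_eventually) (auto simp: eventually_sequentially)
    qed
    show "AE w in completion Q. norm (indicator (?B n) w * h w) \<le> \<bar>h w\<bar>" for n by (auto split: split_indicator)
  qed (use h bm in auto)
  have "(\<lambda>n. \<integral>w. indicator (?B n) w * ?g w \<partial>completion Q) \<longlonglongrightarrow> (\<integral>w. ?g w \<partial>completion Q)"
    by (rule lim[OF gi borel_measurable_integrable[OF sw(2)[OF tT(2)]]])
  moreover have "(\<lambda>n. \<integral>w. indicator (?B n) w * ?g w \<partial>completion Q) \<longlonglongrightarrow> (\<integral>w. ?f w \<partial>completion Q)"
    unfolding sw(1) by (rule lim[OF int borel_measurable_integrable[OF sw(2)[OF tT(1)]]])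
  ultimately show "(\<integral>w. ?g w \<partial>completion Q) = (\<integral>w. ?f w \<partial>completion Q)" by (rule LIMSEQ_unique)
qed

end

text \<open>The integrable lower bound \<open>W\<close> controls the negative part at the horizon,
  and a backward pass carries this control to time 0. A forward pass starts from the nonpositive
  value at time 0 and yields integrability with nonpositive mean at each date, since every trade
  lowers the value.\<close>

theorem weak_duality:
  assumes QZ: "(Q, Z) \<in> S0 T PP K" and \<eta>: "\<eta> \<in> adm T PP K" and W: "integrable Q W"
    and le: "AE w in Q. W w \<le> (\<Sum>t\<in>{0..T}. \<eta> t w) \<bullet> Z T w"
  shows "(\<integral>w. W w \<partial>Q) \<le> 0"
proof -
  let ?R = "completion Q"
  define X where "X t w = (\<Sum>s\<in>{0..t}. \<eta> s w)" for t w
  have \<eta>m: "\<eta> t \<in> borel_measurable (Ffilt T t)" and \<eta>q: "qs T PP (\<lambda>w. - \<eta> t w \<in> K t w)" if "t \<le> T" for t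
    using \<eta> that unfolding adm_def by auto
  have Xm: "X t \<in> borel_measurable (Ffilt T t)" if t: "t \<le> T" for t
    unfolding X_def[abs_def] by (intro borel_measurable_sum Ffilt_mono[OF _ t \<eta>m]) (use t in auto)
  have cm: "(\<lambda>w. X t w \<bullet> Z s w) \<in> borel_measurable ?R" if "t \<le> T" "s \<le> T" for t s
  proof (rule borel_measurable_inner)
    show "X t \<in> borel_measurable ?R"
      by (rule measurable_from_subalg[OF sigma_finite_subalgebra.subalg[OF subalgebra_Ffilt[OF S0D(1)[OF QZ] that(1)]] Xm[OF that(1)]])
    show "Z s \<in> borel_measurable ?R" by (rule measurable_completion[OF S0_Q_meas[OF QZ that(2)]])
  qed
  have \<eta>Z: "AE w in ?R. \<eta> t w \<bullet> Z t w \<le> 0" if t: "t \<le> T" for t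
  proof -
    have "AE w in Q. \<eta> t w \<bullet> Z t w \<le> 0"
      using qs_AE[OF QZ \<eta>q[OF t]] S0D(4)[OF QZ t]
    proof (rule AE_mp[OF AE_conjI], intro AE_I2 impI)
      fix w assume h: "- \<eta> t w \<in> K t w \<and> Z t w \<in> icone (K t w)"
      have "0 \<le> - \<eta> t w \<bullet> Z t w"
        using icone_pos[of "Z t w" "K t w" "- \<eta> t w"] h by (cases "- \<eta> t w = 0") (auto simp: less_imp_le)
      then show "\<eta> t w \<bullet> Z t w \<le> 0" by simp
    qed
    then show ?thesis by (simp add: AE_completion_iff)
  qed
  have WR: "integrable ?R W" "(\<integral>w. W w \<partial>?R) = (\<integral>w. W w \<partial>Q)"
    using W integrable_completion[OF borel_measurable_integrable[OF W]] integral_completion[OF borel_measurable_integrable[OF W]] by auto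
  have XS: "X (Suc t) w = X t w + \<eta> (Suc t) w" for t w by (simp add: X_def)
  have leT: "AE w in ?R. W w \<le> X T w \<bullet> Z T w" using le unfolding X_def AE_completion_iff .
  have mono_step: "AE w in ?R. X (Suc t) w \<bullet> Z (Suc t) w \<le> X t w \<bullet> Z (Suc t) w" if "t < T" for t
    using \<eta>Z[of "Suc t"] that by (auto simp: XS inner_add_left elim!: eventually_mono)
  have down': "(\<integral>\<^sup>+w. ennreal (- (X t w \<bullet> Z (Suc t) w)) \<partial>?R) < \<infinity>"
    if "t < T" and f: "(\<integral>\<^sup>+w. ennreal (- (X (Suc t) w \<bullet> Z (Suc t) w)) \<partial>?R) < \<infinity>" for t
  proof (rule order_le_less_trans[OF _ f], rule nn_integral_mono_AE)
    show "AE w in ?R. ennreal (- (X t w \<bullet> Z (Suc t) w)) \<le> ennreal (- (X (Suc t) w \<bullet> Z (Suc t) w))"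
      using mono_step[OF that(1)] by (rule eventually_mono) (simp add: ennreal_leI)
  qed
  have down: "(\<integral>\<^sup>+w. ennreal (- (X t w \<bullet> Z t w)) \<partial>?R) < \<infinity>" if "t \<le> T" for t
    using that
  proof (induction t rule: inc_induct)
    case base
    have "(\<integral>\<^sup>+w. ennreal (- (X T w \<bullet> Z T w)) \<partial>?R) \<le> (\<integral>\<^sup>+w. ennreal (norm (W w)) \<partial>?R)"
      by (rule nn_integral_mono_AE) (use leT in \<open>auto elim!: eventually_mono intro!: ennreal_leI\<close>)
    also have "\<dots> < \<infinity>" using WR(1) unfolding integrable_iff_bounded by simp
    finally show ?case .
  next
    case (step t)
    show ?case by (rule step_down[OF QZ step.hyps(2) Xm down'[OF step.hyps(2) step.IH]]) (use step.hyps in simp)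
  qed
  have up: "integrable ?R (\<lambda>w. X t w \<bullet> Z t w) \<and> (\<integral>w. X t w \<bullet> Z t w \<partial>?R) \<le> 0" if "t \<le> T" for t
    using that
  proof (induction t)
    case 0
    have np: "AE w in ?R. X 0 w \<bullet> Z 0 w \<le> 0" using \<eta>Z[of 0] by (simp add: X_def)
    have "(\<integral>\<^sup>+w. ennreal (X 0 w \<bullet> Z 0 w) \<partial>?R) = (\<integral>\<^sup>+w. 0 \<partial>?R)"
      by (rule nn_integral_cong_AE) (use np in \<open>auto elim!: eventually_mono simp: ennreal_neg\<close>)
    then have "integrable ?R (\<lambda>w. X 0 w \<bullet> Z 0 w)"
      unfolding real_integrable_def using cm[of 0 0] down[of 0] by auto
    moreover have "(\<integral>w. X 0 w \<bullet> Z 0 w \<partial>?R) \<le> 0" using integral_nonneg_AE[where M="?R" and f="\<lambda>w. - (X 0 w \<bullet> Z 0 w)"] np by simp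
    ultimately show ?case by blast
  next
    case (Suc t)
    then have t: "t < T" and IH: "integrable ?R (\<lambda>w. X t w \<bullet> Z t w)" "(\<integral>w. X t w \<bullet> Z t w \<partial>?R) \<le> 0" by auto
    note su = step_up[OF QZ t Xm[OF less_imp_le[OF t]] down'[OF t down[OF Suc.prems]] IH(1)]
    have "(\<integral>\<^sup>+w. ennreal (X (Suc t) w \<bullet> Z (Suc t) w) \<partial>?R) \<le> (\<integral>\<^sup>+w. ennreal (X t w \<bullet> Z (Suc t) w) \<partial>?R)"
      by (rule nn_integral_mono_AE) (use mono_step[OF t] in \<open>auto elim!: eventually_mono intro!: ennreal_leI\<close>)
    also have "\<dots> < \<infinity>" using su(1) unfolding real_integrable_def by (simp add: top.not_eq_extremum)
    finally have i: "integrable ?R (\<lambda>w. X (Suc t) w \<bullet> Z (Suc t) w)"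
      unfolding real_integrable_def using cm[OF Suc.prems Suc.prems] down[OF Suc.prems] by auto
    have "(\<integral>w. X (Suc t) w \<bullet> Z (Suc t) w \<partial>?R) \<le> (\<integral>w. X t w \<bullet> Z (Suc t) w \<partial>?R)"
      by (rule integral_mono_AE[OF i su(1) mono_step[OF t]])
    then show ?case using i su(2) IH(2) by simp
  qed
  have "(\<integral>w. W w \<partial>?R) \<le> (\<integral>w. X T w \<bullet> Z T w \<partial>?R)"
    by (rule integral_mono_AE[OF WR(1) _ leT]) (use up[OF order_refl] in simp)
  then show ?thesis using up[OF order_refl] WR(2) by simp
qed

end

section \<open>Mixtures of price systems\<close>

text \<open>A point of an open convex set lies in the hull of finitely many of its dense points;
  this reduces a moving point to fixed points and compact hulls.\<close>

lemma icone_mem_measurable: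
  fixes K :: "'a \<Rightarrow> (real ^ 'd::finite) set"
  assumes K: "\<And>U. open U \<Longrightarrow> {w \<in> space M. K w \<inter> U \<noteq> {}} \<in> sets M" and X: "X \<in> borel_measurable M"
  shows "{w \<in> space M. X w \<in> icone (K w)} \<in> sets M"
proof -
  let ?D = "{F. finite F \<and> F \<subseteq> (dset :: (real ^ 'd) set)}"
  have "X w \<in> icone (K w) \<longleftrightarrow> (\<exists>F\<in>?D. F \<subseteq> icone (K w) \<and> X w \<in> convex hull F)" for w
  proof
    assume "X w \<in> icone (K w)"
    then have "X w \<in> convex hull (dset \<inter> icone (K w))"
      unfolding convex_hull_dset[OF icone_open] by (rule hull_inc)
    then obtain F where "finite F" "F \<subseteq> dset \<inter> icone (K w)" "X w \<in> convex hull F"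
      unfolding caratheodory[of "dset \<inter> icone (K w)"] mem_Collect_eq by (elim exE conjE)
    then show "\<exists>F\<in>?D. F \<subseteq> icone (K w) \<and> X w \<in> convex hull F" by (intro bexI[of _ F] conjI CollectI) simp_all
  next
    assume "\<exists>F\<in>?D. F \<subseteq> icone (K w) \<and> X w \<in> convex hull F"
    then obtain F where "F \<subseteq> icone (K w)" "X w \<in> convex hull F" by (elim bexE conjE)
    then show "X w \<in> icone (K w)" using hull_minimal[where S=convex, OF _ icone_convex] by (elim subsetD[rotated])
  qed
  then have "{w \<in> space M. X w \<in> icone (K w)} =
      (\<Union>F\<in>?D. {w \<in> space M. \<forall>z\<in>F. z \<in> icone (K w)} \<inter> (X -` (convex hull F) \<inter> space M))"
    by (simp only: subset_iff set_eq_iff UN_iff Int_iff mem_Collect_eq vimage_eq Ball_def) blast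
  also have "\<dots> \<in> sets M"
  proof (rule sets.countable_UN'', rule countable_Collect_finite_subset[OF dset(1)], rule sets.Int)
    fix F assume F: "F \<in> ?D"
    show "{w \<in> space M. \<forall>z\<in>F. z \<in> icone (K w)} \<in> sets M"
      using F by (intro sets_Collect_ball_countable icone_measurable[OF K]) (auto intro: countable_finite)
    have "compact (convex hull F)" using F by (simp add: finite_imp_compact_convex_hull)
    then show "X -` (convex hull F) \<inter> space M \<in> sets M" by (intro measurable_sets[OF X]) (simp add: borel_compact)
  qed
  finally show ?thesis .
qed

text \<open>\<open>Q\<close> is the mixture of \<open>Q1\<close> and \<open>Q2\<close> with weights
  \<open>u\<close> and \<open>1 - u\<close>, and \<open>A\<close> is \<open>u\<close> times the
  density of \<open>Q1\<close> relative to \<open>Q\<close>. Where the mixture density vanishes,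
  \<open>A\<close> is set to \<open>u\<close>, which keeps it between 0 and 1.\<close>

lemma mixture_density:
  fixes u :: real
  assumes P: "prob_space P" and Q: "prob_space Q1" "prob_space Q2" "sets Q1 = sets P" "sets Q2 = sets P"
    and ac: "absolutely_continuous P Q1" "absolutely_continuous P Q2" and u: "0 < u" "u < 1"
  obtains Q A where "prob_space Q" "sets Q = sets P" "absolutely_continuous P Q" "A \<in> borel_measurable Q"
    "\<And>x. 0 \<le> A x \<and> A x \<le> (1::real)" "Q1 = density Q (\<lambda>x. ennreal (A x / u))" "Q2 = density Q (\<lambda>x. ennreal ((1 - A x) / (1 - u)))"
proof -
  interpret P: prob_space P by fact
  interpret Q1: prob_space Q1 by fact
  interpret Q2: prob_space Q2 by fact
  have ex: "\<exists>D. D \<in> borel_measurable P \<and> (\<forall>x. 0 \<le> (D x :: real)) \<and> density P (\<lambda>x. ennreal (D x)) = N"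
    if N: "finite_measure N" "absolutely_continuous P N" "sets N = sets P" for N
  proof -
    obtain D where D: "D \<in> borel_measurable P" "AE x in P. RN_deriv P N x = ennreal (D x)" "\<And>x. 0 \<le> D x"
      using P.real_RN_deriv[OF N] by metis
    have "density P (\<lambda>x. ennreal (D x)) = density P (RN_deriv P N)"
      by (rule density_cong) (use D in \<open>auto elim!: eventually_mono\<close>)
    also have "\<dots> = N" by (rule P.density_RN_deriv[OF N(2,3)])
    finally show ?thesis using D by blast
  qed
  obtain D1 where D1: "D1 \<in> borel_measurable P" "\<And>x. 0 \<le> D1 x" "density P (\<lambda>x. ennreal (D1 x)) = Q1"
    using ex[OF Q1.finite_measure_axioms ac(1) Q(3)] by blast
  obtain D2 where D2: "D2 \<in> borel_measurable P" "\<And>x. 0 \<le> D2 x" "density P (\<lambda>x. ennreal (D2 x)) = Q2"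
    using ex[OF Q2.finite_measure_axioms ac(2) Q(4)] by blast
  define h where "h x = u * D1 x + (1 - u) * D2 x" for x
  define A where "A x = (if 0 < h x then u * D1 x / h x else u)" for x
  have hm: "h \<in> borel_measurable P" unfolding h_def[abs_def] using D1(1) D2(1) by simp
  have Am: "A \<in> borel_measurable P" unfolding A_def[abs_def] using D1(1) hm by simp
  have pos: "0 \<le> u * D1 x" "0 \<le> (1 - u) * D2 x" for x using u D1(2) D2(2) by simp_all
  have h0: "0 \<le> h x" for x using pos[of x] by (simp add: h_def)
  have A01: "0 \<le> A x \<and> A x \<le> 1" for x
    using u pos[of x] by (auto simp: A_def divide_le_eq) (simp add: h_def)
  have hA: "h x * (A x / u) = D1 x" "h x * ((1 - A x) / (1 - u)) = D2 x" for x
  proof -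
    have z: "D1 x = 0 \<and> D2 x = 0" if "\<not> 0 < h x"
      using that pos[of x] u unfolding h_def by (metis add_nonneg_nonneg add_nonneg_eq_0_iff diff_gt_0_iff_gt less_eq_real_def less_irrefl mult_eq_0_iff)
    show "h x * (A x / u) = D1 x" using u z h0[of x] by (cases "0 < h x") (auto simp: A_def)
    have "h x - u * D1 x = (1 - u) * D2 x" by (simp add: h_def)
    then show "h x * ((1 - A x) / (1 - u)) = D2 x"
    proof (cases "0 < h x")
      case True
      then have "h x * (1 - A x) = h x - u * D1 x" by (simp add: A_def right_diff_distrib)
      then show ?thesis using u by (simp add: h_def)
    qed (use z u in \<open>auto simp: A_def\<close>)
  qed
  let ?Q = "density P (\<lambda>x. ennreal (h x))"
  have dQ: "density ?Q (\<lambda>x. ennreal (f x)) = density P (\<lambda>x. ennreal (h x * f x))" if "f \<in> borel_measurable P" for f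
    using that hm by (subst density_density_eq) (auto simp: ennreal_mult' h0)
  have i: "(\<integral>\<^sup>+x. ennreal (D1 x) \<partial>P) = 1" "(\<integral>\<^sup>+x. ennreal (D2 x) \<partial>P) = 1"
    using Q1.emeasure_space_1 Q2.emeasure_space_1 sets_eq_imp_space_eq[OF Q(3)] sets_eq_imp_space_eq[OF Q(4)] D1(1,3) D2(1,3)
    by (auto simp: emeasure_density cong: nn_integral_cong)
  have "emeasure ?Q (space ?Q) = (\<integral>\<^sup>+x. ennreal (h x) \<partial>P)"
    using hm by (simp add: emeasure_density cong: nn_integral_cong)
  also have "\<dots> = (\<integral>\<^sup>+x. ennreal u * ennreal (D1 x) + ennreal (1 - u) * ennreal (D2 x) \<partial>P)"
    using u pos D1(2) D2(2) by (intro nn_integral_cong) (simp add: h_def ennreal_plus ennreal_mult)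
  also have "\<dots> = ennreal u + ennreal (1 - u)" using D1(1) D2(1) i by (simp add: nn_integral_add nn_integral_cmult)
  also have "\<dots> = 1" using u by (simp flip: ennreal_plus)
  finally have "prob_space ?Q" by (rule prob_spaceI)
  moreover have "Q1 = density ?Q (\<lambda>x. ennreal (A x / u))" "Q2 = density ?Q (\<lambda>x. ennreal ((1 - A x) / (1 - u)))"
    using dQ[of "\<lambda>x. A x / u"] dQ[of "\<lambda>x. (1 - A x) / (1 - u)"] Am hA D1(3) D2(3) by auto
  ultimately show thesis using hm Am A01 by (intro that[of ?Q A]) (auto intro: absolutely_continuousI_density)
qed

context market
begin

text \<open>Averaging kernel by kernel; convexity of the priors along each path thereby produces a
  prior dominating both products.\<close>

lemma dominating_prior:
  assumes "P1 \<in> PP" "P2 \<in> PP"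
  obtains P where "P \<in> PP" "absolutely_continuous P P1" "absolutely_continuous P P2"
proof -
  obtain k1 k2 where k: "valid k1" "valid k2" "P1 = kprod k1 T" "P2 = kprod k2 T"
    using assms unfolding PP_eq by blast
  have "\<exists>\<kappa>. t < T \<longrightarrow> ksel t \<kappa> \<and> (\<forall>w\<in>space (Om_t t). null_sets (\<kappa> w) \<subseteq> null_sets (k1 t w) \<and> null_sets (\<kappa> w) \<subseteq> null_sets (k2 t w))" for t
  proof (cases "t < T")
    case True
    have "ksel t (k1 t)" "ksel t (k2 t)" using k(1,2) True unfolding valid_def ksel_def by simp_all
    from ksel_mix[OF True this] show ?thesis by (elim exE) (rule exI, rule impI)
  qed simp
  then obtain k where kk: "t < T \<longrightarrow> ksel t (k t) \<and> (\<forall>w\<in>space (Om_t t). null_sets (k t w) \<subseteq> null_sets (k1 t w) \<and> null_sets (k t w) \<subseteq> null_sets (k2 t w))" for t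
    using choice[of "\<lambda>t \<kappa>. t < T \<longrightarrow> ksel t \<kappa> \<and> (\<forall>w\<in>space (Om_t t). null_sets (\<kappa> w) \<subseteq> null_sets (k1 t w) \<and> null_sets (\<kappa> w) \<subseteq> null_sets (k2 t w))"]
    by (metis (no_types, lifting))
  have v: "valid k" unfolding valid_def using kk unfolding ksel_def by simp
  have "absolutely_continuous (kprod k T) P1" unfolding k(3)
    by (rule kprod_absolutely_continuous) (use kk valid_kern[OF v] valid_kern[OF k(1)] in \<open>simp_all, blast\<close>)
  moreover have "absolutely_continuous (kprod k T) P2" unfolding k(4)
    by (rule kprod_absolutely_continuous) (use kk valid_kern[OF v] valid_kern[OF k(2)] in \<open>simp_all, blast\<close>)
  moreover have "kprod k T \<in> PP" unfolding PP_eq using v by blast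
  ultimately show thesis using that by blast
qed

lemma F0_sub_Om: "s \<le> T \<Longrightarrow> A \<in> sets (F0 T s) \<Longrightarrow> A \<in> sets (Om_t T)"
  using measurable_sets[OF measurable_res[of s T]] unfolding sets_F0 by blast

lemma F0_sub_Ffilt: "A \<in> sets (F0 T s) \<Longrightarrow> A \<in> sets (Ffilt T s)"
  unfolding sets_F0 sets_Ffilt using sets_univ_completionI by blast

lemma F0_mono: assumes "s \<le> t" "t \<le> T" "A \<in> sets (F0 T s)" shows "A \<in> sets (F0 T t)"
proof -
  obtain B where B: "B \<in> sets (Om_t s)" "A = (\<lambda>w. res s w) -` B \<inter> space (Om_t T)" using assms(3) unfolding sets_F0 by blast
  let ?B = "(\<lambda>w. res s w) -` B \<inter> space (Om_t t)"
  have "?B \<in> sets (Om_t t)" by (rule measurable_sets[OF measurable_res[OF assms(1)] B(1)])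
  moreover have "A = (\<lambda>w. res t w) -` ?B \<inter> space (Om_t T)"
  proof -
    have "(w \<in> space (Om_t T) \<and> res s w \<in> B) \<longleftrightarrow> (w \<in> space (Om_t T) \<and> res t w \<in> space (Om_t t) \<and> res s (res t w) \<in> B)" for w
      unfolding res_res[OF assms(1)] using res_Om by blast
    then show ?thesis unfolding B(2) by blast
  qed
  ultimately show ?thesis unfolding sets_F0 by blast
qed

lemma subalgebra_F0:
  assumes R: "R \<in> probs (Om_t T)" and s: "s \<le> T"
  shows "sigma_finite_subalgebra R (F0 T s)"
proof (rule finite_measure_subalgebra_is_sigma_finite)
  interpret prob_space R by (rule probs_prob[OF R])
  have "subalgebra R (F0 T s)" unfolding subalgebra_def
    using probs_space[OF R] probs_sets[OF R] F0_sub_Om[OF s] by auto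
  then show "finite_measure_subalgebra R (F0 T s)"
    unfolding finite_measure_subalgebra_def finite_measure_subalgebra_axioms_def using finite_measure_axioms by simp
qed

lemma S0_integrable:
  assumes "(Q, Z) \<in> S0 T PP K" "s \<le> T" shows "integrable Q (Z s)" "integrable Q (\<lambda>w. Z s w $ i)"
proof -
  show "integrable Q (Z s)" using S0D(5)[OF assms(1)] assms(2) unfolding martingale_F_def by simp
  then show "integrable Q (\<lambda>w. Z s w $ i)" by (rule integrable_bounded_linear[OF bounded_linear_vec_nth])
qed

lemma S0_F0_martingale:
  assumes QZ: "(Q, Z) \<in> S0 T PP K" and s: "s < T" and E: "E \<in> sets (F0 T s)"
  shows "(\<integral>w. indicator E w * Z (Suc s) w $ i \<partial>Q) = (\<integral>w. indicator E w * Z s w $ i \<partial>Q)"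
proof -
  have EQ: "E \<in> sets Q" using F0_sub_Om[OF less_imp_le[OF s] E] probs_sets[OF S0D(1)[OF QZ]] by simp
  have i: "integrable Q (\<lambda>w. indicator E w *\<^sub>R Z r w)" if "r \<le> T" for r
    by (rule integrable_mult_indicator[OF EQ S0_integrable(1)[OF QZ that]])
  have "(\<integral>w. indicator E w *\<^sub>R Z (Suc s) w \<partial>completion Q) = (\<integral>w. indicator E w *\<^sub>R Z s w \<partial>completion Q)"
    using S0D(5)[OF QZ] s F0_sub_Ffilt[OF E] unfolding martingale_F_def by blast
  then have "(\<integral>w. indicator E w *\<^sub>R Z (Suc s) w \<partial>Q) = (\<integral>w. indicator E w *\<^sub>R Z s w \<partial>Q)"
    using integral_completion[OF borel_measurable_integrable[OF i[of s]]] integral_completion[OF borel_measurable_integrable[OF i[of "Suc s"]]] s by simp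
  from arg_cong[OF this, of "\<lambda>v. v $ i"] show ?thesis using s by (simp add: integral_vec_nth[OF i])
qed

section \<open>Mixing two price systems\<close>

context
  fixes Q1 Z1 Q2 Z2 u Q A
  assumes 1: "(Q1, Z1) \<in> S0 T PP K" and 2: "(Q2, Z2) \<in> S0 T PP K" and u: "0 < u" "u < (1::real)"
    and Q: "Q \<in> probs (Om_t T)" and A: "A \<in> borel_measurable Q" "\<And>w. 0 \<le> A w \<and> A w \<le> (1::real)"
    and Q1: "Q1 = density Q (\<lambda>w. ennreal (A w / u))" and Q2: "Q2 = density Q (\<lambda>w. ennreal ((1 - A w) / (1 - u)))"
begin

interpretation Q: prob_space Q by (rule probs_prob[OF Q])

lemma A_int: "integrable Q A"
  by (rule Q.integrable_const_bound[of _ 1]) (use A in auto)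

lemma density_transfer:
  fixes f :: "_ \<Rightarrow> real"
  assumes f: "f \<in> borel_measurable Q"
  shows "integrable Q (\<lambda>w. A w * f w) \<longleftrightarrow> integrable Q1 f" "(\<integral>w. A w * f w \<partial>Q) = u * (\<integral>w. f w \<partial>Q1)"
    "integrable Q (\<lambda>w. (1 - A w) * f w) \<longleftrightarrow> integrable Q2 f" "(\<integral>w. (1 - A w) * f w \<partial>Q) = (1 - u) * (\<integral>w. f w \<partial>Q2)"
proof -
  have m: "(\<lambda>w. A w / u) \<in> borel_measurable Q" "(\<lambda>w. (1 - A w) / (1 - u)) \<in> borel_measurable Q" using A(1) by simp_all
  have n: "AE w in Q. 0 \<le> A w / u" "AE w in Q. 0 \<le> (1 - A w) / (1 - u)" using A(2) u by simp_all
  have e: "A w * f w = u * ((A w / u) *\<^sub>R f w)" "(1 - A w) * f w = (1 - u) * (((1 - A w) / (1 - u)) *\<^sub>R f w)" for w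
    using u by simp_all
  have "integrable Q (\<lambda>w. u * ((A w / u) *\<^sub>R f w)) \<longleftrightarrow> integrable Q (\<lambda>w. (A w / u) *\<^sub>R f w)"
    "integrable Q (\<lambda>w. (1 - u) * (((1 - A w) / (1 - u)) *\<^sub>R f w)) \<longleftrightarrow> integrable Q (\<lambda>w. ((1 - A w) / (1 - u)) *\<^sub>R f w)"
    unfolding integrable_mult_left_iff using u by simp_all
  then show "integrable Q (\<lambda>w. A w * f w) \<longleftrightarrow> integrable Q1 f" "integrable Q (\<lambda>w. (1 - A w) * f w) \<longleftrightarrow> integrable Q2 f"
    unfolding Q1 Q2 integrable_density[OF f m(1) n(1)] integrable_density[OF f m(2) n(2)] e(1) e(2) .
  show "(\<integral>w. A w * f w \<partial>Q) = u * (\<integral>w. f w \<partial>Q1)" "(\<integral>w. (1 - A w) * f w \<partial>Q) = (1 - u) * (\<integral>w. f w \<partial>Q2)"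
    unfolding Q1 Q2 integral_density[OF f m(1) n(1)] integral_density[OF f m(2) n(2)] e
    by (simp_all only: integral_mult_right_zero)
qed

text \<open>Clipping to \<open>[0, 1]\<close> keeps the last coordinate of the mixed process equal to 1 everywhere, not just almost surely.\<close>
definition wt where "wt s w = min 1 (max 0 (real_cond_exp Q (F0 T s) A w))"

lemma wt01: "0 \<le> wt s w" "wt s w \<le> 1" unfolding wt_def by auto

lemma wt_F0: "wt s \<in> borel_measurable (F0 T s)" unfolding wt_def[abs_def] by simp

lemma wt_eq: assumes s: "s \<le> T" shows "AE w in Q. wt s w = real_cond_exp Q (F0 T s) A w"
proof -
  interpret sub: sigma_finite_subalgebra Q "F0 T s" by (rule subalgebra_F0[OF Q s])
  have "AE w in Q. 0 \<le> real_cond_exp Q (F0 T s) A w"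
    by (rule sub.real_cond_exp_ge_c[OF A_int]) (use A in auto)
  moreover have "AE w in Q. real_cond_exp Q (F0 T s) A w \<le> 1"
    by (rule sub.real_cond_exp_le_c[OF A_int]) (use A in auto)
  ultimately show ?thesis by eventually_elim (simp add: wt_def)
qed

lemma F0_Q: "s \<le> T \<Longrightarrow> f \<in> measurable (F0 T s) N \<Longrightarrow> f \<in> measurable Q N"
  unfolding measurable_probs[OF Q] by (rule measurable_F0_Om)

lemma wt_transfer1:
  fixes f :: "_ \<Rightarrow> real"
  assumes s: "s \<le> T" and f: "f \<in> borel_measurable (F0 T s)" and i: "integrable Q1 f"
  shows "integrable Q (\<lambda>w. wt s w * f w)" "(\<integral>w. wt s w * f w \<partial>Q) = u * (\<integral>w. f w \<partial>Q1)"
proof -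
  interpret sub: sigma_finite_subalgebra Q "F0 T s" by (rule subalgebra_F0[OF Q s])
  let ?c = "real_cond_exp Q (F0 T s) A"
  have fQ: "f \<in> borel_measurable Q" by (rule F0_Q[OF s f])
  have "integrable Q (\<lambda>w. A w * f w)" using density_transfer(1)[OF fQ] i by simp
  then have "integrable Q (\<lambda>w. f w * A w)" by (simp only: mult.commute)
  note c = sub.real_cond_exp_intg[OF this f A(1)]
  have ae: "AE w in Q. f w * ?c w = wt s w * f w" using wt_eq[OF s] by (rule eventually_mono) simp
  have m: "(\<lambda>w. f w * ?c w) \<in> borel_measurable Q" "(\<lambda>w. wt s w * f w) \<in> borel_measurable Q"
    using c(1) fQ F0_Q[OF s wt_F0] by simp_all
  show "integrable Q (\<lambda>w. wt s w * f w)" using integrable_cong_AE[OF m ae] c(1) by simp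
  have "(\<integral>w. wt s w * f w \<partial>Q) = (\<integral>w. f w * A w \<partial>Q)" using integral_cong_AE[OF m ae] c(2) by simp
  then show "(\<integral>w. wt s w * f w \<partial>Q) = u * (\<integral>w. f w \<partial>Q1)"
    using density_transfer(2)[OF fQ] by (simp only: mult.commute)
qed

lemma wt_transfer2:
  fixes f :: "_ \<Rightarrow> real"
  assumes s: "s \<le> T" and f: "f \<in> borel_measurable (F0 T s)" and i: "integrable Q2 f"
  shows "integrable Q (\<lambda>w. (1 - wt s w) * f w)" "(\<integral>w. (1 - wt s w) * f w \<partial>Q) = (1 - u) * (\<integral>w. f w \<partial>Q2)"
proof -
  interpret sub: sigma_finite_subalgebra Q "F0 T s" by (rule subalgebra_F0[OF Q s])
  let ?c = "real_cond_exp Q (F0 T s) (\<lambda>w. 1 - A w)"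
  have fQ: "f \<in> borel_measurable Q" by (rule F0_Q[OF s f])
  have "integrable Q (\<lambda>w. (1 - A w) * f w)" using density_transfer(3)[OF fQ] i by simp
  then have "integrable Q (\<lambda>w. f w * (1 - A w))" by (simp only: mult.commute)
  note c = sub.real_cond_exp_intg[OF this f borel_measurable_diff[OF borel_measurable_const A(1)]]
  have "AE w in Q. ?c w = real_cond_exp Q (F0 T s) (\<lambda>w. 1) w - real_cond_exp Q (F0 T s) A w"
    by (rule sub.real_cond_exp_diff[OF _ A_int]) simp
  moreover have "AE w in Q. real_cond_exp Q (F0 T s) (\<lambda>w. 1) w = 1" by (rule sub.real_cond_exp_F_meas) simp_all
  ultimately have ae: "AE w in Q. f w * ?c w = (1 - wt s w) * f w" using wt_eq[OF s] by eventually_elim simp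
  have m: "(\<lambda>w. f w * ?c w) \<in> borel_measurable Q" "(\<lambda>w. (1 - wt s w) * f w) \<in> borel_measurable Q"
    using c(1) fQ F0_Q[OF s wt_F0] by simp_all
  show "integrable Q (\<lambda>w. (1 - wt s w) * f w)" using integrable_cong_AE[OF m ae] c(1) by simp
  have "(\<integral>w. (1 - wt s w) * f w \<partial>Q) = (\<integral>w. f w * (1 - A w) \<partial>Q)" using integral_cong_AE[OF m ae] c(2) by simp
  then show "(\<integral>w. (1 - wt s w) * f w \<partial>Q) = (1 - u) * (\<integral>w. f w \<partial>Q2)"
    using density_transfer(4)[OF fQ] by (simp only: mult.commute)
qed

text \<open>The weight is the conditional share of the first system given the past, not the constant
  \<open>u\<close>: against a function known at \<open>s\<close>, \<open>wt s\<close> under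
  \<open>Q\<close> integrates like \<open>u\<close> times \<open>Q1\<close>. This turns the two
  martingale properties into one under \<open>Q\<close>.\<close>

definition Zm where "Zm s w = wt s w *\<^sub>R Z1 s w + (1 - wt s w) *\<^sub>R Z2 s w"

lemma Zm_F0: "s \<le> T \<Longrightarrow> Zm s \<in> borel_measurable (F0 T s)"
  unfolding Zm_def[abs_def] by (intro borel_measurable_add borel_measurable_scaleR borel_measurable_diff
      borel_measurable_const wt_F0 S0D(3)[OF 1] S0D(3)[OF 2])

lemma icone_bad:
  assumes s: "s \<le> T" and X: "X \<in> borel_measurable (F0 T s)"
  shows "{w \<in> space (Om_t T). X w \<notin> icone (K s w)} \<in> sets (F0 T s)"
proof -
  have "{w \<in> space (F0 T s). X w \<in> icone (K s w)} \<in> sets (F0 T s)"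
    by (rule icone_mem_measurable[OF _ X]) (use K_meas s in simp)
  then have "space (F0 T s) - {w \<in> space (F0 T s). X w \<in> icone (K s w)} \<in> sets (F0 T s)" by (rule sets.compl_sets)
  moreover have "space (F0 T s) - {w \<in> space (F0 T s). X w \<in> icone (K s w)} = {w \<in> space (Om_t T). X w \<notin> icone (K s w)}" by auto
  ultimately show ?thesis by simp
qed

text \<open>\<open>Z1\<close> is strictly consistent only almost surely under \<open>Q1\<close>,
  which may ignore sets charged by \<open>Q\<close>. There the weight vanishes, because its integral
  over the bad event is \<open>u\<close> times the mass given to it by \<open>Q1\<close>; likewise
  for \<open>Z2\<close>.\<close>

lemma wt_zero:
  assumes s: "s \<le> T"
  shows "AE w in Q. Z1 s w \<notin> icone (K s w) \<longrightarrow> wt s w = 0" "AE w in Q. Z2 s w \<notin> icone (K s w) \<longrightarrow> 1 - wt s w = 0"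
proof -
  have gen: "AE w in Q. X w \<notin> icone (K s w) \<longrightarrow> v w = 0"
    if X: "X \<in> borel_measurable (F0 T s)" and v: "\<And>w. 0 \<le> v w" "v \<in> borel_measurable Q"
      and R: "R \<in> probs (Om_t T)" "AE w in R. X w \<in> icone (K s w)"
      and tr: "\<And>f. f \<in> borel_measurable (F0 T s) \<Longrightarrow> integrable R f \<Longrightarrow> integrable Q (\<lambda>w. v w * f w) \<and> (\<integral>w. v w * f w \<partial>Q) = q * (\<integral>w. f w \<partial>R)"
    for X :: "(nat \<Rightarrow> 'w) \<Rightarrow> (real, 'd) vec" and v :: "(nat \<Rightarrow> 'w) \<Rightarrow> real" and R and q :: real
  proof -
    interpret R: prob_space R by (rule probs_prob[OF R(1)])
    let ?B = "{w \<in> space (Om_t T). X w \<notin> icone (K s w)}"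
    note B = icone_bad[OF s X]
    have BR: "?B \<in> sets R" using F0_sub_Om[OF s B] probs_sets[OF R(1)] by simp
    have "AE w in R. indicator ?B w = (0::real)" using R(2) by (rule eventually_mono) simp
    then have z: "(\<integral>w. indicator ?B w \<partial>R) = (0::real)" by (rule integral_eq_zero_AE)
    have "integrable R (indicator ?B :: _ \<Rightarrow> real)" using BR by (simp add: less_top[symmetric])
    from tr[OF borel_measurable_indicator[OF B] this]
    have i: "integrable Q (\<lambda>w. v w * indicator ?B w)" "(\<integral>w. v w * indicator ?B w \<partial>Q) = 0" unfolding z by simp_all
    have "AE w in Q. v w * indicator ?B w = 0"
      using integral_nonneg_eq_0_iff_AE[OF i(1)] i(2) v(1) by simp
    then show ?thesis by (rule AE_mono_space) (auto simp add: probs_space[OF Q] indicator_def)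
  qed
  show "AE w in Q. Z1 s w \<notin> icone (K s w) \<longrightarrow> wt s w = 0"
  proof (rule gen[OF S0D(3)[OF 1 s] wt01(1) F0_Q[OF s wt_F0] S0D(1)[OF 1] S0D(4)[OF 1 s]])
    fix f :: "_ \<Rightarrow> real" assume f: "f \<in> borel_measurable (F0 T s)" "integrable Q1 f"
    show "integrable Q (\<lambda>w. wt s w * f w) \<and> (\<integral>w. wt s w * f w \<partial>Q) = u * (\<integral>w. f w \<partial>Q1)"
      by (intro conjI wt_transfer1[OF s f])
  qed
  show "AE w in Q. Z2 s w \<notin> icone (K s w) \<longrightarrow> 1 - wt s w = 0"
  proof (rule gen[OF S0D(3)[OF 2 s] _ _ S0D(1)[OF 2] S0D(4)[OF 2 s]])
    fix f :: "_ \<Rightarrow> real" assume f: "f \<in> borel_measurable (F0 T s)" "integrable Q2 f"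
    show "integrable Q (\<lambda>w. (1 - wt s w) * f w) \<and> (\<integral>w. (1 - wt s w) * f w \<partial>Q) = (1 - u) * (\<integral>w. f w \<partial>Q2)"
      by (intro conjI wt_transfer2[OF s f])
  qed (use wt01(2) F0_Q[OF s wt_F0] in simp_all)
qed

lemma Zm_icone: assumes s: "s \<le> T" shows "AE w in Q. Zm s w \<in> icone (K s w)"
  using wt_zero[OF s]
proof eventually_elim
  case (elim w)
  show ?case
  proof (cases "Z1 s w \<in> icone (K s w)")
    case False
    then have "wt s w = 0" using elim(1) by simp
    then show ?thesis using elim(2) by (auto simp: Zm_def)
  next
    case t: True
    show ?thesis
    proof (cases "Z2 s w \<in> icone (K s w)")
      case False
      then have "wt s w = 1" using elim(2) by simp
      then show ?thesis using t by (simp add: Zm_def)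
    next
      case True
      then show ?thesis unfolding Zm_def using wt01[of s w] by (intro convexD[OF icone_convex t]) simp_all
    qed
  qed
qed

lemma Zm_transfer:
  fixes f :: "_ \<Rightarrow> real"
  assumes s: "s \<le> T" and f: "f \<in> borel_measurable (F0 T s)" and i: "integrable Q1 (\<lambda>w. f w * Z1 s w $ i)" "integrable Q2 (\<lambda>w. f w * Z2 s w $ i)"
  shows "integrable Q (\<lambda>w. f w * Zm s w $ i)"
    "(\<integral>w. f w * Zm s w $ i \<partial>Q) = u * (\<integral>w. f w * Z1 s w $ i \<partial>Q1) + (1 - u) * (\<integral>w. f w * Z2 s w $ i \<partial>Q2)"
proof -
  have m: "(\<lambda>w. f w * Z1 s w $ i) \<in> borel_measurable (F0 T s)" "(\<lambda>w. f w * Z2 s w $ i) \<in> borel_measurable (F0 T s)"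
    by (intro borel_measurable_times f vec_nth_meas S0D(3)[OF 1 s] S0D(3)[OF 2 s])+
  note t1 = wt_transfer1[OF s m(1) i(1)] and t2 = wt_transfer2[OF s m(2) i(2)]
  have e: "f w * Zm s w $ i = wt s w * (f w * Z1 s w $ i) + (1 - wt s w) * (f w * Z2 s w $ i)" for w
    by (simp add: Zm_def algebra_simps)
  show "integrable Q (\<lambda>w. f w * Zm s w $ i)" unfolding e by (rule Bochner_Integration.integrable_add[OF t1(1) t2(1)])
  show "(\<integral>w. f w * Zm s w $ i \<partial>Q) = u * (\<integral>w. f w * Z1 s w $ i \<partial>Q1) + (1 - u) * (\<integral>w. f w * Z2 s w $ i \<partial>Q2)"
    unfolding e Bochner_Integration.integral_add[OF t1(1) t2(1)] t1(2) t2(2) ..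
qed

lemma Zm_integrable: assumes s: "s \<le> T" shows "integrable Q (Zm s)"
  by (rule integrable_vecI) (use Zm_transfer(1)[OF s, of "\<lambda>_. 1"] S0_integrable(2)[OF 1 s] S0_integrable(2)[OF 2 s] in simp)

lemma Zm_martingale: "martingale_F T Q Zm"
  unfolding martingale_F_def
proof (intro conjI allI impI ballI)
  fix s assume s: "s \<le> T"
  show "Zm s \<in> borel_measurable (Ffilt T s)" by (rule measurable_F0_Ffilt[OF Zm_F0[OF s]])
  show "integrable Q (Zm s)" by (rule Zm_integrable[OF s])
next
  fix s and E :: "(nat \<Rightarrow> 'w) set" assume s: "s < T" and E: "E \<in> sets (Ffilt T s)"
  then have sT: "s \<le> T" "Suc s \<le> T" by simp_all
  \<comment> \<open>The weights condition on the Borel filtration, so the universally measurable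
    event is first replaced by a Borel one up to a null set.\<close>
  obtain E' where E': "E' \<in> sets (F0 T s)" "AE w in Q. w \<in> E \<longleftrightarrow> w \<in> E'" using Ffilt_F0_AE[OF Q sT(1) E] by (elim bexE)
  have EQ: "E' \<in> sets Q" using F0_sub_Om[OF sT(1) E'(1)] probs_sets[OF Q] by simp
  have EC: "E \<in> sets (completion Q)" by (rule univ_completion_sets_completion[OF Ffilt_sub_univ[OF sT(1) E] Q])
  have i: "integrable Q (\<lambda>w. indicator E' w *\<^sub>R Zm r w)" if "r \<le> T" for r
    by (rule integrable_mult_indicator[OF EQ Zm_integrable[OF that]])
  have red: "(\<integral>w. indicator E w *\<^sub>R Zm r w \<partial>completion Q) = (\<integral>w. indicator E' w *\<^sub>R Zm r w \<partial>Q)" if r: "r \<le> T" for r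
  proof -
    have m: "Zm r \<in> borel_measurable (completion Q)" by (rule measurable_completion[OF F0_Q[OF r Zm_F0[OF r]]])
    have "AE w in completion Q. indicator E w *\<^sub>R Zm r w = indicator E' w *\<^sub>R Zm r w"
      using E'(2) unfolding AE_completion_iff by (rule eventually_mono) (simp add: indicator_def)
    then have "(\<integral>w. indicator E w *\<^sub>R Zm r w \<partial>completion Q) = (\<integral>w. indicator E' w *\<^sub>R Zm r w \<partial>completion Q)"
      by (intro integral_cong_AE borel_measurable_scaleR borel_measurable_indicator EC m sets_completionI_sets[OF EQ])
    also have "\<dots> = (\<integral>w. indicator E' w *\<^sub>R Zm r w \<partial>Q)" by (rule integral_completion[OF borel_measurable_integrable[OF i[OF r]]])
    finally show ?thesis .
  qed
  have "(\<integral>w. indicator E' w *\<^sub>R Zm (Suc s) w \<partial>Q) $ j = (\<integral>w. indicator E' w *\<^sub>R Zm s w \<partial>Q) $ j" for j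
  proof -
    have ii: "integrable R (\<lambda>w. indicator E' w * X r w $ j)" if "(R, X) \<in> S0 T PP K" "r \<le> T" for R X r
      using integrable_mult_indicator[OF _ S0_integrable(2)[OF that], of E'] F0_sub_Om[OF sT(1) E'(1)] probs_sets[OF S0D(1)[OF that(1)]] by simp
    have e: "E' \<in> sets (F0 T (Suc s))" by (rule F0_mono[OF _ sT(2) E'(1)]) simp
    note a = Zm_transfer(2)[OF sT(1) borel_measurable_indicator[OF E'(1)] ii[OF 1 sT(1)] ii[OF 2 sT(1)]]
    note b = Zm_transfer(2)[OF sT(2) borel_measurable_indicator[OF e] ii[OF 1 sT(2)] ii[OF 2 sT(2)]]
    show ?thesis unfolding integral_vec_nth[OF i[OF sT(1)]] integral_vec_nth[OF i[OF sT(2)]] vector_scaleR_component real_scaleR_def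
      a b S0_F0_martingale[OF 1 s E'(1)] S0_F0_martingale[OF 2 s E'(1)] ..
  qed
  then have "(\<integral>w. indicator E' w *\<^sub>R Zm (Suc s) w \<partial>Q) = (\<integral>w. indicator E' w *\<^sub>R Zm s w \<partial>Q)" by (simp add: vec_eq_iff)
  then show "(\<integral>w. indicator E w *\<^sub>R Zm (Suc s) w \<partial>completion Q) = (\<integral>w. indicator E w *\<^sub>R Zm s w \<partial>completion Q)"
    unfolding red[OF sT(1)] red[OF sT(2)] .
qed

lemma Zm_S0: assumes "P \<in> PP" "absolutely_continuous P Q" shows "(Q, Zm) \<in> S0 T PP K"
  unfolding S0_def mem_Collect_eq prod.case
proof (intro conjI allI impI ballI)
  fix s and w :: "nat \<Rightarrow> 'w" assume "s \<le> T" "w \<in> space (Om_t T)"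
  then show "Zm s w $ dlast = 1" using S0D(6)[OF 1] S0D(6)[OF 2] by (simp add: Zm_def)
qed (use Q assms Zm_F0 Zm_icone[unfolded icone_def] Zm_martingale in blast)+

lemma Zm_claim:
  assumes f: "f \<in> borel_measurable (Om_t T)" and i: "integrable Q1 (\<lambda>w. f w \<bullet> Z1 T w)" "integrable Q2 (\<lambda>w. f w \<bullet> Z2 T w)"
  shows "integrable Q (\<lambda>w. f w \<bullet> Zm T w)"
    "(\<integral>w. f w \<bullet> Zm T w \<partial>Q) = u * (\<integral>w. f w \<bullet> Z1 T w \<partial>Q1) + (1 - u) * (\<integral>w. f w \<bullet> Z2 T w \<partial>Q2)"
proof -
  have fF: "f \<in> borel_measurable (F0 T T)"
    by (rule measurable_cong[THEN iffD1, OF _ measurable_F0_res[OF f]]) (simp only: space_F0 res_id)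
  have m: "(\<lambda>w. f w \<bullet> Z1 T w) \<in> borel_measurable (F0 T T)" "(\<lambda>w. f w \<bullet> Z2 T w) \<in> borel_measurable (F0 T T)"
    by (intro borel_measurable_inner fF S0D(3)[OF 1 order_refl] S0D(3)[OF 2 order_refl])+
  note t1 = wt_transfer1[OF order_refl m(1) i(1)] and t2 = wt_transfer2[OF order_refl m(2) i(2)]
  have e: "f w \<bullet> Zm T w = wt T w * (f w \<bullet> Z1 T w) + (1 - wt T w) * (f w \<bullet> Z2 T w)" for w
    by (simp add: Zm_def inner_add_right)
  show "integrable Q (\<lambda>w. f w \<bullet> Zm T w)" unfolding e by (rule Bochner_Integration.integrable_add[OF t1(1) t2(1)])
  show "(\<integral>w. f w \<bullet> Zm T w \<partial>Q) = u * (\<integral>w. f w \<bullet> Z1 T w \<partial>Q1) + (1 - u) * (\<integral>w. f w \<bullet> Z2 T w \<partial>Q2)"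
    unfolding e Bochner_Integration.integral_add[OF t1(1) t2(1)] t1(2) t2(2) ..
qed

end

text \<open>One mixture serves all claims simultaneously, so whole vectors of values are mixed, not
  just single values.\<close>

theorem S0_convex:
  assumes 1: "(Q1, Z1) \<in> S0 T PP K" and 2: "(Q2, Z2) \<in> S0 T PP K" and u: "0 < u" "u < (1::real)"
  shows "\<exists>Q Z. (Q, Z) \<in> S0 T PP K \<and> (\<forall>f. f \<in> borel_measurable (Om_t T) \<longrightarrow>
      integrable Q1 (\<lambda>w. f w \<bullet> Z1 T w) \<longrightarrow> integrable Q2 (\<lambda>w. f w \<bullet> Z2 T w) \<longrightarrow> integrable Q (\<lambda>w. f w \<bullet> Z T w) \<and>
      (\<integral>w. f w \<bullet> Z T w \<partial>Q) = u * (\<integral>w. f w \<bullet> Z1 T w \<partial>Q1) + (1 - u) * (\<integral>w. f w \<bullet> Z2 T w \<partial>Q2))"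
proof -
  obtain P1 where P1: "P1 \<in> PP" "absolutely_continuous P1 Q1" using S0D(2)[OF 1] by (elim bexE)
  obtain P2 where P2: "P2 \<in> PP" "absolutely_continuous P2 Q2" using S0D(2)[OF 2] by (elim bexE)
  obtain P where P: "P \<in> PP" "absolutely_continuous P P1" "absolutely_continuous P P2" by (rule dominating_prior[OF P1(1) P2(1)])
  have Pp: "P \<in> probs (Om_t T)" using P(1) valid_probs unfolding PP_eq by blast
  note s = probs_sets[OF Pp] probs_sets[OF S0D(1)[OF 1]] probs_sets[OF S0D(1)[OF 2]]
  have ac: "absolutely_continuous P Q1" "absolutely_continuous P Q2"
    using P(2,3) P1(2) P2(2) unfolding absolutely_continuous_def by (blast intro: subset_trans)+
  obtain Q A where Q: "prob_space Q" "sets Q = sets P" "absolutely_continuous P Q" "A \<in> borel_measurable Q"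
    "\<And>x. 0 \<le> A x \<and> A x \<le> (1::real)" "Q1 = density Q (\<lambda>x. ennreal (A x / u))" "Q2 = density Q (\<lambda>x. ennreal ((1 - A x) / (1 - u)))"
    by (rule mixture_density[OF probs_prob[OF Pp] probs_prob[OF S0D(1)[OF 1]] probs_prob[OF S0D(1)[OF 2]] _ _ ac u])
      (simp_all only: s)
  have Qp: "Q \<in> probs (Om_t T)" unfolding probs_def using Q(1,2) s(1) by simp
  note h = 1 2 u Qp Q(4-7)
  show ?thesis
    by (rule exI[of _ Q], rule exI[of _ "Zm Z1 Z2 Q A"], intro conjI allI impI)
      (rule Zm_S0[OF h P(1) Q(3)], (rule Zm_claim[OF h]; assumption)+)
qed

end

section \<open>Lagrange multipliers\<close>

text \<open>Every slope from a point beyond \<open>c\<close> is at most every slope from a point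
  below \<open>c\<close>, since otherwise the mixture sitting exactly at \<open>c\<close> would
  exceed \<gamma>. The supremum of the former slopes is the multiplier.\<close>

lemma half_line_multiplier:
  fixes a b :: "'m \<Rightarrow> real"
  assumes mix: "\<And>x y u. x \<in> V \<Longrightarrow> y \<in> V \<Longrightarrow> 0 < u \<Longrightarrow> u < 1 \<Longrightarrow>
      \<exists>z\<in>V. a z = u * a x + (1 - u) * a y \<and> b z = u * b x + (1 - u) * b y"
    and up: "\<exists>x\<in>V. b x < c" and le: "\<And>x. x \<in> V \<Longrightarrow> b x = c \<Longrightarrow> a x \<le> \<gamma>"
    and ex: "\<exists>x\<in>V. c < b x \<and> \<gamma> < a x"
  shows "\<exists>s\<ge>0. \<forall>x\<in>V. a x - s * (b x - c) \<le> \<gamma>"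
proof -
  have key: "(a x - \<gamma>) / (b x - c) \<le> (\<gamma> - a y) / (c - b y)"
    if x: "x \<in> V" "c < b x" and y: "y \<in> V" "b y < c" for x y
  proof -
    \<comment> \<open>The weight for which the mixture of \<open>x\<close> and \<open>y\<close> has
      second value exactly \<open>c\<close>.\<close>
    let ?u = "(c - b y) / (b x - b y)"
    have d: "0 < b x - b y" using x y by simp
    have u: "0 < ?u" "?u < 1" using x y by (simp_all add: field_simps)
    have u': "1 - ?u = (b x - c) / (b x - b y)" using d by (simp add: field_simps)
    obtain z where z: "z \<in> V" "a z = ?u * a x + (1 - ?u) * a y" "b z = ?u * b x + (1 - ?u) * b y"
      using mix[OF x(1) y(1) u] by blast
    have "b z = ((c - b y) * b x + (b x - c) * b y) / (b x - b y)"
      unfolding z(3) u' by (simp add: add_divide_distrib)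
    also have "\<dots> = c" using d by (simp add: field_simps)
    finally have "a z \<le> \<gamma>" by (rule le[OF z(1)])
    moreover have "a z = ((c - b y) * a x + (b x - c) * a y) / (b x - b y)"
      unfolding z(2) u' by (simp add: add_divide_distrib)
    ultimately have "(c - b y) * a x + (b x - c) * a y \<le> \<gamma> * (b x - b y)" using d by (simp add: field_simps)
    then have "(a x - \<gamma>) * (c - b y) \<le> (\<gamma> - a y) * (b x - c)" by (simp add: algebra_simps)
    then show ?thesis using x y by (simp add: field_simps)
  qed
  define R where "R = (\<lambda>x. (a x - \<gamma>) / (b x - c)) ` {x \<in> V. c < b x}"
  define s where "s = Sup R"
  obtain y where y: "y \<in> V" "b y < c" using up by blast
  have bdd: "bdd_above R" unfolding R_def by (rule bdd_aboveI2) (use key[OF _ _ y] in blast)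
  have ups: "(a x - \<gamma>) / (b x - c) \<le> s" if "x \<in> V" "c < b x" for x
    unfolding s_def by (rule cSup_upper[OF _ bdd]) (use that in \<open>auto simp: R_def\<close>)
  have lows: "s \<le> (\<gamma> - a x) / (c - b x)" if "x \<in> V" "b x < c" for x
    unfolding s_def by (rule cSup_least) (use ex key[OF _ _ that] in \<open>auto simp: R_def\<close>)
  have "0 \<le> s"
  proof -
    obtain x where x: "x \<in> V" "c < b x" "\<gamma> < a x" using ex by blast
    then have "0 \<le> (a x - \<gamma>) / (b x - c)" by simp
    then show ?thesis using ups[OF x(1,2)] by simp
  qed
  moreover have "a x - s * (b x - c) \<le> \<gamma>" if x: "x \<in> V" for x
  proof (cases "b x" c rule: linorder_cases)
    case less
    then show ?thesis using lows[OF x less] by (simp add: field_simps)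
  next
    case equal
    then show ?thesis using le[OF x] by simp
  next
    case greater
    then show ?thesis using ups[OF x greater] by (simp add: field_simps)
  qed
  ultimately show ?thesis by blast
qed

text \<open>A point exceeding \<gamma> violates exactly one of the two bounds. Relaxing that bound
  alone already gives a multiplier, whose sign tells which side was active.\<close>

lemma interval_multiplier:
  fixes a b :: "'m \<Rightarrow> real"
  assumes mix: "\<And>x y u. x \<in> V \<Longrightarrow> y \<in> V \<Longrightarrow> 0 < u \<Longrightarrow> u < 1 \<Longrightarrow>
      \<exists>z\<in>V. a z = u * a x + (1 - u) * a y \<and> b z = u * b x + (1 - u) * b y"
    and c: "0 \<le> c" and low: "\<exists>x\<in>V. - c < b x" and up: "\<exists>x\<in>V. b x < c"
    and le: "\<And>x. x \<in> V \<Longrightarrow> \<bar>b x\<bar> \<le> c \<Longrightarrow> a x \<le> \<gamma>"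
  shows "\<exists>l. \<forall>x\<in>V. a x + l * b x + c * \<bar>l\<bar> \<le> \<gamma>"
proof (cases "\<exists>x\<in>V. \<gamma> < a x")
  case False
  then show ?thesis by (intro exI[of _ 0]) auto
next
  case True
  then obtain x where x: "x \<in> V" "\<gamma> < a x" by blast
  then have "\<not> \<bar>b x\<bar> \<le> c" using le by fastforce
  then consider "c < b x" | "c < - b x" by linarith
  then show ?thesis
  proof cases
    case 1
    have "\<exists>s\<ge>0. \<forall>x\<in>V. a x - s * (b x - c) \<le> \<gamma>"
      by (rule half_line_multiplier[OF mix up]) (use le c 1 x in auto)
    then obtain s where s: "0 \<le> s" "\<And>x. x \<in> V \<Longrightarrow> a x - s * (b x - c) \<le> \<gamma>" by blast
    show ?thesis by (rule exI[of _ "- s"]) (use s in \<open>auto simp: algebra_simps\<close>)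
  next
    case 2
    have "\<exists>s\<ge>0. \<forall>x\<in>V. a x - s * (- b x - c) \<le> \<gamma>"
    proof (rule half_line_multiplier)
      fix x y and u :: real assume "x \<in> V" "y \<in> V" "0 < u" "u < 1"
      from mix[OF this] show "\<exists>z\<in>V. a z = u * a x + (1 - u) * a y \<and> - b z = u * - b x + (1 - u) * - b y"
        by (elim bexE, intro bexI) auto
    qed (use le low c 2 x in \<open>auto simp: minus_less_iff\<close>)
    then obtain s where s: "0 \<le> s" "\<And>x. x \<in> V \<Longrightarrow> a x - s * (- b x - c) \<le> \<gamma>" by blast
    show ?thesis by (rule exI[of _ s]) (use s in \<open>auto simp: algebra_simps\<close>)
  qed
qed

definition mixable :: "(nat \<Rightarrow> real) set \<Rightarrow> bool" where
  "mixable V \<longleftrightarrow> (\<forall>x\<in>V. \<forall>y\<in>V. \<forall>u. 0 < u \<and> u < 1 \<longrightarrow> (\<lambda>i. u * x i + (1 - u) * y i) \<in> V)"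

definition affine_fun :: "((nat \<Rightarrow> real) \<Rightarrow> real) \<Rightarrow> bool" where
  "affine_fun a \<longleftrightarrow> (\<forall>x y u. a (\<lambda>i. u * x i + (1 - u) * y i) = u * a x + (1 - u) * a y)"

lemma affine_fun_coord: "affine_fun (\<lambda>x. k * x i)"
  by (simp add: affine_fun_def algebra_simps)

lemma affine_fun_add: "affine_fun a \<Longrightarrow> affine_fun b \<Longrightarrow> affine_fun (\<lambda>x. a x + b x)"
  by (simp add: affine_fun_def ring_distribs)

text \<open>Induction on the number of options: if the Slater condition for option \<open>n + 1\<close> failed, the multipliers of
  the first \<open>n\<close> options would contradict non-degeneracy.\<close>
lemma box_multipliers:
  fixes V :: "(nat \<Rightarrow> real) set" and c :: "nat \<Rightarrow> real"
  assumes V: "mixable V" "V \<noteq> {}" and c: "\<And>i. i \<in> {1..e} \<Longrightarrow> 0 \<le> c i"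
    and nondeg: "\<And>l. (\<And>x. x \<in> V \<Longrightarrow> (\<Sum>i\<in>{1..e}. c i * \<bar>l i\<bar>) \<le> (\<Sum>i\<in>{1..e}. l i * x i)) \<Longrightarrow> \<forall>i\<in>{1..e}. l i = (0::real)"
    and n: "n \<le> e"
  shows "(\<exists>x\<in>V. \<forall>i\<in>{1..n}. \<bar>x i\<bar> \<le> c i) \<and>
    (\<forall>a \<gamma>. affine_fun a \<longrightarrow> (\<forall>x\<in>V. (\<forall>i\<in>{1..n}. \<bar>x i\<bar> \<le> c i) \<longrightarrow> a x \<le> \<gamma>) \<longrightarrow>
      (\<exists>l. \<forall>x\<in>V. a x + (\<Sum>i\<in>{1..n}. l i * x i + c i * \<bar>l i\<bar>) \<le> \<gamma>))"
  using n
proof (induction n)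
  case 0
  then show ?case using V(2) by auto
next
  case (Suc n)
  let ?V = "{x\<in>V. \<forall>i\<in>{1..n}. \<bar>x i\<bar> \<le> c i}"
  have mult: "\<exists>l. \<forall>x\<in>V. a x + (\<Sum>i\<in>{1..n}. l i * x i + c i * \<bar>l i\<bar>) \<le> \<gamma>"
    if "affine_fun a" "\<And>x. x \<in> ?V \<Longrightarrow> a x \<le> \<gamma>" for a \<gamma>
    using Suc.IH Suc.prems that by simp
  have cn: "0 \<le> c i" if "i \<in> {1..n}" for i using c[of i] that Suc.prems by simp
  have cS: "0 \<le> c (Suc n)" using c Suc.prems by simp
  have mixV: "(\<lambda>i. u * x i + (1 - u) * y i) \<in> ?V" if xy: "x \<in> ?V" "y \<in> ?V" and u: "0 < u" "u < 1" for x y u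
  proof -
    have "\<bar>u * x i + (1 - u) * y i\<bar> \<le> c i" if i: "i \<in> {1..n}" for i
    proof -
      have b: "\<bar>x i\<bar> \<le> c i" "\<bar>y i\<bar> \<le> c i" using xy i by simp_all
      have "\<bar>u * x i + (1 - u) * y i\<bar> \<le> \<bar>u * x i\<bar> + \<bar>(1 - u) * y i\<bar>" by (rule abs_triangle_ineq)
      also have "\<dots> = u * \<bar>x i\<bar> + (1 - u) * \<bar>y i\<bar>" using u by (simp add: abs_mult)
      also have "\<dots> \<le> u * c i + (1 - u) * c i" using b u by (intro add_mono mult_left_mono) simp_all
      finally show ?thesis by (simp add: algebra_simps)
    qed
    then show ?thesis using V(1) xy u unfolding mixable_def by simp
  qed
  have sl: "\<exists>x\<in>?V. q * x (Suc n) < c (Suc n)" if q: "q = 1 \<or> q = - 1" for q :: real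
  proof (rule ccontr)
    assume "\<not> (\<exists>x\<in>?V. q * x (Suc n) < c (Suc n))"
    then have "- q * x (Suc n) \<le> - c (Suc n)" if "x \<in> ?V" for x using that by force
    then obtain l where l: "\<And>x. x \<in> V \<Longrightarrow> - q * x (Suc n) + (\<Sum>i\<in>{1..n}. l i * x i + c i * \<bar>l i\<bar>) \<le> - c (Suc n)"
      using mult[OF affine_fun_coord[of "- q" "Suc n"]] by blast
    \<comment> \<open>Option \<open>n + 1\<close> is held in the direction \<open>q\<close>, the
      others with reversed multipliers. Under every price system this portfolio would be worth at
      least its cost.\<close>
    define l' where "l' i = (if i \<le> n then - l i else if i = Suc n then q else 0)" for i
    have sub: "(\<Sum>i\<in>{1..e}. h i) = (\<Sum>i\<in>{1..n}. h i) + h (Suc n)" if "\<And>i. i > Suc n \<Longrightarrow> h i = 0" for h :: "nat \<Rightarrow> real"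
    proof -
      have "(\<Sum>i\<in>{1..e}. h i) = (\<Sum>i\<in>{1..Suc n}. h i)"
        by (rule sum.mono_neutral_right) (use Suc.prems that in auto)
      then show ?thesis by simp
    qed
    have "\<forall>i\<in>{1..e}. l' i = 0"
    proof (rule nondeg)
      fix x assume x: "x \<in> V"
      have a: "(\<Sum>i\<in>{1..e}. c i * \<bar>l' i\<bar>) = (\<Sum>i\<in>{1..n}. c i * \<bar>l i\<bar>) + c (Suc n)"
        using q by (subst sub) (auto simp: l'_def intro!: sum.cong)
      have b: "(\<Sum>i\<in>{1..e}. l' i * x i) = - (\<Sum>i\<in>{1..n}. l i * x i) + q * x (Suc n)"
        by (subst sub) (auto simp: l'_def sum_negf[symmetric] intro!: sum.cong)
      show "(\<Sum>i\<in>{1..e}. c i * \<bar>l' i\<bar>) \<le> (\<Sum>i\<in>{1..e}. l' i * x i)"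
        using l[OF x] unfolding a b sum.distrib by simp
    qed
    then have "l' (Suc n) = 0" using Suc.prems by simp
    then show False using q by (auto simp: l'_def)
  qed
  obtain p where p: "p \<in> ?V" "p (Suc n) < c (Suc n)" using sl[of 1] by auto
  obtain m where m: "m \<in> ?V" "- c (Suc n) < m (Suc n)" using sl[of "- 1"] by (auto simp: minus_less_iff)
  have "\<exists>x\<in>?V. \<bar>x (Suc n)\<bar> \<le> c (Suc n)"
  proof (cases "- c (Suc n) \<le> p (Suc n) \<or> m (Suc n) \<le> c (Suc n)")
    case True
    then show ?thesis using p m by (auto simp: abs_le_iff)
  next
    case False
    then have f: "p (Suc n) < 0" "0 < m (Suc n)" using cS by auto
    \<comment> \<open>The weight for which the mixture has value 0 for option
      \<open>n + 1\<close>.\<close>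
    let ?u = "m (Suc n) / (m (Suc n) - p (Suc n))"
    have u: "0 < ?u" "?u < 1" using f by (simp_all add: field_simps)
    have "?u * p (Suc n) + (1 - ?u) * m (Suc n) = 0" using f by (simp add: field_simps)
    then show ?thesis using mixV[OF p(1) m(1) u] cS by (intro bexI[OF _ mixV[OF p(1) m(1) u]]) simp
  qed
  then obtain x0 where x0: "x0 \<in> ?V" "\<bar>x0 (Suc n)\<bar> \<le> c (Suc n)" by blast
  have "\<exists>l. \<forall>x\<in>V. a x + (\<Sum>i\<in>{1..Suc n}. l i * x i + c i * \<bar>l i\<bar>) \<le> \<gamma>"
    if a: "affine_fun a" and le: "\<forall>x\<in>V. (\<forall>i\<in>{1..Suc n}. \<bar>x i\<bar> \<le> c i) \<longrightarrow> a x \<le> \<gamma>" for a \<gamma>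
  proof -
    \<comment> \<open>Option \<open>n + 1\<close> is priced first, over the systems that respect the
      first \<open>n\<close> constraints. The resulting functional is again affine, so the induction
      hypothesis removes those constraints.\<close>
    have "\<exists>l. \<forall>x\<in>?V. a x + l * x (Suc n) + c (Suc n) * \<bar>l\<bar> \<le> \<gamma>"
    proof (rule interval_multiplier[OF _ cS])
      fix x y u assume h: "x \<in> ?V" "y \<in> ?V" "0 < u" "u < (1::real)"
      show "\<exists>z\<in>?V. a z = u * a x + (1 - u) * a y \<and> z (Suc n) = u * x (Suc n) + (1 - u) * y (Suc n)"
        by (rule bexI[OF _ mixV[OF h]]) (use a in \<open>simp add: affine_fun_def\<close>)
    next
      fix x assume "x \<in> ?V" "\<bar>x (Suc n)\<bar> \<le> c (Suc n)"
      then show "a x \<le> \<gamma>" using le by (auto simp: atLeastAtMostSuc_conv)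
    qed (use p m in blast)+
    then obtain k where k: "\<And>x. x \<in> ?V \<Longrightarrow> a x + k * x (Suc n) \<le> \<gamma> - c (Suc n) * \<bar>k\<bar>" by (auto simp: algebra_simps)
    obtain l where l: "\<And>x. x \<in> V \<Longrightarrow> a x + k * x (Suc n) + (\<Sum>i\<in>{1..n}. l i * x i + c i * \<bar>l i\<bar>) \<le> \<gamma> - c (Suc n) * \<bar>k\<bar>"
      using mult[OF affine_fun_add[OF a affine_fun_coord[of k "Suc n"]] k] by blast
    have s: "(\<Sum>i\<in>{1..n}. (l(Suc n := k)) i * x i + c i * \<bar>(l(Suc n := k)) i\<bar>) = (\<Sum>i\<in>{1..n}. l i * x i + c i * \<bar>l i\<bar>)" for x
      by (rule sum.cong) auto
    show ?thesis
      by (rule exI[of _ "l(Suc n := k)"]) (use l s in \<open>simp add: algebra_simps\<close>)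
  qed
  moreover have "\<exists>x\<in>V. \<forall>i\<in>{1..Suc n}. \<bar>x i\<bar> \<le> c i"
    using x0 by (intro bexI[of _ x0]) (auto simp: atLeastAtMostSuc_conv)
  ultimately show ?case by blast
qed

section \<open>Integrability of claims, and duality for a single claim\<close>

lemma gexp_integrable: assumes f: "integrable M f" shows "gexp M f = ereal (\<integral>x. f x \<partial>M)"
proof -
  have fin: "(\<integral>\<^sup>+x. ennreal (f x) \<partial>M) \<noteq> \<infinity>" "(\<integral>\<^sup>+x. ennreal (- f x) \<partial>M) \<noteq> \<infinity>"
    using f unfolding real_integrable_def by auto
  have "enn2ereal a - enn2ereal b = ereal (enn2real a - enn2real b)" if "a \<noteq> \<infinity>" "b \<noteq> \<infinity>" for a b
    using that by (cases a; cases b) (auto simp: enn2ereal_ennreal)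
  then show ?thesis unfolding gexp_def using fin by (simp add: real_lebesgue_integral_def[OF f])
qed

lemma gexp_finite:
  assumes f: "f \<in> borel_measurable M" and fin: "\<bar>gexp M f\<bar> \<noteq> \<infinity>"
  shows "integrable M f"
  unfolding real_integrable_def
proof (intro conjI f)
  show n: "(\<integral>\<^sup>+x. ennreal (- f x) \<partial>M) \<noteq> \<infinity>" using fin unfolding gexp_def by (auto split: if_splits)
  show "(\<integral>\<^sup>+x. ennreal (f x) \<partial>M) \<noteq> \<infinity>"
  proof
    assume "(\<integral>\<^sup>+x. ennreal (f x) \<partial>M) = \<infinity>"
    with n have "gexp M f = \<infinity>" unfolding gexp_def
      by (cases "\<integral>\<^sup>+x. ennreal (- f x) \<partial>M") (auto simp: enn2ereal_ennreal)
    then show False using fin by simp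
  qed
qed

text \<open>Weak duality bounds the mean of an integrable claim only. Applied to the truncations
  from above, the uniform bound yields integrability of the claim itself by monotone
  convergence.\<close>

lemma (in finite_measure) integrable_truncations:
  fixes f :: "'a \<Rightarrow> real"
  assumes f: "f \<in> borel_measurable M" and neg: "(\<integral>\<^sup>+x. ennreal (- f x) \<partial>M) < \<infinity>"
    and le: "\<And>n::nat. integrable M (\<lambda>x. min (f x) (real n)) \<Longrightarrow> (\<integral>x. min (f x) (real n) \<partial>M) \<le> B"
  shows "integrable M f"
proof -
  have negi: "integrable M (\<lambda>x. max 0 (- f x))"
  proof (rule integrableI_nonneg)
    have "(\<integral>\<^sup>+x. ennreal (max 0 (- f x)) \<partial>M) = (\<integral>\<^sup>+x. ennreal (- f x) \<partial>M)"
      by (intro nn_integral_cong) (simp add: max_def ennreal_neg)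
    then show "(\<integral>\<^sup>+x. ennreal (max 0 (- f x)) \<partial>M) < \<infinity>" using neg by simp
  qed (use f in auto)
  have posi: "integrable M (\<lambda>x. min (max 0 (f x)) (real n))" for n
    by (rule integrable_const_bound[of _ "real n"]) (use f in auto)
  have e: "min (f x) (real n) = min (max 0 (f x)) (real n) - max 0 (- f x)" for x n by (simp add: min_def max_def)
  have mini: "integrable M (\<lambda>x. min (f x) (real n))" for n
    unfolding e by (rule Bochner_Integration.integrable_diff[OF posi negi])
  let ?c = "B + (\<integral>x. max 0 (- f x) \<partial>M)"
  have "(\<integral>x. min (max 0 (f x)) (real n) \<partial>M) \<le> ?c" for n
    using le[OF mini[of n]] unfolding e Bochner_Integration.integral_diff[OF posi negi] by simp
  moreover have "(\<integral>\<^sup>+x. ennreal (min (max 0 (f x)) (real n)) \<partial>M) = ennreal (\<integral>x. min (max 0 (f x)) (real n) \<partial>M)" for n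
    by (rule nn_integral_eq_integral[OF posi]) simp
  ultimately have le': "(\<integral>\<^sup>+x. ennreal (min (max 0 (f x)) (real n)) \<partial>M) \<le> ennreal ?c" for n
    by (simp only: ennreal_leI)
  have "(\<integral>\<^sup>+x. ennreal (f x) \<partial>M) = (\<integral>\<^sup>+x. (SUP n. ennreal (min (max 0 (f x)) (real n))) \<partial>M)"
  proof (rule nn_integral_cong, rule antisym)
    fix x
    obtain n :: nat where "f x \<le> real n" using real_arch_simple by blast
    then have "ennreal (f x) = ennreal (min (max 0 (f x)) (real n))" by (simp add: min_def max_def ennreal_neg)
    also have "\<dots> \<le> (SUP n. ennreal (min (max 0 (f x)) (real n)))" by (rule SUP_upper) simp
    finally show "ennreal (f x) \<le> (SUP n. ennreal (min (max 0 (f x)) (real n)))" .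
    have "ennreal (min (max 0 (f x)) (real n)) \<le> ennreal (max 0 (f x))" for n by (rule ennreal_leI) simp
    moreover have "ennreal (max 0 (f x)) = ennreal (f x)" by (simp add: max_def ennreal_neg)
    ultimately show "(SUP n. ennreal (min (max 0 (f x)) (real n))) \<le> ennreal (f x)" by (intro SUP_least) simp
  qed
  also have "\<dots> = (SUP n. \<integral>\<^sup>+x. ennreal (min (max 0 (f x)) (real n)) \<partial>M)"
    by (rule nn_integral_monotone_convergence_SUP) (use f in \<open>auto intro!: incseq_SucI le_funI ennreal_leI\<close>)
  also have "\<dots> \<le> ennreal ?c" by (rule SUP_least) (rule le')
  finally have "(\<integral>\<^sup>+x. ennreal (f x) \<partial>M) < \<infinity>" by (simp add: order_le_less_trans)
  then show ?thesis using f neg unfolding real_integrable_def by auto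
qed

lemma Om_0_unique: "w \<in> space (Om_t 0) \<Longrightarrow> w' \<in> space (Om_t 0) \<Longrightarrow> w = w'"
  by (simp add: space_Om)

context claim
begin

text \<open>A state of \<open>G 0\<close> is rescaled to last price component 1 and realised by a
  price system; the assumed bound on its value says that the cash position dominates the
  state.\<close>

lemma superhedge_dual:
  assumes y: "\<And>Q Z. (Q, Z) \<in> S0 T PP K \<Longrightarrow> integrable Q (\<lambda>w. \<phi> w * norm (Z T w)) \<Longrightarrow> (\<integral>w. \<xi> w \<bullet> Z T w \<partial>Q) \<le> y"
  shows "\<exists>\<eta>\<in>adm T PP K. qs T PP (\<lambda>w. y *\<^sub>R one_d + (\<Sum>t\<in>{0..T}. \<eta> t w) - \<xi> w \<in> K T w)"
proof (rule superhedge_exists)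
  fix w :: "nat \<Rightarrow> 'w" assume w: "w \<in> space (Om_t 0)"
  have n: "nice (G 0 w)" by (rule nice_G[OF _ w]) simp
  have "fst (snd p) \<le> y *\<^sub>R one_d \<bullet> fst p" if p: "p \<in> G 0 w" for p
  proof -
    define r where "r = fst p $ dlast"
    have r: "0 < r" unfolding r_def using n p unfolding nice_def by blast
    let ?p = "(1 / r) *\<^sub>R p"
    have "?p \<in> G 0 w" using n p r unfolding nice_def by simp
    then have "?p \<in> G 0 v" if "v \<in> space (Om_t 0)" for v using Om_0_unique[OF w that] by simp
    moreover have "fst ?p $ dlast = 1" using r by (simp add: r_def)
    ultimately have "\<exists>Q Z. (Q, Z) \<in> S0 T PP K \<and> integrable Q (\<lambda>w. \<phi> w * norm (Z T w)) \<and> fst (snd ?p) \<le> (\<integral>w. \<xi> w \<bullet> Z T w \<partial>Q)"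
      by (rule SCPS_exists)
    then obtain Q Z where "(Q, Z) \<in> S0 T PP K" "integrable Q (\<lambda>w. \<phi> w * norm (Z T w))" "fst (snd ?p) \<le> (\<integral>w. \<xi> w \<bullet> Z T w \<partial>Q)"
      by (elim exE conjE)
    then have "fst (snd ?p) \<le> y" using y by (meson order_trans)
    then have "fst (snd p) \<le> y * r" using r by (simp add: field_simps)
    then show ?thesis by (simp add: one_d_def inner_axis' r_def)
  qed
  then show "y *\<^sub>R one_d \<in> Dset 0 w" unfolding Dset_def by blast
qed

text \<open>At time 0 there is a single path, and a polar set cannot contain it since priors have
  mass 1. There the cone is full, so the reference price \<open>S 0\<close> extends to a price
  system.\<close>

lemma SCPS_integrable_exists: "\<exists>Q Z. (Q, Z) \<in> S0 T PP K \<and> integrable Q (\<lambda>w. \<phi> w * norm (Z T w))"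
proof -
  obtain N where N: "polar 0 N" "\<forall>w\<in>space (Om_t 0) - N. full 0 w" using full_qs[OF le0] by (elim exE conjE)
  obtain k where k: "valid k" using valid_exists by (elim exE)
  have pr: "kprod k 0 \<in> probs (Om_t 0)" by (rule valid_probs[OF k]) simp
  interpret prob_space "kprod k 0" by (rule probs_prob[OF pr])
  have ae: "AE w in kprod k 0. w \<notin> N" using N(1) k unfolding polar_def by (elim conjE) simp
  have "\<exists>w\<in>space (Om_t 0). w \<notin> N"
  proof (rule ccontr)
    assume *: "\<not> (\<exists>w\<in>space (Om_t 0). w \<notin> N)"
    have "AE w in kprod k 0. False" using ae by (rule AE_mono_space) (use * probs_space[OF pr] in blast)
    then show False by (simp add: AE_False del: kprod.simps)
  qed
  then obtain w where w: "w \<in> space (Om_t 0)" "w \<notin> N" by blast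
  have f: "full 0 w" using N(2) w by blast
  have "w \<in> space (Om_t T)" by (rule Om_mono[OF _ w(1)]) simp
  then have S: "S 0 w \<in> Kstar0 (K 0 w)" "S 0 w \<in> icone (K 0 w)" using S_in unfolding icone_def by auto
  then obtain v r where p: "(S 0 w, v, r) \<in> G 0 w" using f unfolding full_def by blast
  have "(S 0 w, v, r) \<in> G 0 w'" if "w' \<in> space (Om_t 0)" for w' using Om_0_unique[OF w(1) that] p by simp
  moreover have "fst (S 0 w, v, r) $ dlast = 1" using S(1) by (simp add: Kstar0_def)
  ultimately have "\<exists>Q Z. (Q, Z) \<in> S0 T PP K \<and> integrable Q (\<lambda>w. \<phi> w * norm (Z T w)) \<and>
      fst (snd (S 0 w, v, r)) \<le> (\<integral>w. \<xi> w \<bullet> Z T w \<partial>Q)" by (rule SCPS_exists)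
  then show ?thesis by (elim exE conjE) (intro exI conjI)
qed

end

section \<open>Duality with static options\<close>

lemma one_d_inner: "one_d \<bullet> z = z $ dlast"
  by (simp add: one_d_def inner_axis')

context market
begin

context
  fixes e :: nat and c :: "nat \<Rightarrow> real" and \<zeta> :: "nat \<Rightarrow> (nat \<Rightarrow> 'w) \<Rightarrow> (real, 'd) vec" and \<xi> :: "(nat \<Rightarrow> 'w) \<Rightarrow> (real, 'd) vec"
  assumes xi: "\<xi> \<in> borel_measurable (Om_t T)" and zeta: "\<And>i. i \<in> {1..e} \<Longrightarrow> \<zeta> i \<in> borel_measurable (Om_t T)"
begin

definition Sint where
  "Sint = {(Q, Z). (Q, Z) \<in> S0 T PP K \<and> integrable Q (\<lambda>w. \<xi> w \<bullet> Z T w) \<and> (\<forall>i\<in>{1..e}. integrable Q (\<lambda>w. \<zeta> i w \<bullet> Z T w))}"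

text \<open>Coordinate 0 is the claim and the coordinates up to \<open>e\<close> are the options, so
  that both enter the multiplier lemma as one convex set of functions.\<close>

definition val where
  "val Q Z i = (if i = 0 then (\<integral>w. \<xi> w \<bullet> Z T w \<partial>Q) else if i \<le> e then (\<integral>w. \<zeta> i w \<bullet> Z T w \<partial>Q) else 0)"

lemma Sint_iff: "(Q, Z) \<in> Sint \<longleftrightarrow> (Q, Z) \<in> S0 T PP K \<and> integrable Q (\<lambda>w. \<xi> w \<bullet> Z T w) \<and> (\<forall>i\<in>{1..e}. integrable Q (\<lambda>w. \<zeta> i w \<bullet> Z T w))"
  unfolding Sint_def by simp

definition combo where "combo k l w = k *\<^sub>R \<xi> w + (\<Sum>i\<in>{1..e}. l i *\<^sub>R \<zeta> i w)"

text \<open>The claim and every option enter separately: in \<open>combo\<close> they might cancel,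
  while a price system in \<open>Sint\<close> has to integrate each of them.\<close>

definition majorant where "majorant k l w = norm (combo k l w) + (norm (\<xi> w) + (\<Sum>i\<in>{1..e}. norm (\<zeta> i w)))"

lemma majorant_le: "norm (combo k l w) \<le> majorant k l w" "norm (\<xi> w) \<le> majorant k l w" "i \<in> {1..e} \<Longrightarrow> norm (\<zeta> i w) \<le> majorant k l w"
proof -
  have s: "0 \<le> (\<Sum>i\<in>{1..e}. norm (\<zeta> i w))" by (rule sum_nonneg) simp
  then show "norm (combo k l w) \<le> majorant k l w" "norm (\<xi> w) \<le> majorant k l w" unfolding majorant_def by simp_all
  assume "i \<in> {1..e}"
  then have "norm (\<zeta> i w) \<le> (\<Sum>i\<in>{1..e}. norm (\<zeta> i w))" by (intro member_le_sum) simp_all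
  then show "norm (\<zeta> i w) \<le> majorant k l w" unfolding majorant_def
    using norm_ge_zero[of "combo k l w"] norm_ge_zero[of "\<xi> w"] by linarith
qed

lemma combo_meas: "combo k l \<in> borel_measurable (Om_t T)"
  unfolding combo_def[abs_def]
  by (intro borel_measurable_add borel_measurable_scaleR borel_measurable_const borel_measurable_sum xi zeta)

lemma claim_combo: "claim T Pt K S (combo k l) (majorant k l)"
proof (intro claim.intro claim_axioms.intro market_axioms combo_meas majorant_le(1))
  show "majorant k l \<in> borel_measurable (Om_t T)" unfolding majorant_def[abs_def]
    by (intro borel_measurable_add borel_measurable_sum measurable_compose[OF combo_meas borel_measurable_norm]
        measurable_compose[OF xi borel_measurable_norm] measurable_compose[OF zeta borel_measurable_norm])
qed

lemma S0_claim_meas: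
  assumes QZ: "(Q, Z) \<in> S0 T PP K" and f: "f \<in> borel_measurable (Om_t T)"
  shows "(\<lambda>w. f w \<bullet> Z T w) \<in> borel_measurable Q"
  by (rule borel_measurable_inner[OF f[folded measurable_probs[OF S0D(1)[OF QZ]]] S0_Q_meas[OF QZ order_refl]])

lemma majorant_Sint:
  assumes QZ: "(Q, Z) \<in> S0 T PP K" and i: "integrable Q (\<lambda>w. majorant k l w * norm (Z T w))"
  shows "(Q, Z) \<in> Sint"
proof -
  have "integrable Q (\<lambda>w. f w \<bullet> Z T w)" if f: "f \<in> borel_measurable (Om_t T)" and le: "\<And>w. norm (f w) \<le> majorant k l w"
    for f :: "(nat \<Rightarrow> 'w) \<Rightarrow> (real, 'd) vec"
  proof (rule Bochner_Integration.integrable_bound[OF i S0_claim_meas[OF QZ f]], rule AE_I2)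
    fix w
    have "norm (f w \<bullet> Z T w) \<le> norm (f w) * norm (Z T w)" using Cauchy_Schwarz_ineq2[of "f w" "Z T w"] by simp
    also have "\<dots> \<le> majorant k l w * norm (Z T w)" by (rule mult_right_mono[OF le]) simp
    finally show "norm (f w \<bullet> Z T w) \<le> norm (majorant k l w * norm (Z T w))" by simp
  qed
  then show ?thesis unfolding Sint_iff using QZ xi zeta majorant_le(2,3) by simp
qed

lemma combo_integral:
  assumes QZ: "(Q, Z) \<in> Sint"
  shows "integrable Q (\<lambda>w. combo k l w \<bullet> Z T w)" "(\<integral>w. combo k l w \<bullet> Z T w \<partial>Q) = k * val Q Z 0 + (\<Sum>i\<in>{1..e}. l i * val Q Z i)"
proof -
  have e: "combo k l w \<bullet> Z T w = k * (\<xi> w \<bullet> Z T w) + (\<Sum>i\<in>{1..e}. l i * (\<zeta> i w \<bullet> Z T w))" for w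
    unfolding combo_def by (simp add: inner_add_left inner_sum_left)
  have i: "integrable Q (\<lambda>w. k * (\<xi> w \<bullet> Z T w))" "i \<in> {1..e} \<Longrightarrow> integrable Q (\<lambda>w. l i * (\<zeta> i w \<bullet> Z T w))" for i
    using QZ unfolding Sint_iff by simp_all
  have s: "integrable Q (\<lambda>w. \<Sum>i\<in>{1..e}. l i * (\<zeta> i w \<bullet> Z T w))" by (rule Bochner_Integration.integrable_sum[OF i(2)])
  show "integrable Q (\<lambda>w. combo k l w \<bullet> Z T w)" unfolding e by (rule Bochner_Integration.integrable_add[OF i(1) s])
  have sI: "(\<integral>w. (\<Sum>i\<in>{1..e}. l i * (\<zeta> i w \<bullet> Z T w)) \<partial>Q) = (\<Sum>i\<in>{1..e}. l i * val Q Z i)"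
    by (rule trans[OF Bochner_Integration.integral_sum[OF i(2)]], assumption, rule sum.cong) (simp_all add: val_def)
  show "(\<integral>w. combo k l w \<bullet> Z T w \<partial>Q) = k * val Q Z 0 + (\<Sum>i\<in>{1..e}. l i * val Q Z i)"
    unfolding e Bochner_Integration.integral_add[OF i(1) s] sI by (simp add: val_def)
qed

text \<open>Option positions are absorbed into a new claim. The duality for a single claim tests
  only systems integrating \<open>majorant\<close>, and all of these lie in
  \<open>Sint\<close>.\<close>

lemma hedge_from_bound:
  assumes le: "\<And>Q Z. (Q, Z) \<in> Sint \<Longrightarrow> k * val Q Z 0 + (\<Sum>i\<in>{1..e}. l i * val Q Z i) \<le> y"
  shows "\<exists>\<eta>\<in>adm T PP K. qs T PP (\<lambda>w. y *\<^sub>R one_d + (\<Sum>t\<in>{0..T}. \<eta> t w) - combo k l w \<in> K T w)"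
proof (rule claim.superhedge_dual[OF claim_combo])
  fix Q Z assume "(Q, Z) \<in> S0 T PP K" "integrable Q (\<lambda>w. majorant k l w * norm (Z T w))"
  then have "(Q, Z) \<in> Sint" by (rule majorant_Sint)
  from le[OF this] show "(\<integral>w. combo k l w \<bullet> Z T w \<partial>Q) \<le> y" unfolding combo_integral(2)[OF \<open>(Q, Z) \<in> Sint\<close>] .
qed

lemma Sint_nonempty: "\<exists>Q Z. (Q, Z) \<in> Sint"
  using claim.SCPS_integrable_exists[OF claim_combo[of 0 "\<lambda>_. 0"]] by (elim exE conjE) (rule exI, rule exI, rule majorant_Sint)

lemma mixable_vals: "mixable {val Q Z | Q Z. (Q, Z) \<in> Sint}"
  unfolding mixable_def
proof (intro ballI allI impI)
  fix x y u assume "x \<in> {val Q Z | Q Z. (Q, Z) \<in> Sint}" "y \<in> {val Q Z | Q Z. (Q, Z) \<in> Sint}" and u: "0 < u \<and> u < (1::real)"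
  then obtain Q1 Z1 Q2 Z2 where 1: "(Q1, Z1) \<in> Sint" "x = val Q1 Z1" and 2: "(Q2, Z2) \<in> Sint" "y = val Q2 Z2"
    unfolding mem_Collect_eq by (elim exE conjE)
  have s: "(Q1, Z1) \<in> S0 T PP K" "(Q2, Z2) \<in> S0 T PP K" using 1 2 unfolding Sint_iff by simp_all
  obtain Q Z where QZ: "(Q, Z) \<in> S0 T PP K" and f: "\<forall>f. f \<in> borel_measurable (Om_t T) \<longrightarrow>
      integrable Q1 (\<lambda>w. f w \<bullet> Z1 T w) \<longrightarrow> integrable Q2 (\<lambda>w. f w \<bullet> Z2 T w) \<longrightarrow> integrable Q (\<lambda>w. f w \<bullet> Z T w) \<and>
      (\<integral>w. f w \<bullet> Z T w \<partial>Q) = u * (\<integral>w. f w \<bullet> Z1 T w \<partial>Q1) + (1 - u) * (\<integral>w. f w \<bullet> Z2 T w \<partial>Q2)"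
    using S0_convex[OF s conjunct1[OF u] conjunct2[OF u]] by (elim exE conjE)
  have x: "integrable Q (\<lambda>w. \<xi> w \<bullet> Z T w) \<and>
      (\<integral>w. \<xi> w \<bullet> Z T w \<partial>Q) = u * (\<integral>w. \<xi> w \<bullet> Z1 T w \<partial>Q1) + (1 - u) * (\<integral>w. \<xi> w \<bullet> Z2 T w \<partial>Q2)"
    using f[rule_format, OF xi] 1(1) 2(1) unfolding Sint_iff by simp
  have z: "integrable Q (\<lambda>w. \<zeta> i w \<bullet> Z T w) \<and>
      (\<integral>w. \<zeta> i w \<bullet> Z T w \<partial>Q) = u * (\<integral>w. \<zeta> i w \<bullet> Z1 T w \<partial>Q1) + (1 - u) * (\<integral>w. \<zeta> i w \<bullet> Z2 T w \<partial>Q2)" if "i \<in> {1..e}" for i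
    using f[rule_format, OF zeta[OF that]] 1(1) 2(1) that unfolding Sint_iff by simp
  have "(Q, Z) \<in> Sint" unfolding Sint_iff using QZ x z by simp
  moreover have "(\<lambda>i. u * x i + (1 - u) * y i) = val Q Z"
    unfolding 1(2) 2(2) fun_eq_iff val_def using x z by simp
  ultimately show "(\<lambda>i. u * x i + (1 - u) * y i) \<in> {val Q Z | Q Z. (Q, Z) \<in> Sint}"
    unfolding mem_Collect_eq by (intro exI conjI)
qed

lemma Se_iff: "(Q, Z) \<in> Se T PP K e c \<zeta> \<longleftrightarrow> (Q, Z) \<in> S0 T PP K \<and>
    (\<forall>i\<in>{1..e}. integrable Q (\<lambda>w. \<zeta> i w \<bullet> Z T w) \<and> \<bar>\<integral>w. \<zeta> i w \<bullet> Z T w \<partial>Q\<bar> \<le> c i)"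
proof (cases "(Q, Z) \<in> S0 T PP K")
  case True
  have "gexp Q (\<lambda>w. \<zeta> i w \<bullet> Z T w) \<in> {- ereal (c i) .. ereal (c i)} \<longleftrightarrow>
      integrable Q (\<lambda>w. \<zeta> i w \<bullet> Z T w) \<and> \<bar>\<integral>w. \<zeta> i w \<bullet> Z T w \<partial>Q\<bar> \<le> c i" if i: "i \<in> {1..e}" for i
  proof (cases "integrable Q (\<lambda>w. \<zeta> i w \<bullet> Z T w)")
    case True
    then show ?thesis by (simp add: gexp_integrable abs_le_iff) linarith
  next
    case False
    then have "\<bar>gexp Q (\<lambda>w. \<zeta> i w \<bullet> Z T w)\<bar> = \<infinity>" using gexp_finite[OF S0_claim_meas[OF \<open>(Q, Z) \<in> S0 T PP K\<close> zeta[OF i]]] by blast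
    then show ?thesis using False by (cases "gexp Q (\<lambda>w. \<zeta> i w \<bullet> Z T w)") auto
  qed
  then show ?thesis using True unfolding Se_def by simp
qed (simp add: Se_def)

text \<open>Weak duality is applied to truncations of the claim minus the cash and option positions,
  which are integrable; \<open>integrable_truncations\<close> then passes to the claim
  itself.\<close>

lemma hedge_integral:
  assumes QZ: "(Q, Z) \<in> S0 T PP K" and int: "\<And>i. i \<in> {1..e} \<Longrightarrow> integrable Q (\<lambda>w. \<zeta> i w \<bullet> Z T w)"
    and neg: "(\<integral>\<^sup>+w. ennreal (- (\<xi> w \<bullet> Z T w)) \<partial>Q) < \<infinity>" and \<eta>: "\<eta> \<in> adm T PP K"
    and hedge: "qs T PP (\<lambda>w. y *\<^sub>R one_d + (\<Sum>i\<in>{1..e}. l i *\<^sub>R \<zeta> i w) + (\<Sum>t\<in>{0..T}. \<eta> t w) - \<xi> w \<in> K T w)"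
  shows "integrable Q (\<lambda>w. \<xi> w \<bullet> Z T w)" "(\<integral>w. \<xi> w \<bullet> Z T w \<partial>Q) \<le> y + (\<Sum>i\<in>{1..e}. l i * (\<integral>w. \<zeta> i w \<bullet> Z T w \<partial>Q))"
proof -
  interpret prob_space Q by (rule probs_prob[OF S0D(1)[OF QZ]])
  let ?x = "\<lambda>w. \<xi> w \<bullet> Z T w" and ?s = "\<lambda>w. \<Sum>i\<in>{1..e}. l i * (\<zeta> i w \<bullet> Z T w)" and ?\<eta> = "\<lambda>w. (\<Sum>t\<in>{0..T}. \<eta> t w) \<bullet> Z T w"
  have si: "integrable Q ?s" by (intro Bochner_Integration.integrable_sum integrable_mult_right int)
  have sI: "(\<integral>w. ?s w \<partial>Q) = (\<Sum>i\<in>{1..e}. l i * (\<integral>w. \<zeta> i w \<bullet> Z T w \<partial>Q))"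
    using int by (subst Bochner_Integration.integral_sum) (simp_all add: integrable_mult_right)
  have ae: "AE w in Q. ?x w - y - ?s w \<le> ?\<eta> w"
    using qs_AE[OF QZ hedge] S0D(4)[OF QZ order_refl]
  proof (rule AE_mono_space[OF AE_conjI])
    fix w assume w: "w \<in> space Q" and h: "y *\<^sub>R one_d + (\<Sum>i\<in>{1..e}. l i *\<^sub>R \<zeta> i w) + (\<Sum>t\<in>{0..T}. \<eta> t w) - \<xi> w \<in> K T w \<and> Z T w \<in> icone (K T w)"
    let ?v = "y *\<^sub>R one_d + (\<Sum>i\<in>{1..e}. l i *\<^sub>R \<zeta> i w) + (\<Sum>t\<in>{0..T}. \<eta> t w) - \<xi> w"
    have "Z T w $ dlast = 1" using S0D(6)[OF QZ order_refl] w probs_space[OF S0D(1)[OF QZ]] by simp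
    then have "?v \<bullet> Z T w = y + ?s w + ?\<eta> w - ?x w"
      by (simp add: inner_diff_left inner_add_left inner_sum_left one_d_inner)
    moreover have "0 \<le> ?v \<bullet> Z T w"
      using icone_pos[of "Z T w" "K T w" ?v] h by (cases "?v = 0") (simp_all add: less_imp_le)
    ultimately show "?x w - y - ?s w \<le> ?\<eta> w" by simp
  qed
  have le: "(\<integral>w. f w \<partial>Q) \<le> y + (\<integral>w. ?s w \<partial>Q)" if f: "integrable Q f" "\<And>w. f w \<le> ?x w" for f
  proof -
    have i: "integrable Q (\<lambda>w. f w - y - ?s w)" using f(1) si by simp
    have "AE w in Q. f w - y - ?s w \<le> ?\<eta> w" using ae
    proof (rule eventually_mono)
      fix w assume "?x w - y - ?s w \<le> ?\<eta> w"
      then show "f w - y - ?s w \<le> ?\<eta> w" using f(2)[of w] by linarith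
    qed
    from weak_duality[OF QZ \<eta> i this] show ?thesis using f(1) si by (simp add: prob_space)
  qed
  show xi: "integrable Q ?x"
    by (rule integrable_truncations[OF S0_claim_meas[OF QZ xi] neg], rule le) simp_all
  show "(\<integral>w. ?x w \<partial>Q) \<le> y + (\<Sum>i\<in>{1..e}. l i * (\<integral>w. \<zeta> i w \<bullet> Z T w \<partial>Q))" using le[OF xi] sI by simp
qed

lemma gexp_le_hedge:
  assumes QZ: "(Q, Z) \<in> Se T PP K e c \<zeta>" and \<eta>: "\<eta> \<in> adm T PP K"
    and hedge: "qs T PP (\<lambda>w. y *\<^sub>R one_d + (\<Sum>i\<in>{1..e}. l i *\<^sub>R \<zeta> i w) + (\<Sum>t\<in>{0..T}. \<eta> t w) - \<xi> w \<in> K T w)"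
  shows "gexp Q (\<lambda>w. \<xi> w \<bullet> Z T w) \<le> ereal (y + (\<Sum>i\<in>{1..e}. c i * \<bar>l i\<bar>))"
proof (cases "(\<integral>\<^sup>+w. ennreal (- (\<xi> w \<bullet> Z T w)) \<partial>Q) = \<infinity>")
  \<comment> \<open>An infinite negative part makes \<open>gexp\<close> minus infinity by
    convention.\<close>
  case True
  then show ?thesis by (simp add: gexp_def)
next
  case False
  then have neg: "(\<integral>\<^sup>+w. ennreal (- (\<xi> w \<bullet> Z T w)) \<partial>Q) < \<infinity>" by (simp add: top.not_eq_extremum)
  have s: "(Q, Z) \<in> S0 T PP K" and i: "\<And>i. i \<in> {1..e} \<Longrightarrow> integrable Q (\<lambda>w. \<zeta> i w \<bullet> Z T w)"
    and b: "\<And>i. i \<in> {1..e} \<Longrightarrow> \<bar>\<integral>w. \<zeta> i w \<bullet> Z T w \<partial>Q\<bar> \<le> c i" using QZ unfolding Se_iff by simp_all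
  note h = hedge_integral[OF s i neg \<eta> hedge]
  have "(\<Sum>i\<in>{1..e}. l i * (\<integral>w. \<zeta> i w \<bullet> Z T w \<partial>Q)) \<le> (\<Sum>i\<in>{1..e}. c i * \<bar>l i\<bar>)"
  proof (rule sum_mono)
    fix i assume "i \<in> {1..e}"
    have "l i * (\<integral>w. \<zeta> i w \<bullet> Z T w \<partial>Q) \<le> \<bar>l i\<bar> * \<bar>\<integral>w. \<zeta> i w \<bullet> Z T w \<partial>Q\<bar>"
      by (metis abs_ge_self abs_mult)
    also have "\<dots> \<le> \<bar>l i\<bar> * c i" by (rule mult_left_mono[OF b]) (use \<open>i \<in> {1..e}\<close> in simp_all)
    finally show "l i * (\<integral>w. \<zeta> i w \<bullet> Z T w \<partial>Q) \<le> c i * \<bar>l i\<bar>" by (simp add: mult.commute)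
  qed
  then show ?thesis using h by (simp add: gexp_integrable)
qed

theorem option_duality:
  assumes c: "\<forall>i\<in>{1..e}. 0 \<le> c i"
    and nondeg: "e = 0 \<or> (\<forall>l. \<forall>\<eta>\<in>adm T PP K.
      qs T PP (\<lambda>w. (\<Sum>i\<in>{1..e}. l i *\<^sub>R \<zeta> i w - (\<bar>l i\<bar> * c i) *\<^sub>R one_d) + (\<Sum>t\<in>{0..T}. \<eta> t w) \<in> K T w) \<longrightarrow> (\<forall>i\<in>{1..e}. l i = 0))"
  shows "Se T PP K e c \<zeta> \<noteq> {} \<and>
    spr T PP K e c \<zeta> \<xi> = (SUP QZ\<in>Se T PP K e c \<zeta>. gexp (fst QZ) (\<lambda>w. \<xi> w \<bullet> snd QZ T w)) \<and>
    (\<bar>spr T PP K e c \<zeta> \<xi>\<bar> \<noteq> \<infinity> \<longrightarrow> (\<exists>\<eta>\<in>adm T PP K. \<exists>l. qs T PP (\<lambda>w. real_of_ereal (spr T PP K e c \<zeta> \<xi>) *\<^sub>R one_d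
      + (\<Sum>i\<in>{1..e}. l i *\<^sub>R \<zeta> i w - (\<bar>l i\<bar> * c i) *\<^sub>R one_d) + (\<Sum>t\<in>{0..T}. \<eta> t w) - \<xi> w \<in> K T w)))"
proof -
  let ?V = "{val Q Z | Q Z. (Q, Z) \<in> Sint}"
  let ?g = "\<lambda>QZ. gexp (fst QZ) (\<lambda>w. \<xi> w \<bullet> snd QZ T w)"
  let ?\<sigma> = "SUP QZ\<in>Se T PP K e c \<zeta>. ?g QZ"
  have valV: "val Q Z \<in> ?V" if "(Q, Z) \<in> Sint" for Q Z unfolding mem_Collect_eq by (rule exI[of _ Q], rule exI[of _ Z], rule conjI[OF refl that])
  have V0: "?V \<noteq> {}" using Sint_nonempty valV by (elim exE) (rule notI, simp)
  have c0: "\<And>i. i \<in> {1..e} \<Longrightarrow> 0 \<le> c i" using c by simp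
  \<comment> \<open>A portfolio worth at least its cost under all price systems can be superhedged
    from zero capital, so the assumption on trivial option positions forces it to vanish.\<close>
  have nd: "\<forall>i\<in>{1..e}. l i = 0" if le: "\<And>x. x \<in> ?V \<Longrightarrow> (\<Sum>i\<in>{1..e}. c i * \<bar>l i\<bar>) \<le> (\<Sum>i\<in>{1..e}. l i * x i)" for l :: "nat \<Rightarrow> real"
  proof (cases "e = 0")
    case False
    have "\<exists>\<eta>\<in>adm T PP K. qs T PP (\<lambda>w. (- (\<Sum>i\<in>{1..e}. c i * \<bar>l i\<bar>)) *\<^sub>R one_d + (\<Sum>t\<in>{0..T}. \<eta> t w) - combo 0 (\<lambda>i. - l i) w \<in> K T w)"
      by (rule hedge_from_bound) (use le[OF valV] in \<open>simp add: sum_negf\<close>)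
    moreover have "(- (\<Sum>i\<in>{1..e}. c i * \<bar>l i\<bar>)) *\<^sub>R one_d + h - combo 0 (\<lambda>i. - l i) w =
        (\<Sum>i\<in>{1..e}. l i *\<^sub>R \<zeta> i w - (\<bar>l i\<bar> * c i) *\<^sub>R one_d) + h" for h w
      by (simp add: combo_def sum_subtractf sum_negf scaleR_sum_left mult.commute)
    ultimately have "\<exists>\<eta>\<in>adm T PP K. qs T PP (\<lambda>w. (\<Sum>i\<in>{1..e}. l i *\<^sub>R \<zeta> i w - (\<bar>l i\<bar> * c i) *\<^sub>R one_d) + (\<Sum>t\<in>{0..T}. \<eta> t w) \<in> K T w)"
      by (simp only:)
    then obtain \<eta> where \<eta>: "\<eta> \<in> adm T PP K"
        "qs T PP (\<lambda>w. (\<Sum>i\<in>{1..e}. l i *\<^sub>R \<zeta> i w - (\<bar>l i\<bar> * c i) *\<^sub>R one_d) + (\<Sum>t\<in>{0..T}. \<eta> t w) \<in> K T w)" by (elim bexE)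
    show ?thesis by (rule disj_imp[THEN iffD1, THEN mp, OF nondeg False, THEN spec, THEN bspec, OF \<eta>(1), THEN mp, OF \<eta>(2)])
  qed simp
  have box: "(\<exists>x\<in>?V. \<forall>i\<in>{1..e}. \<bar>x i\<bar> \<le> c i) \<and>
    (\<forall>a \<gamma>. affine_fun a \<longrightarrow> (\<forall>x\<in>?V. (\<forall>i\<in>{1..e}. \<bar>x i\<bar> \<le> c i) \<longrightarrow> a x \<le> \<gamma>) \<longrightarrow>
      (\<exists>l. \<forall>x\<in>?V. a x + (\<Sum>i\<in>{1..e}. l i * x i + c i * \<bar>l i\<bar>) \<le> \<gamma>))"
  proof (rule box_multipliers[OF mixable_vals V0 _ _ order_refl])
    show "0 \<le> c i" if "i \<in> {1..e}" for i by (rule c0[OF that])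
    show "\<forall>i\<in>{1..e}. l i = 0" if "\<And>x. x \<in> ?V \<Longrightarrow> (\<Sum>i\<in>{1..e}. c i * \<bar>l i\<bar>) \<le> (\<Sum>i\<in>{1..e}. l i * x i)" for l :: "nat \<Rightarrow> real"
      using that by (rule nd)
  qed
  have SeI: "(Q, Z) \<in> Se T PP K e c \<zeta>" if "(Q, Z) \<in> Sint" "\<forall>i\<in>{1..e}. \<bar>val Q Z i\<bar> \<le> c i" for Q Z
    unfolding Se_iff using that unfolding Sint_iff by (simp add: val_def)
  obtain Q0 Z0 where Q0: "(Q0, Z0) \<in> Sint" "\<forall>i\<in>{1..e}. \<bar>val Q0 Z0 i\<bar> \<le> c i"
    using conjunct1[OF box] by (elim bexE CollectE exE conjE) simp
  have ge: "ereal (val Q Z 0) \<le> ?\<sigma>" if "(Q, Z) \<in> Sint" "\<forall>i\<in>{1..e}. \<bar>val Q Z i\<bar> \<le> c i" for Q Z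
  proof -
    have "?g (Q, Z) = ereal (val Q Z 0)" using that(1) unfolding Sint_iff by (simp add: gexp_integrable val_def)
    then show ?thesis using SUP_upper[OF SeI[OF that], of ?g] by simp
  qed
  have weak: "?\<sigma> \<le> spr T PP K e c \<zeta> \<xi>"
    unfolding spr_def
  proof (rule SUP_least, rule Inf_greatest)
    fix QZ v assume QZ: "QZ \<in> Se T PP K e c \<zeta>" and v: "v \<in> {ereal (y + (\<Sum>i\<in>{1..e}. c i * \<bar>l i\<bar>)) | y l \<eta>. \<eta> \<in> adm T PP K \<and>
      qs T PP (\<lambda>w. y *\<^sub>R one_d + (\<Sum>i\<in>{1..e}. l i *\<^sub>R \<zeta> i w) + (\<Sum>t\<in>{0..T}. \<eta> t w) - \<xi> w \<in> K T w)}"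
    have q: "(fst QZ, snd QZ) \<in> Se T PP K e c \<zeta>" using QZ by simp
    from v show "?g QZ \<le> v" unfolding mem_Collect_eq by (elim exE conjE) (simp only: gexp_le_hedge[OF q])
  qed
  have "Se T PP K e c \<zeta> \<noteq> {}" using SeI[OF Q0] by blast
  moreover have strong: "spr T PP K e c \<zeta> \<xi> \<le> ereal \<gamma> \<and> (\<exists>\<eta>\<in>adm T PP K. \<exists>l. qs T PP (\<lambda>w. \<gamma> *\<^sub>R one_d
      + (\<Sum>i\<in>{1..e}. l i *\<^sub>R \<zeta> i w - (\<bar>l i\<bar> * c i) *\<^sub>R one_d) + (\<Sum>t\<in>{0..T}. \<eta> t w) - \<xi> w \<in> K T w))"
    if \<sigma>: "?\<sigma> = ereal \<gamma>" for \<gamma>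
  proof -
    have "\<forall>x\<in>?V. (\<forall>i\<in>{1..e}. \<bar>x i\<bar> \<le> c i) \<longrightarrow> 1 * x 0 \<le> \<gamma>"
    proof (intro ballI impI)
      fix x assume "x \<in> ?V" and b: "\<forall>i\<in>{1..e}. \<bar>x i\<bar> \<le> c i"
      then obtain Q Z where "(Q, Z) \<in> Sint" "x = val Q Z" unfolding mem_Collect_eq by (elim exE conjE)
      then show "1 * x 0 \<le> \<gamma>" using ge[of Q Z] b \<sigma> by simp
    qed
    from conjunct2[OF box, THEN spec, THEN spec, THEN mp, OF affine_fun_coord, THEN mp, OF this]
    obtain l where l: "\<forall>x\<in>?V. 1 * x 0 + (\<Sum>i\<in>{1..e}. l i * x i + c i * \<bar>l i\<bar>) \<le> \<gamma>" by (elim exE)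
    \<comment> \<open>The hedge holds \<open>- l\<close> in the options; \<open>?y\<close> is what
      remains of \<gamma> after paying their cost.\<close>
    let ?y = "\<gamma> - (\<Sum>i\<in>{1..e}. c i * \<bar>- l i\<bar>)"
    have "\<exists>\<eta>\<in>adm T PP K. qs T PP (\<lambda>w. ?y *\<^sub>R one_d + (\<Sum>t\<in>{0..T}. \<eta> t w) - combo 1 l w \<in> K T w)"
      by (rule hedge_from_bound) (use bspec[OF l valV] in \<open>simp add: sum.distrib le_diff_eq add.assoc\<close>)
    then obtain \<eta> where \<eta>: "\<eta> \<in> adm T PP K" "qs T PP (\<lambda>w. ?y *\<^sub>R one_d + (\<Sum>t\<in>{0..T}. \<eta> t w) - combo 1 l w \<in> K T w)"
      by (elim bexE)
    have e1: "?y *\<^sub>R one_d + h - combo 1 l w = ?y *\<^sub>R one_d + (\<Sum>i\<in>{1..e}. (- l i) *\<^sub>R \<zeta> i w) + h - \<xi> w" for h w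
      by (simp add: combo_def sum_negf)
    have e2: "?y *\<^sub>R one_d + h - combo 1 l w =
        \<gamma> *\<^sub>R one_d + (\<Sum>i\<in>{1..e}. (- l i) *\<^sub>R \<zeta> i w - (\<bar>- l i\<bar> * c i) *\<^sub>R one_d) + h - \<xi> w" for h w
      by (simp add: combo_def sum_negf sum_subtractf scaleR_sum_left mult.commute scaleR_diff_left)
    have "spr T PP K e c \<zeta> \<xi> \<le> ereal (?y + (\<Sum>i\<in>{1..e}. c i * \<bar>- l i\<bar>))"
      unfolding spr_def
    proof (rule Inf_lower, rule CollectI)
      show "\<exists>y l' \<eta>. ereal (?y + (\<Sum>i\<in>{1..e}. c i * \<bar>- l i\<bar>)) = ereal (y + (\<Sum>i\<in>{1..e}. c i * \<bar>l' i\<bar>)) \<and> \<eta> \<in> adm T PP K \<and>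
          qs T PP (\<lambda>w. y *\<^sub>R one_d + (\<Sum>i\<in>{1..e}. l' i *\<^sub>R \<zeta> i w) + (\<Sum>t\<in>{0..T}. \<eta> t w) - \<xi> w \<in> K T w)"
        by (rule exI[of _ ?y], rule exI[of _ "\<lambda>i. - l i"], rule exI[of _ \<eta>], intro conjI refl \<eta>(1) \<eta>(2)[unfolded e1])
    qed
    then have "spr T PP K e c \<zeta> \<xi> \<le> ereal \<gamma>" by simp
    moreover have "\<exists>\<eta>\<in>adm T PP K. \<exists>l. qs T PP (\<lambda>w. \<gamma> *\<^sub>R one_d
      + (\<Sum>i\<in>{1..e}. l i *\<^sub>R \<zeta> i w - (\<bar>l i\<bar> * c i) *\<^sub>R one_d) + (\<Sum>t\<in>{0..T}. \<eta> t w) - \<xi> w \<in> K T w)"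
      by (rule bexI[OF _ \<eta>(1)], rule exI[of _ "\<lambda>i. - l i"], rule \<eta>(2)[unfolded e2])
    ultimately show ?thesis by (rule conjI)
  qed
  moreover have \<sigma>0: "?\<sigma> \<noteq> - \<infinity>" using ge[OF Q0] by auto
  moreover have eq: "spr T PP K e c \<zeta> \<xi> = ?\<sigma>"
  proof (cases "?\<sigma>")
    case (real \<gamma>)
    then show ?thesis using strong[OF real] weak by (intro antisym) simp_all
  next
    \<comment> \<open>Weak duality alone settles an infinite supremum: the infimum over hedges is
      then infinite as well.\<close>
    case PInf
    then show ?thesis using weak by simp
  qed (use \<sigma>0 in simp)
  moreover have "\<exists>\<eta>\<in>adm T PP K. \<exists>l. qs T PP (\<lambda>w. real_of_ereal (spr T PP K e c \<zeta> \<xi>) *\<^sub>R one_d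
      + (\<Sum>i\<in>{1..e}. l i *\<^sub>R \<zeta> i w - (\<bar>l i\<bar> * c i) *\<^sub>R one_d) + (\<Sum>t\<in>{0..T}. \<eta> t w) - \<xi> w \<in> K T w)"
    if "\<bar>spr T PP K e c \<zeta> \<xi>\<bar> \<noteq> \<infinity>"
  proof -
    have "?\<sigma> = ereal (real_of_ereal (spr T PP K e c \<zeta> \<xi>))" using that eq by (simp add: ereal_real)
    from conjunct2[OF strong[OF this]] show ?thesis .
  qed
  ultimately show ?thesis by (intro conjI impI)
qed

end

end

theorem mainTheorem4:
  fixes T :: nat
    and Pt :: "nat \<Rightarrow> (nat \<Rightarrow> 'w::polish_space) \<Rightarrow> 'w measure set"
    and K :: "nat \<Rightarrow> (nat \<Rightarrow> 'w) \<Rightarrow> ((real, 'd::{finite,linorder}) vec) set"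
    and S :: "nat \<Rightarrow> (nat \<Rightarrow> 'w) \<Rightarrow> (real, 'd) vec"
    and cS :: real
    and e :: nat
    and c :: "nat \<Rightarrow> real"
    and \<zeta> :: "nat \<Rightarrow> (nat \<Rightarrow> 'w) \<Rightarrow> (real, 'd) vec"
    and \<xi> :: "(nat \<Rightarrow> 'w) \<Rightarrow> (real, 'd) vec"
  assumes T_pos: "1 \<le> T"
    and d_ge2: "2 \<le> CARD('d)"
    (* the sets of priors P_t(omega) *)
    and Pt_nonempty: "\<forall>t<T. \<forall>\<omega>\<in>space (Om_t t). Pt t \<omega> \<noteq> {}"
    and Pt_probs: "\<forall>t<T. \<forall>\<omega>\<in>space (Om_t t). Pt t \<omega> \<subseteq> probs (borel :: 'w measure)"
    and Pt_convex: "\<forall>t<T. \<forall>\<omega>\<in>space (Om_t t). convex_meas (Pt t \<omega>)"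
    and Pt_analytic: "\<forall>t<T. analytic_in (prod_topology (Om_top t) weak_top)
                         {(\<omega>, P). \<omega> \<in> space (Om_t t) \<and> P \<in> Pt t \<omega>}"
    (* the solvency cones K_t *)
    and K_meas: "\<forall>t\<le>T. \<forall>U. open U \<longrightarrow>
                   {\<omega> \<in> space (Om_t T). K t \<omega> \<inter> U \<noteq> {}} \<in> sets (F0 T t)"
    and K_closed: "\<forall>t\<le>T. \<forall>\<omega>\<in>space (Om_t T). closed (K t \<omega>)"
    and K_cone: "\<forall>t\<le>T. \<forall>\<omega>\<in>space (Om_t T). convex_cone (K t \<omega>)"
    and K_orthant: "\<forall>t\<le>T. \<forall>\<omega>\<in>space (Om_t T). orthant \<subseteq> K t \<omega>"
    and Kstar_bd: "\<forall>t\<le>T. \<forall>\<omega>\<in>space (Om_t T). Kstar (K t \<omega>) \<inter> frontier orthant = {0}"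
    and Kstar_int: "\<forall>t\<le>T. \<forall>\<omega>\<in>space (Om_t T). interior (Kstar (K t \<omega>)) \<noteq> {}"
    (* the reference price process S and the constant c > 1 *)
    and S_adapted: "\<forall>t\<le>T. S t \<in> borel_measurable (F0 T t)"
    and S_in: "\<forall>t\<le>T. \<forall>\<omega>\<in>space (Om_t T).
                 S t \<omega> \<in> Kstar0 (K t \<omega>) \<inter> interior (Kstar (K t \<omega>))"
    and cS_gt1: "1 < cS"
    and cS_bd: "\<forall>t\<le>T. \<forall>\<omega>\<in>space (Om_t T). \<forall>y\<in>Kstar0 (K t \<omega>). \<forall>i. i \<noteq> dlast \<longrightarrow>
                 S t \<omega> $ i / cS \<le> y $ i \<and> y $ i \<le> cS * S t \<omega> $ i"
    (* hypotheses of the theorem *)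
    and xi_meas: "\<xi> \<in> borel_measurable (Om_t T)"
    and zeta_meas: "\<forall>i\<in>{1..e}. \<zeta> i \<in> borel_measurable (Om_t T)"
    and zeta_nonzero: "\<forall>i\<in>{1..e}. \<exists>\<omega>\<in>space (Om_t T). \<zeta> i \<omega> \<noteq> 0"
    and c_nonneg: "\<forall>i\<in>{1..e}. 0 \<le> c i"
    and NA: "NA2 T (Pcal T Pt) K"
    and nondeg: "e = 0 \<or> (1 \<le> e \<and> (\<forall>l :: nat \<Rightarrow> real. \<forall>\<eta>\<in>adm T (Pcal T Pt) K.
                   qs T (Pcal T Pt) (\<lambda>\<omega>. (\<Sum>i\<in>{1..e}. l i *\<^sub>R \<zeta> i \<omega> - (\<bar>l i\<bar> * c i) *\<^sub>R one_d)
                                         + (\<Sum>t\<in>{0..T}. \<eta> t \<omega>) \<in> K T \<omega>)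
                   \<longrightarrow> (\<forall>i\<in>{1..e}. l i = 0)))"
  shows "Se T (Pcal T Pt) K e c \<zeta> \<noteq> {}
    \<and> spr T (Pcal T Pt) K e c \<zeta> \<xi> =
        (SUP QZ\<in>Se T (Pcal T Pt) K e c \<zeta>. gexp (fst QZ) (\<lambda>\<omega>. inner (\<xi> \<omega>) (snd QZ T \<omega>)))
    \<and> (\<bar>spr T (Pcal T Pt) K e c \<zeta> \<xi>\<bar> \<noteq> \<infinity> \<longrightarrow>
        (\<exists>\<eta>\<in>adm T (Pcal T Pt) K. \<exists>l :: nat \<Rightarrow> real.
           qs T (Pcal T Pt) (\<lambda>\<omega>. real_of_ereal (spr T (Pcal T Pt) K e c \<zeta> \<xi>) *\<^sub>R one_d
              + (\<Sum>i\<in>{1..e}. l i *\<^sub>R \<zeta> i \<omega> - (\<bar>l i\<bar> * c i) *\<^sub>R one_d)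
              + (\<Sum>t\<in>{0..T}. \<eta> t \<omega>) - \<xi> \<omega> \<in> K T \<omega>)))"
proof -
  have "market T Pt K S"
    by (rule market.intro[OF Pt_nonempty Pt_probs Pt_convex Pt_analytic K_meas K_closed K_cone K_orthant S_adapted S_in NA])
  moreover have "\<And>i. i \<in> {1..e} \<Longrightarrow> \<zeta> i \<in> borel_measurable (Om_t T)" by (rule bspec[OF zeta_meas])
  moreover have "e = 0 \<or> (\<forall>l. \<forall>\<eta>\<in>adm T (Pcal T Pt) K.
      qs T (Pcal T Pt) (\<lambda>\<omega>. (\<Sum>i\<in>{1..e}. l i *\<^sub>R \<zeta> i \<omega> - (\<bar>l i\<bar> * c i) *\<^sub>R one_d)
        + (\<Sum>t\<in>{0..T}. \<eta> t \<omega>) \<in> K T \<omega>) \<longrightarrow> (\<forall>i\<in>{1..e}. l i = 0))"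
    using nondeg by (elim disjE conjE) (rule disjI1, assumption, rule disjI2, assumption)
  ultimately show ?thesis by (rule market.option_duality[OF _ xi_meas _ c_nonneg])
qed

end
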